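(* There exists a family $\{f_\lambda\}_\lambda$ of efficiently computable oracle-aided compressing keyless (resp. keyed) functions that is collision-resistant in the CROM (resp. AI-CROM) but not even one-way against oracle-independent adversaries in the QROM.
   Context: $\lambda$ is the security parameter. A random oracle is a uniformly random function $H:\{0,1\}^{n}\to\{0,1\}^{m}$, with $n=n(\lambda)$, $m=m(\lambda)$ polynomials that may depend on the construction. CROM: the adversary makes classical queries to $H$. AI-CROM: additionally the adversary receives a polynomial-size classical advice string $a(H)$ that may depend arbitrarily on $H$. QROM: the adversary makes quantum queries to $H$ (unitary $|x\rangle|y\rangle\mapsto|x\rangle|y\oplus H(x)\rangle$). An oracle-independent adversary is one receiving no oracle-dependent advice. A family of efficiently computable oracle-aided keyed functions $\{f_\lambda:\{0,1\}^{\ell_{\mathsf{key}}}\times\{0,1\}^{\ell_{\mathrm{in}}}\to\{0,1\}^{\ell_{\mathrm{out}}}\}_\lambda$ is one where $f_\lambda^{H}$ is computed by a deterministic classical polynomial-time machine with oracle access to $H$; it is keyless if $\ell_{\mathsf{key}}=0$, and compressing if $\ell_{\mathrm{in}}>\ell_{\mathrm{out}}$. Collision resistance: for every unbounded-time $\mathcal{A}$ making $\mathrm{poly}(\lambda)$ classical queries to $H$ (and, in the AI-CROM, receiving in addition the advice $a(H)$), $\Pr_{H}[f_\lambda^{H}(k,x_0)=f_\lambda^{H}(k,x_1)\wedge x_0\ne x_1:k\leftarrow\{0,1\}^{\ell_{\mathsf{key}}},(x_0,x_1)\leftarrow\mathcal{A}^{H}(k)]$ is negligible. One-wayness in the QROM: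 for every unbounded-time $\mathcal{A}$ making $\mathrm{poly}(\lambda)$ quantum queries to $H$, $\Pr_H[y=f_\lambda^{H}(k,x'):k\leftarrow\{0,1\}^{\ell_{\mathsf{key}}},\ x\leftarrow\{0,1\}^{\ell_{\mathrm{in}}},\ y=f_\lambda^{H}(k,x),\ x'\leftarrow\mathcal{A}^{H}(1^\lambda,k,y)]$ is negligible (with $k$ omitted in the keyless case). *)

theory Defs
  imports "HOL-Probability.Probability" "HOL-Computational_Algebra.Polynomial"
begin

section \<open>Bit strings, random oracles, negligible functions\<close>

type_synonym bitstr = "bool list"
type_synonym oracle_fn = "bitstr \<Rightarrow> bitstr"

definition bitstrs :: "nat \<Rightarrow> bitstr set" where
  "bitstrs l = {x. length x = l}"

(* The functions from n-bit to m-bit strings, made extensional so that they form a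
  finite set.  A random oracle is a sample from pmf_of_set (oracles n m). *)

definition oracles :: "nat \<Rightarrow> nat \<Rightarrow> oracle_fn set" where
  "oracles n m = bitstrs n \<rightarrow>\<^sub>E bitstrs m"

definition xor_bits :: "bitstr \<Rightarrow> bitstr \<Rightarrow> bitstr" where
  "xor_bits = map2 (\<noteq>)"

definition negl :: "(nat \<Rightarrow> real) \<Rightarrow> bool" where
  "negl f \<longleftrightarrow> (\<forall>c::nat. \<forall>\<^sub>F l in sequentially. \<bar>f l\<bar> < 1 / real l ^ c)"


section \<open>Deterministic machines with access to oracles\<close>

(* Structured programs over registers that hold bit strings and are accessed as stacks.  Only
  the finitely many registers mentioned in a program matter.  Query r treats register r as an
  oracle tape: its content is overwritten by the oracle's answer.  Each primitive instruction and
  each test costs one step.  A register corresponds to a tape accessed at one end, and a Turing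
  machine tape to two registers; so, up to polynomial factors, time is that of deterministic
  multi-tape oracle Turing machines. *)

datatype prog =
    Skip
  | Push nat bool
  | Pop nat
  | Query nat
  | Seq prog prog
  | Branch nat prog prog prog  \<comment> \<open>register empty / top bit \<open>True\<close> / top bit \<open>False\<close>\<close>
  | While nat prog             \<comment> \<open>loop as long as the register is nonempty\<close>

(* exec D H c s t s': from store s, program c halts after t steps in store s'.  Here
  D is the domain of the oracle; on a query outside D the machine gets stuck, so that with
  D = {} this is execution without an oracle. *)

inductive exec :: "bitstr set \<Rightarrow> oracle_fn \<Rightarrow> prog \<Rightarrow> (nat \<Rightarrow> bitstr) \<Rightarrow> nat \<Rightarrow> (nat \<Rightarrow> bitstr) \<Rightarrow> bool"
  for D :: "bitstr set" and H :: oracle_fn where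
  exec_Skip: "exec D H Skip s 1 s"
| exec_Push: "exec D H (Push r b) s 1 (s(r := b # s r))"
| exec_Pop: "exec D H (Pop r) s 1 (s(r := tl (s r)))"
| exec_Query: "s r \<in> D \<Longrightarrow> exec D H (Query r) s 1 (s(r := H (s r)))"
| exec_Seq: "exec D H c1 s t1 s1 \<Longrightarrow> exec D H c2 s1 t2 s2 \<Longrightarrow> exec D H (Seq c1 c2) s (t1 + t2) s2"
| exec_Branch_empty: "s r = [] \<Longrightarrow> exec D H c0 s t s' \<Longrightarrow> exec D H (Branch r c0 c1 c2) s (t + 1) s'"
| exec_Branch_True: "s r = True # w \<Longrightarrow> exec D H c1 s t s' \<Longrightarrow> exec D H (Branch r c0 c1 c2) s (t + 1) s'"
| exec_Branch_False: "s r = False # w \<Longrightarrow> exec D H c2 s t s' \<Longrightarrow> exec D H (Branch r c0 c1 c2) s (t + 1) s'"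
| exec_While_stop: "s r = [] \<Longrightarrow> exec D H (While r c) s 1 s"
| exec_While_step: "s r \<noteq> [] \<Longrightarrow> exec D H c s t1 s1 \<Longrightarrow> exec D H (While r c) s1 t2 s2 \<Longrightarrow>
    exec D H (While r c) s (t1 + t2 + 1) s2"

(* The inputs 1\<^sup>\<lambda>, k, x are placed in registers 0, 1, 2; the output is read off register 0. *)

definition init_store :: "nat \<Rightarrow> bitstr \<Rightarrow> bitstr \<Rightarrow> nat \<Rightarrow> bitstr" where
  "init_store l k x = (\<lambda>_. [])(0 := replicate l True, 1 := k, 2 := x)"

definition polytime_length :: "(nat \<Rightarrow> nat) \<Rightarrow> bool" where
  "polytime_length len \<longleftrightarrow> (\<exists>c (p :: nat poly). \<forall>l. \<exists>t s.
     exec {} (\<lambda>_. []) c (init_store l [] []) t s \<and> t \<le> poly p l \<and> s 0 = replicate (len l) True)"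


section \<open>Families of keyed functions with access to oracles\<close>

record function_family =
  query_len :: "nat \<Rightarrow> nat"
  answer_len :: "nat \<Rightarrow> nat"
  key_len :: "nat \<Rightarrow> nat"
  in_len :: "nat \<Rightarrow> nat"
  out_len :: "nat \<Rightarrow> nat"
  apply_fn :: "nat \<Rightarrow> oracle_fn \<Rightarrow> bitstr \<Rightarrow> bitstr \<Rightarrow> bitstr"

definition oracles_of :: "function_family \<Rightarrow> nat \<Rightarrow> oracle_fn set" where
  "oracles_of F l = oracles (query_len F l) (answer_len F l)"

definition efficient_family :: "function_family \<Rightarrow> bool" where
  "efficient_family F \<longleftrightarrow>
     (\<exists>(pn :: nat poly) (pm :: nat poly). query_len F = poly pn \<and> answer_len F = poly pm) \<and>
     polytime_length (key_len F) \<and> polytime_length (in_len F) \<and> polytime_length (out_len F) \<and>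
     (\<forall>l. \<forall>H \<in> oracles_of F l. \<forall>k \<in> bitstrs (key_len F l). \<forall>x \<in> bitstrs (in_len F l).
        apply_fn F l H k x \<in> bitstrs (out_len F l)) \<and>
     (\<exists>c (p :: nat poly). \<forall>l. \<forall>H \<in> oracles_of F l.
        \<forall>k \<in> bitstrs (key_len F l). \<forall>x \<in> bitstrs (in_len F l). \<exists>t s.
          exec (bitstrs (query_len F l)) H c (init_store l k x) t s \<and>
          t \<le> poly p l \<and> s 0 = apply_fn F l H k x)"

definition keyless :: "function_family \<Rightarrow> bool" where
  "keyless F \<longleftrightarrow> (\<forall>l. key_len F l = 0)"

definition compressing :: "function_family \<Rightarrow> bool" where
  "compressing F \<longleftrightarrow> (\<forall>l. in_len F l > out_len F l)"


section \<open>Collision resistance against classical queries\<close>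

(* A computationally unbounded algorithm with classical oracle access is an adaptive decision
  tree; randomised algorithms are probability distributions over such trees. *)

datatype 'a qtree = Return 'a | Ask bitstr "bitstr \<Rightarrow> 'a qtree"

primrec run_qtree :: "oracle_fn \<Rightarrow> 'a qtree \<Rightarrow> 'a" where
  "run_qtree H (Return a) = a"
| "run_qtree H (Ask x c) = run_qtree H (c (H x))"

(* bounded_qtree n T q: all queries of T have length n, and at most q are made on any path. *)

primrec bounded_qtree :: "nat \<Rightarrow> 'a qtree \<Rightarrow> nat \<Rightarrow> bool" where
  "bounded_qtree n (Return a) = (\<lambda>q. True)"
| "bounded_qtree n (Ask x c) = (\<lambda>q. q > 0 \<and> x \<in> bitstrs n \<and> (\<forall>y. bounded_qtree n (c y) (q - 1)))"

(* The collision game.  The adversary's strategy may be selected in dependence on H; the two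
  notions below allow this dependence not at all or only through the advice string. *)

definition collision_prob ::
  "function_family \<Rightarrow> nat \<Rightarrow> (oracle_fn \<Rightarrow> bitstr \<Rightarrow> (bitstr \<times> bitstr) qtree pmf) \<Rightarrow> real" where
  "collision_prob F l A = pmf (do {
       H \<leftarrow> pmf_of_set (oracles_of F l);
       k \<leftarrow> pmf_of_set (bitstrs (key_len F l));
       T \<leftarrow> A H k;
       let (x0, x1) = run_qtree H T;
       return_pmf (x0 \<in> bitstrs (in_len F l) \<and> x1 \<in> bitstrs (in_len F l) \<and>
                   apply_fn F l H k x0 = apply_fn F l H k x1 \<and> x0 \<noteq> x1)
     }) True"

definition collision_resistant_CROM :: "function_family \<Rightarrow> bool" where
  "collision_resistant_CROM F \<longleftrightarrow>
     (\<forall>(A :: nat \<Rightarrow> bitstr \<Rightarrow> (bitstr \<times> bitstr) qtree pmf) (q :: nat poly).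
        (\<forall>l. \<forall>k \<in> bitstrs (key_len F l). \<forall>T \<in> set_pmf (A l k).
            bounded_qtree (query_len F l) T (poly q l)) \<longrightarrow>
        negl (\<lambda>l. collision_prob F l (\<lambda>H k. A l k)))"

definition collision_resistant_AI_CROM :: "function_family \<Rightarrow> bool" where
  "collision_resistant_AI_CROM F \<longleftrightarrow>
     (\<forall>(advice :: nat \<Rightarrow> oracle_fn \<Rightarrow> bitstr)
       (A :: nat \<Rightarrow> bitstr \<Rightarrow> bitstr \<Rightarrow> (bitstr \<times> bitstr) qtree pmf) (q :: nat poly) (r :: nat poly).
        (\<forall>l. \<forall>H \<in> oracles_of F l. length (advice l H) \<le> poly r l) \<and>
        (\<forall>l z. \<forall>k \<in> bitstrs (key_len F l). length z \<le> poly r l \<longrightarrow>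
            (\<forall>T \<in> set_pmf (A l z k). bounded_qtree (query_len F l) T (poly q l))) \<longrightarrow>
        negl (\<lambda>l. collision_prob F l (\<lambda>H k. A l (advice l H) k)))"


section \<open>One-wayness against quantum queries\<close>

(* States are amplitude functions on the finite computational basis of states
  |x\<rangle>|y\<rangle>|w\<rangle> with n-bit query register x, m-bit answer register y and a work register
  of arbitrary finite dimension d; operators are matrices U i j (row i, column j). *)

type_synonym qindex = "bitstr \<times> bitstr \<times> nat"
type_synonym qstate = "qindex \<Rightarrow> complex"
type_synonym qmatrix = "qindex \<Rightarrow> qindex \<Rightarrow> complex"

definition qbasis :: "nat \<Rightarrow> nat \<Rightarrow> nat \<Rightarrow> qindex set" where
  "qbasis n m d = bitstrs n \<times> bitstrs m \<times> {..<d}"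

definition unitary_on :: "qindex set \<Rightarrow> qmatrix \<Rightarrow> bool" where
  "unitary_on B U \<longleftrightarrow> (\<forall>i\<in>B. \<forall>j\<in>B.
     (\<Sum>k\<in>B. cnj (U k i) * U k j) = (if i = j then 1 else 0) \<and>
     (\<Sum>k\<in>B. U i k * cnj (U j k)) = (if i = j then 1 else 0))"

definition apply_matrix :: "qindex set \<Rightarrow> qmatrix \<Rightarrow> qstate \<Rightarrow> qstate" where
  "apply_matrix B U \<psi> = (\<lambda>i. if i \<in> B then \<Sum>j\<in>B. U i j * \<psi> j else 0)"

(* |x\<rangle>|y\<rangle>|w\<rangle> \<mapsto> |x\<rangle>|y \<oplus> H(x)\<rangle>|w\<rangle> *)

definition oracle_matrix :: "oracle_fn \<Rightarrow> qmatrix" where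
  "oracle_matrix H = (\<lambda>(x', y', w') (x, y, w).
     if x' = x \<and> y' = xor_bits y (H x) \<and> w' = w then 1 else 0)"

(* A quantum query algorithm applies unitaries U\<^sub>0, \<dots>, U\<^sub>q to |0\<rangle>|0\<rangle>|0\<rangle>, interleaved with
  q oracle calls, measures in the computational basis and postprocesses the outcome.  Its classical
  input is not part of the state: the algorithm itself may depend on it. *)

record qalg =
  num_queries :: nat
  work_dim :: nat
  unitaries :: "nat \<Rightarrow> qmatrix"
  postprocess :: "qindex \<Rightarrow> bitstr"

definition qalg_basis :: "nat \<Rightarrow> nat \<Rightarrow> qalg \<Rightarrow> qindex set" where
  "qalg_basis n m Q = qbasis n m (work_dim Q)"

definition valid_qalg :: "nat \<Rightarrow> nat \<Rightarrow> qalg \<Rightarrow> bool" where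
  "valid_qalg n m Q \<longleftrightarrow> work_dim Q > 0 \<and>
     (\<forall>i \<le> num_queries Q. unitary_on (qalg_basis n m Q) (unitaries Q i))"

definition initial_state :: "nat \<Rightarrow> nat \<Rightarrow> qstate" where
  "initial_state n m = (\<lambda>b. if b = (replicate n False, replicate m False, 0) then 1 else 0)"

primrec state_after :: "nat \<Rightarrow> nat \<Rightarrow> oracle_fn \<Rightarrow> qalg \<Rightarrow> nat \<Rightarrow> qstate" where
  "state_after n m H Q 0 = apply_matrix (qalg_basis n m Q) (unitaries Q 0) (initial_state n m)"
| "state_after n m H Q (Suc i) =
     apply_matrix (qalg_basis n m Q) (unitaries Q (Suc i))
       (apply_matrix (qalg_basis n m Q) (oracle_matrix H) (state_after n m H Q i))"

definition output_prob :: "nat \<Rightarrow> nat \<Rightarrow> oracle_fn \<Rightarrow> qalg \<Rightarrow> (bitstr \<Rightarrow> bool) \<Rightarrow> real" where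
  "output_prob n m H Q P =
     (\<Sum>b \<in> {b \<in> qalg_basis n m Q. P (postprocess Q b)}. (cmod (state_after n m H Q (num_queries Q) b))\<^sup>2)"

definition inversion_prob :: "function_family \<Rightarrow> nat \<Rightarrow> (bitstr \<Rightarrow> bitstr \<Rightarrow> qalg) \<Rightarrow> real" where
  "inversion_prob F l A = measure_pmf.expectation (do {
       H \<leftarrow> pmf_of_set (oracles_of F l);
       k \<leftarrow> pmf_of_set (bitstrs (key_len F l));
       x \<leftarrow> pmf_of_set (bitstrs (in_len F l));
       return_pmf (H, k, apply_fn F l H k x)
     }) (\<lambda>(H, k, y). output_prob (query_len F l) (answer_len F l) H (A k y)
            (\<lambda>x'. x' \<in> bitstrs (in_len F l) \<and> y = apply_fn F l H k x'))"

definition one_way_QROM :: "function_family \<Rightarrow> bool" where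
  "one_way_QROM F \<longleftrightarrow>
     (\<forall>(A :: nat \<Rightarrow> bitstr \<Rightarrow> bitstr \<Rightarrow> qalg) (q :: nat poly).
        (\<forall>l. \<forall>k \<in> bitstrs (key_len F l). \<forall>y \<in> bitstrs (out_len F l).
            valid_qalg (query_len F l) (answer_len F l) (A l k y) \<and>
            num_queries (A l k y) \<le> poly q l) \<longrightarrow>
        negl (\<lambda>l. inversion_prob F l (A l)))"

end

theory Submission
  imports Defs "HOL-Computational_Algebra.Computational_Algebra" "HOL-Real_Asymp.Real_Asymp"
begin

text \<open>
  The first \<open>l\<close> bits \<open>x\<close> of the input are returned as they are if the remaining bits \<open>z\<close> solve a puzzle
  about the oracle; otherwise the oracle hashes the whole input.  Whoever can solve the puzzle inverts
  the function at once, as every \<open>y\<close> has the preimage \<open>y @ z\<close>; so the puzzle must be easy with quantum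
  queries and hard with classical ones.  Following Yamakawa and Zhandry, a solution is a polynomial of
  degree less than \<open>n\<close> over the field with \<open>l\<close> elements whose values, cut into blocks of \<open>m\<close> consecutive
  arguments, are all marked by the oracle, where a block is unmarked with probability \<open>1 / (64 m^2)\<close>.
  For simplicity \<open>m\<close> is about \<open>l^(1/8)\<close>, \<open>n = m^3\<close>, there are \<open>2 m^4\<close> blocks, and there are no solutions
  unless \<open>l\<close> is prime.

  Quantum queries: one phase query and one partial reflection per block turn the uniform
  superposition of all words into a product state concentrated on the words with all blocks marked.
  Its Fourier transform is concentrated on errors with few nonzero blocks, and by the distance
  of the dual code these remain orthonormal as characters of the code.  Hence a unitary can replace
  the characters of the word space by those of the code, which yields a marked code word with
  constant probability.

  Classical queries: fewer than \<open>2^m\<close> queries touch at least \<open>m^4\<close> blocks of at most \<open>l^(m+1)\<close> code words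
  only, because a nonzero multilinear polynomial in \<open>m\<close> variables that vanishes on all queried blocks
  vanishes identically along each such code word.  When a code word reaches \<open>m^4\<close> queried blocks, its
  other \<open>m^4\<close> blocks are all marked with probability \<open>exp (- m^2 / 64)\<close> only, which beats the union bound
  over the code words that ever do so.  Against advice, independent runs with fresh keys succeed
  simultaneously with a probability that decays exponentially in their number, which beats the union
  bound over all advice strings.
\<close>

section \<open>Folded polynomial codes: list recovery and separation of points\<close>

section \<open>Polynomial functions modulo a prime\<close>

text \<open>The parameters balance two demands. Fewer than \<open>2 ^ m\<close> queries may still
  exceed every power of \<open>l\<close>, so one block can have very many queried symbols. List
  recovery that tolerates this admits about \<open>l ^ m\<close> code words, that is exp (O (m * ln
  m)); hence \<open>m ^ 4\<close> blocks, each unmarked with probability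
  \<open>1 / (64 * m ^ 2)\<close>, are kept in reserve to get below its inverse. On the quantum side
  a block is in error with about that probability, so about \<open>m ^ 2 / 32\<close> of the
  \<open>2 * m ^ 4\<close> blocks are. Errors of weight up to \<open>m ^ 2 / 2\<close> must stay
  distinguishable on the code; two of them involve at most \<open>m ^ 2\<close> blocks, that is
  \<open>m ^ 3 = n\<close> field elements, exactly as many as a polynomial of degree below
  \<open>n\<close> can prescribe. The other obstacle is that for one fixed oracle nothing is known
  about the marks on the code. The oracle is however invariant under translating all symbols, and
  averaging over translations replaces the code by the whole word space. Restricting to prime
  \<open>l\<close> costs nothing, since non-negligibility only concerns infinitely many
  parameters.\<close>

lemma poly_roots_mod_prime:
  fixes f :: "int poly"
  assumes "prime p" "degree f < d" "A \<subseteq> {0..<int p}" "d \<le> card A"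
    and "\<And>x. x \<in> A \<Longrightarrow> int p dvd poly f x"
  shows "int p dvd poly f y"
  using assms(2-)
proof (induction d arbitrary: f A y)
  case 0
  then show ?case by simp
next
  case (Suc d)
  have pp: "prime (int p)" using assms(1) by simp
  have finA: "finite A" using Suc.prems(2) finite_subset by blast
  obtain r where r: "r \<in> A" using Suc.prems(3) by fastforce
  define g where "g = synthetic_div f r"
  have f_eq: "poly f x = (x - r) * poly g x + poly f r" for x
    using arg_cong[OF synthetic_div_correct'[of r f], of "\<lambda>q. poly q x"]
    by (simp add: g_def algebra_simps)
  show ?case
  proof (cases "d = 0")
    case True
    then have "degree f = 0" using Suc.prems by simp
    then show ?thesis using Suc.prems(4)[OF r] by (metis degree_0_id poly_const_conv)
  next
    case False
    have "int p dvd poly g y" for y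
    proof (rule Suc.IH)
      show "degree g < d" using Suc.prems(1) False by (auto simp: g_def degree_synthetic_div)
      show "A - {r} \<subseteq> {0..<int p}" "d \<le> card (A - {r})"
        using Suc.prems r finA by auto
      show "int p dvd poly g x" if "x \<in> A - {r}" for x
      proof -
        have "int p dvd (x - r) * poly g x"
          using f_eq[of x] Suc.prems(4)[OF r] Suc.prems(4)[of x] that
          by (metis DiffD1 add_diff_cancel_right' dvd_diff)
        moreover have "\<not> int p dvd x - r"
        proof
          assume "int p dvd x - r"
          moreover have "x \<in> {0..<int p}" "r \<in> {0..<int p}" using that r Suc.prems(2) by auto
          then have "\<bar>x - r\<bar> < int p" by auto
          ultimately have "x - r = 0" by (metis dvd_imp_le_int abs_of_nat not_less)
          then show False using that by simp
        qed
        ultimately show ?thesis using pp prime_dvd_mult_iff by blast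
      qed
    qed
    then show ?thesis using f_eq[of y] Suc.prems(4)[OF r] by simp
  qed
qed

text \<open>A multilinear polynomial in \<open>length ys\<close> variables: \<open>Q b\<close> is
  the coefficient of the monomial formed by the variables at which \<open>b\<close> is
  \<open>True\<close>. The \<open>2 ^ m\<close> monomials in \<open>m\<close> variables are what
  lets list recovery absorb almost \<open>2 ^ m\<close> queries.\<close>

primrec mleval :: "(bool list \<Rightarrow> int) \<Rightarrow> int list \<Rightarrow> int" where
  "mleval Q [] = Q []"
| "mleval Q (y # ys) = mleval (\<lambda>b. Q (False # b)) ys + y * mleval (\<lambda>b. Q (True # b)) ys"

lemma mleval_diff: "mleval (\<lambda>b. Q b - R b) ys = mleval Q ys - mleval R ys"
proof (induction ys arbitrary: Q R)
  case (Cons y ys)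
  show ?case using Cons[of "\<lambda>b. Q (False # b)" "\<lambda>b. R (False # b)"]
      Cons[of "\<lambda>b. Q (True # b)" "\<lambda>b. R (True # b)"] by (simp add: right_diff_distrib)
qed simp

lemma mleval_dvd: "(\<And>b. length b = length ys \<Longrightarrow> p dvd Q b) \<Longrightarrow> p dvd mleval Q ys"
  by (induction ys arbitrary: Q) (auto intro!: dvd_add dvd_mult)

lemma mleval_cong_mod:
  assumes "list_all2 (\<lambda>x y. (p::int) dvd x - y) xs ys"
  shows "p dvd mleval Q xs - mleval Q ys"
  using assms
proof (induction xs ys arbitrary: Q rule: list_all2_induct)
  case Nil
  then show ?case by simp
next
  case (Cons x xs y ys)
  let ?Q = "\<lambda>c b. Q (c # b)"
  have "mleval Q (x # xs) - mleval Q (y # ys)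
      = (mleval (?Q False) xs - mleval (?Q False) ys) + (x - y) * mleval (?Q True) xs
        + y * (mleval (?Q True) xs - mleval (?Q True) ys)"
    by (simp add: algebra_simps)
  then show ?case using Cons by (metis dvd_add dvd_mult dvd_mult2)
qed

definition window :: "int poly \<Rightarrow> nat \<Rightarrow> int \<Rightarrow> int list" where
  "window f m x = map (\<lambda>j. poly f (x + int j)) [0..<m]"

lemma window_Suc: "window f (Suc m) x = poly f x # window f m (x + 1)"
  unfolding window_def upt_conv_Cons[OF zero_less_Suc] 
  by (simp add: map_Suc_upt[symmetric] del: upt_Suc) (simp add: algebra_simps comp_def)

text \<open>Every variable enters with degree at most one and becomes a shift of \<open>f\<close>,
  so \<open>m\<close> variables cost degree at most \<open>m * degree f\<close>. The tail of the
  window starts at \<open>x + 1\<close>, whence the substitution of \<open>[:1, 1:]\<close>.\<close>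

lemma mleval_window_poly:
  "\<exists>g. degree g \<le> m * degree f \<and> (\<forall>x. poly g x = mleval Q (window f m x))"
proof (induction m arbitrary: Q)
  case 0
  show ?case by (rule exI[of _ "[:Q []:]"]) (simp add: window_def)
next
  case (Suc m)
  obtain g0 where g0: "degree g0 \<le> m * degree f"
    "\<And>x. poly g0 x = mleval (\<lambda>b. Q (False # b)) (window f m x)" using Suc[of "\<lambda>b. Q (False # b)"] by blast
  obtain g1 where g1: "degree g1 \<le> m * degree f"
    "\<And>x. poly g1 x = mleval (\<lambda>b. Q (True # b)) (window f m x)" using Suc[of "\<lambda>b. Q (True # b)"] by blast
  let ?s = "\<lambda>q. pcompose q [:1, 1::int:]"
  have ds: "degree (?s q) = degree q" for q by (simp add: degree_pcompose)
  have "degree (?s g0 + f * ?s g1) \<le> Suc m * degree f"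
    using g0(1) g1(1) degree_mult_le[of f "?s g1"] ds[of g0] ds[of g1]
    by (intro degree_add_le) auto
  moreover have "poly (?s g0 + f * ?s g1) x = mleval Q (window f (Suc m) x)" for x
    using g0(2) g1(2) by (simp add: window_Suc poly_pcompose add.commute)
  ultimately show ?case by blast
qed

text \<open>Polynomials are taken over \<open>int\<close> and reduced on evaluation, because the
  prime is a variable and so cannot be part of a type. The restriction to \<open>{..<p}\<close>
  makes code words equal as functions as soon as they agree on the field.\<close>

definition mod_fun :: "nat \<Rightarrow> int poly \<Rightarrow> nat \<Rightarrow> nat" where
  "mod_fun p f = (\<lambda>x\<in>{..<p}. nat (poly f (int x) mod int p))"

lemma mod_fun_eq_iff:
  assumes "p > 0" "x < p"
  shows "mod_fun p f x = mod_fun p g x \<longleftrightarrow> int p dvd poly f (int x) - poly g (int x)"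
proof -
  have "mod_fun p f x = mod_fun p g x \<longleftrightarrow> poly f (int x) mod int p = poly g (int x) mod int p"
    using assms by (simp add: mod_fun_def nat_eq_iff)
  then show ?thesis by (simp add: mod_eq_dvd_iff)
qed

lemma mod_fun_less: "p > 0 \<Longrightarrow> x < p \<Longrightarrow> mod_fun p f x < p"
  by (simp add: mod_fun_def nat_less_iff)

lemma mod_fun_eqI:
  assumes p: "prime p" and deg: "degree f < n" "degree g < n"
    and A: "A \<subseteq> {..<p}" "n \<le> card A" "\<And>x. x \<in> A \<Longrightarrow> mod_fun p f x = mod_fun p g x"
  shows "mod_fun p f = mod_fun p g"
proof -
  have p0: "p > 0" using p prime_gt_0_nat by blast
  have "int p dvd poly (f - g) y" for y
  proof (rule poly_roots_mod_prime[OF p, where d = n and A = "int ` A"])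
    show "degree (f - g) < n" using deg by (intro degree_diff_less) auto
    show "int ` A \<subseteq> {0..<int p}" "n \<le> card (int ` A)"
      using A(1,2) by (auto simp: card_image)
    show "int p dvd poly (f - g) x" if "x \<in> int ` A" for x
    proof -
      from that obtain a where a: "a \<in> A" "x = int a" by blast
      then show ?thesis using A mod_fun_eq_iff[OF p0, of a f g] by auto
    qed
  qed
  then have "x < p \<Longrightarrow> mod_fun p f x = mod_fun p g x" for x
    using mod_fun_eq_iff[OF p0] by simp
  then show ?thesis by (auto simp: mod_fun_def restrict_def fun_eq_iff)
qed

section \<open>The number of polynomials annihilated by a multilinear form\<close>

text \<open>The polynomial solutions of an algebraic difference equation that is linear in each of
  \<open>m\<close> consecutive values. There are few of them because such an equation mostly
  determines each value from its neighbours.\<close>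

definition annihilated :: "nat \<Rightarrow> nat \<Rightarrow> nat \<Rightarrow> (bool list \<Rightarrow> int) \<Rightarrow> int poly set" where
  "annihilated p n m Q = {f. degree f < n \<and> (\<forall>x. int p dvd mleval Q (window f m x))}"

text \<open>Pigeonhole: cut an initial part of the field into \<open>D\<close> disjoint intervals of
  length \<open>n\<close>. If each of them held a root, there would be more roots than the degree
  allows.\<close>

lemma zero_free_run:
  assumes p: "prime p" and g: "degree g < D" "D * n \<le> p" and y: "\<not> int p dvd poly g y"
  shows "\<exists>a. a + n \<le> p \<and> (\<forall>x\<in>{a..<a + n}. \<not> int p dvd poly g (int x))"
proof (rule ccontr)
  assume contra: "\<not> ?thesis"
  have "\<exists>x\<in>{a..<a + n}. int p dvd poly g (int x)" if "a + n \<le> p" for a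
    using contra that by blast
  then obtain X where X: "\<And>a. a + n \<le> p \<Longrightarrow> X a \<in> {a..<a + n} \<and> int p dvd poly g (int (X a))"
    by metis
  let ?Z = "\<lambda>i. X (i * n)"
  have le: "i * n + n \<le> p" if "i < D" for i
    using that g(2) by (metis add.commute mult_Suc Suc_leI le_trans mult_le_mono1)
  have inj: "inj_on ?Z {..<D}"
  proof (rule inj_onI)
    fix i j assume "i \<in> {..<D}" "j \<in> {..<D}" and eq: "?Z i = ?Z j"
    then have "?Z i \<in> {i * n..<i * n + n}" "?Z j \<in> {j * n..<j * n + n}"
      using X[OF le[of i]] X[OF le[of j]] by blast+
    moreover have "z div n = i" if "z \<in> {i * n..<i * n + n}" for z i
      using that by (intro div_nat_eqI) (auto simp: algebra_simps)
    ultimately show "i = j" using eq by metis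
  qed
  have "int p dvd poly g y"
  proof (rule poly_roots_mod_prime[OF p g(1)])
    show "int ` ?Z ` {..<D} \<subseteq> {0..<int p}" 
    proof clarify
      fix i assume "i < D" then show "int (?Z i) \<in> {0..<int p}" using X[OF le[of i]] le[of i] by auto
    qed
    show "D \<le> card (int ` ?Z ` {..<D})" using inj by (simp add: card_image)
    show "int p dvd poly g x" if "x \<in> int ` ?Z ` {..<D}" for x using that X le by auto
  qed
  then show False using y by simp
qed

text \<open>Induction on the number of variables. Write the form as A + y * B in its first variable
  y. If B vanishes as a form, then A alone annihilates. Otherwise the \<open>f\<close> annihilated
  by B are counted by the induction hypothesis, and for the remaining ones B is nonzero along
  \<open>n\<close> consecutive places, where the equation can be solved for the current value given
  the next ones. Such an \<open>f\<close> is fixed by the place of the run and the \<open>m\<close>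
  values behind it, which gives \<open>p ^ Suc m\<close> possibilities. \<open>M\<close> stays fixed
  in the induction, as it only bounds the degree of B along \<open>f\<close>.\<close>

lemma card_annihilated:
  assumes p: "prime p" and n: "n > 0" "(M * n + 1) * n \<le> p" and m: "m \<le> M"
    and Q: "length b = m" "\<not> int p dvd Q b"
  shows "card (mod_fun p ` annihilated p n m Q) \<le> (\<Sum>j=1..m. p ^ j) \<and> finite (mod_fun p ` annihilated p n m Q)"
  using m Q
proof (induction m arbitrary: Q b)
  case 0
  then have "annihilated p n 0 Q = {}" by (auto simp: annihilated_def window_def)
  then show ?case by simp
next
  case (Suc m)
  have p0: "p > 0" using p prime_gt_0_nat by blast
  let ?Q = "\<lambda>c b. Q (c # b)"
  let ?A = "annihilated p n (Suc m) Q"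
  show ?case
  proof (cases "\<forall>b. length b = m \<longrightarrow> int p dvd ?Q True b")
    case True
    obtain c b' where b: "b = c # b'" "length b' = m" using Suc.prems(2) by (cases b) auto
    have b': "\<not> int p dvd ?Q False b'" using True b Suc.prems(3) by (cases c) auto
    have "?A \<subseteq> annihilated p n m (?Q False)"
    proof
      fix f assume f: "f \<in> ?A"
      have "int p dvd mleval (?Q False) (window f m x)" for x
      proof -
        \<comment> \<open>The window is started one place earlier, so that its tail is the window at
          \<open>x\<close>.\<close>
        have "int p dvd mleval Q (window f (Suc m) (x - 1))" using f by (simp add: annihilated_def)
        moreover have "int p dvd mleval (?Q True) (window f m x)"
          using True by (intro mleval_dvd) (auto simp: window_def)
        ultimately show ?thesis by (simp add: window_Suc) (metis dvd_add_left_iff dvd_mult)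
      qed
      then show "f \<in> annihilated p n m (?Q False)" using f by (simp add: annihilated_def)
    qed
    then have sub: "mod_fun p ` ?A \<subseteq> mod_fun p ` annihilated p n m (?Q False)" by blast
    have IH: "card (mod_fun p ` annihilated p n m (?Q False)) \<le> (\<Sum>j=1..m. p ^ j) \<and>
        finite (mod_fun p ` annihilated p n m (?Q False))"
      using Suc.IH[of b' "?Q False"] b(2) b' Suc.prems(1) by simp
    have "card (mod_fun p ` ?A) \<le> card (mod_fun p ` annihilated p n m (?Q False))"
      using IH sub by (intro card_mono) auto
    moreover have "finite (mod_fun p ` ?A)" using IH sub by (meson finite_subset)
    moreover have "(\<Sum>j=1..m. p ^ j) \<le> (\<Sum>j=1..Suc m. p ^ j)" by simp
    ultimately show ?thesis using IH by linarith
  next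
    case False
    then obtain b1 where b1: "length b1 = m" "\<not> int p dvd ?Q True b1" by blast
    let ?A1 = "annihilated p n m (?Q True)"
    have IH: "card (mod_fun p ` ?A1) \<le> (\<Sum>j=1..m. p ^ j)" "finite (mod_fun p ` ?A1)"
      using Suc.IH[of b1 "?Q True"] b1 Suc.prems(1) by auto
    define init where "init = (\<lambda>a F. (a, \<lambda>j\<in>{..<m}. (F (a + n + j) :: nat)))"
    let ?run = "\<lambda>f a. a + n \<le> p \<and> (\<forall>x\<in>{a..<a + n}. \<not> int p dvd mleval (?Q True) (window f m (int x + 1)))"
    have run: "\<exists>a. ?run f a" if f: "f \<in> ?A - ?A1" for f
    proof -
      from f obtain y where y: "\<not> int p dvd mleval (?Q True) (window f m y)"
        and df: "degree f < n" by (auto simp: annihilated_def)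
      obtain g where g: "degree g \<le> m * degree f" "\<And>x. poly g x = mleval (?Q True) (window f m x)"
        using mleval_window_poly by blast
      let ?g = "pcompose g [:1, 1:]"
      have "degree ?g < M * n + 1"
        using g(1) df Suc.prems(1) by (simp add: degree_pcompose)
           (meson Suc_leD le_imp_less_Suc le_trans less_or_eq_imp_le mult_le_mono)
      moreover have "\<not> int p dvd poly ?g (y - 1)" using y g(2) by (simp add: poly_pcompose)
      ultimately show ?thesis using zero_free_run[OF p _ n(2), of ?g "y - 1"] 
        by (simp add: poly_pcompose g(2) add.commute)
    qed
    define start where "start = (\<lambda>f. SOME a. ?run f a)"
    have start: "?run f (start f)" if "f \<in> ?A - ?A1" for f
      unfolding start_def by (rule someI_ex[OF run[OF that]])
    \<comment> \<open>Initial data of the backward recursion: where the run starts and the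
      \<open>m\<close> values just after its end.\<close>
    define code where "code = (\<lambda>f. (start f, \<lambda>j\<in>{..<m}. nat (poly f (int (start f + n + j)) mod int p)))"
    have determined: "mod_fun p f = mod_fun p g"
      if f: "f \<in> ?A - ?A1" and g: "g \<in> ?A - ?A1" and eq: "code f = code g" for f g
    proof -
      define a where "a = start f"
      have ag: "start g = a" using eq by (simp add: code_def a_def)
      have a: "?run f a" using start[OF f] by (simp add: a_def)
      have init: "int p dvd poly f (int (a + n + j)) - poly g (int (a + n + j))" if "j < m" for j
      proof -
        have "nat (poly f (int (a + n + j)) mod int p) = nat (poly g (int (a + n + j)) mod int p)"
          using fun_cong[OF arg_cong[OF eq, of snd], of j] that ag by (simp add: code_def a_def)
        then show ?thesis using p0 by (simp add: mod_eq_dvd_iff[symmetric] nat_eq_iff)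
      qed
      \<comment> \<open>\<open>k\<close> counts how far the recursion has gone back from the end of
        the run; \<open>k = n\<close> reaches its start.\<close>
      have agree: "int p dvd poly f (int y) - poly g (int y)" if "a + n - k \<le> y" "y < a + n + m" "k \<le> n" for k y
        using that
      proof (induction k arbitrary: y)
        case 0
        then show ?case using init[of "y - (a + n)"] by simp
      next
        case (Suc k)
        show ?case
        proof (cases "a + n - k \<le> y")
          case True
          then show ?thesis using Suc by simp
        next
          case False
          then have y: "y = a + n - Suc k" "Suc y = a + n - k" using Suc.prems by auto
          have win: "int p dvd mleval R (window f m (int y + 1)) - mleval R (window g m (int y + 1))" for R
          proof (rule mleval_cong_mod)
            show "list_all2 (\<lambda>x y. int p dvd x - y) (window f m (int y + 1)) (window g m (int y + 1))"
            proof (clarsimp simp: window_def list_all2_conv_all_nth)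
              fix j assume "j < m"
              then have "int p dvd poly f (int (Suc y + j)) - poly g (int (Suc y + j))"
                using Suc.prems y by (intro Suc.IH) auto
              then show "int p dvd poly f (int y + 1 + int j) - poly g (int y + 1 + int j)"
                by (simp add: algebra_simps)
            qed
          qed
          let ?F = "\<lambda>c. mleval (?Q c) (window f m (int y + 1))"
          let ?G = "\<lambda>c. mleval (?Q c) (window g m (int y + 1))"
          have "int p dvd mleval Q (window f (Suc m) (int y))" "int p dvd mleval Q (window g (Suc m) (int y))"
            using f g by (auto simp: annihilated_def)
          then have *: "int p dvd ?F False + poly f (int y) * ?F True" "int p dvd ?G False + poly g (int y) * ?G True"
            by (simp_all add: window_Suc)
          \<comment> \<open>Difference of the two equations at \<open>y\<close>: all terms known to
            agree cancel modulo \<open>p\<close>, and what remains is the unknown difference times a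
            factor prime to \<open>p\<close>.\<close>
          have "(poly f (int y) - poly g (int y)) * ?F True
              = (?F False + poly f (int y) * ?F True) - (?G False + poly g (int y) * ?G True)
                - (?F False - ?G False) - poly g (int y) * (?F True - ?G True)"
            by (simp add: algebra_simps)
          then have "int p dvd (poly f (int y) - poly g (int y)) * ?F True"
            using * win by (metis dvd_diff dvd_mult)
          moreover have "y \<in> {a..<a + n}" using y Suc.prems by auto
          then have "\<not> int p dvd ?F True" using a by blast
          ultimately show ?thesis using p by (simp add: prime_dvd_mult_iff)
        qed
      qed
      show ?thesis
      proof (rule mod_fun_eqI[OF p, where n = n and A = "{a..<a + n}"])
        show "degree f < n" "degree g < n" using f g by (auto simp: annihilated_def)
        show "{a..<a + n} \<subseteq> {..<p}" "n \<le> card {a..<a + n}" using a by auto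
        show "mod_fun p f x = mod_fun p g x" if "x \<in> {a..<a + n}" for x
          using that agree[of n x] mod_fun_eq_iff[OF p0, of x f g] a by auto
      qed
    qed
    have code_in: "code ` (?A - ?A1) \<subseteq> {..<p} \<times> ({..<m} \<rightarrow>\<^sub>E {..<p})"
    proof (rule image_subsetI)
      fix f assume "f \<in> ?A - ?A1"
      then have "start f < p" using start[of f] n(1) by auto
      then show "code f \<in> {..<p} \<times> ({..<m} \<rightarrow>\<^sub>E {..<p})" using p0 by (auto simp: code_def nat_less_iff)
    qed
    have fin: "finite ({..<p} \<times> ({..<m} \<rightarrow>\<^sub>E {..<p}))" by (simp add: finite_PiE)
    have fin_code: "finite (code ` (?A - ?A1))" using finite_subset[OF code_in fin] .
    let ?h = "\<lambda>c. mod_fun p (SOME f. f \<in> ?A - ?A1 \<and> code f = c)"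
    have img: "mod_fun p ` (?A - ?A1) \<subseteq> ?h ` code ` (?A - ?A1)"
    proof
      fix F assume "F \<in> mod_fun p ` (?A - ?A1)"
      then obtain f where f: "f \<in> ?A - ?A1" "F = mod_fun p f" by blast
      let ?g = "SOME g. g \<in> ?A - ?A1 \<and> code g = code f"
      have "?g \<in> ?A - ?A1 \<and> code ?g = code f" by (rule someI[of _ f]) (use f in auto)
      then have "mod_fun p f = mod_fun p ?g" using determined[OF f(1), of ?g] by simp
      then show "F \<in> ?h ` code ` (?A - ?A1)" using f by blast
    qed
    have "card (mod_fun p ` (?A - ?A1)) \<le> card (?h ` code ` (?A - ?A1))"
      using img fin_code by (intro card_mono) auto
    also have "\<dots> \<le> card (code ` (?A - ?A1))" using fin_code by (rule card_image_le)
    also have "\<dots> \<le> card ({..<p} \<times> ({..<m} \<rightarrow>\<^sub>E {..<p}))" using code_in fin by (rule card_mono[rotated])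
    also have "\<dots> = p ^ Suc m" by (simp add: card_cartesian_product card_PiE)
    finally have c1: "card (mod_fun p ` (?A - ?A1)) \<le> p ^ Suc m" .
    have sub: "mod_fun p ` ?A \<subseteq> mod_fun p ` (?A - ?A1) \<union> mod_fun p ` ?A1" by blast
    have fin2: "finite (mod_fun p ` (?A - ?A1) \<union> mod_fun p ` ?A1)"
      using IH(2) finite_subset[OF img] fin_code by blast
    have "card (mod_fun p ` ?A) \<le> card (mod_fun p ` (?A - ?A1) \<union> mod_fun p ` ?A1)"
      using sub fin2 by (rule card_mono[rotated])
    also have "\<dots> \<le> p ^ Suc m + (\<Sum>j=1..m. p ^ j)"
      using card_Un_le[of "mod_fun p ` (?A - ?A1)" "mod_fun p ` ?A1"] c1 IH(1) by linarith
    finally have "card (mod_fun p ` ?A) \<le> (\<Sum>j=1..Suc m. p ^ j)" by simp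
    then show ?thesis using finite_subset[OF sub fin2] by blast
  qed
qed

text \<open>Counting in place of linear algebra: there are \<open>p ^ 2 ^ m\<close> forms with
  reduced coefficients but only \<open>p ^ card S\<close> value vectors on \<open>S\<close>, so two
  forms collide, and their difference vanishes on \<open>S\<close>.\<close>

lemma interpolating_form:
  assumes p: "p > 1" and S: "finite S" "card S < 2 ^ m" "\<And>ys. ys \<in> S \<Longrightarrow> length ys = m"
  shows "\<exists>Q b. length b = m \<and> \<not> int p dvd Q b \<and> (\<forall>ys\<in>S. int p dvd mleval Q ys)"
proof -
  let ?B = "{b :: bool list. length b = m}"
  let ?F = "?B \<rightarrow>\<^sub>E {0..<int p}"
  let ?E = "\<lambda>Q. \<lambda>ys\<in>S. mleval Q ys mod int p"
  have finB: "finite ?B" and cardB: "card ?B = 2 ^ m"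
    using finite_lists_length_eq[of "UNIV :: bool set" m] card_lists_length_eq[of "UNIV :: bool set" m] by auto
  have "?E ` ?F \<subseteq> S \<rightarrow>\<^sub>E {0..<int p}" using p by auto
  then have "card (?E ` ?F) \<le> card (S \<rightarrow>\<^sub>E {0..<int p})"
    using S(1) by (intro card_mono finite_PiE) auto
  also have "\<dots> = p ^ card S" using S(1) by (simp add: card_PiE)
  also have "\<dots> < p ^ 2 ^ m" using p S(2) by simp
  also have "\<dots> = card ?F" using finB cardB by (simp add: card_PiE)
  finally have "\<not> inj_on ?E ?F" using pigeonhole by blast
  then obtain Q R where QR: "Q \<in> ?F" "R \<in> ?F" "Q \<noteq> R" "?E Q = ?E R" unfolding inj_on_def by blast
  then obtain b where b: "b \<in> ?B" "Q b \<noteq> R b" by (meson PiE_ext)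
  have in_range: "Q b \<in> {0..<int p}" "R b \<in> {0..<int p}" using QR(1,2) b(1) PiE_mem by fast+
  have "\<not> int p dvd Q b - R b"
  proof
    assume "int p dvd Q b - R b"
    moreover have "\<bar>Q b - R b\<bar> < int p" using in_range by auto
    ultimately have "Q b - R b = 0" by (metis dvd_imp_le_int abs_of_nat not_less)
    then show False using b by simp
  qed
  moreover have "int p dvd mleval (\<lambda>b. Q b - R b) ys" if "ys \<in> S" for ys
    using fun_cong[OF QR(4), of ys] that by (simp add: mleval_diff mod_eq_dvd_iff)
  ultimately show ?thesis using b(1) by (intro exI[of _ "\<lambda>b. Q b - R b"] exI[of _ b]) auto
qed

text \<open>Beyond the Johnson bound: although the total number of listed symbols may exceed every fixed
  power of the parameters, it stays below the number \<open>2 ^ m\<close> of multilinear monomials.\<close>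

theorem list_recovery_bound:
  assumes p: "prime p" and n: "n > 0" "(m * n + 1) * n \<le> p" and m: "m > 0" and A: "A \<subseteq> {..<p}"
    and S: "finite S" "card S < 2 ^ m"
  shows "card (mod_fun p ` {f. degree f < n \<and>
            m * n \<le> card {x \<in> A. map (\<lambda>j. nat (poly f (int (x + j)) mod int p)) [0..<m] \<in> S}})
         \<le> (\<Sum>j=1..m. p ^ j)" (is "card (mod_fun p ` ?X) \<le> _")
    and "finite (mod_fun p ` {f. degree f < n \<and>
            m * n \<le> card {x \<in> A. map (\<lambda>j. nat (poly f (int (x + j)) mod int p)) [0..<m] \<in> S}})"
proof -
  let ?S = "{map int s |s. s \<in> S \<and> length s = m}"
  have S_eq: "?S = map int ` {s \<in> S. length s = m}" by auto
  have "card ?S \<le> card {s \<in> S. length s = m}" unfolding S_eq using S(1) by (intro card_image_le) auto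
  also have "\<dots> \<le> card S" using S(1) by (intro card_mono) auto
  finally have cS: "card ?S < 2 ^ m" using S(2) by simp
  obtain Q b where Q: "length b = m" "\<not> int p dvd Q b" "\<And>ys. ys \<in> ?S \<Longrightarrow> int p dvd mleval Q ys"
  proof -
    have "finite ?S" "\<And>ys. ys \<in> ?S \<Longrightarrow> length ys = m" unfolding S_eq using S(1) by auto
    then show ?thesis using interpolating_form[of p ?S m] prime_gt_1_nat[OF p] cS that by blast
  qed
  have p0: "int p > 0" using prime_gt_0_nat[OF p] by simp
  have sub: "?X \<subseteq> annihilated p n m Q"
  proof
    fix f assume f: "f \<in> ?X"
    let ?Z = "{x \<in> A. map (\<lambda>j. nat (poly f (int (x + j)) mod int p)) [0..<m] \<in> S}"
    have "finite A" using A finite_subset by blast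
    obtain g where g: "degree g \<le> m * degree f" "\<And>x. poly g x = mleval Q (window f m x)"
      using mleval_window_poly by blast
    have zero: "int p dvd poly g (int x)" if x: "x \<in> ?Z" for x
    proof -
      let ?ys = "map int (map (\<lambda>j. nat (poly f (int (x + j)) mod int p)) [0..<m])"
      have "int p dvd mleval Q ?ys" using x by (intro Q(3) CollectI exI[of _ "map (\<lambda>j. nat (poly f (int (x + j)) mod int p)) [0..<m]"]) auto
      moreover have "int p dvd mleval Q (window f m (int x)) - mleval Q ?ys"
        using p0 by (intro mleval_cong_mod) (auto simp: window_def list_all2_conv_all_nth mod_eq_dvd_iff[symmetric])
      ultimately show ?thesis using g(2) by (metis diff_add_cancel dvd_add)
    qed
    \<comment> \<open>Along \<open>f\<close> the form is a polynomial of degree below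
      \<open>m * n\<close>, and the start of every listed window is a root.\<close>
    have "int p dvd poly g y" for y
    proof (rule poly_roots_mod_prime[OF p, where d = "m * n" and A = "int ` ?Z"])
      have "m * degree f < m * n" using f m by auto
      then show "degree g < m * n" using g(1) by linarith
      show "int ` ?Z \<subseteq> {0..<int p}" using A by auto
      show "m * n \<le> card (int ` ?Z)" using f by (simp add: card_image)
      show "\<And>x. x \<in> int ` ?Z \<Longrightarrow> int p dvd poly g x" using zero by auto
    qed
    then show "f \<in> annihilated p n m Q" using f g(2) by (auto simp: annihilated_def)
  qed
  have bound: "card (mod_fun p ` annihilated p n m Q) \<le> (\<Sum>j=1..m. p ^ j)" "finite (mod_fun p ` annihilated p n m Q)"
    using card_annihilated[OF p n le_refl, of b Q] Q(1,2) by auto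
  show "finite (mod_fun p ` ?X)" by (rule finite_subset[OF image_mono[OF sub] bound(2)])
  have "card (mod_fun p ` ?X) \<le> card (mod_fun p ` annihilated p n m Q)"
    by (rule card_mono[OF bound(2) image_mono[OF sub]])
  then show "card (mod_fun p ` ?X) \<le> (\<Sum>j=1..m. p ^ j)" using bound(1) by simp
qed

text \<open>A Lagrange basis polynomial without its normalising factor: a value that is nonzero
  modulo \<open>p\<close> is all that the separation of light errors asks for.\<close>

lemma lagrange_mod_prime:
  assumes p: "prime p" and X: "X \<subseteq> {..<p}" "x0 \<in> X" "card X \<le> n"
  shows "\<exists>f :: int poly. degree f < n \<and> (\<forall>x\<in>X - {x0}. poly f (int x) = 0) \<and> \<not> int p dvd poly f (int x0)"
proof -
  have finX: "finite X" using X(1) finite_subset by blast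
  let ?f = "\<Prod>x\<in>X - {x0}. [:- int x, 1:]"
  have "degree ?f \<le> (\<Sum>x\<in>X - {x0}. degree [:- int x, 1:])" using degree_prod_sum_le[OF finite_Diff[OF finX], of "\<lambda>x. [:- int x, 1:]" "{x0}"] by (simp add: comp_def)
  also have "\<dots> = card X - 1" using X(2) finX by simp
  also have "\<dots> < n" using X finX by (metis Suc_pred' card_gt_0_iff empty_iff lessI less_le_trans)
  finally have "degree ?f < n" .
  moreover have "poly ?f (int x) = 0" if "x \<in> X - {x0}" for x
    using that finX by (simp add: poly_prod)
  moreover have "\<not> int p dvd poly ?f (int x0)"
  proof
    assume "int p dvd poly ?f (int x0)"
    then have "int p dvd (\<Prod>x\<in>X - {x0}. int x0 - int x)" by (simp add: poly_prod)
    then obtain x where x: "x \<in> X - {x0}" "int p dvd int x0 - int x"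
      using finX p prime_dvd_prod_iff[of "X - {x0}" "int p"] by auto
    moreover have "x < p" "x0 < p" using x X by auto
    then have "\<bar>int x0 - int x\<bar> < int p" by linarith
    ultimately have "int x0 - int x = 0" by (metis dvd_imp_le_int abs_of_nat not_less)
    then show False using x by simp
  qed
  ultimately show ?thesis by blast
qed

section \<open>Lazy sampling, potential functions and advice\<close>

section \<open>Random functions with a fixed finite part\<close>

text \<open>Conditioning on the answers seen so far: a uniform element of this set is the random
  oracle given the table \<open>\<tau>\<close>.\<close>

definition ext_oracles :: "nat \<Rightarrow> nat \<Rightarrow> (bitstr \<rightharpoonup> bitstr) \<Rightarrow> oracle_fn set" where
  "ext_oracles n m \<tau> = {H \<in> oracles n m. \<forall>x y. \<tau> x = Some y \<longrightarrow> H x = y}"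

definition table :: "nat \<Rightarrow> nat \<Rightarrow> (bitstr \<rightharpoonup> bitstr) \<Rightarrow> bool" where
  "table n m \<tau> \<longleftrightarrow> dom \<tau> \<subseteq> bitstrs n \<and> ran \<tau> \<subseteq> bitstrs m"

definition avg :: "'a set \<Rightarrow> ('a \<Rightarrow> real) \<Rightarrow> real" where
  "avg S f = (\<Sum>x\<in>S. f x) / real (card S)"

lemma finite_bitstrs [simp]: "finite (bitstrs n)"
  and card_bitstrs [simp]: "card (bitstrs n) = 2 ^ n"
  and bitstrs_nonempty [simp]: "bitstrs n \<noteq> {}"
proof -
  have b: "bitstrs n = {xs. set xs \<subseteq> (UNIV :: bool set) \<and> length xs = n}" by (auto simp: bitstrs_def)
  show "finite (bitstrs n)" unfolding b by (rule finite_lists_length_eq) simp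
  show "card (bitstrs n) = 2 ^ n" unfolding b by (subst card_lists_length_eq) auto
  show "bitstrs n \<noteq> {}" by (auto simp: bitstrs_def intro!: exI[of _ "replicate n True"])
qed

lemma finite_oracles [simp]: "finite (oracles n m)"
  by (simp add: oracles_def finite_PiE)

lemma oracles_nonempty [simp]: "oracles n m \<noteq> {}"
  by (simp add: oracles_def PiE_eq_empty_iff)

lemma ext_oracles_PiE:
  assumes "table n m \<tau>"
  shows "ext_oracles n m \<tau> = (\<Pi>\<^sub>E x\<in>bitstrs n. case \<tau> x of None \<Rightarrow> bitstrs m | Some y \<Rightarrow> {y})"
    (is "_ = ?P")
proof (intro equalityI subsetI)
  fix H assume "H \<in> ext_oracles n m \<tau>"
  then show "H \<in> ?P" by (auto simp: ext_oracles_def oracles_def PiE_iff split: option.splits)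
next
  fix H assume H: "H \<in> ?P"
  have "H x = y" if "\<tau> x = Some y" for x y
    using PiE_mem[OF H, of x] that assms by (auto simp: table_def)
  moreover have "H x \<in> bitstrs m" if "x \<in> bitstrs n" for x
    using PiE_mem[OF H that] assms by (auto simp: table_def ran_def split: option.splits)
  ultimately show "H \<in> ext_oracles n m \<tau>" using H
    by (auto simp: ext_oracles_def oracles_def PiE_iff)
qed

lemma avg_nonneg: "(\<And>x. x \<in> S \<Longrightarrow> 0 \<le> f x) \<Longrightarrow> 0 \<le> avg S f"
  by (simp add: avg_def sum_nonneg)

lemma avg_mono: "(\<And>x. x \<in> S \<Longrightarrow> f x \<le> g x) \<Longrightarrow> avg S f \<le> avg S g"
  by (simp add: avg_def sum_mono divide_right_mono)

lemma avg_cong: "(\<And>x. x \<in> S \<Longrightarrow> f x = g x) \<Longrightarrow> avg S f = avg S g"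
  by (simp add: avg_def)

lemma avg_mult_right: "avg S (\<lambda>x. c * f x) = c * avg S f"
  by (simp add: avg_def sum_distrib_left)

lemma avg_mult_left: "avg S (\<lambda>x. f x * c) = avg S f * c"
  by (simp add: avg_def sum_distrib_right)

lemma avg_add: "avg S (\<lambda>x. f x + g x) = avg S f + avg S g"
  by (simp add: avg_def sum.distrib add_divide_distrib)

lemma avg_diff: "avg S (\<lambda>x. f x - g x) = avg S f - avg S g"
  by (simp add: avg_def sum_subtractf diff_divide_distrib)

lemma avg_sum: "avg S (\<lambda>x. \<Sum>i\<in>I. f i x) = (\<Sum>i\<in>I. avg S (f i))"
  unfolding avg_def by (subst sum.swap) (simp add: sum_divide_distrib)

lemma avg_const: "finite S \<Longrightarrow> S \<noteq> {} \<Longrightarrow> avg S (\<lambda>_. c) = c"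
  by (simp add: avg_def)

lemma avg_swap: "avg S (\<lambda>x. avg T (f x)) = avg T (\<lambda>y. avg S (\<lambda>x. f x y))"
  unfolding avg_def sum_divide_distrib[symmetric] by (subst sum.swap) (simp add: field_simps)

lemma expectation_pmf_of_set_avg:
  "finite S \<Longrightarrow> S \<noteq> {} \<Longrightarrow> measure_pmf.expectation (pmf_of_set S) f = avg S f"
  by (simp add: integral_pmf_of_set avg_def)

lemma table_update: "table n m \<tau> \<Longrightarrow> x \<in> bitstrs n \<Longrightarrow> y \<in> bitstrs m \<Longrightarrow> table n m (\<tau>(x \<mapsto> y))"
  unfolding table_def by (auto simp: ran_def)

lemma ext_oracles_empty [simp]: "ext_oracles n m Map.empty = oracles n m"
  by (simp add: ext_oracles_def)

lemma table_empty [simp]: "table n m Map.empty"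
  by (simp add: table_def)

lemma finite_ext_oracles [simp]: "finite (ext_oracles n m \<tau>)"
  by (simp add: ext_oracles_def)

lemma ext_oracles_nonempty: "table n m \<tau> \<Longrightarrow> ext_oracles n m \<tau> \<noteq> {}"
  by (subst ext_oracles_PiE) (auto simp: PiE_eq_empty_iff split: option.splits)

lemma finite_dom_table: "table n m \<tau> \<Longrightarrow> finite (dom \<tau>)"
  unfolding table_def using finite_subset[OF _ finite_bitstrs] by blast

lemma card_ext_oracles:
  assumes "table n m \<tau>"
  shows "card (ext_oracles n m \<tau>) = (2 ^ m) ^ (2 ^ n - card (dom \<tau>))"
proof -
  have "card (ext_oracles n m \<tau>) = (\<Prod>x\<in>bitstrs n. if x \<in> dom \<tau> then 1 else 2 ^ m)"
    unfolding ext_oracles_PiE[OF assms] by (subst card_PiE) (auto intro!: prod.cong split: option.splits)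
  also have "\<dots> = (\<Prod>x\<in>bitstrs n - dom \<tau>. 2 ^ m)"
    by (simp add: prod.If_cases Diff_eq)
  also have "\<dots> = (2 ^ m) ^ (2 ^ n - card (dom \<tau>))"
    using assms finite_dom_table[OF assms] by (simp add: table_def card_Diff_subset)
  finally show ?thesis .
qed

text \<open>Lazy sampling: the oracles extending \<open>\<tau>\<close> split by their answer at a
  fresh point into classes of equal size. So this answer is uniform, and the rest is again uniform
  given the larger table.\<close>

lemma avg_ext_oracles_step:
  assumes \<tau>: "table n m \<tau>" and x: "x \<in> bitstrs n" "\<tau> x = None"
  shows "avg (ext_oracles n m \<tau>) F = avg (bitstrs m) (\<lambda>y. avg (ext_oracles n m (\<tau>(x \<mapsto> y))) F)"
proof -
  let ?E = "\<lambda>y. ext_oracles n m (\<tau>(x \<mapsto> y))"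
  have un: "ext_oracles n m \<tau> = (\<Union>y\<in>bitstrs m. ?E y)"
  proof (intro equalityI subsetI)
    fix H assume H: "H \<in> ext_oracles n m \<tau>"
    then have "H x \<in> bitstrs m" using x(1) by (auto simp: ext_oracles_def oracles_def)
    then show "H \<in> (\<Union>y\<in>bitstrs m. ?E y)" using H by (auto simp: ext_oracles_def)
  next
    fix H assume "H \<in> (\<Union>y\<in>bitstrs m. ?E y)"
    then obtain y where "H \<in> oracles n m" "\<And>z y'. (\<tau>(x \<mapsto> y)) z = Some y' \<Longrightarrow> H z = y'"
      by (auto simp: ext_oracles_def)
    then have "H z = y'" if "\<tau> z = Some y'" for z y' using that x(2) by (cases "z = x") auto
    then show "H \<in> ext_oracles n m \<tau>" using \<open>H \<in> oracles n m\<close> by (auto simp: ext_oracles_def)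
  qed
  have lt: "card (dom \<tau>) < 2 ^ n"
  proof -
    have "dom \<tau> \<subset> bitstrs n" using \<tau> x by (auto simp: table_def)
    then show ?thesis using psubset_card_mono[of "bitstrs n"] by simp
  qed
  have cE: "card (?E y) = (2 ^ m) ^ (2 ^ n - Suc (card (dom \<tau>)))" if "y \<in> bitstrs m" for y
    using card_ext_oracles[OF table_update[OF \<tau> x(1) that]] finite_dom_table[OF \<tau>] x(2)
    by (simp add: card_insert_if domIff)
  have c: "card (ext_oracles n m \<tau>) = 2 ^ m * (2 ^ m) ^ (2 ^ n - Suc (card (dom \<tau>)))"
    using card_ext_oracles[OF \<tau>] lt by (metis Suc_diff_Suc power_Suc)
  have "(\<Sum>H\<in>ext_oracles n m \<tau>. F H) = (\<Sum>y\<in>bitstrs m. \<Sum>H\<in>?E y. F H)"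
    unfolding un by (rule sum.UNION_disjoint) (auto simp: ext_oracles_def)
  then show ?thesis
    using c cE by (simp add: avg_def sum_divide_distrib[symmetric])
qed

section \<open>Potential functions for classical query algorithms\<close>

text \<open>Here \<open>w T H\<close> is the success indicator and \<open>K\<close> the weight of the events that concern the
  rest of the experiment; \<open>K\<close> is used to chain several runs that share one oracle.\<close>

context
  fixes n m B :: nat and \<Phi> :: "(bitstr \<rightharpoonup> bitstr) \<Rightarrow> real" and K :: "oracle_fn \<Rightarrow> real" and \<delta> \<kappa> :: real
  assumes K_nonneg: "\<And>H. 0 \<le> K H" and \<kappa>: "\<kappa> \<ge> 0" and \<delta>: "\<delta> \<ge> 0" and \<Phi>: "\<And>\<tau>. 0 \<le> \<Phi> \<tau>"
    and step: "\<And>\<tau> x. table n m \<tau> \<Longrightarrow> card (dom \<tau>) < B \<Longrightarrow> x \<in> bitstrs n \<Longrightarrow> \<tau> x = None \<Longrightarrow>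
        avg (bitstrs m) (\<lambda>y. \<Phi> (\<tau>(x \<mapsto> y))) \<le> \<Phi> \<tau> + \<delta>"
    and K: "\<And>\<tau>. table n m \<tau> \<Longrightarrow> card (dom \<tau>) \<le> B \<Longrightarrow> avg (ext_oracles n m \<tau>) K \<le> \<kappa>"
begin

lemma potential_query:
  assumes \<tau>: "table n m \<tau>" "card (dom \<tau>) < B" and x: "x \<in> bitstrs n" "\<tau> x = None"
    and F: "\<And>y. y \<in> bitstrs m \<Longrightarrow> avg (ext_oracles n m (\<tau>(x \<mapsto> y))) F \<le> \<kappa> * (\<Phi> (\<tau>(x \<mapsto> y)) + c)"
  shows "avg (ext_oracles n m \<tau>) F \<le> \<kappa> * (\<Phi> \<tau> + (\<delta> + c))"
proof -
  have "avg (ext_oracles n m \<tau>) F \<le> avg (bitstrs m) (\<lambda>y. \<kappa> * (\<Phi> (\<tau>(x \<mapsto> y)) + c))"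
    unfolding avg_ext_oracles_step[OF \<tau>(1) x] by (rule avg_mono) (rule F)
  also have "\<dots> = \<kappa> * (avg (bitstrs m) (\<lambda>y. \<Phi> (\<tau>(x \<mapsto> y))) + c)"
    by (simp add: avg_mult_right avg_add avg_const)
  also have "\<dots> \<le> \<kappa> * (\<Phi> \<tau> + \<delta> + c)"
    using step[OF \<tau> x] \<kappa> by (intro mult_left_mono) auto
  finally show ?thesis by (simp add: algebra_simps)
qed

text \<open>After the adversary has stopped, the points that decide its success are queried on its
  behalf, one at a time. Once all are in the table, \<open>w\<close> is at most the potential of the
  table, a constant, and the average of \<open>K\<close> can be split off.\<close>

lemma potential_bound_list:
  assumes w: "\<And>\<tau>' H. table n m \<tau>' \<Longrightarrow> dom \<tau> \<union> set vs \<subseteq> dom \<tau>' \<Longrightarrow> H \<in> ext_oracles n m \<tau>' \<Longrightarrow> w H \<le> \<Phi> \<tau>'"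
    and vs: "set vs \<subseteq> bitstrs n" "card (dom \<tau>) + length vs \<le> B" and \<tau>: "table n m \<tau>"
  shows "avg (ext_oracles n m \<tau>) (\<lambda>H. w H * K H) \<le> \<kappa> * (\<Phi> \<tau> + real (length vs) * \<delta>)"
  using w vs \<tau>
proof (induction vs arbitrary: \<tau>)
  case Nil
  have "avg (ext_oracles n m \<tau>) (\<lambda>H. w H * K H) \<le> avg (ext_oracles n m \<tau>) (\<lambda>H. \<Phi> \<tau> * K H)"
    using Nil K_nonneg by (intro avg_mono mult_right_mono) auto
  also have "\<dots> \<le> \<Phi> \<tau> * \<kappa>"
    unfolding avg_mult_right using K[of \<tau>] Nil \<Phi> by (intro mult_left_mono) auto
  finally show ?case by (simp add: mult.commute)
next
  case (Cons v vs)
  show ?case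
  proof (cases "\<tau> v")
    case None
    have fin: "finite (dom \<tau>)" using Cons.prems(4) by (rule finite_dom_table)
    have "avg (ext_oracles n m \<tau>) (\<lambda>H. w H * K H) \<le> \<kappa> * (\<Phi> \<tau> + (\<delta> + real (length vs) * \<delta>))"
    proof (rule potential_query)
      fix y assume y: "y \<in> bitstrs m"
      show "avg (ext_oracles n m (\<tau>(v \<mapsto> y))) (\<lambda>H. w H * K H)
          \<le> \<kappa> * (\<Phi> (\<tau>(v \<mapsto> y)) + real (length vs) * \<delta>)"
      proof (rule Cons.IH)
        show "card (dom (\<tau>(v \<mapsto> y))) + length vs \<le> B"
          using Cons.prems(3) fin by (simp add: card_insert_if)
        show "set vs \<subseteq> bitstrs n" "table n m (\<tau>(v \<mapsto> y))" using Cons.prems y by (auto intro!: table_update simp del: fun_upd_apply)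
        show "w H \<le> \<Phi> \<tau>'" if "table n m \<tau>'" "dom (\<tau>(v \<mapsto> y)) \<union> set vs \<subseteq> dom \<tau>'" "H \<in> ext_oracles n m \<tau>'" for \<tau>' H
        proof (rule Cons.prems(1))
          show "dom \<tau> \<union> set (v # vs) \<subseteq> dom \<tau>'" using that(2) by (simp del: fun_upd_apply) 
        qed (use that in auto)
      qed
    qed (use Cons.prems None in auto)
    then show ?thesis by (simp add: algebra_simps)
  next
    case (Some y)
    have "avg (ext_oracles n m \<tau>) (\<lambda>H. w H * K H) \<le> \<kappa> * (\<Phi> \<tau> + real (length vs) * \<delta>)"
    proof (rule Cons.IH)
      show "w H \<le> \<Phi> \<tau>'" if "table n m \<tau>'" "dom \<tau> \<union> set vs \<subseteq> dom \<tau>'" "H \<in> ext_oracles n m \<tau>'" for \<tau>' H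
        using that Some by (intro Cons.prems(1)) auto
    qed (use Cons.prems in auto)
    also have "\<dots> \<le> \<kappa> * (\<Phi> \<tau> + real (length (v # vs)) * \<delta>)"
      using \<kappa> \<delta> by (intro mult_left_mono) (auto simp: algebra_simps)
    finally show ?thesis .
  qed
qed

text \<open>Induction on the decision tree: a fresh query raises the expected potential by at most
  \<delta>, and a repeated one is answered from the table. The \<open>v\<close> verification queries
  come on top of the \<open>q\<close> queries of the tree.\<close>

lemma potential_bound:
  assumes w: "\<And>a \<tau> H. table n m \<tau> \<Longrightarrow> set (V a) \<subseteq> dom \<tau> \<Longrightarrow> H \<in> ext_oracles n m \<tau> \<Longrightarrow> w a H \<le> \<Phi> \<tau>"
    and V: "\<And>a. set (V a) \<subseteq> bitstrs n" "\<And>a. length (V a) \<le> v"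
    and T: "bounded_qtree n T q" "card (dom \<tau>) + q + v \<le> B" "table n m \<tau>"
  shows "avg (ext_oracles n m \<tau>) (\<lambda>H. w (run_qtree H T) H * K H) \<le> \<kappa> * (\<Phi> \<tau> + real (q + v) * \<delta>)"
  using T
proof (induction T arbitrary: q \<tau>)
  case (Return a)
  have "avg (ext_oracles n m \<tau>) (\<lambda>H. w a H * K H) \<le> \<kappa> * (\<Phi> \<tau> + real (length (V a)) * \<delta>)"
    using w V(1) Return V(2)[of a] by (intro potential_bound_list) auto
  also have "\<dots> \<le> \<kappa> * (\<Phi> \<tau> + real (q + v) * \<delta>)"
    using V(2)[of a] \<kappa> \<delta> by (intro mult_left_mono add_left_mono mult_right_mono) auto
  finally show ?case by simp
next
  case (Ask x c)
  then have q: "q > 0" and x: "x \<in> bitstrs n" and c: "\<And>y. bounded_qtree n (c y) (q - 1)" by auto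
  have fin: "finite (dom \<tau>)" using Ask.prems(3) by (rule finite_dom_table)
  show ?case
  proof (cases "\<tau> x")
    case None
    have "avg (ext_oracles n m \<tau>) (\<lambda>H. w (run_qtree H (Ask x c)) H * K H)
        \<le> \<kappa> * (\<Phi> \<tau> + (\<delta> + real (q - 1 + v) * \<delta>))"
    proof (rule potential_query)
      fix y assume y: "y \<in> bitstrs m"
      have "avg (ext_oracles n m (\<tau>(x \<mapsto> y))) (\<lambda>H. w (run_qtree H (Ask x c)) H * K H)
          = avg (ext_oracles n m (\<tau>(x \<mapsto> y))) (\<lambda>H. w (run_qtree H (c y)) H * K H)"
        by (rule avg_cong) (auto simp: ext_oracles_def)
      also have "\<dots> \<le> \<kappa> * (\<Phi> (\<tau>(x \<mapsto> y)) + real (q - 1 + v) * \<delta>)"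
      proof (rule Ask.IH)
        show "card (dom (\<tau>(x \<mapsto> y))) + (q - 1) + v \<le> B"
          using Ask.prems(2) fin None q by (simp add: card_insert_if domIff)
      qed (use c y x Ask.prems in \<open>auto intro!: table_update simp del: fun_upd_apply\<close>)
      finally show "avg (ext_oracles n m (\<tau>(x \<mapsto> y))) (\<lambda>H. w (run_qtree H (Ask x c)) H * K H)
        \<le> \<kappa> * (\<Phi> (\<tau>(x \<mapsto> y)) + real (q - 1 + v) * \<delta>)" .
    qed (use Ask.prems x q None in auto)
    moreover have "\<delta> + real (q - 1 + v) * \<delta> = real (q + v) * \<delta>"
      using q by (cases q) (auto simp: algebra_simps)
    ultimately show ?thesis by simp
  next
    case (Some y)
    have "avg (ext_oracles n m \<tau>) (\<lambda>H. w (run_qtree H (Ask x c)) H * K H)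
        = avg (ext_oracles n m \<tau>) (\<lambda>H. w (run_qtree H (c y)) H * K H)"
      using Some by (intro avg_cong) (auto simp: ext_oracles_def)
    also have "\<dots> \<le> \<kappa> * (\<Phi> \<tau> + real (q - 1 + v) * \<delta>)"
      using c Ask.prems by (intro Ask.IH) auto
    also have "\<dots> \<le> \<kappa> * (\<Phi> \<tau> + real (q + v) * \<delta>)"
      using \<kappa> \<delta> by (intro mult_left_mono add_left_mono mult_right_mono) auto
    finally show ?thesis .
  qed
qed

end


lemma avg_take_bits:
  assumes "length a = l" "l \<le> m"
  shows "avg (bitstrs m) (\<lambda>y. of_bool (take l y = a)) = 1 / 2 ^ l"
proof -
  have "bij_betw (\<lambda>z. a @ z) (bitstrs (m - l)) {y \<in> bitstrs m. take l y = a}"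
  proof (rule bij_betwI[where g = "drop l"])
    show "(@) a \<in> bitstrs (m - l) \<rightarrow> {y \<in> bitstrs m. take l y = a}"
      using assms by (auto simp: bitstrs_def)
    show "a @ drop l y = y" if "y \<in> {y \<in> bitstrs m. take l y = a}" for y
      using that append_take_drop_id[of l y] by simp
  qed (use assms in \<open>auto simp: bitstrs_def\<close>)
  then have "card {y \<in> bitstrs m. take l y = a} = 2 ^ (m - l)"
    using bij_betw_same_card by fastforce
  then have "(\<Sum>y\<in>bitstrs m. of_bool (take l y = a)) = (2 ^ (m - l) :: real)"
    by (simp only: of_bool_def sum.inter_filter[symmetric, OF finite_bitstrs] sum_constant) simp
  then show ?thesis using assms(2) by (simp add: avg_def power_diff)
qed

text \<open>Here \<open>c \<in> \<C>\<close> is the set of points that must all be accepted for one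
  puzzle solution, and \<open>P\<close> the set of points whose answers must not collide in their
  first \<open>l\<close> bits. \<open>L\<close> is the list recovery bound: for few \<open>c\<close>
  can \<open>M\<close> points be among the queries.\<close>

context
  fixes n m B l N M L :: nat and \<C> :: "bitstr set set" and P :: "bitstr set" and acc :: "bitstr \<Rightarrow> bool" and p :: real
  assumes p_def: "p = avg (bitstrs m) (\<lambda>y. of_bool (acc y))"
    and \<C>: "\<And>c. c \<in> \<C> \<Longrightarrow> finite c \<and> card c = N" and finC: "finite \<C>"
    and L: "\<And>Q. finite Q \<Longrightarrow> card Q \<le> B \<Longrightarrow> card {c \<in> \<C>. M \<le> card (c \<inter> Q)} \<le> L"
    and l: "l \<le> m"
begin

text \<open>Given the table, this is the probability that the rest of \<open>c\<close> will be
  accepted, but counted as zero until \<open>M\<close> points of \<open>c\<close> are known. Without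
  the threshold the sum over all code words would be huge before the first query.\<close>

definition solution_weight :: "(bitstr \<rightharpoonup> bitstr) \<Rightarrow> bitstr set \<Rightarrow> real" where
  "solution_weight \<tau> c = (if M \<le> card (c \<inter> dom \<tau>) \<and> (\<forall>x\<in>c \<inter> dom \<tau>. acc (the (\<tau> x)))
     then p ^ card (c - dom \<tau>) else 0)"

definition solution_potential :: "(bitstr \<rightharpoonup> bitstr) \<Rightarrow> real" where
  "solution_potential \<tau> = (\<Sum>c\<in>\<C>. solution_weight \<tau> c)"

text \<open>Ordered pairs, so a collision counts twice; hence the factor 2 in
  \<open>2 * real B / 2 ^ l\<close>.\<close>

definition collision_potential :: "(bitstr \<rightharpoonup> bitstr) \<Rightarrow> real" where
  "collision_potential \<tau> = (\<Sum>x\<in>dom \<tau> \<inter> P. \<Sum>x'\<in>dom \<tau> \<inter> P. of_bool (x \<noteq> x' \<and> take l (the (\<tau> x)) = take l (the (\<tau> x'))))"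

lemma p_bounds: "0 \<le> p" "p \<le> 1"
proof -
  show "0 \<le> p" unfolding p_def by (rule avg_nonneg) auto
  have "p \<le> avg (bitstrs m) (\<lambda>_. 1)" unfolding p_def by (rule avg_mono) auto
  then show "p \<le> 1" by (simp add: avg_const)
qed

lemma solution_weight_nonneg: "0 \<le> solution_weight \<tau> c"
  using p_bounds by (simp add: solution_weight_def)

text \<open>Above the threshold the weight is a martingale: acceptance of the fresh point has
  probability \<open>p\<close>, and the exponent drops by one. It can grow on average only when the
  query is the \<open>M\<close>-th point of \<open>c\<close>, from zero to at most
  \<open>p ^ (N - M)\<close>.\<close>

lemma solution_weight_step:
  assumes c: "c \<in> \<C>" and x: "\<tau> x = None"
  shows "avg (bitstrs m) (\<lambda>y. solution_weight (\<tau>(x \<mapsto> y)) c)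
    \<le> solution_weight \<tau> c + (if M \<le> card (c \<inter> insert x (dom \<tau>)) then p ^ (N - M) else 0)"
proof (cases "x \<in> c")
  case False
  then have "c \<inter> dom (\<tau>(x \<mapsto> y)) = c \<inter> dom \<tau>" "c - dom (\<tau>(x \<mapsto> y)) = c - dom \<tau>"
    "\<forall>z\<in>c \<inter> dom \<tau>. (\<tau>(x \<mapsto> y)) z = \<tau> z" for y by auto
  then have "solution_weight (\<tau>(x \<mapsto> y)) c = solution_weight \<tau> c" for y
    unfolding solution_weight_def by (metis (no_types, lifting))
  then show ?thesis using p_bounds by (simp add: avg_const)
next
  case True
  have c': "finite c" "card c = N" using \<C> c by auto
  define u where "u = card (c \<inter> dom \<tau>)"
  have xd: "x \<notin> dom \<tau>" using x by auto
  have ins: "c \<inter> insert x (dom \<tau>) = insert x (c \<inter> dom \<tau>)" using True by auto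
  have card_ins: "card (c \<inter> insert x (dom \<tau>)) = Suc u"
    unfolding ins u_def using c' xd by simp
  have rest: "card (c - dom \<tau>) = N - u" unfolding u_def using c' by (simp add: card_Diff_subset_Int)
  have rest': "card (c - insert x (dom \<tau>)) = N - Suc u"
    using c' card_ins by (simp add: card_Diff_subset_Int)
  have "u < card c" unfolding u_def using c' True xd by (intro psubset_card_mono) auto
  then have uN: "u < N" using c' by simp
  let ?ok = "\<forall>z\<in>c \<inter> dom \<tau>. acc (the (\<tau> z))"
  have upd: "solution_weight (\<tau>(x \<mapsto> y)) c = (if M \<le> Suc u \<and> ?ok then p ^ (N - Suc u) else 0) * of_bool (acc y)" for y
  proof -
    have "(\<forall>z\<in>c \<inter> dom (\<tau>(x \<mapsto> y)). acc (the ((\<tau>(x \<mapsto> y)) z))) \<longleftrightarrow> ?ok \<and> acc y"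
      using True xd by (auto simp: ins)
    then show ?thesis using card_ins rest' by (simp add: solution_weight_def)
  qed
  have "avg (bitstrs m) (\<lambda>y. solution_weight (\<tau>(x \<mapsto> y)) c) = (if M \<le> Suc u \<and> ?ok then p ^ (N - Suc u) else 0) * p"
    by (simp only: upd avg_mult_right p_def[symmetric])
  also have "\<dots> = (if M \<le> Suc u \<and> ?ok then p ^ (N - u) else 0)"
    using uN by (simp add: Suc_diff_Suc[symmetric])
  also have "\<dots> \<le> solution_weight \<tau> c + (if M \<le> Suc u then p ^ (N - M) else 0)"
  proof (cases "M \<le> u")
    case True
    then show ?thesis using p_bounds rest by (simp add: solution_weight_def u_def)
  next
    case False
    have "p ^ (N - u) \<le> p ^ (N - M)" if "M \<le> Suc u"
      using that False p_bounds by (intro power_decreasing) auto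
    then show ?thesis using False p_bounds solution_weight_nonneg[of \<tau> c] by auto
  qed
  finally show ?thesis unfolding card_ins .
qed

text \<open>Only sets with at least \<open>M\<close> queried points after the query are charged, and
  list recovery admits at most \<open>L\<close> of them.\<close>

lemma solution_potential_step:
  assumes "finite (dom \<tau>)" "card (dom \<tau>) < B" and x: "\<tau> x = None"
  shows "avg (bitstrs m) (\<lambda>y. solution_potential (\<tau>(x \<mapsto> y))) \<le> solution_potential \<tau> + real L * p ^ (N - M)"
proof -
  have "avg (bitstrs m) (\<lambda>y. solution_potential (\<tau>(x \<mapsto> y)))
      \<le> (\<Sum>c\<in>\<C>. solution_weight \<tau> c + (if M \<le> card (c \<inter> insert x (dom \<tau>)) then p ^ (N - M) else 0))"
    unfolding solution_potential_def avg_sum by (intro sum_mono solution_weight_step x)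
  also have "\<dots> = solution_potential \<tau> + real (card {c \<in> \<C>. M \<le> card (c \<inter> insert x (dom \<tau>))}) * p ^ (N - M)"
    unfolding solution_potential_def sum.distrib using finC by (simp add: sum.If_cases Int_def)
  also have "\<dots> \<le> solution_potential \<tau> + real L * p ^ (N - M)"
    using assms p_bounds L[of "insert x (dom \<tau>)"] x
    by (intro add_left_mono mult_right_mono) (auto simp: card_insert_if domIff)
  finally show ?thesis .
qed

lemma collision_potential_step:
  assumes fin: "finite (dom \<tau>)" and B: "card (dom \<tau>) \<le> B" and x: "\<tau> x = None" and \<tau>: "table n m \<tau>"
  shows "avg (bitstrs m) (\<lambda>y. collision_potential (\<tau>(x \<mapsto> y))) \<le> collision_potential \<tau> + 2 * real B / 2 ^ l"
proof (cases "x \<in> P")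
  case False
  then have d: "dom (\<tau>(x \<mapsto> y)) \<inter> P = dom \<tau> \<inter> P" for y by auto
  have "collision_potential (\<tau>(x \<mapsto> y)) = collision_potential \<tau>" for y
  proof -
    have "(\<tau>(x \<mapsto> y)) z = \<tau> z" if "z \<in> dom \<tau> \<inter> P" for z using that False by auto
    then show ?thesis unfolding collision_potential_def d by (intro sum.cong refl) (simp del: fun_upd_apply)
  qed
  then show ?thesis by (simp add: avg_const)
next
  case True
  let ?D = "dom \<tau> \<inter> P"
  have d: "dom (\<tau>(x \<mapsto> y)) \<inter> P = insert x ?D" for y using True by auto
  have xD: "x \<notin> ?D" "finite ?D" using x fin by auto
  let ?e = "\<lambda>y z. of_bool (take l y = take l (the (\<tau> z))) :: real"
  have "collision_potential (\<tau>(x \<mapsto> y)) = collision_potential \<tau> + 2 * (\<Sum>z\<in>?D. ?e y z)" for y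
  proof -
    let ?G = "\<lambda>z z'. of_bool (z \<noteq> z' \<and> take l (the ((\<tau>(x \<mapsto> y)) z)) = take l (the ((\<tau>(x \<mapsto> y)) z'))) :: real"
    have G: "?G x x = 0" by simp
    have G1: "?G x z = ?e y z" "?G z x = ?e y z" if "z \<in> ?D" for z
    proof -
      have "z \<noteq> x" using that x by auto
      then show "?G x z = ?e y z" "?G z x = ?e y z" by (simp_all add: eq_commute[of "take l y"])
    qed
    have G2: "?G z z' = of_bool (z \<noteq> z' \<and> take l (the (\<tau> z)) = take l (the (\<tau> z')))" if "z \<in> ?D" "z' \<in> ?D" for z z'
    proof -
      have "z \<noteq> x" "z' \<noteq> x" using that x by auto
      then show ?thesis by simp
    qed
    have "collision_potential (\<tau>(x \<mapsto> y)) = (\<Sum>z\<in>insert x ?D. \<Sum>z'\<in>insert x ?D. ?G z z')"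
      unfolding collision_potential_def d ..
    also have "\<dots> = (\<Sum>z'\<in>?D. ?G x z') + (\<Sum>z\<in>?D. ?G z x + (\<Sum>z'\<in>?D. ?G z z'))"
      unfolding sum.insert[OF xD(2,1)] G by (simp only: add_0)
    also have "(\<Sum>z'\<in>?D. ?G x z') = (\<Sum>z\<in>?D. ?e y z)" using G1(1) by (rule sum.cong[OF refl])
    also have "(\<Sum>z\<in>?D. ?G z x + (\<Sum>z'\<in>?D. ?G z z')) = (\<Sum>z\<in>?D. ?e y z + 
        (\<Sum>z'\<in>?D. of_bool (z \<noteq> z' \<and> take l (the (\<tau> z)) = take l (the (\<tau> z')))))"
      using G1(2) G2 by (intro sum.cong refl arg_cong2[where f = "(+)"])
    finally show ?thesis unfolding collision_potential_def sum.distrib by (simp only: mult_2 add_ac)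
  qed
  then have "avg (bitstrs m) (\<lambda>y. collision_potential (\<tau>(x \<mapsto> y)))
     = collision_potential \<tau> + 2 * (\<Sum>z\<in>?D. avg (bitstrs m) (\<lambda>y. ?e y z))"
    by (simp add: avg_add avg_const avg_mult_right avg_sum)
  also have "(\<Sum>z\<in>?D. avg (bitstrs m) (\<lambda>y. ?e y z)) = (\<Sum>z\<in>?D. 1 / 2 ^ l)"
  proof (intro sum.cong refl avg_take_bits)
    fix z assume "z \<in> ?D"
    then have "the (\<tau> z) \<in> bitstrs m" using \<tau> by (auto simp: table_def ran_def)
    then show "length (take l (the (\<tau> z))) = l" using l by (simp add: bitstrs_def)
  qed (use l in auto)
  also have "\<dots> \<le> real B / 2 ^ l"
    using card_mono[OF fin, of ?D] B by (simp add: divide_right_mono)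
  finally show ?thesis by (simp del: fun_upd_apply)
qed

definition search_potential :: "(bitstr \<rightharpoonup> bitstr) \<Rightarrow> real" where
  "search_potential \<tau> = solution_potential \<tau> + collision_potential \<tau>"

lemma search_potential_nonneg: "0 \<le> search_potential \<tau>"
  unfolding search_potential_def solution_potential_def collision_potential_def
  using solution_weight_nonneg by (intro add_nonneg_nonneg sum_nonneg) auto

lemma search_potential_step:
  assumes "table n m \<tau>" "card (dom \<tau>) < B" "\<tau> x = None"
  shows "avg (bitstrs m) (\<lambda>y. search_potential (\<tau>(x \<mapsto> y)))
    \<le> search_potential \<tau> + (real L * p ^ (N - M) + 2 * real B / 2 ^ l)"
proof -
  note fin = finite_dom_table[OF assms(1)]
  show ?thesis unfolding search_potential_def avg_add
    using add_mono[OF solution_potential_step[OF fin assms(2,3)] collision_potential_step[OF fin less_imp_le[OF assms(2)] assms(3,1)]]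
    by (simp add: algebra_simps del: fun_upd_apply)
qed

lemma search_potential_solution:
  assumes "c \<in> \<C>" "c \<subseteq> dom \<tau>" "\<forall>x\<in>c. acc (the (\<tau> x))" "M \<le> N"
  shows "1 \<le> search_potential \<tau>"
proof -
  have "c \<inter> dom \<tau> = c" "c - dom \<tau> = {}" using assms(2) by auto
  then have "solution_weight \<tau> c = 1" unfolding solution_weight_def \<open>c - dom \<tau> = {}\<close> using assms \<C>[OF assms(1)] by simp
  then have "1 \<le> solution_potential \<tau>"
    unfolding solution_potential_def using member_le_sum[of c \<C> "solution_weight \<tau>"] assms finC solution_weight_nonneg by auto
  moreover have "0 \<le> collision_potential \<tau>"
    unfolding collision_potential_def by (intro sum_nonneg) auto
  ultimately show ?thesis by (simp add: search_potential_def)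
qed

lemma search_potential_collision:
  assumes "x \<in> dom \<tau> \<inter> P" "x' \<in> dom \<tau> \<inter> P" "x \<noteq> x'" "take l (the (\<tau> x)) = take l (the (\<tau> x'))" "finite (dom \<tau>)"
  shows "1 \<le> search_potential \<tau>"
proof -
  let ?e = "\<lambda>x x'. of_bool (x \<noteq> x' \<and> take l (the (\<tau> x)) = take l (the (\<tau> x'))) :: real"
  have fin: "finite (dom \<tau> \<inter> P)" using assms(5) by simp
  have "1 = ?e x x'" using assms by simp
  also have "\<dots> \<le> (\<Sum>x'\<in>dom \<tau> \<inter> P. ?e x x')"
    using assms(2) fin by (intro member_le_sum[of x' _ "?e x"]) auto
  also have "\<dots> \<le> collision_potential \<tau>" unfolding collision_potential_def
    using assms(1) fin by (intro member_le_sum[of x _ "\<lambda>x. \<Sum>x'\<in>dom \<tau> \<inter> P. ?e x x'"]) (auto intro: sum_nonneg)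
  finally show ?thesis using solution_weight_nonneg by (simp add: search_potential_def solution_potential_def add_increasing sum_nonneg)
qed

text \<open>A run whose key has no points in the table starts from potential zero, even if earlier
  runs have filled the table; \<open>M > 0\<close> keeps untouched solution sets at weight
  zero.\<close>

lemma search_potential_untouched:
  assumes "dom \<tau> \<inter> P = {}" "\<And>c. c \<in> \<C> \<Longrightarrow> c \<inter> dom \<tau> = {}" "M > 0"
  shows "search_potential \<tau> = 0"
  using assms by (simp add: search_potential_def solution_potential_def collision_potential_def solution_weight_def)

end

section \<open>Independent keys and oracle-dependent advice\<close>

lemma expectation_avg_swap:
  fixes f :: "'a \<Rightarrow> 'b \<Rightarrow> real"
  assumes "\<And>x T. x \<in> S \<Longrightarrow> \<bar>f x T\<bar> \<le> c"
  shows "measure_pmf.expectation p (\<lambda>T. avg S (\<lambda>x. f x T)) = avg S (\<lambda>x. measure_pmf.expectation p (f x))"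
proof -
  have int: "integrable (measure_pmf p) (f x)" if "x \<in> S" for x
    by (rule measure_pmf.integrable_const_bound[where B = c]) (use assms[OF that] in auto)
  then show ?thesis unfolding avg_def by simp
qed

lemma expectation_mono_set_pmf:
  fixes f g :: "'a \<Rightarrow> real"
  assumes "\<And>x. x \<in> set_pmf p \<Longrightarrow> f x \<le> g x" "\<And>x. \<bar>f x\<bar> \<le> c" "\<And>x. \<bar>g x\<bar> \<le> c"
  shows "measure_pmf.expectation p f \<le> measure_pmf.expectation p g"
proof (rule integral_mono_AE)
  show "integrable (measure_pmf p) f" "integrable (measure_pmf p) g"
    using assms(2,3) by (auto intro!: measure_pmf.integrable_const_bound[where B = c])
  show "AE x in measure_pmf p. f x \<le> g x" using assms(1) by (simp add: AE_measure_pmf_iff)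
qed

lemma avg_indicator_card: "finite S \<Longrightarrow> avg S (\<lambda>x. of_bool (P x)) = real (card {x \<in> S. P x}) / real (card S)"
  by (simp only: avg_def of_bool_def sum.inter_filter[symmetric] sum_constant mult_1_right)

text \<open>The oracle stays fixed while key and coins are averaged, so the \<open>u\<close>-th
  power is the probability that \<open>u\<close> independent runs against the same oracle all
  succeed.\<close>

definition success_rate :: "'k set \<Rightarrow> ('k \<Rightarrow> 'a qtree pmf) \<Rightarrow> ('k \<Rightarrow> 'a \<Rightarrow> oracle_fn \<Rightarrow> real) \<Rightarrow> oracle_fn \<Rightarrow> real" where
  "success_rate Ks A win H = avg Ks (\<lambda>k. measure_pmf.expectation (A k) (\<lambda>T. win k (run_qtree H T) H))"

context
  fixes n m B s :: nat and Ks :: "'k set" and pts :: "'k \<Rightarrow> bitstr set"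
    and win :: "'k \<Rightarrow> 'a \<Rightarrow> oracle_fn \<Rightarrow> real" and Tr :: "'a qtree set" and \<epsilon> :: real
  assumes Ks: "finite Ks" "Ks \<noteq> {}" and disj: "\<And>k k'. k \<in> Ks \<Longrightarrow> k' \<in> Ks \<Longrightarrow> k \<noteq> k' \<Longrightarrow> pts k \<inter> pts k' = {}"
    and win: "\<And>k a H. 0 \<le> win k a H \<and> win k a H \<le> 1" and \<epsilon>: "\<epsilon> \<ge> 0"
    and run: "\<And>k T \<tau> K \<kappa> B'. \<lbrakk>k \<in> Ks; T \<in> Tr; table n m \<tau>; card (dom \<tau>) + s \<le> B'; B' \<le> B;
        dom \<tau> \<inter> pts k = {}; \<And>H. 0 \<le> K H; \<kappa> \<ge> 0;
        \<And>\<tau>'. table n m \<tau>' \<Longrightarrow> card (dom \<tau>') \<le> B' \<Longrightarrow> avg (ext_oracles n m \<tau>') K \<le> \<kappa>\<rbrakk>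
        \<Longrightarrow> avg (ext_oracles n m \<tau>) (\<lambda>H. win k (run_qtree H T) H * K H) \<le> \<kappa> * \<epsilon>"
begin

lemma success_rate_bounds:
  shows "0 \<le> success_rate Ks A win H" "success_rate Ks A win H \<le> 1"
proof -
  have i: "integrable (measure_pmf (A k)) (\<lambda>T. win k (run_qtree H T) H)" for k
    by (rule measure_pmf.integrable_const_bound[where B = 1]) (use win in auto)
  show "0 \<le> success_rate Ks A win H"
    unfolding success_rate_def using win by (intro avg_nonneg integral_nonneg) auto
  have "measure_pmf.expectation (A k) (\<lambda>T. win k (run_qtree H T) H) \<le> measure_pmf.expectation (A k) (\<lambda>T. 1)" for k
    by (rule integral_mono) (use i win in auto)
  then have "success_rate Ks A win H \<le> avg Ks (\<lambda>_. 1)" unfolding success_rate_def by (intro avg_mono) auto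
  then show "success_rate Ks A win H \<le> 1" using Ks by (simp add: avg_const)
qed

text \<open>One run is peeled off, and the other \<open>u\<close> enter as the weight
  \<open>K\<close>, whose conditional averages the induction hypothesis bounds for every table that
  the first run can leave behind. If the key of the first run already has points in the table, the
  run is conceded; as different keys have disjoint points, this concerns at most \<open>B\<close>
  keys.\<close>

lemma success_rate_power:
  assumes A: "\<And>k. k \<in> Ks \<Longrightarrow> set_pmf (A k) \<subseteq> Tr"
  shows "table n m \<tau> \<Longrightarrow> card (dom \<tau>) + u * s \<le> B \<Longrightarrow>
    avg (ext_oracles n m \<tau>) (\<lambda>H. success_rate Ks A win H ^ u) \<le> (real B / real (card Ks) + \<epsilon>) ^ u"
proof (induction u arbitrary: \<tau>)
  case 0
  then show ?case by (simp add: avg_const ext_oracles_nonempty)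
next
  case (Suc u)
  let ?g = "success_rate Ks A win" and ?E = "ext_oracles n m \<tau>"
  define \<eta> where "\<eta> = real B / real (card Ks) + \<epsilon>"
  have \<eta>: "\<eta> \<ge> 0" using \<epsilon> by (simp add: \<eta>_def)
  have g: "0 \<le> ?g H ^ u" "?g H ^ u \<le> 1" for H
    using success_rate_bounds[of A H] by (auto intro: power_le_one)
  have fin: "finite (dom \<tau>)" using Suc.prems(1) by (rule finite_dom_table)
  let ?f = "\<lambda>k T H. win k (run_qtree H T) H * ?g H ^ u"
  have f: "0 \<le> ?f k T H" "?f k T H \<le> 1" for k T H
    using win g by (auto intro: mult_le_one)
  have "avg ?E (\<lambda>H. ?g H ^ Suc u) = avg ?E (\<lambda>H. avg Ks (\<lambda>k. measure_pmf.expectation (A k) (\<lambda>T. ?f k T H)))"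
    by (rule avg_cong) (simp add: success_rate_def[of Ks A win] avg_mult_left)
  also have "\<dots> = avg Ks (\<lambda>k. measure_pmf.expectation (A k) (\<lambda>T. avg ?E (\<lambda>H. ?f k T H)))"
    unfolding avg_swap[of ?E] using f by (subst expectation_avg_swap[where c = 1]) (auto simp: abs_le_iff intro: order_trans[of _ 0])
  also have "\<dots> \<le> avg Ks (\<lambda>k. \<eta> ^ u * (of_bool (dom \<tau> \<inter> pts k \<noteq> {}) + \<epsilon>))"
  proof (rule avg_mono)
    fix k assume k: "k \<in> Ks"
    have IH: "avg (ext_oracles n m \<tau>') (\<lambda>H. ?g H ^ u) \<le> \<eta> ^ u" if "table n m \<tau>'" "card (dom \<tau>') \<le> B - u * s" for \<tau>'
      unfolding \<eta>_def using that Suc.prems(2) by (intro Suc.IH) auto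
    have le: "avg ?E (\<lambda>H. ?f k T H) \<le> \<eta> ^ u * (of_bool (dom \<tau> \<inter> pts k \<noteq> {}) + \<epsilon>)" if T: "T \<in> Tr" for T
    proof (cases "dom \<tau> \<inter> pts k = {}")
      case True
      have "avg ?E (\<lambda>H. ?f k T H) \<le> \<eta> ^ u * \<epsilon>"
        by (rule run[OF k T Suc.prems(1) _ _ True, where B' = "B - u * s"])
           (use Suc.prems(2) g IH \<eta> in auto)
      then show ?thesis using True by simp
    next
      case False
      have "avg ?E (\<lambda>H. ?f k T H) \<le> avg ?E (\<lambda>H. ?g H ^ u)"
        using win g by (intro avg_mono mult_left_le_one_le) auto
      also have "\<dots> \<le> \<eta> ^ u" using Suc.prems by (intro IH) auto
      also have "\<dots> \<le> \<eta> ^ u * (of_bool (dom \<tau> \<inter> pts k \<noteq> {}) + \<epsilon>)"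
        using False \<eta> \<epsilon> by (simp add: mult_ge1_I distrib_left)
      finally show ?thesis .
    qed
    have bd: "\<bar>avg ?E (\<lambda>H. ?f k T H)\<bar> \<le> 1" for T
    proof -
      have "avg ?E (\<lambda>H. ?f k T H) \<le> avg ?E (\<lambda>_. 1)" using f by (intro avg_mono) auto
      moreover have "0 \<le> avg ?E (\<lambda>H. ?f k T H)" using f by (intro avg_nonneg) auto
      ultimately show ?thesis using Suc.prems(1) by (simp add: avg_const ext_oracles_nonempty)
    qed
    define c where "c = \<eta> ^ u * (of_bool (dom \<tau> \<inter> pts k \<noteq> {}) + \<epsilon>)"
    have "measure_pmf.expectation (A k) (\<lambda>T. avg ?E (\<lambda>H. ?f k T H)) \<le> measure_pmf.expectation (A k) (\<lambda>_. c)"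
    proof (rule expectation_mono_set_pmf[where c = "max 1 \<bar>c\<bar>"])
      show "avg ?E (\<lambda>H. ?f k T H) \<le> c" if "T \<in> set_pmf (A k)" for T
        unfolding c_def by (rule le) (use A[OF k] that in blast)
      show "\<bar>avg ?E (\<lambda>H. ?f k T H)\<bar> \<le> max 1 \<bar>c\<bar>" for T using bd[of T] by linarith
    qed simp
    then show "measure_pmf.expectation (A k) (\<lambda>T. avg ?E (\<lambda>H. ?f k T H)) \<le> \<eta> ^ u * (of_bool (dom \<tau> \<inter> pts k \<noteq> {}) + \<epsilon>)"
      by (simp add: c_def)
  qed
  also have "\<dots> = \<eta> ^ u * (real (card {k \<in> Ks. dom \<tau> \<inter> pts k \<noteq> {}}) / real (card Ks) + \<epsilon>)"
    using Ks by (simp add: avg_mult_right avg_add avg_const avg_indicator_card)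
  also have "\<dots> \<le> \<eta> ^ u * \<eta>"
  proof -
    let ?X = "{k \<in> Ks. dom \<tau> \<inter> pts k \<noteq> {}}"
    define h where "h k = (SOME x. x \<in> dom \<tau> \<inter> pts k)" for k
    have h: "h k \<in> dom \<tau> \<inter> pts k" if "k \<in> ?X" for k
      unfolding h_def using that some_in_eq[of "dom \<tau> \<inter> pts k"] by blast
    have "inj_on h ?X"
    proof (rule inj_onI)
      fix k k' assume kk: "k \<in> ?X" "k' \<in> ?X" "h k = h k'"
      then have "h k \<in> pts k \<inter> pts k'" using h[of k] h[of k'] by auto
      then show "k = k'" using kk disj[of k k'] by blast
    qed
    then have "card ?X \<le> card (dom \<tau>)" using h fin by (intro card_inj_on_le) auto
    then have "card ?X \<le> B" using Suc.prems(2) by simp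
    then show ?thesis using \<eta> by (intro mult_left_mono) (auto simp: \<eta>_def divide_right_mono)
  qed
  finally show ?case by (simp add: \<eta>_def mult.commute)
qed

text \<open>A single run from the empty table, where every key is fresh. This form serves the
  keyless family: with only one key, the term \<open>B / card Ks\<close> of
  \<open>success_rate_power\<close> would make the bound trivial.\<close>

lemma success_rate_fresh:
  assumes A: "\<And>k. k \<in> Ks \<Longrightarrow> set_pmf (A k) \<subseteq> Tr" and s: "s \<le> B"
  shows "avg (oracles n m) (success_rate Ks A win) \<le> \<epsilon>"
proof -
  let ?O = "oracles n m"
  let ?f = "\<lambda>k T H. win k (run_qtree H T) H"
  have "avg ?O (success_rate Ks A win) = avg Ks (\<lambda>k. measure_pmf.expectation (A k) (\<lambda>T. avg ?O (\<lambda>H. ?f k T H)))"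
    unfolding success_rate_def[abs_def] avg_swap[of ?O] using win
    by (subst expectation_avg_swap[where c = 1]) (auto simp: abs_le_iff intro: order_trans[of _ 0])
  also have "\<dots> \<le> avg Ks (\<lambda>_. \<epsilon>)"
  proof (rule avg_mono)
    fix k assume k: "k \<in> Ks"
    have "measure_pmf.expectation (A k) (\<lambda>T. avg ?O (\<lambda>H. ?f k T H)) \<le> measure_pmf.expectation (A k) (\<lambda>_. \<epsilon>)"
    proof (rule expectation_mono_set_pmf[where c = "max 1 \<bar>\<epsilon>\<bar>"])
      fix T assume "T \<in> set_pmf (A k)"
      then have "T \<in> Tr" using A[OF k] by blast
      then have "avg (ext_oracles n m Map.empty) (\<lambda>H. ?f k T H * 1) \<le> 1 * \<epsilon>"
        by (rule run[OF k _ table_empty _ le_refl]) (use s in \<open>auto simp: avg_const ext_oracles_nonempty\<close>)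
      then show "avg ?O (\<lambda>H. ?f k T H) \<le> \<epsilon>" by simp
    next
      fix T
      have "avg ?O (\<lambda>H. ?f k T H) \<le> avg ?O (\<lambda>_. 1)" using win by (intro avg_mono) auto
      moreover have "0 \<le> avg ?O (\<lambda>H. ?f k T H)" using win by (intro avg_nonneg) auto
      ultimately show "\<bar>avg ?O (\<lambda>H. ?f k T H)\<bar> \<le> max 1 \<bar>\<epsilon>\<bar>" by (simp add: avg_const)
    qed simp
    then show "measure_pmf.expectation (A k) (\<lambda>T. avg ?O (\<lambda>H. ?f k T H)) \<le> \<epsilon>" by simp
  qed
  also have "\<dots> = \<epsilon>" using Ks by (simp add: avg_const)
  finally show ?thesis .
qed

text \<open>For the advice that the oracle selects, either the rate is at most \<theta>, or the
  \<open>u\<close>-th power of the rate over \<theta> is at least one. Summing this power over all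
  advice strings removes the dependence of the advice on the oracle.\<close>

theorem success_rate_advice:
  assumes A: "\<And>z k. z \<in> Z \<Longrightarrow> k \<in> Ks \<Longrightarrow> set_pmf (A z k) \<subseteq> Tr" and Z: "finite Z" "\<And>H. H \<in> oracles n m \<Longrightarrow> adv H \<in> Z"
    and u: "u * s \<le> B" and \<theta>: "\<theta> > 0"
  shows "avg (oracles n m) (\<lambda>H. success_rate Ks (A (adv H)) win H)
      \<le> \<theta> + real (card Z) * ((real B / real (card Ks) + \<epsilon>) / \<theta>) ^ u"
proof -
  let ?g = "\<lambda>z H. success_rate Ks (A z) win H"
  have "avg (oracles n m) (\<lambda>H. ?g (adv H) H) \<le> avg (oracles n m) (\<lambda>H. \<theta> + (\<Sum>z\<in>Z. (?g z H / \<theta>) ^ u))"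
  proof (rule avg_mono)
    fix H assume H: "H \<in> oracles n m"
    note b = success_rate_bounds[of "A _" H]
    have nn: "0 \<le> (?g z H / \<theta>) ^ u" for z using b(1)[of z] \<theta> by simp
    show "?g (adv H) H \<le> \<theta> + (\<Sum>z\<in>Z. (?g z H / \<theta>) ^ u)"
    proof (cases "?g (adv H) H \<le> \<theta>")
      case True
      then show ?thesis using nn by (simp add: sum_nonneg add_increasing2)
    next
      case False
      then have "1 \<le> (?g (adv H) H / \<theta>) ^ u" using \<theta> by (intro one_le_power) simp
      also have "\<dots> \<le> (\<Sum>z\<in>Z. (?g z H / \<theta>) ^ u)"
        using Z H nn by (intro member_le_sum[of "adv H" Z "\<lambda>z. (?g z H / \<theta>) ^ u"]) auto
      finally show ?thesis using b(2)[of "adv H"] \<theta> by linarith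
    qed
  qed
  also have "\<dots> = \<theta> + (\<Sum>z\<in>Z. avg (oracles n m) (\<lambda>H. ?g z H ^ u) / \<theta> ^ u)"
    unfolding avg_add avg_sum using avg_mult_right[of "oracles n m" "1 / \<theta> ^ u"]
    by (simp add: avg_const power_divide)
  also have "\<dots> \<le> \<theta> + (\<Sum>z\<in>Z. (real B / real (card Ks) + \<epsilon>) ^ u / \<theta> ^ u)"
    using success_rate_power[of "A _" Map.empty u] A u \<theta>
    by (intro add_left_mono sum_mono divide_right_mono) auto
  also have "\<dots> = \<theta> + real (card Z) * ((real B / real (card Ks) + \<epsilon>) / \<theta>) ^ u"
    by (simp add: power_divide)
  finally show ?thesis .
qed

end

section \<open>The hash family and its resistance to classical queries\<close>

section \<open>The function family\<close>

text \<open>The rounded-down logarithm to base 256 (zero at zero). For positive \<open>l\<close> it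
  makes \<open>fold_len l\<close> a power of two within a factor of two of the eighth root of
  \<open>l\<close>, computable by repeated division.\<close>

fun log256 :: "nat \<Rightarrow> nat" where
  "log256 l = (if l < 256 then 0 else Suc (log256 (l div 256)))"

declare log256.simps [simp del]

definition fold_len :: "nat \<Rightarrow> nat" where "fold_len l = 2 ^ log256 l"
definition code_dim :: "nat \<Rightarrow> nat" where "code_dim l = fold_len l ^ 3"
definition block_count :: "nat \<Rightarrow> nat" where "block_count l = 2 * fold_len l ^ 4"
text \<open>Chosen so that \<open>2 ^ mark_len l = 64 * fold_len l ^ 2\<close>: a block is unmarked
  if this many answer bits are all zero.\<close>

definition mark_len :: "nat \<Rightarrow> nat" where "mark_len l = 2 * log256 l + 6"

text \<open>A field element is written as the number of ones in a chunk of \<open>l\<close> bits.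
  Only surjectivity onto the residues matters, and counting spares the machine any binary
  arithmetic.\<close>

definition digit :: "nat \<Rightarrow> bitstr \<Rightarrow> nat \<Rightarrow> nat" where
  "digit l z j = length (filter id (take l (drop (j * l) z)))"

definition horner_mod :: "nat \<Rightarrow> nat list \<Rightarrow> nat \<Rightarrow> nat" where
  "horner_mod p cs x = foldl (\<lambda>acc c. (acc * x + c) mod p) 0 cs"

definition code_value :: "nat \<Rightarrow> bitstr \<Rightarrow> nat \<Rightarrow> nat" where
  "code_value l z x = horner_mod l (map (digit l z) [0..<code_dim l]) x"

definition enc :: "nat \<Rightarrow> nat \<Rightarrow> bitstr" where
  "enc l a = replicate (l - a) False @ replicate a True"

text \<open>The leading bit separates these points from those of \<open>hash_point\<close> and from
  the all-zero query register; the padding gives both kinds of points the same length. The symbols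
  stand in reverse order because the machine assembles the query on a stack.\<close>

definition block_point :: "nat \<Rightarrow> bitstr \<Rightarrow> nat \<Rightarrow> nat list \<Rightarrow> bitstr" where
  "block_point l k i vs = True # k @ enc l i @ replicate (l * l + 1 - fold_len l * l) False
      @ foldl (\<lambda>s a. enc l a @ s) [] vs"

definition code_block :: "nat \<Rightarrow> (nat \<Rightarrow> nat) \<Rightarrow> nat \<Rightarrow> nat list" where
  "code_block l F i = map (\<lambda>j. F (i * fold_len l + j)) [0..<fold_len l]"

definition marked :: "nat \<Rightarrow> bitstr \<Rightarrow> bool" where
  "marked l y \<longleftrightarrow> take (mark_len l) y \<noteq> replicate (mark_len l) False"

definition solves :: "nat \<Rightarrow> oracle_fn \<Rightarrow> bitstr \<Rightarrow> bitstr \<Rightarrow> bool" where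
  "solves l H k z \<longleftrightarrow> prime l \<and>
     (\<forall>i<block_count l. marked l (H (block_point l k i (code_block l (code_value l z) i))))"

definition hash_point :: "bitstr \<Rightarrow> bitstr \<Rightarrow> bitstr" where
  "hash_point k x = False # k @ x"

definition trapdoor_hash :: "nat \<Rightarrow> oracle_fn \<Rightarrow> bitstr \<Rightarrow> bitstr \<Rightarrow> bitstr" where
  "trapdoor_hash l H k x = (if solves l H k (drop l x) then take l x else take l (H (hash_point k x)))"

text \<open>An input is a prefix of \<open>l\<close> bits and a candidate of
  \<open>l * l + 1\<close> bits, with room for \<open>l\<close> coefficients of \<open>l\<close>
  bits; the extra bit keeps the family compressing at \<open>l = 0\<close>. Answers are long enough
  both for the output and for the mark.\<close>

definition hash_family :: "(nat \<Rightarrow> nat) \<Rightarrow> function_family" where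
  "hash_family \<kappa> = \<lparr>query_len = (\<lambda>l. \<kappa> l + l * l + l + 2), answer_len = (\<lambda>l. 2 * l + 6),
     key_len = \<kappa>, in_len = (\<lambda>l. l * l + l + 1), out_len = (\<lambda>l. l), apply_fn = trapdoor_hash\<rparr>"

lemma fold_len_pos [simp]: "0 < fold_len l" "fold_len l \<noteq> 0"
  by (simp_all add: fold_len_def)

lemma code_dim_pos [simp]: "0 < code_dim l"
  by (simp add: code_dim_def)

lemma fold_len_power_le: "l > 0 \<Longrightarrow> fold_len l ^ 8 \<le> l"
proof (induction l rule: log256.induct)
  case (1 l)
  show ?case
  proof (cases "l < 256")
    case True
    then show ?thesis using 1 by (simp add: fold_len_def log256.simps[of l])
  next
    case False
    then have "fold_len (l div 256) ^ 8 \<le> l div 256" by (intro 1) auto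
    moreover have "fold_len l ^ 8 = 256 * fold_len (l div 256) ^ 8"
      using False by (simp add: fold_len_def log256.simps[of l] power_mult_distrib)
    ultimately show ?thesis using div_times_less_eq_dividend[of l 256] by linarith
  qed
qed

lemma fold_len_power_gt: "l < 256 * fold_len l ^ 8"
proof (induction l rule: log256.induct)
  case (1 l)
  show ?case
  proof (cases "l < 256")
    case True
    then show ?thesis by (simp add: fold_len_def log256.simps[of l])
  next
    case False
    then have "l div 256 < 256 * fold_len (l div 256) ^ 8" by (intro 1) auto
    moreover have "fold_len l ^ 8 = 256 * fold_len (l div 256) ^ 8"
      using False by (simp add: fold_len_def log256.simps[of l] power_mult_distrib)
    ultimately show ?thesis by linarith
  qed
qed

lemma fold_len_le:
  assumes "l > 0" "e \<le> 8"
  shows "fold_len l ^ e \<le> l"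
  by (rule order_trans[OF power_increasing[OF assms(2)] fold_len_power_le[OF assms(1)]]) (simp add: Suc_le_eq)

lemma log256_le: "log256 l \<le> l"
proof (cases "l = 0")
  case False
  have "log256 l \<le> fold_len l ^ 1" unfolding fold_len_def by (simp add: less_imp_le)
  then show ?thesis using fold_len_le[of l 1] False by simp
qed (simp add: log256.simps[of 0])

lemma block_count_le: "prime l \<Longrightarrow> block_count l \<le> l"
proof (cases "fold_len l = 1")
  case True
  then show "prime l \<Longrightarrow> ?thesis" using prime_ge_2_nat by (auto simp: block_count_def)
next
  case False
  assume "prime l"
  then have "fold_len l ^ 5 \<le> l" using fold_len_le[of l 5] prime_gt_0_nat by auto
  moreover have "2 \<le> fold_len l" using False fold_len_pos(1)[of l] by linarith
  then have "2 * fold_len l ^ 4 \<le> fold_len l * fold_len l ^ 4" by (rule mult_right_mono) simp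
  moreover have "fold_len l ^ 5 = fold_len l * fold_len l ^ 4" by (simp add: eval_nat_numeral)
  ultimately show ?thesis unfolding block_count_def by linarith
qed

lemma code_length_le: "prime l \<Longrightarrow> block_count l * fold_len l \<le> l"
proof (cases "fold_len l = 1")
  case True
  then show "prime l \<Longrightarrow> ?thesis" using prime_ge_2_nat by (auto simp: block_count_def)
next
  case False
  assume "prime l"
  then have "fold_len l ^ 6 \<le> l" using fold_len_le[of l 6] prime_gt_0_nat by auto
  moreover have "2 \<le> fold_len l" using False fold_len_pos(1)[of l] by linarith
  then have "2 * fold_len l ^ 5 \<le> fold_len l * fold_len l ^ 5" by (rule mult_right_mono) simp
  moreover have "fold_len l ^ 6 = fold_len l * fold_len l ^ 5" by (simp add: eval_nat_numeral)
  moreover have "block_count l * fold_len l = 2 * fold_len l ^ 5" by (simp add: block_count_def eval_nat_numeral algebra_simps)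
  ultimately show ?thesis by linarith
qed

text \<open>This hypothesis of the list recovery bound, \<open>m ^ 7 + m ^ 3 \<le> l\<close> with
  \<open>m = fold_len l\<close>, is what makes \<open>m\<close> as small as the eighth root of
  \<open>l\<close>. For \<open>m = 1\<close> it holds since a prime is at least 2.\<close>

lemma run_length_le:
  assumes "prime l"
  shows "(fold_len l * code_dim l + 1) * code_dim l \<le> l"
proof (cases "fold_len l = 1")
  case True
  then show ?thesis using assms prime_ge_2_nat[of l] by (simp add: code_dim_def)
next
  case False
  let ?m = "fold_len l"
  have "2 \<le> ?m" using False fold_len_pos(1)[of l] by linarith
  have "(?m * code_dim l + 1) * code_dim l = ?m ^ 7 + ?m ^ 3" by (simp add: code_dim_def eval_nat_numeral algebra_simps)
  also have "\<dots> \<le> 2 * ?m ^ 7" using power_increasing[of 3 7 ?m] by (simp add: Suc_le_eq)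
  also have "\<dots> \<le> ?m * ?m ^ 7" using \<open>2 \<le> ?m\<close> by (rule mult_right_mono) simp
  also have "\<dots> = ?m ^ 8" by (simp add: eval_nat_numeral)
  also have "\<dots> \<le> l" using assms prime_gt_0_nat by (intro fold_len_power_le) auto
  finally show ?thesis .
qed

section \<open>Code words as polynomials\<close>

definition horner_poly :: "nat list \<Rightarrow> int poly" where
  "horner_poly cs = foldl (\<lambda>q c. pCons (int c) q) 0 cs"

lemma horner_mod_poly: "p > 0 \<Longrightarrow> int (horner_mod p cs x) = poly (horner_poly cs) (int x) mod int p"
proof (induction cs rule: rev_induct)
  case (snoc c cs)
  have "int (horner_mod p (cs @ [c]) x) = (int (horner_mod p cs x) * int x + int c) mod int p"
    by (simp add: horner_mod_def zmod_int)
  also have "\<dots> = (poly (horner_poly cs) (int x) * int x + int c) mod int p"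
    unfolding snoc.IH[OF snoc.prems] by (metis mod_add_left_eq mod_mult_left_eq)
  also have "\<dots> = poly (horner_poly (cs @ [c])) (int x) mod int p"
    by (simp add: horner_poly_def algebra_simps)
  finally show ?case .
qed (simp add: horner_mod_def horner_poly_def)

lemma degree_horner_poly: "cs \<noteq> [] \<Longrightarrow> degree (horner_poly cs) < length cs"
proof (induction cs rule: rev_induct)
  case (snoc c cs)
  show ?case
  proof (cases "cs = []")
    case False
    then show ?thesis using snoc by (auto simp: horner_poly_def degree_pCons_eq_if)
  qed (simp add: horner_poly_def)
qed simp

lemma coeff_horner_poly: "j < length cs \<Longrightarrow> coeff (horner_poly cs) j = int (rev cs ! j)"
proof (induction cs arbitrary: j rule: rev_induct)
  case (snoc c cs)
  then show ?case by (cases j) (auto simp: horner_poly_def)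
qed simp

lemma code_value_eq_mod_fun:
  assumes "x < l"
  shows "code_value l z x = mod_fun l (horner_poly (map (digit l z) [0..<code_dim l])) x"
  using assms horner_mod_poly[of l _ x] by (simp add: code_value_def mod_fun_def nat_eq_iff2)

lemma digits_surj:
  assumes "\<And>j. c j \<le> l" 
  shows "\<exists>z\<in>bitstrs (l * l + 1). \<forall>j<l. digit l z j = c j"
proof -
  let ?b = "\<lambda>j. replicate (c j) True @ replicate (l - c j) False"
  let ?z = "\<lambda>N. concat (map ?b [0..<N])"
  have len: "length (?z N) = N * l" for N using assms by (induction N) auto
  have dig: "take l (drop (j * l) (?z N @ w)) = ?b j" if "j < N" for j N w
    using that
  proof (induction N arbitrary: w)
    case (Suc N)
    show ?case
    proof (cases "j = N")
      case True
      then show ?thesis using assms len[of N] by simp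
    next
      case False
      then show ?thesis using Suc.IH[of "?b N @ w"] Suc.prems by simp
    qed
  qed simp
  show ?thesis
  proof (intro bexI[of _ "?z l @ [False]"] allI impI)
    show "?z l @ [False] \<in> bitstrs (l * l + 1)" using len by (simp add: bitstrs_def)
    show "digit l (?z l @ [False]) j = c j" if "j < l" for j
      unfolding digit_def dig[OF that] by simp
  qed
qed

text \<open>The inverter finds code words but has to output bit strings; this supplies one for every
  code word. Horner's rule reads the leading coefficient first, so the coefficients are laid out in
  reverse.\<close>

lemma code_value_surj:
  assumes l: "prime l" and f: "degree f < code_dim l"
  shows "\<exists>z\<in>bitstrs (l * l + 1). \<forall>x<l. code_value l z x = mod_fun l f x"
proof -
  let ?n = "code_dim l"
  have l0: "l > 0" using l prime_gt_0_nat by blast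
  have nl: "?n \<le> l" using fold_len_le[OF l0, of 3] by (simp add: code_dim_def)
  define c where "c j = nat (coeff f (?n - 1 - j) mod int l)" for j
  have c: "c j \<le> l" "int (c j) = coeff f (?n - 1 - j) mod int l" for j
    using l0 pos_mod_bound[of "int l" "coeff f (?n - 1 - j)"] by (auto simp: c_def nat_le_iff intro: less_imp_le)
  obtain z where z: "z \<in> bitstrs (l * l + 1)" "\<And>j. j < l \<Longrightarrow> digit l z j = c j"
    using digits_surj[of c l] c(1) by blast
  let ?h = "horner_poly (map (digit l z) [0..<?n])"
  have deg: "degree ?h < ?n" using degree_horner_poly[of "map (digit l z) [0..<?n]"] by simp
  have co: "int l dvd coeff ?h j - coeff f j" if "j < ?n" for j
  proof -
    have "coeff ?h j = int (digit l z (?n - 1 - j))"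
      using that by (subst coeff_horner_poly) (auto simp: rev_nth)
    also have "\<dots> = coeff f j mod int l" using that nl z(2)[of "?n - 1 - j"] c(2)[of "?n - 1 - j"] by simp
    finally show ?thesis by (simp add: mod_eq_dvd_iff[symmetric])
  qed
  have "int l dvd poly ?h x - poly f x" for x
  proof -
    have "poly ?h x = (\<Sum>i<?n. coeff ?h i * x ^ i)" "poly f x = (\<Sum>i<?n. coeff f i * x ^ i)"
      using deg f by (auto simp: poly_altdef intro!: sum.mono_neutral_left coeff_eq_0)
    then have "poly ?h x - poly f x = (\<Sum>i<?n. (coeff ?h i - coeff f i) * x ^ i)"
      by (simp add: sum_subtractf algebra_simps)
    then show ?thesis using co by (auto intro!: dvd_sum dvd_mult2)
  qed
  then have "mod_fun l ?h x = mod_fun l f x" if "x < l" for x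
    using mod_fun_eq_iff[OF l0 that] by blast
  then show ?thesis using z(1) code_value_eq_mod_fun by auto
qed

section \<open>Query points\<close>

lemma length_enc [simp]: "a \<le> l \<Longrightarrow> length (enc l a) = l"
  by (simp add: enc_def)

lemma enc_inject: "a \<le> l \<Longrightarrow> b \<le> l \<Longrightarrow> enc l a = enc l b \<longleftrightarrow> a = b"
proof -
  have "length (filter id (enc l a)) = a" for a by (simp add: enc_def)
  then show ?thesis by metis
qed

lemma foldl_enc: "foldl (\<lambda>s a. enc l a @ s) w vs = concat (map (enc l) (rev vs)) @ w"
  by (induction vs arbitrary: w) auto

lemma length_concat_enc: "\<forall>v\<in>set vs. v \<le> l \<Longrightarrow> length (concat (map (enc l) vs)) = length vs * l"
  by (induction vs) auto

lemma block_point_in: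
  assumes "length k = \<kappa>" "i \<le> l" "l > 0" "length vs = fold_len l" "\<forall>v\<in>set vs. v \<le> l"
  shows "block_point l k i vs \<in> bitstrs (\<kappa> + l * l + l + 2)"
proof -
  have "fold_len l * l \<le> l * l" using fold_len_le[OF assms(3), of 1] by simp
  then have "l * l + 1 - fold_len l * l + fold_len l * l = l * l + 1" by linarith
  then show ?thesis using assms length_concat_enc[of "rev vs" l]
    by (simp add: block_point_def bitstrs_def foldl_enc del: Nat.diff_diff_right)
qed

lemma block_point_inject:
  assumes "length k = length k'" "i \<le> l" "i' \<le> l" "length vs = fold_len l" "length vs' = fold_len l"
    "\<forall>v\<in>set vs. v \<le> l" "\<forall>v\<in>set vs'. v \<le> l"
    and eq: "block_point l k i vs = block_point l k' i' vs'"
  shows "k = k' \<and> i = i' \<and> vs = vs'"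
proof -
  have ki: "k = k'" "enc l i = enc l i'" and c: "concat (map (enc l) (rev vs)) = concat (map (enc l) (rev vs'))"
    using eq assms(1-3) unfolding block_point_def foldl_enc by auto
  have "map (enc l) (rev vs) = map (enc l) (rev vs')"
  proof (rule concat_injective[OF c])
    have "\<forall>x\<in>set (map (enc l) (rev vs)). length x = l" "\<forall>x\<in>set (map (enc l) (rev vs')). length x = l"
      using assms(6,7) by auto
    then have "length (fst u) = length (snd u)" if "u \<in> set (zip (map (enc l) (rev vs)) (map (enc l) (rev vs')))" for u
      using that set_zip_leftD[of "fst u" "snd u"] set_zip_rightD[of "fst u" "snd u"] by (metis prod.collapse)
    then show "\<forall>(x, y)\<in>set (zip (map (enc l) (rev vs)) (map (enc l) (rev vs'))). length x = length y"
      unfolding case_prod_unfold by (intro ballI)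
  qed (use assms in simp)
  moreover have "inj_on (enc l) (set (rev vs) \<union> set (rev vs'))"
    using assms(6,7) enc_inject by (auto simp: inj_on_def)
  ultimately have "rev vs = rev vs'" by (simp add: inj_on_map_eq_map)
  then show ?thesis using ki enc_inject assms(2,3) by simp
qed


section \<open>The set of puzzle solutions\<close>

definition code_points :: "nat \<Rightarrow> bitstr \<Rightarrow> (nat \<Rightarrow> nat) \<Rightarrow> bitstr set" where
  "code_points l k F = (\<lambda>i. block_point l k i (code_block l F i)) ` {..<block_count l}"

definition code_words :: "nat \<Rightarrow> (nat \<Rightarrow> nat) set" where
  "code_words l = mod_fun l ` {f. degree f < code_dim l}"

definition solution_sets :: "nat \<Rightarrow> bitstr \<Rightarrow> bitstr set set" where
  "solution_sets l k = (if prime l then code_points l k ` code_words l else {})"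

lemma code_index_less:
  assumes "prime l" "i < block_count l" "j < fold_len l"
  shows "i * fold_len l + j < l"
proof -
  have "i * fold_len l + j < Suc i * fold_len l" using assms(3) by simp
  also have "\<dots> \<le> block_count l * fold_len l" using assms(2) by (intro mult_right_mono) auto
  also have "\<dots> \<le> l" using code_length_le[OF assms(1)] .
  finally show ?thesis .
qed

lemma code_block_bounds:
  assumes "prime l" "F \<in> code_words l" "i < block_count l"
  shows "length (code_block l F i) = fold_len l" "\<forall>v\<in>set (code_block l F i). v \<le> l"
proof -
  have "l > 0" using assms(1) prime_gt_0_nat by blast
  then have "F x < l" if "x < l" for x using assms(2) that mod_fun_less by (auto simp: code_words_def)
  then show "\<forall>v\<in>set (code_block l F i). v \<le> l"
    using code_index_less[OF assms(1,3)] by (auto simp: code_block_def intro: less_imp_le)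
qed (simp add: code_block_def)

lemma code_block_point_inject:
  assumes "prime l" "F \<in> code_words l" "F' \<in> code_words l" "i < block_count l" "i' < block_count l" "length k = length k'"
    and "block_point l k i (code_block l F i) = block_point l k' i' (code_block l F' i')"
  shows "k = k' \<and> i = i' \<and> code_block l F i = code_block l F' i'"
  using assms block_count_le[OF assms(1)] code_block_bounds
  by (intro block_point_inject) (auto intro: less_imp_le less_le_trans)

lemma code_words_finite: "l > 0 \<Longrightarrow> finite (code_words l)"
proof (rule finite_subset)
  assume "l > 0"
  then show "code_words l \<subseteq> {..<l} \<rightarrow>\<^sub>E {..<l}"
    unfolding code_words_def
    by (intro image_subsetI PiE_I) (use mod_fun_less in \<open>auto simp: mod_fun_def\<close>)
qed (simp add: finite_PiE)

lemma solution_sets_finite: "finite (solution_sets l k)"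
  using code_words_finite[OF prime_gt_0_nat, of l] by (simp add: solution_sets_def)

lemma solution_sets_card:
  assumes "c \<in> solution_sets l k"
  shows "finite c \<and> card c = block_count l"
proof -
  obtain F where F: "prime l" "F \<in> code_words l" "c = code_points l k F"
    using assms by (auto simp: solution_sets_def split: if_splits)
  have "inj_on (\<lambda>i. block_point l k i (code_block l F i)) {..<block_count l}"
    using code_block_point_inject[OF F(1,2,2)] by (auto simp: inj_on_def)
  then show ?thesis by (simp add: F(3) code_points_def card_image)
qed

lemma solution_sets_query:
  assumes "c \<in> solution_sets l k" "x \<in> c" "length k = \<kappa>"
  shows "x \<in> bitstrs (\<kappa> + l * l + l + 2) \<and> take \<kappa> (tl x) = k"
proof -
  obtain F i where F: "prime l" "F \<in> code_words l" "i < block_count l" "x = block_point l k i (code_block l F i)"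
    using assms by (auto simp: solution_sets_def code_points_def split: if_splits)
  have "i \<le> l" using F(3) block_count_le[OF F(1)] by simp
  then have "x \<in> bitstrs (\<kappa> + l * l + l + 2)"
    unfolding F(4) using assms(3) code_block_bounds[OF F(1-3)] prime_gt_0_nat[OF F(1)] by (intro block_point_in)
  then show ?thesis using assms(3) F(4) by (simp add: block_point_def)
qed

definition list_bound :: "nat \<Rightarrow> nat" where
  "list_bound l = (\<Sum>j=1..fold_len l. l ^ j)"

text \<open>The position at which a symbol was queried is forgotten, which gives one common list
  \<open>S\<close> for all blocks. Distinct symbols still need distinct queries, so \<open>S\<close>
  is no larger than \<open>Q\<close>.\<close>

lemma solution_sets_list_bound:
  assumes Q: "finite Q" "card Q < 2 ^ fold_len l" and k: "length k = \<kappa>"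
  shows "card {c \<in> solution_sets l k. fold_len l * code_dim l \<le> card (c \<inter> Q)} \<le> list_bound l"
proof (cases "prime l")
  case False
  then show ?thesis by (simp add: solution_sets_def)
next
  case True
  let ?m = "fold_len l" and ?n = "code_dim l"
  have l0: "l > 0" using True prime_gt_0_nat by blast
  define S where "S = {vs. \<exists>F i. F \<in> code_words l \<and> i < block_count l \<and> vs = code_block l F i \<and> block_point l k i vs \<in> Q}"
  have "\<exists>h. \<forall>vs\<in>S. \<exists>F i. F \<in> code_words l \<and> i < block_count l \<and> vs = code_block l F i \<and> h vs = block_point l k i vs \<and> h vs \<in> Q"
    unfolding S_def by (intro bchoice) blast
  then obtain h where h: "\<And>vs. vs \<in> S \<Longrightarrow> \<exists>F i. F \<in> code_words l \<and> i < block_count l \<and> vs = code_block l F i \<and> h vs = block_point l k i vs \<and> h vs \<in> Q"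
    by blast
  have "inj_on h S"
  proof (rule inj_onI)
    fix vs vs' assume vs: "vs \<in> S" "vs' \<in> S" "h vs = h vs'"
    obtain F i where F: "F \<in> code_words l" "i < block_count l" "vs = code_block l F i" "h vs = block_point l k i vs" using h[OF vs(1)] by blast
    obtain F' i' where F': "F' \<in> code_words l" "i' < block_count l" "vs' = code_block l F' i'" "h vs' = block_point l k i' vs'" using h[OF vs(2)] by blast
    show "vs = vs'" using code_block_point_inject[OF True F(1) F'(1) F(2) F'(2) refl] F F' vs(3) by auto
  qed
  moreover have "h ` S \<subseteq> Q" using h by blast
  ultimately have S: "finite S" "card S \<le> card Q"
    using Q(1) by (auto intro: inj_on_finite card_inj_on_le)
  define A where "A = (\<lambda>i. i * ?m) ` {..<block_count l}"
  have A: "A \<subseteq> {..<l}" using code_index_less[OF True, of _ 0] by (auto simp: A_def)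
  let ?X = "{f. degree f < ?n \<and> ?m * ?n \<le> card {x \<in> A. map (\<lambda>j. nat (poly f (int (x + j)) mod int l)) [0..<?m] \<in> S}}"
  have lb: "card (mod_fun l ` ?X) \<le> list_bound l" "finite (mod_fun l ` ?X)"
    unfolding list_bound_def using S Q(2) A run_length_le[OF True]
    by (intro list_recovery_bound[OF True]; simp)+
  have "{c \<in> solution_sets l k. ?m * ?n \<le> card (c \<inter> Q)} \<subseteq> code_points l k ` mod_fun l ` ?X"
  proof
    fix c assume c: "c \<in> {c \<in> solution_sets l k. ?m * ?n \<le> card (c \<inter> Q)}"
    then obtain f where f: "degree f < ?n" "c = code_points l k (mod_fun l f)"
      using True by (auto simp: solution_sets_def code_words_def)
    let ?F = "mod_fun l f"
    have F: "?F \<in> code_words l" using f by (auto simp: code_words_def)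
    let ?I = "{i. i < block_count l \<and> block_point l k i (code_block l ?F i) \<in> Q}"
    have "c \<inter> Q \<subseteq> (\<lambda>i. block_point l k i (code_block l ?F i)) ` ?I"
      unfolding f(2) code_points_def by auto
    then have "card (c \<inter> Q) \<le> card ?I" by (rule surj_card_le[rotated]) simp
    also have "\<dots> = card ((\<lambda>i. i * ?m) ` ?I)"
      by (rule card_image[symmetric]) (auto simp: inj_on_def)
    also have "\<dots> \<le> card {x \<in> A. map (\<lambda>j. nat (poly f (int (x + j)) mod int l)) [0..<?m] \<in> S}"
    proof (rule card_mono)
      have eq: "map (\<lambda>j. nat (poly f (int (i * ?m + j)) mod int l)) [0..<?m] = code_block l ?F i" if "i < block_count l" for i
        using code_index_less[OF True that] by (auto simp: code_block_def mod_fun_def)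
      show "(\<lambda>i. i * ?m) ` ?I \<subseteq> {x \<in> A. map (\<lambda>j. nat (poly f (int (x + j)) mod int l)) [0..<?m] \<in> S}"
      proof (rule image_subsetI)
        fix i assume i: "i \<in> ?I"
        then have "code_block l ?F i \<in> S" using F unfolding S_def by blast
        then show "i * ?m \<in> {x \<in> A. map (\<lambda>j. nat (poly f (int (x + j)) mod int l)) [0..<?m] \<in> S}"
          using i eq[of i] by (auto simp: A_def)
      qed
    qed (simp add: A_def)
    finally have "f \<in> ?X" using c f(1) by simp
    then show "c \<in> code_points l k ` mod_fun l ` ?X" using f(2) by blast
  qed
  then have "card {c \<in> solution_sets l k. ?m * ?n \<le> card (c \<inter> Q)} \<le> card (code_points l k ` mod_fun l ` ?X)"
    using lb(2) by (intro card_mono) auto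
  also have "\<dots> \<le> list_bound l" using card_image_le[OF lb(2), of "code_points l k"] lb(1) by simp
  finally show ?thesis .
qed

section \<open>Collision resistance\<close>

text \<open>Dropping the leading bit covers block points and hash points alike. For key length 0
  this is every query point.\<close>

definition keyed_points :: "nat \<Rightarrow> nat \<Rightarrow> bitstr \<Rightarrow> bitstr set" where
  "keyed_points l \<kappa> k = {x \<in> bitstrs (\<kappa> + l * l + l + 2). take \<kappa> (tl x) = k}"

definition solution_points :: "nat \<Rightarrow> bitstr \<Rightarrow> bitstr \<Rightarrow> bitstr list" where
  "solution_points l k z = map (\<lambda>i. block_point l k i (code_block l (code_value l z) i)) [0..<block_count l]"

text \<open>Queries that decide the value at \<open>x\<close>. The hash point is included even if
  the puzzle is solved, and the list is empty for ill-formed \<open>x\<close>, which cannot take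
  part in a collision.\<close>

definition verification_points :: "nat \<Rightarrow> bitstr \<Rightarrow> bitstr \<Rightarrow> bitstr list" where
  "verification_points l k x = (if x \<in> bitstrs (l * l + l + 1)
     then hash_point k x # (if prime l then solution_points l k (drop l x) else []) else [])"

definition collides :: "nat \<Rightarrow> bitstr \<Rightarrow> bitstr \<times> bitstr \<Rightarrow> oracle_fn \<Rightarrow> real" where
  "collides l k = (\<lambda>(x0, x1) H. of_bool (x0 \<in> bitstrs (l * l + l + 1) \<and> x1 \<in> bitstrs (l * l + l + 1) \<and>
     trapdoor_hash l H k x0 = trapdoor_hash l H k x1 \<and> x0 \<noteq> x1))"

definition mark_prob :: "nat \<Rightarrow> real" where
  "mark_prob l = 1 - 1 / 2 ^ mark_len l"

text \<open>Bound on the expected increase of the search potential per query. The exponent is the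
  number of blocks beyond the threshold, which equals the threshold itself.\<close>

definition query_gain :: "nat \<Rightarrow> nat \<Rightarrow> real" where
  "query_gain l B = real (list_bound l) * mark_prob l ^ (fold_len l * code_dim l) + 2 * real B / 2 ^ l"

lemma code_value_block:
  assumes "prime l"
  shows "\<exists>F\<in>code_words l. \<forall>i<block_count l. code_block l (code_value l z) i = code_block l F i"
proof (intro bexI allI impI)
  let ?F = "mod_fun l (horner_poly (map (digit l z) [0..<code_dim l]))"
  show "?F \<in> code_words l"
    using degree_horner_poly[of "map (digit l z) [0..<code_dim l]"] by (auto simp: code_words_def)
  show "code_block l (code_value l z) i = code_block l ?F i" if "i < block_count l" for i
    using code_value_eq_mod_fun code_index_less[OF assms that] by (auto simp: code_block_def)
qed

lemma solution_points_set:
  assumes "prime l"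
  shows "set (solution_points l k z) \<in> solution_sets l k"
proof -
  obtain F where F: "F \<in> code_words l" "\<forall>i<block_count l. code_block l (code_value l z) i = code_block l F i"
    using code_value_block[OF assms] by blast
  have "set (solution_points l k z) = code_points l k F"
    using F(2) unfolding solution_points_def code_points_def set_map set_upt atLeast0LessThan
    by (intro image_cong) auto
  then show ?thesis using F(1) assms by (simp add: solution_sets_def)
qed

lemma verification_points_in:
  assumes "length k = \<kappa>"
  shows "set (verification_points l k x) \<subseteq> bitstrs (\<kappa> + l * l + l + 2)"
proof -
  have "set (solution_points l k (drop l x)) \<subseteq> bitstrs (\<kappa> + l * l + l + 2)" if "prime l"
  proof
    fix y assume "y \<in> set (solution_points l k (drop l x))"
    then show "y \<in> bitstrs (\<kappa> + l * l + l + 2)"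
      using solution_sets_query[OF solution_points_set[OF that, of k "drop l x"], of y \<kappa>] assms by simp
  qed
  moreover have "hash_point k x \<in> bitstrs (\<kappa> + l * l + l + 2)" if "x \<in> bitstrs (l * l + l + 1)"
    using that assms by (simp add: hash_point_def bitstrs_def)
  ultimately show ?thesis
    by (cases "prime l"; cases "x \<in> bitstrs (l * l + l + 1)")
       (simp_all only: verification_points_def if_True if_False list.set set_append insert_subset empty_subsetI simp_thms)
qed

lemma length_verification_points: "length (verification_points l k x) \<le> 1 + block_count l"
  by (simp add: verification_points_def solution_points_def)

lemma avg_marked: "avg (bitstrs (2 * l + 6)) (\<lambda>y. of_bool (marked l y)) = mark_prob l"
proof -
  have "mark_len l \<le> 2 * l + 6" using log256_le[of l] by (simp add: mark_len_def)
  then have "avg (bitstrs (2 * l + 6)) (\<lambda>y. of_bool (take (mark_len l) y = replicate (mark_len l) False)) = 1 / 2 ^ mark_len l"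
    by (intro avg_take_bits) auto
  moreover have "of_bool (marked l y) = 1 - (of_bool (take (mark_len l) y = replicate (mark_len l) False) :: real)" for y
    by (simp add: marked_def)
  ultimately show ?thesis by (simp add: avg_diff avg_const mark_prob_def)
qed

lemma mark_prob_bounds: "1 / 2 \<le> mark_prob l" "mark_prob l < 1"
proof -
  have "(2::real) ^ 1 \<le> 2 ^ mark_len l" by (intro power_increasing) (auto simp: mark_len_def)
  then show "1 / 2 \<le> mark_prob l" "mark_prob l < 1" by (auto simp: mark_prob_def field_simps)
qed

lemma query_gain_nonneg: "0 \<le> query_gain l B"
  using mark_prob_bounds(1)[of l] by (simp add: query_gain_def)

text \<open>A collision in which one input solves the puzzle exhibits a code word with all blocks
  marked; any other collision gives two distinct hash points whose answers share their first
  \<open>l\<close> bits. Either way the search potential reaches one as soon as both inputs are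
  verified, which takes at most \<open>2 + 2 * block_count l\<close> queries.\<close>

lemma collision_run_bound:
  assumes k: "k \<in> bitstrs \<kappa>" and T: "bounded_qtree (\<kappa> + l * l + l + 2) T q"
    and \<tau>: "table (\<kappa> + l * l + l + 2) (2 * l + 6) \<tau>" "card (dom \<tau>) + (q + (2 + 2 * block_count l)) \<le> B'" "B' \<le> B"
    and B: "B < 2 ^ fold_len l" and fresh: "dom \<tau> \<inter> keyed_points l \<kappa> k = {}"
    and K: "\<And>H. 0 \<le> K H" "\<xi> \<ge> 0"
      "\<And>\<tau>'. table (\<kappa> + l * l + l + 2) (2 * l + 6) \<tau>' \<Longrightarrow> card (dom \<tau>') \<le> B' \<Longrightarrow> avg (ext_oracles (\<kappa> + l * l + l + 2) (2 * l + 6) \<tau>') K \<le> \<xi>"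
  shows "avg (ext_oracles (\<kappa> + l * l + l + 2) (2 * l + 6) \<tau>) (\<lambda>H. collides l k (run_qtree H T) H * K H)
    \<le> \<xi> * (real (q + (2 + 2 * block_count l)) * query_gain l B)"
proof -
  let ?n = "\<kappa> + l * l + l + 2" and ?a = "2 * l + 6" and ?C = "solution_sets l k" and ?M = "fold_len l * code_dim l"
  let ?V = "\<lambda>(x0, x1). verification_points l k x0 @ verification_points l k x1"
  let ?P = "keyed_points l \<kappa> k"
  have lk: "length k = \<kappa>" using k by (simp add: bitstrs_def)
  \<comment> \<open>Half of the blocks trigger the list bound, the other half pay for it.\<close>
  have N: "block_count l = 2 * ?M" by (simp add: block_count_def code_dim_def eval_nat_numeral)
  have list: "card {c \<in> ?C. ?M \<le> card (c \<inter> Q)} \<le> list_bound l" if "finite Q" "card Q \<le> B" for Q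
    using that B by (intro solution_sets_list_bound[OF _ _ lk]) auto
  note sp = avg_marked[symmetric, of l] solution_sets_card[of _ l k] solution_sets_finite[of l k] list
  let ?\<Phi> = "search_potential l ?M ?C ?P (marked l) (mark_prob l)"
  have la: "l \<le> ?a" by simp
  have \<Phi>0: "?\<Phi> \<tau> = 0"
  proof (rule search_potential_untouched[OF sp la fresh])
    fix c assume c: "c \<in> ?C"
    then have "c \<subseteq> ?P" using solution_sets_query[OF c _ lk] by (auto simp: keyed_points_def)
    then show "c \<inter> dom \<tau> = {}" using fresh by blast
  qed auto
  have win: "collides l k a H \<le> ?\<Phi> \<tau>'"
    if t: "table ?n ?a \<tau>'" "set (?V a) \<subseteq> dom \<tau>'" "H \<in> ext_oracles ?n ?a \<tau>'" for a \<tau>' H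
  proof (cases "collides l k a H = 0")
    case True
    then show ?thesis using search_potential_nonneg[OF sp la] by simp
  next
    case False
    obtain x0 x1 where a: "a = (x0, x1)" by (cases a)
    from False have x: "x0 \<in> bitstrs (l * l + l + 1)" "x1 \<in> bitstrs (l * l + l + 1)" "x0 \<noteq> x1"
      "trapdoor_hash l H k x0 = trapdoor_hash l H k x1" by (auto simp: collides_def a)
    have \<tau>': "the (\<tau>' y) = H y" if "y \<in> dom \<tau>'" for y using t(3) that by (auto simp: ext_oracles_def)
    have sol: "1 \<le> ?\<Phi> \<tau>'" if s: "solves l H k (drop l x)" and sub: "set (verification_points l k x) \<subseteq> dom \<tau>'" 
      and xin: "x \<in> bitstrs (l * l + l + 1)" for x
    proof (rule search_potential_solution[OF sp la])
      have p: "prime l" using s by (simp add: solves_def)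
      then show "set (solution_points l k (drop l x)) \<in> ?C" by (rule solution_points_set)
      show sub': "set (solution_points l k (drop l x)) \<subseteq> dom \<tau>'"
        using sub p xin by (auto simp: verification_points_def)
      show "\<forall>y\<in>set (solution_points l k (drop l x)). marked l (the (\<tau>' y))"
      proof
        fix y assume y: "y \<in> set (solution_points l k (drop l x))"
        then have "marked l (H y)" using s by (auto simp: solves_def solution_points_def)
        moreover have "y \<in> dom \<tau>'" using y sub' by blast
        ultimately show "marked l (the (\<tau>' y))" using \<tau>' by metis
      qed
      show "?M \<le> block_count l" using N by simp
    qed
    have "1 \<le> ?\<Phi> \<tau>'"
    proof (cases "solves l H k (drop l x0) \<or> solves l H k (drop l x1)")
      case True
      then show ?thesis using sol x(1,2) t(2) by (auto simp: a)
    next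
      case False
      have hp: "hash_point k x \<in> dom \<tau>' \<inter> ?P" if "set (verification_points l k x) \<subseteq> dom \<tau>'" "x \<in> bitstrs (l * l + l + 1)" for x
        using that lk by (auto simp: verification_points_def keyed_points_def hash_point_def bitstrs_def)
      have h0: "hash_point k x0 \<in> dom \<tau>' \<inter> ?P" and h1: "hash_point k x1 \<in> dom \<tau>' \<inter> ?P"
        using hp[of x0] hp[of x1] x(1,2) t(2) by (auto simp: a)
      show ?thesis
      proof (rule search_potential_collision[OF sp la h0 h1])
        show "hash_point k x0 \<noteq> hash_point k x1" using x(3) by (simp add: hash_point_def)
        show "take l (the (\<tau>' (hash_point k x0))) = take l (the (\<tau>' (hash_point k x1)))"
          using x(4) False \<tau>' h0 h1 by (simp add: trapdoor_hash_def)
        show "finite (dom \<tau>')" using t(1) by (rule finite_dom_table)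
      qed
    qed
    moreover have "collides l k a H \<le> 1" by (simp add: collides_def a)
    ultimately show ?thesis by simp
  qed
  have "avg (ext_oracles ?n ?a \<tau>) (\<lambda>H. collides l k (run_qtree H T) H * K H)
      \<le> \<xi> * (?\<Phi> \<tau> + real (q + (2 + 2 * block_count l)) * query_gain l B)"
  proof (rule potential_bound[where V = ?V and w = "collides l k" and B = B', OF K(1,2) query_gain_nonneg])
    show "0 \<le> ?\<Phi> \<tau>'" for \<tau>' by (rule search_potential_nonneg[OF sp la])
    show "avg (bitstrs ?a) (\<lambda>y. ?\<Phi> (\<tau>'(x \<mapsto> y))) \<le> ?\<Phi> \<tau>' + query_gain l B"
      if "table ?n ?a \<tau>'" "card (dom \<tau>') < B'" "x \<in> bitstrs ?n" "\<tau>' x = None" for \<tau>' x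
    proof -
      have "card (dom \<tau>') < B" using that(2) \<tau>(3) by simp
      from search_potential_step[OF sp la that(1) this that(4), where P = ?P]
      have "avg (bitstrs ?a) (\<lambda>y. ?\<Phi> (\<tau>'(x \<mapsto> y)))
          \<le> ?\<Phi> \<tau>' + (real (list_bound l) * mark_prob l ^ (block_count l - ?M) + 2 * real B / 2 ^ l)" .
      also have "block_count l - ?M = ?M" using N by simp
      finally show ?thesis unfolding query_gain_def .
    qed
    show "set (?V a) \<subseteq> bitstrs ?n" for a
      using verification_points_in[OF lk] by (cases a) auto
    show "length (?V a) \<le> 2 + 2 * block_count l" for a
      using length_verification_points[of l k "fst a"] length_verification_points[of l k "snd a"] by (cases a) auto
    show "collides l k a H \<le> ?\<Phi> \<tau>'"
      if "table ?n ?a \<tau>'" "set (?V a) \<subseteq> dom \<tau>'" "H \<in> ext_oracles ?n ?a \<tau>'" for a \<tau>' H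
      using win[OF that] .
  qed (use K(3) T \<tau> in auto)
  then show ?thesis using \<Phi>0 by simp
qed

lemma collision_prob_avg:
  "collision_prob (hash_family \<kappa>) l A = avg (oracles (\<kappa> l + l * l + l + 2) (2 * l + 6))
     (\<lambda>H. success_rate (bitstrs (\<kappa> l)) (A H) (collides l) H)"
proof -
  have b: "pmf (case_prod (\<lambda>x0 x1. return_pmf (P x0 x1)) y) True = of_bool (case_prod P y)" for P and y :: "bitstr \<times> bitstr"
    by (cases y) simp
  show ?thesis
    unfolding collision_prob_def Let_def pmf_bind b success_rate_def
    by (simp add: hash_family_def oracles_of_def expectation_pmf_of_set_avg b collides_def case_prod_unfold)
qed

lemma keyed_points_disjoint: "k \<noteq> k' \<Longrightarrow> keyed_points l \<kappa> k \<inter> keyed_points l \<kappa> k' = {}"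
  by (auto simp: keyed_points_def)

lemma collides_bounds: "0 \<le> collides l k a H \<and> collides l k a H \<le> 1"
  by (auto simp: collides_def case_prod_unfold)

lemma collision_prob_fresh:
  assumes A: "\<And>k T. k \<in> bitstrs (\<kappa> l) \<Longrightarrow> T \<in> set_pmf (A k) \<Longrightarrow> bounded_qtree (\<kappa> l + l * l + l + 2) T q"
    and B: "q + (2 + 2 * block_count l) < 2 ^ fold_len l"
  shows "collision_prob (hash_family \<kappa>) l (\<lambda>H k. A k)
    \<le> real (q + (2 + 2 * block_count l)) * query_gain l (q + (2 + 2 * block_count l))"
proof -
  let ?s = "q + (2 + 2 * block_count l)"
  have "avg (oracles (\<kappa> l + l * l + l + 2) (2 * l + 6)) (success_rate (bitstrs (\<kappa> l)) A (collides l)) \<le> real ?s * query_gain l ?s"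
    by (rule success_rate_fresh[where B = ?s and s = ?s and pts = "keyed_points l (\<kappa> l)"
          and Tr = "{T. bounded_qtree (\<kappa> l + l * l + l + 2) T q}"];
        (rule collision_run_bound | use A query_gain_nonneg keyed_points_disjoint collides_bounds in auto); use B in simp)
  then show ?thesis by (simp add: collision_prob_avg)
qed

lemma collision_prob_advice:
  assumes A: "\<And>z k T. z \<in> Z \<Longrightarrow> k \<in> bitstrs (\<kappa> l) \<Longrightarrow> T \<in> set_pmf (A z k) \<Longrightarrow> bounded_qtree (\<kappa> l + l * l + l + 2) T q"
    and Z: "finite Z" "\<And>H. H \<in> oracles (\<kappa> l + l * l + l + 2) (2 * l + 6) \<Longrightarrow> adv H \<in> Z"
    and B: "u * (q + (2 + 2 * block_count l)) \<le> B" "B < 2 ^ fold_len l" and \<theta>: "\<theta> > 0"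
  shows "collision_prob (hash_family \<kappa>) l (\<lambda>H k. A (adv H) k)
    \<le> \<theta> + real (card Z) * ((real B / 2 ^ \<kappa> l + real (q + (2 + 2 * block_count l)) * query_gain l B) / \<theta>) ^ u"
proof -
  let ?s = "q + (2 + 2 * block_count l)"
  have "avg (oracles (\<kappa> l + l * l + l + 2) (2 * l + 6)) (\<lambda>H. success_rate (bitstrs (\<kappa> l)) (A (adv H)) (collides l) H)
     \<le> \<theta> + real (card Z) * ((real B / real (card (bitstrs (\<kappa> l))) + real ?s * query_gain l B) / \<theta>) ^ u"
    by (rule success_rate_advice[where s = ?s and pts = "keyed_points l (\<kappa> l)"
          and Tr = "{T. bounded_qtree (\<kappa> l + l * l + l + 2) T q}"];
        (rule collision_run_bound[where B = B] | use A Z B \<theta> query_gain_nonneg keyed_points_disjoint collides_bounds in auto); use B in simp)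
  then show ?thesis by (simp add: collision_prob_avg)
qed

section \<open>Polynomially bounded and superpolynomially small functions\<close>

definition pbounded :: "(nat \<Rightarrow> nat) \<Rightarrow> bool" where
  "pbounded f \<longleftrightarrow> (\<exists>p :: nat poly. \<forall>l. f l \<le> poly p l)"

lemma pbounded_poly: "pbounded (poly p)"
  by (auto simp: pbounded_def)

lemma pbounded_const: "pbounded (\<lambda>_. c)"
  unfolding pbounded_def by (rule exI[of _ "[:c:]"]) simp

lemma pbounded_id: "pbounded (\<lambda>l. l)"
  unfolding pbounded_def by (rule exI[of _ "[:0, 1:]"]) simp

lemma pbounded_add: "pbounded f \<Longrightarrow> pbounded g \<Longrightarrow> pbounded (\<lambda>l. f l + g l)"
  unfolding pbounded_def by (metis add_mono poly_add)

lemma pbounded_mult: "pbounded f \<Longrightarrow> pbounded g \<Longrightarrow> pbounded (\<lambda>l. f l * g l)"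
  unfolding pbounded_def by (metis mult_le_mono poly_mult)

lemma pbounded_mono: "pbounded g \<Longrightarrow> (\<And>l. f l \<le> g l) \<Longrightarrow> pbounded f"
  unfolding pbounded_def by (meson order_trans)

lemma pbounded_Suc: "pbounded f \<Longrightarrow> pbounded (\<lambda>l. Suc (f l))"
  using pbounded_add[OF _ pbounded_const[of 1]] by simp

lemma pbounded_power: "pbounded f \<Longrightarrow> pbounded (\<lambda>l. f l ^ k)"
  by (induction k) (auto intro: pbounded_const pbounded_mult)

lemmas pbounded_intros = pbounded_poly pbounded_const pbounded_id pbounded_add pbounded_mult pbounded_Suc pbounded_power

lemma pbounded_eventually:
  assumes "pbounded f"
  shows "\<exists>D. \<forall>\<^sub>F l in sequentially. f l \<le> l ^ D"
proof -
  obtain p :: "nat poly" where p: "\<And>l. f l \<le> poly p l" using assms by (auto simp: pbounded_def)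
  have "\<exists>C d. \<forall>l\<ge>1. poly p l \<le> C * l ^ d"
  proof (induction p)
    case (pCons a p)
    then obtain C d where C: "\<And>l. l \<ge> 1 \<Longrightarrow> poly p l \<le> C * l ^ d" by blast
    have "poly (pCons a p) l \<le> (a + C) * l ^ Suc d" if "l \<ge> 1" for l
    proof -
      have "a * 1 \<le> a * l ^ Suc d" using that by (intro mult_left_mono) auto
      moreover have "l * poly p l \<le> l * (C * l ^ d)" using C[OF that] by (rule mult_left_mono) simp
      moreover have "(a + C) * l ^ Suc d = a * l ^ Suc d + l * (C * l ^ d)" by (simp add: algebra_simps)
      ultimately show ?thesis unfolding poly_pCons by linarith
    qed
    then show ?case by blast
  qed auto
  then obtain C d where C: "\<And>l. l \<ge> 1 \<Longrightarrow> poly p l \<le> C * l ^ d" by blast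
  have le: "f l \<le> l ^ Suc d" if "l \<ge> C + 1" for l
  proof -
    have "f l \<le> C * l ^ d" using order_trans[OF p[of l] C[of l]] that by simp
    also have "\<dots> \<le> l * l ^ d" using that by (intro mult_right_mono) auto
    finally show ?thesis by simp
  qed
  have "\<forall>\<^sub>F l in sequentially. f l \<le> l ^ Suc d" using eventually_ge_at_top[of "C + 1"] by eventually_elim (rule le)
  then show ?thesis ..
qed

text \<open>One-sided and only eventual, so that bounds compose without regard to signs;
  \<open>negl_tiny\<close> returns to \<open>negl\<close> for nonnegative functions.\<close>

definition tiny :: "(nat \<Rightarrow> real) \<Rightarrow> bool" where
  "tiny f \<longleftrightarrow> (\<forall>D. \<forall>\<^sub>F l in sequentially. f l \<le> 1 / real l ^ D)"

lemma tiny_add: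
  assumes "tiny f" "tiny g"
  shows "tiny (\<lambda>l. f l + g l)"
  unfolding tiny_def
proof
  fix D
  have "\<forall>\<^sub>F l in sequentially. f l \<le> 1 / real l ^ Suc D" "\<forall>\<^sub>F l in sequentially. g l \<le> 1 / real l ^ Suc D"
    using assms by (auto simp: tiny_def simp del: power_Suc)
  then show "\<forall>\<^sub>F l in sequentially. f l + g l \<le> 1 / real l ^ D"
    using eventually_ge_at_top[of 2]
  proof eventually_elim
    case (elim l)
    have "f l + g l \<le> 1 / (real l * real l ^ D) + 1 / (real l * real l ^ D)" using elim(1,2) unfolding power_Suc by (rule add_mono)
    also have "\<dots> = 2 / (real l * real l ^ D)" by simp
    also have "\<dots> \<le> real l / (real l * real l ^ D)" using elim by (intro divide_right_mono) auto
    finally show ?case using elim by simp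
  qed
qed

lemma tiny_mult:
  assumes f: "tiny f" and g: "pbounded g"
  shows "tiny (\<lambda>l. real (g l) * f l)"
  unfolding tiny_def
proof
  fix D
  obtain E where "\<forall>\<^sub>F l in sequentially. g l \<le> l ^ E" using pbounded_eventually[OF g] by blast
  moreover have "\<forall>\<^sub>F l in sequentially. f l \<le> 1 / real l ^ (E + D)" using f by (auto simp: tiny_def)
  ultimately show "\<forall>\<^sub>F l in sequentially. real (g l) * f l \<le> 1 / real l ^ D"
    using eventually_gt_at_top[of 0]
  proof eventually_elim
    case (elim l)
    have "real (g l) * f l \<le> real (g l) * (1 / real l ^ (E + D))" using elim by (intro mult_left_mono) auto
    also have "\<dots> \<le> real (l ^ E) * (1 / real l ^ (E + D))" using elim by (intro mult_right_mono) (auto simp flip: of_nat_power)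
    also have "\<dots> = 1 / real l ^ D" using elim by (simp add: power_add)
    finally show ?case .
  qed
qed

lemma tiny_mono: "tiny g \<Longrightarrow> \<forall>\<^sub>F l in sequentially. f l \<le> g l \<Longrightarrow> tiny f"
  unfolding tiny_def
proof
  fix D
  assume "\<forall>D. \<forall>\<^sub>F l in sequentially. g l \<le> 1 / real l ^ D" "\<forall>\<^sub>F l in sequentially. f l \<le> g l"
  then have "\<forall>\<^sub>F l in sequentially. g l \<le> 1 / real l ^ D" "\<forall>\<^sub>F l in sequentially. f l \<le> g l" by auto
  then show "\<forall>\<^sub>F l in sequentially. f l \<le> 1 / real l ^ D" by eventually_elim linarith
qed

lemma negl_tiny:
  assumes "tiny f" "\<And>l. 0 \<le> f l"
  shows "negl f"
  unfolding negl_def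
proof
  fix c
  have "\<forall>\<^sub>F l in sequentially. f l \<le> 1 / real l ^ Suc c" using assms by (auto simp: tiny_def simp del: power_Suc)
  then show "\<forall>\<^sub>F l in sequentially. \<bar>f l\<bar> < 1 / real l ^ c"
    using eventually_ge_at_top[of 2]
  proof eventually_elim
    case (elim l)
    have "1 / (real l * real l ^ c) < 1 / real l ^ c" using elim by (intro divide_strict_left_mono) auto
    then show ?case using elim assms(2)[of l] by simp
  qed
qed

lemma tiny_half_power: "tiny (\<lambda>l. 1 / 2 ^ l)"
  unfolding tiny_def
proof
  fix D
  have "\<forall>\<^sub>F l in sequentially. real l ^ D \<le> 2 ^ l" by real_asymp
  then show "\<forall>\<^sub>F l in sequentially. 1 / 2 ^ l \<le> 1 / real l ^ D"
    using eventually_gt_at_top[of 0] by eventually_elim (auto simp: frac_le)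
qed

lemma filterlim_fold_len: "filterlim fold_len at_top sequentially"
  unfolding filterlim_at_top
proof
  fix K
  show "\<forall>\<^sub>F l in sequentially. K \<le> fold_len l"
    using eventually_ge_at_top[of "256 * K ^ 8"]
  proof eventually_elim
    case (elim l)
    then have "K ^ 8 < fold_len l ^ 8" using fold_len_power_gt[of l] by linarith
    then show ?case using power_less_imp_less_base[of K 8 "fold_len l"] by simp
  qed
qed

lemma real_le_fold_len: "real l \<le> 256 * real (fold_len l) ^ 8"
proof -
  have "real l \<le> real (256 * fold_len l ^ 8)" using fold_len_power_gt[of l] by (intro of_nat_mono) simp
  then show ?thesis by (simp only: of_nat_mult of_nat_power of_nat_numeral)
qed

text \<open>As \<open>fold_len l\<close> is at least a fixed fraction of the eighth root of
  \<open>l\<close>, the power \<open>2 ^ fold_len l\<close> is superpolynomial. So every polynomial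
  number of queries meets the hypothesis of the list bound for large \<open>l\<close>.\<close>

lemma pbounded_less_exp_fold_len:
  assumes "pbounded f"
  shows "\<forall>\<^sub>F l in sequentially. f l < 2 ^ fold_len l"
proof -
  obtain D where D: "\<forall>\<^sub>F l in sequentially. f l \<le> l ^ D" using pbounded_eventually[OF assms] by blast
  have "\<forall>\<^sub>F m in sequentially. (256 * real m ^ 8) ^ D < 2 ^ m" by real_asymp
  then have "\<forall>\<^sub>F l in sequentially. (256 * real (fold_len l) ^ 8) ^ D < 2 ^ fold_len l"
    using filterlim_fold_len by (rule eventually_compose_filterlim)
  with D show ?thesis
  proof eventually_elim
    case (elim l)
    have "real (f l) \<le> real (l ^ D)" using elim by simp
    also have "\<dots> \<le> (256 * real (fold_len l) ^ 8) ^ D"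
      unfolding of_nat_power by (rule power_mono[OF real_le_fold_len]) simp
    also note elim(2)
    finally have "real (f l) < real (2 ^ fold_len l)" by simp
    then show ?case by (simp only: of_nat_less_iff)
  qed
qed

lemma list_bound_le: "l > 0 \<Longrightarrow> list_bound l \<le> l ^ (fold_len l + 1)"
proof -
  assume l: "l > 0"
  have "list_bound l \<le> (\<Sum>j=1..fold_len l. l ^ fold_len l)"
    unfolding list_bound_def using l by (intro sum_mono power_increasing) auto
  also have "\<dots> \<le> l * l ^ fold_len l" using fold_len_le[OF l, of 1] by simp
  finally show ?thesis by simp
qed

lemma mark_prob_power_le: "mark_prob l ^ (fold_len l * code_dim l) \<le> exp (- (real (fold_len l) ^ 2 / 64))"
proof -
  have "2 ^ mark_len l = 64 * real (fold_len l) ^ 2"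
    by (simp add: mark_len_def fold_len_def power_add power_mult power2_eq_square power_mult_distrib[symmetric])
  then have "mark_prob l = 1 + (- (1 / (64 * real (fold_len l) ^ 2)))" by (simp add: mark_prob_def)
  also have "\<dots> \<le> exp (- (1 / (64 * real (fold_len l) ^ 2)))" by (rule exp_ge_add_one_self)
  finally have "mark_prob l ^ (fold_len l * code_dim l) \<le> exp (- (1 / (64 * real (fold_len l) ^ 2))) ^ (fold_len l * code_dim l)"
    using mark_prob_bounds(1)[of l] by (intro power_mono) auto
  also have "\<dots> = exp (real (fold_len l * code_dim l) * (- (1 / (64 * real (fold_len l) ^ 2))))"
    by (rule exp_of_nat_mult[symmetric])
  also have "real (fold_len l * code_dim l) * (- (1 / (64 * real (fold_len l) ^ 2))) = - (real (fold_len l) ^ 2 / 64)"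
    by (simp add: code_dim_def field_simps eval_nat_numeral)
  finally show ?thesis .
qed

text \<open>With \<open>m = fold_len l\<close> and \<open>l < 256 * m ^ 8\<close> the list bound is
  at most exp ((m + 1) * ln (256 * m ^ 8)), which loses against exp (- m^2 / 64); the extra
  \<open>D\<close> in the exponent leaves room for an arbitrary power of \<open>l\<close>.\<close>

lemma tiny_list_term: "tiny (\<lambda>l. real (list_bound l) * mark_prob l ^ (fold_len l * code_dim l))"
  unfolding tiny_def
proof
  fix D
  have "\<forall>\<^sub>F m in at_top. (m + 1 + real D) * ln (256 * m ^ 8) \<le> m ^ 2 / 64" by real_asymp
  then have "\<forall>\<^sub>F l in sequentially. (real (fold_len l) + 1 + real D) * ln (256 * real (fold_len l) ^ 8) \<le> real (fold_len l) ^ 2 / 64"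
    by (rule eventually_compose_filterlim)
      (rule filterlim_compose[OF filterlim_real_sequentially filterlim_fold_len])
  then show "\<forall>\<^sub>F l in sequentially. real (list_bound l) * mark_prob l ^ (fold_len l * code_dim l) \<le> 1 / real l ^ D"
    using eventually_gt_at_top[of 0]
  proof eventually_elim
    case (elim l)
    let ?m = "real (fold_len l)" and ?e = "fold_len l + 1 + D"
    have m0: "256 * ?m ^ 8 > 0" by simp
    have "real l ^ ?e \<le> (256 * ?m ^ 8) ^ ?e" by (rule power_mono[OF real_le_fold_len]) simp
    also have "\<dots> = exp (real ?e * ln (256 * ?m ^ 8))" using m0 by (simp only: exp_of_nat_mult exp_ln)
    also have "\<dots> \<le> exp (?m ^ 2 / 64)" using elim(1) unfolding exp_le_cancel_iff of_nat_add of_nat_1 .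
    finally have 1: "real l ^ (fold_len l + 1) * real l ^ D \<le> exp (?m ^ 2 / 64)" by (simp only: power_add)
    have "real (list_bound l) * mark_prob l ^ (fold_len l * code_dim l) \<le> real (l ^ (fold_len l + 1)) * exp (- (?m ^ 2 / 64))"
      using mark_prob_bounds(1)[of l]
      by (intro mult_mono of_nat_mono list_bound_le mark_prob_power_le elim(2)) auto
    also have "\<dots> \<le> 1 / real l ^ D"
      using 1 elim(2) by (simp add: exp_minus field_simps)
    finally show ?case .
  qed
qed

lemma tiny_query_gain:
  assumes "pbounded B"
  shows "tiny (\<lambda>l. query_gain l (B l))"
proof -
  have "tiny (\<lambda>l. real (list_bound l) * mark_prob l ^ (fold_len l * code_dim l) + real (2 * B l) * (1 / 2 ^ l))"
    by (intro tiny_add tiny_list_term tiny_mult tiny_half_power pbounded_intros assms)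
  then show ?thesis by (simp add: query_gain_def)
qed

lemma pbounded_block_count: "pbounded block_count"
proof (rule pbounded_mono)
  show "pbounded (\<lambda>l. 2 * (l + 1))" by (intro pbounded_intros)
  show "block_count l \<le> 2 * (l + 1)" for l
    using fold_len_le[of l 4] by (cases "l = 0") (auto simp: block_count_def fold_len_def log256.simps[of 0])
qed

theorem hash_family_CROM: "collision_resistant_CROM (hash_family (\<lambda>_. 0))"
  unfolding collision_resistant_CROM_def
proof (intro allI impI)
  fix A :: "nat \<Rightarrow> bitstr \<Rightarrow> (bitstr \<times> bitstr) qtree pmf" and q :: "nat poly"
  let ?F = "hash_family (\<lambda>_. 0)"
  assume A: "\<forall>l. \<forall>k\<in>bitstrs (key_len ?F l). \<forall>T\<in>set_pmf (A l k). bounded_qtree (query_len ?F l) T (poly q l)"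
  let ?s = "\<lambda>l. poly q l + (2 + 2 * block_count l)"
  have s: "pbounded ?s" by (intro pbounded_intros pbounded_block_count)
  have "\<forall>\<^sub>F l in sequentially. collision_prob ?F l (\<lambda>H k. A l k) \<le> real (?s l) * query_gain l (?s l)"
    using pbounded_less_exp_fold_len[OF s]
  proof eventually_elim
    case (elim l)
    then show ?case using A by (intro collision_prob_fresh) (auto simp: hash_family_def)
  qed
  moreover have "tiny (\<lambda>l. real (?s l) * query_gain l (?s l))" by (intro tiny_mult tiny_query_gain s)
  ultimately show "negl (\<lambda>l. collision_prob ?F l (\<lambda>H k. A l k))"
    by (intro negl_tiny) (auto intro: tiny_mono simp: collision_prob_def)
qed

lemma card_short_bitstrs: "finite {z :: bitstr. length z \<le> r} \<and> card {z :: bitstr. length z \<le> r} \<le> 2 ^ (r + 1)"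
proof (induction r)
  case (Suc r)
  have "{z :: bitstr. length z \<le> Suc r} = {z. length z \<le> r} \<union> bitstrs (Suc r)" by (auto simp: bitstrs_def)
  then show ?case using Suc card_Un_le[of "{z :: bitstr. length z \<le> r}" "bitstrs (Suc r)"] by simp
qed simp

theorem hash_family_AI_CROM: "collision_resistant_AI_CROM (hash_family (\<lambda>l. l))"
  unfolding collision_resistant_AI_CROM_def
proof (intro allI impI)
  fix adv :: "nat \<Rightarrow> oracle_fn \<Rightarrow> bitstr" and A :: "nat \<Rightarrow> bitstr \<Rightarrow> bitstr \<Rightarrow> (bitstr \<times> bitstr) qtree pmf" and q r :: "nat poly"
  let ?F = "hash_family (\<lambda>l. l)"
  assume asm: "(\<forall>l. \<forall>H\<in>oracles_of ?F l. length (adv l H) \<le> poly r l) \<and>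
    (\<forall>l z. \<forall>k\<in>bitstrs (key_len ?F l). length z \<le> poly r l \<longrightarrow>
      (\<forall>T\<in>set_pmf (A l z k). bounded_qtree (query_len ?F l) T (poly q l)))"
  let ?s = "\<lambda>l. poly q l + (2 + 2 * block_count l)"
  \<comment> \<open>The threshold will be twice \<open>?\<eta>\<close>, so that each run contributes
    a factor 1/2: \<open>poly r l + 1\<close> runs outweigh the number of advice strings, and
    \<open>l\<close> more leave \<open>1 / 2 ^ l\<close>.\<close>
  let ?u = "\<lambda>l. poly r l + 1 + l"
  let ?B = "\<lambda>l. ?u l * ?s l"
  let ?\<eta> = "\<lambda>l. real (?B l) * (1 / 2 ^ l) + real (?s l) * query_gain l (?B l)"
  have s: "pbounded ?s" by (intro pbounded_intros pbounded_block_count)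
  have B: "pbounded ?B" by (intro pbounded_intros s)
  have "\<forall>\<^sub>F l in sequentially. collision_prob ?F l (\<lambda>H k. A l (adv l H) k) \<le> real 2 * ?\<eta> l + 1 / 2 ^ l"
    using pbounded_less_exp_fold_len[OF B]
  proof eventually_elim
    case (elim l)
    let ?Z = "{z :: bitstr. length z \<le> poly r l}"
    have pos: "0 < ?\<eta> l"     proof -
      have "0 < ?B l" by simp
      then have "0 < real (?B l)" by (simp only: of_nat_0_less_iff)
      then show ?thesis by (intro add_pos_nonneg mult_pos_pos mult_nonneg_nonneg query_gain_nonneg) auto
    qed
    have "collision_prob ?F l (\<lambda>H k. A l (adv l H) k) \<le> 2 * ?\<eta> l + real (card ?Z) *
        ((real (?B l) / 2 ^ l + real (?s l) * query_gain l (?B l)) / (2 * ?\<eta> l)) ^ ?u l"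
    proof (rule collision_prob_advice[where Z = ?Z])
      show "0 < 2 * ?\<eta> l" using pos by (rule mult_pos_pos[rotated]) simp
    qed (use asm elim card_short_bitstrs in \<open>auto simp: hash_family_def oracles_of_def\<close>)
    also have "(real (?B l) / 2 ^ l + real (?s l) * query_gain l (?B l)) / (2 * ?\<eta> l) = 1 / 2"
    proof -
      have "x / (2 * x) = 1 / 2" if "x > 0" for x :: real using that by simp
      moreover have "real (?B l) / 2 ^ l = real (?B l) * (1 / 2 ^ l)" by (simp only: times_divide_eq_right mult_1_right)
      ultimately show ?thesis using pos by presburger
    qed
    also have "real (card ?Z) * (1 / 2) ^ ?u l \<le> 2 ^ (poly r l + 1) * (1 / 2) ^ ?u l"
    proof (rule mult_right_mono)
      have "real (card ?Z) \<le> real (2 ^ (poly r l + 1))" using card_short_bitstrs by (intro of_nat_mono) blast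
      then show "real (card ?Z) \<le> 2 ^ (poly r l + 1)" by (simp only: of_nat_power of_nat_numeral)
    qed simp
    also have "\<dots> = 1 / 2 ^ l" by (simp add: power_add power_one_over)
    finally show ?case by simp
  qed
  moreover have "tiny (\<lambda>l. real 2 * ?\<eta> l + 1 / 2 ^ l)"
    by (intro tiny_add tiny_mult tiny_query_gain tiny_half_power pbounded_const B s)
  ultimately show "negl (\<lambda>l. collision_prob ?F l (\<lambda>H k. A l (adv l H) k))"
    by (intro negl_tiny) (auto intro: tiny_mono simp: collision_prob_def)
qed

section \<open>Quantum circuits that sample from a code\<close>

section \<open>Unitary operators from orthonormal families\<close>

definition ip :: "qindex set \<Rightarrow> qstate \<Rightarrow> qstate \<Rightarrow> complex" where
  "ip B u v = (\<Sum>b\<in>B. cnj (u b) * v b)"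

definition orthonormal_on :: "qindex set \<Rightarrow> 'e set \<Rightarrow> ('e \<Rightarrow> qstate) \<Rightarrow> bool" where
  "orthonormal_on B I v \<longleftrightarrow> (\<forall>e\<in>I. \<forall>e'\<in>I. ip B (v e) (v e') = of_bool (e = e'))"

text \<open>For an orthonormal family this multiplies its span by \<alpha> and fixes the complement.
  All unitaries of the algorithm are products of such operators.\<close>

definition rotation :: "complex \<Rightarrow> 'e set \<Rightarrow> ('e \<Rightarrow> qstate) \<Rightarrow> qmatrix" where
  "rotation \<alpha> I v = (\<lambda>i j. of_bool (i = j) + (\<alpha> - 1) * (\<Sum>e\<in>I. v e i * cnj (v e j)))"

definition mat_mul :: "qindex set \<Rightarrow> qmatrix \<Rightarrow> qmatrix \<Rightarrow> qmatrix" where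
  "mat_mul B U V = (\<lambda>i j. \<Sum>k\<in>B. U i k * V k j)"

lemma sum_of_bool_mult:
  "finite B \<Longrightarrow> i \<in> B \<Longrightarrow> (\<Sum>k\<in>B. of_bool (i = k) * f k) = (f i :: complex)"
  "finite B \<Longrightarrow> i \<in> B \<Longrightarrow> (\<Sum>k\<in>B. f k * of_bool (k = i)) = (f i :: complex)"
  "finite B \<Longrightarrow> i \<in> B \<Longrightarrow> (\<Sum>k\<in>B. f k * of_bool (i = k)) = (f i :: complex)"
  by (simp_all add: of_bool_def if_distrib[of "\<lambda>x. x * _"] if_distrib[of "\<lambda>x. _ * x"] sum.delta sum.delta' cong: if_cong)

lemma cnj_of_bool: "cnj (of_bool b) = of_bool b"
  by (cases b) auto

lemma sqrt_two_sq: "complex_of_real (sqrt 2) * complex_of_real (sqrt 2) = 2"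
  by (simp flip: of_real_mult)

lemma projection_idem:
  assumes "finite I" "orthonormal_on B I v"
  shows "(\<Sum>k\<in>B. (\<Sum>e\<in>I. v e i * cnj (v e k)) * (\<Sum>e\<in>I. v e k * cnj (v e j))) = (\<Sum>e\<in>I. v e i * cnj (v e j))"
proof -
  have "(\<Sum>k\<in>B. (\<Sum>e\<in>I. v e i * cnj (v e k)) * (\<Sum>e\<in>I. v e k * cnj (v e j)))
      = (\<Sum>k\<in>B. \<Sum>e\<in>I. \<Sum>e'\<in>I. v e i * cnj (v e' j) * (cnj (v e k) * v e' k))"
    unfolding sum_product by (intro sum.cong refl) (simp add: algebra_simps)
  also have "\<dots> = (\<Sum>e\<in>I. \<Sum>e'\<in>I. v e i * cnj (v e' j) * ip B (v e) (v e'))"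
    unfolding ip_def sum_distrib_left by (subst sum.swap, rule sum.cong[OF refl], subst sum.swap) rule
  also have "\<dots> = (\<Sum>e\<in>I. \<Sum>e'\<in>I. (v e i * cnj (v e' j)) * of_bool (e = e'))"
    using assms(2) by (intro sum.cong refl) (auto simp: orthonormal_on_def)
  also have "\<dots> = (\<Sum>e\<in>I. v e i * cnj (v e j))"
    using assms(1) by (intro sum.cong refl) (simp add: of_bool_def if_distrib[of "\<lambda>x. _ * x"] cong: if_cong)
  finally show ?thesis .
qed

lemma rotation_unitary:
  assumes B: "finite B" and I: "finite I" "orthonormal_on B I v" and \<alpha>: "cnj \<alpha> * \<alpha> = 1"
  shows "unitary_on B (rotation \<alpha> I v)"
proof -
  define P where "P i j = (\<Sum>e\<in>I. v e i * cnj (v e j))" for i j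
  have cP: "cnj (P i j) = P j i" for i j by (simp add: P_def mult.commute)
  have PP: "(\<Sum>k\<in>B. P i k * P k j) = P i j" for i j
    unfolding P_def by (rule projection_idem[OF I])
  have R: "rotation \<alpha> I v i j = of_bool (i = j) + (\<alpha> - 1) * P i j" for i j by (simp add: rotation_def P_def)
  \<comment> \<open>Modulus one of \<alpha> is exactly what cancels the coefficient of the
    projection in the product with the adjoint.\<close>
  have z: "(\<alpha> - 1) + (cnj \<alpha> - 1) + (cnj \<alpha> - 1) * (\<alpha> - 1) = 0" using \<alpha> by (simp add: algebra_simps)
  have 1: "(\<Sum>k\<in>B. cnj (rotation \<alpha> I v k i) * rotation \<alpha> I v k j) = of_bool (i = j)" if "i \<in> B" "j \<in> B" for i j
  proof -
    have "(\<Sum>k\<in>B. cnj (rotation \<alpha> I v k i) * rotation \<alpha> I v k j)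
      = (\<Sum>k\<in>B. of_bool (k = i) * of_bool (k = j) + of_bool (k = i) * ((\<alpha> - 1) * P k j)
          + ((cnj \<alpha> - 1) * P i k) * of_bool (k = j) + (cnj \<alpha> - 1) * (\<alpha> - 1) * (P i k * P k j))"
      unfolding R by (intro sum.cong refl) (simp add: cP cnj_of_bool algebra_simps)
    also have "\<dots> = of_bool (i = j) + (\<alpha> - 1) * P i j + (cnj \<alpha> - 1) * P i j + (cnj \<alpha> - 1) * (\<alpha> - 1) * P i j"
      unfolding sum.distrib sum_distrib_left[symmetric] PP using that B by (simp add: sum_of_bool_mult)
    also have "\<dots> = of_bool (i = j) + ((\<alpha> - 1) + (cnj \<alpha> - 1) + (cnj \<alpha> - 1) * (\<alpha> - 1)) * P i j" by (simp add: algebra_simps)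
    finally show ?thesis unfolding z by simp
  qed
  have 2: "(\<Sum>k\<in>B. rotation \<alpha> I v i k * cnj (rotation \<alpha> I v j k)) = of_bool (i = j)" if "i \<in> B" "j \<in> B" for i j
  proof -
    have "(\<Sum>k\<in>B. rotation \<alpha> I v i k * cnj (rotation \<alpha> I v j k))
      = (\<Sum>k\<in>B. of_bool (i = k) * of_bool (j = k) + of_bool (i = k) * ((cnj \<alpha> - 1) * P k j)
          + ((\<alpha> - 1) * P i k) * of_bool (j = k) + (cnj \<alpha> - 1) * (\<alpha> - 1) * (P i k * P k j))"
      unfolding R by (intro sum.cong refl) (simp add: cP cnj_of_bool algebra_simps)
    also have "\<dots> = of_bool (i = j) + (cnj \<alpha> - 1) * P i j + (\<alpha> - 1) * P i j + (cnj \<alpha> - 1) * (\<alpha> - 1) * P i j"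
      unfolding sum.distrib sum_distrib_left[symmetric] PP using that B by (simp add: sum_of_bool_mult eq_commute[of j])
    also have "\<dots> = of_bool (i = j) + ((\<alpha> - 1) + (cnj \<alpha> - 1) + (cnj \<alpha> - 1) * (\<alpha> - 1)) * P i j" by (simp add: algebra_simps)
    finally show ?thesis unfolding z by simp
  qed
  show ?thesis unfolding unitary_on_def using 1 2 by (auto simp: of_bool_def)
qed

lemma unitary_mat_mul:
  assumes B: "finite B" and U: "unitary_on B U" and V: "unitary_on B V"
  shows "unitary_on B (mat_mul B U V)"
proof -
  have 1: "(\<Sum>k\<in>B. cnj (mat_mul B U V k i) * mat_mul B U V k j) = of_bool (i = j)" if ij: "i \<in> B" "j \<in> B" for i j
  proof -
    have "(\<Sum>k\<in>B. cnj (mat_mul B U V k i) * mat_mul B U V k j)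
       = (\<Sum>k\<in>B. \<Sum>a\<in>B. \<Sum>b\<in>B. (cnj (V a i) * V b j) * (cnj (U k a) * U k b))"
      unfolding mat_mul_def cnj_sum sum_product by (intro sum.cong refl) (simp add: algebra_simps)
    also have "\<dots> = (\<Sum>a\<in>B. \<Sum>b\<in>B. (cnj (V a i) * V b j) * (\<Sum>k\<in>B. cnj (U k a) * U k b))"
      unfolding sum_distrib_left by (subst sum.swap, rule sum.cong[OF refl], subst sum.swap) rule
    also have "\<dots> = (\<Sum>a\<in>B. \<Sum>b\<in>B. (cnj (V a i) * V b j) * of_bool (a = b))"
      using U by (intro sum.cong refl) (auto simp: unitary_on_def)
    also have "\<dots> = (\<Sum>a\<in>B. cnj (V a i) * V a j)"
      using B by (intro sum.cong refl) (simp add: sum_of_bool_mult)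
    also have "\<dots> = of_bool (i = j)" using V ij by (auto simp: unitary_on_def)
    finally show ?thesis .
  qed
  have 2: "(\<Sum>k\<in>B. mat_mul B U V i k * cnj (mat_mul B U V j k)) = of_bool (i = j)" if ij: "i \<in> B" "j \<in> B" for i j
  proof -
    have "(\<Sum>k\<in>B. mat_mul B U V i k * cnj (mat_mul B U V j k))
       = (\<Sum>k\<in>B. \<Sum>a\<in>B. \<Sum>b\<in>B. (U i a * cnj (U j b)) * (V a k * cnj (V b k)))"
      unfolding mat_mul_def cnj_sum sum_product by (intro sum.cong refl) (simp add: algebra_simps)
    also have "\<dots> = (\<Sum>a\<in>B. \<Sum>b\<in>B. (U i a * cnj (U j b)) * (\<Sum>k\<in>B. V a k * cnj (V b k)))"
      unfolding sum_distrib_left by (subst sum.swap, rule sum.cong[OF refl], subst sum.swap) rule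
    also have "\<dots> = (\<Sum>a\<in>B. \<Sum>b\<in>B. (U i a * cnj (U j b)) * of_bool (a = b))"
      using V by (intro sum.cong refl) (auto simp: unitary_on_def)
    also have "\<dots> = (\<Sum>a\<in>B. U i a * cnj (U j a))"
      using B by (intro sum.cong refl) (simp add: sum_of_bool_mult)
    also have "\<dots> = of_bool (i = j)" using U ij by (auto simp: unitary_on_def)
    finally show ?thesis .
  qed
  show ?thesis unfolding unitary_on_def using 1 2 by (auto simp: of_bool_def)
qed

lemma apply_mat_mul: "apply_matrix B (mat_mul B U V) \<psi> = apply_matrix B U (apply_matrix B V \<psi>)"
proof
  fix i
  have "(\<Sum>j\<in>B. (\<Sum>k\<in>B. U i k * V k j) * \<psi> j) = (\<Sum>k\<in>B. U i k * (\<Sum>j\<in>B. V k j * \<psi> j))"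
    unfolding sum_distrib_left sum_distrib_right by (subst sum.swap) (simp add: mult.assoc)
  then show "apply_matrix B (mat_mul B U V) \<psi> i = apply_matrix B U (apply_matrix B V \<psi>) i"
    by (simp add: apply_matrix_def mat_mul_def)
qed

lemma apply_rotation:
  assumes "finite B" "i \<in> B"
  shows "apply_matrix B (rotation \<alpha> I v) \<psi> i = \<psi> i + (\<alpha> - 1) * (\<Sum>e\<in>I. v e i * ip B (v e) \<psi>)"
proof -
  have "apply_matrix B (rotation \<alpha> I v) \<psi> i = (\<Sum>j\<in>B. of_bool (i = j) * \<psi> j) + (\<alpha> - 1) * (\<Sum>j\<in>B. \<Sum>e\<in>I. v e i * (cnj (v e j) * \<psi> j))"
    using assms(2) by (simp add: apply_matrix_def rotation_def ring_distribs sum.distrib sum_distrib_left sum_distrib_right mult.assoc)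
  also have "(\<Sum>j\<in>B. \<Sum>e\<in>I. v e i * (cnj (v e j) * \<psi> j)) = (\<Sum>e\<in>I. v e i * ip B (v e) \<psi>)"
    unfolding ip_def sum_distrib_left by (rule sum.swap)
  finally show ?thesis using assms by (simp add: sum_of_bool_mult)
qed

text \<open>The reflection along (a - b) / sqrt 2 exchanges orthogonal unit vectors a and b; here a
  whole family of pairs is exchanged at once.\<close>

definition swap_family :: "('e \<Rightarrow> qstate) \<Rightarrow> ('e \<Rightarrow> qstate) \<Rightarrow> 'e \<Rightarrow> qstate" where
  "swap_family a b = (\<lambda>e i. (a e i - b e i) / complex_of_real (sqrt 2))"

lemma ip_diff: "ip B (\<lambda>i. u i - v i) w = ip B u w - ip B v w" "ip B w (\<lambda>i. u i - v i) = ip B w u - ip B w v"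
  by (simp_all add: ip_def algebra_simps sum_subtractf)

lemma swap_orthonormal:
  assumes "orthonormal_on B I a" "orthonormal_on B I b"
    and ab: "\<And>e e'. e \<in> I \<Longrightarrow> e' \<in> I \<Longrightarrow> ip B (a e) (b e') = 0"
  shows "orthonormal_on B I (swap_family a b)"
proof -
  have ba: "ip B (b e') (a e) = 0" if "e \<in> I" "e' \<in> I" for e e'
  proof -
    have "ip B (b e') (a e) = cnj (ip B (a e) (b e'))" by (simp add: ip_def mult.commute)
    then show ?thesis using ab[OF that] by simp
  qed
  have sw: "ip B (swap_family a b e) (swap_family a b e') = ip B (\<lambda>i. a e i - b e i) (\<lambda>i. a e' i - b e' i) / 2" for e e'
    unfolding ip_def swap_family_def sum_divide_distrib
    by (intro sum.cong refl) (simp add: sqrt_two_sq)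
  show ?thesis unfolding orthonormal_on_def
  proof (intro ballI)
    fix e e' assume e: "e \<in> I" "e' \<in> I"
    then have "ip B (a e) (a e') = of_bool (e = e')" "ip B (b e) (b e') = of_bool (e = e')"
      using assms(1,2) by (auto simp: orthonormal_on_def)
    then show "ip B (swap_family a b e) (swap_family a b e') = of_bool (e = e')"
      unfolding sw ip_diff using ab[OF e] ba[OF e(2,1)] by simp
  qed
qed

lemma apply_swap:
  assumes "finite B" "i \<in> B" "\<And>e. e \<in> I \<Longrightarrow> ip B (b e) \<psi> = 0"
  shows "apply_matrix B (rotation (-1) I (swap_family a b)) \<psi> i = \<psi> i - (\<Sum>e\<in>I. (a e i - b e i) * ip B (a e) \<psi>)"
proof -
  have "swap_family a b e i * ip B (swap_family a b e) \<psi> = ((a e i - b e i) * ip B (a e) \<psi>) / 2" if "e \<in> I" for e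
  proof -
    have "ip B (swap_family a b e) \<psi> = ip B (\<lambda>i. a e i - b e i) \<psi> / complex_of_real (sqrt 2)"
      by (simp add: ip_def swap_family_def sum_divide_distrib)
    then show ?thesis using assms(3)[OF that]
      by (simp add: swap_family_def ip_diff sqrt_two_sq)
  qed
  then have "(\<Sum>e\<in>I. swap_family a b e i * ip B (swap_family a b e) \<psi>) = (\<Sum>e\<in>I. (a e i - b e i) * ip B (a e) \<psi>) / 2"
    unfolding sum_divide_distrib by (intro sum.cong refl)
  then show ?thesis unfolding apply_rotation[OF assms(1,2)] by (simp add: field_simps)
qed

section \<open>Superpositions along injective labellings\<close>

text \<open>Amplitudes on an abstract index set, carried to basis states by the labelling
  \<open>P\<close>. Changes of the quantum registers thereby become changes of the
  labelling.\<close>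

definition superpose :: "'g set \<Rightarrow> ('g \<Rightarrow> qindex) \<Rightarrow> ('g \<Rightarrow> complex) \<Rightarrow> qstate" where
  "superpose G P \<phi> = (\<lambda>b. \<Sum>g\<in>G. \<phi> g * of_bool (b = P g))"

lemma superpose_at:
  assumes "finite G" "inj_on P G" "g \<in> G"
  shows "superpose G P \<phi> (P g) = \<phi> g"
proof -
  have "superpose G P \<phi> (P g) = (\<Sum>g'\<in>G. \<phi> g' * of_bool (g = g'))"
    unfolding superpose_def using assms by (intro sum.cong refl) (auto dest: inj_onD)
  then show ?thesis using assms by (simp add: of_bool_def if_distrib[of "\<lambda>x. _ * x"] cong: if_cong)
qed

lemma superpose_off: "b \<notin> P ` G \<Longrightarrow> superpose G P \<phi> b = 0"
  unfolding superpose_def by (intro sum.neutral) auto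

lemma superpose_cong: "(\<And>g. g \<in> G \<Longrightarrow> \<phi> g = \<psi> g) \<Longrightarrow> superpose G P \<phi> = superpose G P \<psi>"
  unfolding superpose_def by (intro ext sum.cong) auto

lemma ip_superpose:
  assumes "finite B" "finite G" "inj_on P G" "P ` G \<subseteq> B"
  shows "ip B (superpose G P \<phi>) \<psi> = (\<Sum>g\<in>G. cnj (\<phi> g) * \<psi> (P g))"
proof -
  have "ip B (superpose G P \<phi>) \<psi> = (\<Sum>b\<in>P ` G. cnj (superpose G P \<phi> b) * \<psi> b)"
    unfolding ip_def using assms by (intro sum.mono_neutral_right) (auto simp: superpose_off)
  also have "\<dots> = (\<Sum>g\<in>G. cnj (\<phi> g) * \<psi> (P g))"
    using assms by (simp add: sum.reindex superpose_at)
  finally show ?thesis .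
qed

lemma ip_superpose_same:
  assumes "finite B" "finite G" "inj_on P G" "P ` G \<subseteq> B"
  shows "ip B (superpose G P \<phi>) (superpose G P \<psi>) = (\<Sum>g\<in>G. cnj (\<phi> g) * \<psi> g)"
  unfolding ip_superpose[OF assms] using assms by (intro sum.cong refl) (simp add: superpose_at)

lemma ip_superpose_disjoint:
  assumes "finite B" "finite G" "inj_on P G" "P ` G \<subseteq> B" "P ` G \<inter> P' ` G' = {}"
  shows "ip B (superpose G P \<phi>) (superpose G' P' \<psi>) = 0"
  unfolding ip_superpose[OF assms(1-4)] using assms(5)
  by (intro sum.neutral ballI) (simp, blast intro: superpose_off)

lemma sum_superpose:
  "(\<Sum>e\<in>I. superpose G P (\<phi> e) b * c e) = superpose G P (\<lambda>g. \<Sum>e\<in>I. c e * \<phi> e g) b"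
  unfolding superpose_def sum_distrib_right by (subst sum.swap) (simp add: algebra_simps sum_distrib_left sum_distrib_right)

section \<open>The sampling algorithm\<close>

lemma finite_qbasis: "finite (qbasis n m d)"
  unfolding qbasis_def bitstrs_def
  using finite_lists_length_eq[of "UNIV :: bool set"] by simp

lemma xor_bits_zero: "length h = m \<Longrightarrow> xor_bits (replicate m False) h = h" "xor_bits h h = replicate (length h) False"
proof -
  show "length h = m \<Longrightarrow> xor_bits (replicate m False) h = h"
    unfolding xor_bits_def by (induction h arbitrary: m) auto
  show "xor_bits h h = replicate (length h) False"
    unfolding xor_bits_def by (induction h) auto
qed

lemma apply_matrix_superpose:
  assumes "finite B" "finite G" "inj_on P G" "P ` G \<subseteq> B" "i \<in> B"
  shows "apply_matrix B U (superpose G P \<phi>) i = (\<Sum>g\<in>G. U i (P g) * \<phi> g)"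
proof -
  have "apply_matrix B U (superpose G P \<phi>) i = (\<Sum>j\<in>P ` G. U i j * superpose G P \<phi> j)"
    unfolding apply_matrix_def using assms by (auto intro!: sum.mono_neutral_right simp: superpose_off)
  then show ?thesis using assms by (simp add: sum.reindex superpose_at)
qed

lemma apply_matrix_relabel:
  assumes "finite B" "finite G" "inj_on P G" "P ` G \<subseteq> B" "P' ` G \<subseteq> B"
    and "\<And>i g. i \<in> B \<Longrightarrow> g \<in> G \<Longrightarrow> U i (P g) = of_bool (i = P' g) * c g"
  shows "apply_matrix B U (superpose G P \<phi>) = superpose G P' (\<lambda>g. c g * \<phi> g)"
proof
  fix i
  show "apply_matrix B U (superpose G P \<phi>) i = superpose G P' (\<lambda>g. c g * \<phi> g) i"
  proof (cases "i \<in> B")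
    case True
    have "apply_matrix B U (superpose G P \<phi>) i = (\<Sum>g\<in>G. c g * \<phi> g * of_bool (i = P' g))"
      unfolding apply_matrix_superpose[OF assms(1-4) True] using assms(6)[OF True] by (intro sum.cong refl) simp
    then show ?thesis by (simp add: superpose_def)
  next
    case False
    then have "i \<notin> P' ` G" using assms(5) by blast
    then show ?thesis using False by (simp add: apply_matrix_def superpose_off)
  qed
qed

text \<open>A reflection ignores the sign of its axis, so the operator that moves \<open>a\<close>
  to \<open>b\<close> also moves \<open>b\<close> back.\<close>

lemma swap_commute: "rotation \<alpha> I (swap_family a b) = rotation \<alpha> I (swap_family b a)"
proof -
  have "swap_family a b e i * cnj (swap_family a b e j) = swap_family b a e i * cnj (swap_family b a e j)" for e i j
    by (simp add: swap_family_def) (simp add: algebra_simps)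
  then show ?thesis by (simp add: rotation_def)
qed

lemma csqrt_sq: "complex_of_real (sqrt (real k)) * complex_of_real (sqrt (real k)) = of_nat k"
  by (simp flip: of_real_mult)

text \<open>A circuit on abstract words \<open>g \<in> G\<close>. For block \<open>i\<close> the
  oracle is asked at \<open>pt i g\<close>; the classes of \<open>cls i\<close> have equal size and
  consist, in the application, of the words that differ only in this block. The points must differ
  from the all-zero string, so that loading the query register leads to an orthogonal subspace. At
  the end each \<open>u e\<close> is replaced by \<open>v e\<close>, for which orthonormality of
  both families suffices.\<close>

locale sampler =
  fixes nq na N s :: nat and G :: "'g set" and pt :: "nat \<Rightarrow> 'g \<Rightarrow> bitstr" and acc :: "bitstr \<Rightarrow> bool"
    and \<alpha> :: complex and cls :: "nat \<Rightarrow> 'g \<Rightarrow> 'r" and E :: "'e set" and u v :: "'e \<Rightarrow> 'g \<Rightarrow> complex"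
  assumes G: "finite G" "G \<noteq> {}" and N: "N > 0"
    and pt: "\<And>i g. i < N \<Longrightarrow> g \<in> G \<Longrightarrow> pt i g \<in> bitstrs nq \<and> pt i g \<noteq> replicate nq False"
    and \<alpha>: "cnj \<alpha> * \<alpha> = 1" and s: "s > 0"
    and cls: "\<And>i g. i < N \<Longrightarrow> g \<in> G \<Longrightarrow> card {g' \<in> G. cls i g' = cls i g} = s"
    and E: "finite E"
    and u: "\<And>e e'. e \<in> E \<Longrightarrow> e' \<in> E \<Longrightarrow> (\<Sum>g\<in>G. cnj (u e g) * u e' g) = of_bool (e = e')"
    and v: "\<And>e e'. e \<in> E \<Longrightarrow> e' \<in> E \<Longrightarrow> (\<Sum>g\<in>G. cnj (v e g) * v e' g) = of_bool (e = e')"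
begin

definition mark_step :: "oracle_fn \<Rightarrow> nat \<Rightarrow> ('g \<Rightarrow> complex) \<Rightarrow> 'g \<Rightarrow> complex" where
  "mark_step H i \<phi> = (\<lambda>g. (if acc (H (pt i g)) then \<alpha> else 1) * \<phi> g)"

text \<open>Rotation of the uniform superposition of each class by \<alpha>: the partial reflection
  known from exact amplitude amplification, confined to one block.\<close>

definition diffuse :: "nat \<Rightarrow> ('g \<Rightarrow> complex) \<Rightarrow> 'g \<Rightarrow> complex" where
  "diffuse i \<phi> = (\<lambda>g. \<phi> g + (\<alpha> - 1) * ((\<Sum>g'\<in>{g' \<in> G. cls i g' = cls i g}. \<phi> g') / of_nat s))"

primrec wave :: "oracle_fn \<Rightarrow> nat \<Rightarrow> 'g \<Rightarrow> complex" where
  "wave H 0 = (\<lambda>g. 1 / complex_of_real (sqrt (real (card G))))"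
| "wave H (Suc i) = diffuse i (mark_step H i (wave H i))"

definition project :: "('g \<Rightarrow> complex) \<Rightarrow> 'g \<Rightarrow> complex" where
  "project \<phi> = (\<lambda>g. \<Sum>e\<in>E. (\<Sum>g'\<in>G. cnj (u e g') * \<phi> g') * v e g)"

definition idx :: "'g \<Rightarrow> nat" where
  "idx = (SOME h. bij_betw h G {..<card G})"

lemma idx: "bij_betw idx G {..<card G}"
proof -
  have "\<exists>h. bij_betw h G {..<card G}"
    using ex_bij_betw_finite_nat[OF G(1)] by (simp add: atLeast0LessThan)
  then show ?thesis unfolding idx_def by (rule someI_ex)
qed

lemma idx_less: "g \<in> G \<Longrightarrow> idx g < card G"
  using idx by (auto simp: bij_betw_def)

lemma idx_inj: "inj_on idx G"
  using idx by (simp add: bij_betw_def)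

definition zq :: bitstr where "zq = replicate nq False"
definition za :: bitstr where "za = replicate na False"

text \<open>Work register: \<open>0\<close> is the start, \<open>f * card G + idx g\<close> holds \<open>g\<close> together with a phase counter \<open>f\<close>
  which is \<open>1\<close> while \<open>wave\<close> is prepared and \<open>2\<close> after the final transformation.\<close>

definition slot :: "nat \<Rightarrow> 'g \<Rightarrow> nat" where "slot f g = f * card G + idx g"
definition B :: "qindex set" where "B = qbasis nq na (3 * card G)"
definition P1 :: "'g \<Rightarrow> qindex" where "P1 g = (zq, za, slot 1 g)"
definition P2 :: "'g \<Rightarrow> qindex" where "P2 g = (zq, za, slot 2 g)"
definition Pq :: "nat \<Rightarrow> 'g \<Rightarrow> qindex" where "Pq i g = (pt i g, za, slot 1 g)"
definition Po :: "oracle_fn \<Rightarrow> nat \<Rightarrow> 'g \<Rightarrow> qindex" where "Po H i g = (pt i g, H (pt i g), slot 1 g)"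
definition P0 :: "unit \<Rightarrow> qindex" where "P0 = (\<lambda>_. (zq, za, 0))"

lemma finB [simp]: "finite B"
  by (simp add: B_def finite_qbasis)

lemma card_G_pos: "card G > 0"
  using G by (simp add: card_gt_0_iff)

lemma slot_inj: "g \<in> G \<Longrightarrow> g' \<in> G \<Longrightarrow> slot f g = slot f g' \<Longrightarrow> g = g'"
  using idx_inj by (auto simp: slot_def dest: inj_onD)

lemma inj_P: "inj_on P1 G" "inj_on P2 G" "inj_on (Pq i) G" "inj_on (Po H i) G" "inj_on P0 {()}"
  by (auto simp: inj_on_def P1_def P2_def Pq_def Po_def intro: slot_inj)

lemma zqa: "zq \<in> bitstrs nq" "za \<in> bitstrs na"
  by (auto simp: zq_def za_def bitstrs_def)

lemma slot_less: "g \<in> G \<Longrightarrow> f < 3 \<Longrightarrow> slot f g < 3 * card G"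
proof -
  assume "g \<in> G" "f < 3"
  then have "slot f g < (f + 1) * card G" using idx_less by (simp add: slot_def)
  also have "\<dots> \<le> 3 * card G" using \<open>f < 3\<close> by (intro mult_right_mono) auto
  finally show ?thesis .
qed

lemma P_in: "P1 ` G \<subseteq> B" "P2 ` G \<subseteq> B" "i < N \<Longrightarrow> Pq i ` G \<subseteq> B"
  "i < N \<Longrightarrow> H \<in> oracles nq na \<Longrightarrow> Po H i ` G \<subseteq> B" "P0 ` {()} \<subseteq> B"
  using zqa slot_less pt card_G_pos
  by (auto simp: P1_def P2_def Pq_def Po_def P0_def B_def qbasis_def oracles_def)

lemma P_disj: "P1 ` G \<inter> P2 ` G = {}" "i < N \<Longrightarrow> P1 ` G \<inter> Pq i ` G = {}" "P0 ` {()} \<inter> P1 ` G = {}"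
proof -
  have "slot 1 g \<noteq> slot 2 g'" if "g \<in> G" "g' \<in> G" for g g'
    using idx_less[OF that(1)] idx_less[OF that(2)] by (simp add: slot_def)
  then show "P1 ` G \<inter> P2 ` G = {}" by (auto simp: P1_def P2_def)
  show "P1 ` G \<inter> Pq i ` G = {}" if i: "i < N"
  proof -
    have "zq \<noteq> pt i g" if "g \<in> G" for g using pt[OF i that] by (auto simp: zq_def)
    then show ?thesis by (auto simp: P1_def Pq_def)
  qed
  show "P0 ` {()} \<inter> P1 ` G = {}" using card_G_pos by (auto simp: P0_def P1_def slot_def)
qed

definition ket :: "qindex \<Rightarrow> qstate" where "ket c = superpose {()} (\<lambda>_. c) (\<lambda>_. 1)"

lemma ket: "ket c b = of_bool (b = c)"
  by (simp add: ket_def superpose_def)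

lemma ip_ket: "c \<in> B \<Longrightarrow> ip B (ket c) \<psi> = \<psi> c"
  unfolding ket_def by (subst ip_superpose) auto

text \<open>The initial wave is the same for all oracles, hence the argument
  \<open>undefined\<close>.\<close>

definition start_U :: qmatrix where
  "start_U = rotation (-1) {()} (swap_family (\<lambda>_. ket (P0 ())) (\<lambda>_. superpose G P1 (wave undefined 0)))"
text \<open>An involution: the same operator loads the query of block \<open>i\<close> and clears it
  later.\<close>

definition copy_U :: "nat \<Rightarrow> qmatrix" where
  "copy_U i = rotation (-1) G (swap_family (\<lambda>g. ket (P1 g)) (\<lambda>g. ket (Pq i g)))"
definition mark_U :: qmatrix where
  "mark_U = rotation \<alpha> {b \<in> B. acc (fst (snd b))} ket"
definition diffuse_U :: "nat \<Rightarrow> qmatrix" where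
  "diffuse_U i = rotation \<alpha> (cls i ` G) (\<lambda>r. superpose G P1 (\<lambda>g. of_bool (cls i g = r) / complex_of_real (sqrt (real s))))"
text \<open>The target vectors live on the separate labels \<open>P2\<close>: a swap requires the
  two families to be orthogonal to each other, whereas \<open>u e\<close> and \<open>v e'\<close>
  may overlap as functions on words.\<close>

definition final_U :: qmatrix where
  "final_U = rotation (-1) E (swap_family (\<lambda>e. superpose G P1 (u e)) (\<lambda>e. superpose G P2 (v e)))"

lemma start_state_norm: "(\<Sum>g\<in>G. cnj (wave H 0 g) * wave H 0 g) = 1"
  using card_G_pos by (simp add: csqrt_sq)

lemma cls_orthonormal:
  assumes "i < N"
  shows "orthonormal_on B (cls i ` G) (\<lambda>r. superpose G P1 (\<lambda>g. of_bool (cls i g = r) / complex_of_real (sqrt (real s))))"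
  unfolding orthonormal_on_def ip_superpose_same[OF finB G(1) inj_P(1) P_in(1)]
proof (intro ballI)
  fix r r' assume "r \<in> cls i ` G" "r' \<in> cls i ` G"
  then obtain h where h: "h \<in> G" "r = cls i h" by blast
  have "(\<Sum>g\<in>G. cnj (of_bool (cls i g = r) / complex_of_real (sqrt (real s))) * (of_bool (cls i g = r') / complex_of_real (sqrt (real s))))
     = (\<Sum>g\<in>G. if cls i g = r then of_bool (r = r') / of_nat s else 0)"
    by (intro sum.cong refl) (auto simp: csqrt_sq)
  also have "\<dots> = (\<Sum>g\<in>{g \<in> G. cls i g = r}. of_bool (r = r') / of_nat s)"
    by (rule sum.inter_filter[symmetric, OF G(1)])
  also have "\<dots> = of_bool (r = r')" using cls[OF assms h(1)] s unfolding h(2) by simp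
  finally show "(\<Sum>g\<in>G. cnj (of_bool (cls i g = r) / complex_of_real (sqrt (real s))) * (of_bool (cls i g = r') / complex_of_real (sqrt (real s))))
     = of_bool (r = r')" .
qed

lemma ket_orthonormal: "inj_on P I \<Longrightarrow> P ` I \<subseteq> B \<Longrightarrow> orthonormal_on B I (\<lambda>g. ket (P g))"
  unfolding orthonormal_on_def by (auto simp: ip_ket ket image_subset_iff dest: inj_onD)

lemma copy_orthonormal:
  assumes "i < N"
  shows "orthonormal_on B G (swap_family (\<lambda>g. ket (P1 g)) (\<lambda>g. ket (Pq i g)))"
proof (intro swap_orthonormal ket_orthonormal inj_P P_in assms)
  fix g g' assume "g \<in> G" "g' \<in> G"
  then have "P1 g \<in> B" "P1 g \<noteq> Pq i g'" using P_in(1) P_disj(2)[OF assms] by auto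
  then show "ip B (ket (P1 g)) (ket (Pq i g')) = 0" by (simp add: ip_ket ket)
qed

lemma start_orthonormal:
  "orthonormal_on B {()} (swap_family (\<lambda>_. ket (P0 ())) (\<lambda>_. superpose G P1 (wave undefined 0)))"
proof (intro swap_orthonormal)
  have P0B: "P0 () \<in> B" using P_in(5) by auto
  show "orthonormal_on B {()} (\<lambda>_. ket (P0 ()))" using P0B by (simp add: orthonormal_on_def ip_ket ket)
  show "orthonormal_on B {()} (\<lambda>_. superpose G P1 (wave undefined 0))"
    unfolding orthonormal_on_def ip_superpose_same[OF finB G(1) inj_P(1) P_in(1)] start_state_norm by simp
  show "ip B (ket (P0 ())) (superpose G P1 (wave undefined 0)) = 0"
    unfolding ip_ket[OF P0B] using P_disj(3) by (intro superpose_off) auto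
qed

lemma final_orthonormal:
  "orthonormal_on B E (swap_family (\<lambda>e. superpose G P1 (u e)) (\<lambda>e. superpose G P2 (v e)))"
proof (intro swap_orthonormal)
  show "orthonormal_on B E (\<lambda>e. superpose G P1 (u e))"
    unfolding orthonormal_on_def ip_superpose_same[OF finB G(1) inj_P(1) P_in(1)] using u by simp
  show "orthonormal_on B E (\<lambda>e. superpose G P2 (v e))"
    unfolding orthonormal_on_def ip_superpose_same[OF finB G(1) inj_P(2) P_in(2)] using v by simp
  show "ip B (superpose G P1 (u e)) (superpose G P2 (v e')) = 0" for e e'
    by (rule ip_superpose_disjoint[OF finB G(1) inj_P(1) P_in(1) P_disj(1)])
qed

lemma unitaries:
  "unitary_on B start_U" "i < N \<Longrightarrow> unitary_on B (copy_U i)" "unitary_on B mark_U"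
  "i < N \<Longrightarrow> unitary_on B (diffuse_U i)" "unitary_on B final_U"
proof -
  have m: "orthonormal_on B {b \<in> B. acc (fst (snd b))} ket" using ket_orthonormal[of "\<lambda>x. x"] by auto
  have 1: "cnj (-1) * (-1) = (1 :: complex)" by simp
  show "unitary_on B start_U" unfolding start_U_def by (rule rotation_unitary[OF finB _ start_orthonormal 1]) simp
  show "i < N \<Longrightarrow> unitary_on B (copy_U i)" unfolding copy_U_def by (rule rotation_unitary[OF finB G(1) copy_orthonormal 1])
  show "unitary_on B mark_U" unfolding mark_U_def by (rule rotation_unitary[OF finB _ m \<alpha>]) simp
  show "i < N \<Longrightarrow> unitary_on B (diffuse_U i)" unfolding diffuse_U_def
    by (rule rotation_unitary[OF finB _ cls_orthonormal \<alpha>]) (simp_all add: G(1))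
  show "unitary_on B final_U" unfolding final_U_def by (rule rotation_unitary[OF finB E final_orthonormal 1])
qed

lemma apply_eqI:
  assumes "\<And>i. i \<in> B \<Longrightarrow> apply_matrix B U \<psi> i = \<psi>' i" "\<And>i. i \<notin> B \<Longrightarrow> \<psi>' i = 0"
  shows "apply_matrix B U \<psi> = \<psi>'"
  using assms by (auto simp: apply_matrix_def fun_eq_iff)

lemma superpose_outside: "P ` I \<subseteq> B \<Longrightarrow> i \<notin> B \<Longrightarrow> superpose I P \<phi> i = 0"
  by (intro superpose_off) auto

lemma start_U_apply: "apply_matrix B start_U (initial_state nq na) = superpose G P1 (wave H 0)"
proof (rule apply_eqI)
  have init: "initial_state nq na = ket (P0 ())"
    by (auto simp: initial_state_def ket P0_def zq_def za_def)
  have P0B: "P0 () \<in> B" using P_in(5) by auto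
  have w: "wave H 0 = wave undefined 0" by simp
  fix i assume i: "i \<in> B"
  have "P1 g \<noteq> P0 ()" if "g \<in> G" for g using P_disj(3) that by force
  then have "ip B (superpose G P1 (wave undefined 0)) (ket (P0 ())) = 0"
    unfolding ip_superpose[OF finB G(1) inj_P(1) P_in(1)] by (intro sum.neutral) (simp add: ket)
  then have "apply_matrix B start_U (ket (P0 ())) i = ket (P0 ()) i - (ket (P0 ()) i - superpose G P1 (wave undefined 0) i)"
    unfolding start_U_def using i by (subst apply_swap) (auto simp: ip_ket[OF P0B] ket)
  then show "apply_matrix B start_U (initial_state nq na) i = superpose G P1 (wave H 0) i"
    unfolding init w by simp
qed (rule superpose_outside[OF P_in(1)])

lemma sum_ket: "finite I \<Longrightarrow> (\<Sum>g\<in>I. ket (P g) b * c g) = superpose I P c b"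
  by (simp add: ket superpose_def mult.commute)

lemma copy_U_apply:
  assumes i: "i < N"
  shows "apply_matrix B (copy_U i) (superpose G P1 \<phi>) = superpose G (Pq i) \<phi>"
proof (rule apply_eqI)
  fix b assume b: "b \<in> B"
  have "ip B (ket (Pq i g)) (superpose G P1 \<phi>) = 0" if "g \<in> G" for g
  proof -
    have "Pq i g \<in> B" "Pq i g \<notin> P1 ` G" using that P_in(3)[OF i] P_disj(2)[OF i] by auto
    then show ?thesis by (simp add: ip_ket superpose_off)
  qed
  then have "apply_matrix B (copy_U i) (superpose G P1 \<phi>) b = superpose G P1 \<phi> b
     - (\<Sum>g\<in>G. (ket (P1 g) b - ket (Pq i g) b) * ip B (ket (P1 g)) (superpose G P1 \<phi>))"
    unfolding copy_U_def using b by (intro apply_swap) auto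
  also have "(\<Sum>g\<in>G. (ket (P1 g) b - ket (Pq i g) b) * ip B (ket (P1 g)) (superpose G P1 \<phi>))
      = (\<Sum>g\<in>G. ket (P1 g) b * \<phi> g - ket (Pq i g) b * \<phi> g)"
  proof (intro sum.cong refl)
    fix g assume g: "g \<in> G"
    then have "P1 g \<in> B" using P_in(1) by auto
    then show "(ket (P1 g) b - ket (Pq i g) b) * ip B (ket (P1 g)) (superpose G P1 \<phi>) = ket (P1 g) b * \<phi> g - ket (Pq i g) b * \<phi> g"
      using superpose_at[OF G(1) inj_P(1) g] by (simp add: ip_ket algebra_simps)
  qed
  also have "\<dots> = superpose G P1 \<phi> b - superpose G (Pq i) \<phi> b"
    unfolding sum_subtractf sum_ket[OF G(1)] ..
  finally show "apply_matrix B (copy_U i) (superpose G P1 \<phi>) b = superpose G (Pq i) \<phi> b" by simp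
qed (rule superpose_outside[OF P_in(3)[OF i]])

lemma copy_U_apply_inverse:
  assumes i: "i < N"
  shows "apply_matrix B (copy_U i) (superpose G (Pq i) \<phi>) = superpose G P1 \<phi>"
proof (rule apply_eqI)
  fix b assume b: "b \<in> B"
  have comm: "copy_U i = rotation (-1) G (swap_family (\<lambda>g. ket (Pq i g)) (\<lambda>g. ket (P1 g)))"
    unfolding copy_U_def by (rule swap_commute)
  have "ip B (ket (P1 g)) (superpose G (Pq i) \<phi>) = 0" if "g \<in> G" for g
  proof -
    have "P1 g \<in> B" "P1 g \<notin> Pq i ` G" using that P_in(1) P_disj(2)[OF i] by auto
    then show ?thesis by (simp add: ip_ket superpose_off)
  qed
  then have "apply_matrix B (copy_U i) (superpose G (Pq i) \<phi>) b = superpose G (Pq i) \<phi> b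
     - (\<Sum>g\<in>G. (ket (Pq i g) b - ket (P1 g) b) * ip B (ket (Pq i g)) (superpose G (Pq i) \<phi>))"
    unfolding comm using b by (intro apply_swap) auto
  also have "(\<Sum>g\<in>G. (ket (Pq i g) b - ket (P1 g) b) * ip B (ket (Pq i g)) (superpose G (Pq i) \<phi>))
      = (\<Sum>g\<in>G. ket (Pq i g) b * \<phi> g - ket (P1 g) b * \<phi> g)"
  proof (intro sum.cong refl)
    fix g assume g: "g \<in> G"
    then have "Pq i g \<in> B" using P_in(3)[OF i] by auto
    then show "(ket (Pq i g) b - ket (P1 g) b) * ip B (ket (Pq i g)) (superpose G (Pq i) \<phi>) = ket (Pq i g) b * \<phi> g - ket (P1 g) b * \<phi> g"
      using superpose_at[OF G(1) inj_P(3) g] by (simp add: ip_ket algebra_simps)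
  qed
  also have "\<dots> = superpose G (Pq i) \<phi> b - superpose G P1 \<phi> b"
    unfolding sum_subtractf sum_ket[OF G(1)] ..
  finally show "apply_matrix B (copy_U i) (superpose G (Pq i) \<phi>) b = superpose G P1 \<phi> b" by simp
qed (rule superpose_outside[OF P_in(1)])

lemma mark_U_apply:
  assumes i: "i < N" and H: "H \<in> oracles nq na"
  shows "apply_matrix B mark_U (superpose G (Po H i) \<phi>) = superpose G (Po H i) (mark_step H i \<phi>)"
proof (rule apply_eqI)
  fix b assume b: "b \<in> B"
  let ?I = "{b \<in> B. acc (fst (snd b))}"
  have "apply_matrix B mark_U (superpose G (Po H i) \<phi>) b
    = superpose G (Po H i) \<phi> b + (\<alpha> - 1) * (\<Sum>e\<in>?I. ket e b * ip B (ket e) (superpose G (Po H i) \<phi>))"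
    unfolding mark_U_def by (rule apply_rotation[OF finB b])
  also have "(\<Sum>e\<in>?I. ket e b * ip B (ket e) (superpose G (Po H i) \<phi>)) = (\<Sum>e\<in>?I. of_bool (b = e) * superpose G (Po H i) \<phi> e)"
    by (intro sum.cong refl) (simp add: ket ip_ket)
  also have "\<dots> = of_bool (acc (fst (snd b))) * superpose G (Po H i) \<phi> b"
    using b by (cases "acc (fst (snd b))") (auto simp: sum_of_bool_mult intro!: sum.neutral)
  finally have eq: "apply_matrix B mark_U (superpose G (Po H i) \<phi>) b = (if acc (fst (snd b)) then \<alpha> else 1) * superpose G (Po H i) \<phi> b"
    by (cases "acc (fst (snd b))") (simp_all add: algebra_simps)
  show "apply_matrix B mark_U (superpose G (Po H i) \<phi>) b = superpose G (Po H i) (mark_step H i \<phi>) b"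
  proof (cases "b \<in> Po H i ` G")
    case True
    then obtain g where "g \<in> G" "b = Po H i g" by blast
    then show ?thesis unfolding eq using superpose_at[OF G(1) inj_P(4)] by (simp add: mark_step_def Po_def)
  qed (simp add: eq superpose_off)
qed (rule superpose_outside[OF P_in(4)[OF i H]])

lemma diffuse_U_apply:
  assumes i: "i < N"
  shows "apply_matrix B (diffuse_U i) (superpose G P1 \<phi>) = superpose G P1 (diffuse i \<phi>)"
proof (rule apply_eqI)
  fix b assume b: "b \<in> B"
  let ?v = "\<lambda>r. superpose G P1 (\<lambda>g. of_bool (cls i g = r) / complex_of_real (sqrt (real s)))"
  let ?S = "\<lambda>r. (\<Sum>g'\<in>{g' \<in> G. cls i g' = r}. \<phi> g')"
  have ip: "ip B (?v r) (superpose G P1 \<phi>) = ?S r / complex_of_real (sqrt (real s))" for r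
  proof -
    have "ip B (?v r) (superpose G P1 \<phi>) = (\<Sum>g\<in>G. if cls i g = r then \<phi> g / complex_of_real (sqrt (real s)) else 0)"
      unfolding ip_superpose_same[OF finB G(1) inj_P(1) P_in(1)] by (intro sum.cong refl) auto
    then show ?thesis by (simp only: sum_divide_distrib) (simp only: sum.inter_filter[OF G(1)])
  qed
  have "apply_matrix B (diffuse_U i) (superpose G P1 \<phi>) b
    = superpose G P1 \<phi> b + (\<alpha> - 1) * (\<Sum>r\<in>cls i ` G. ?v r b * (?S r / complex_of_real (sqrt (real s))))"
    unfolding diffuse_U_def apply_rotation[OF finB b] ip ..
  also have "(\<Sum>r\<in>cls i ` G. ?v r b * (?S r / complex_of_real (sqrt (real s))))
     = superpose G P1 (\<lambda>g. \<Sum>r\<in>cls i ` G. (?S r / complex_of_real (sqrt (real s))) * (of_bool (cls i g = r) / complex_of_real (sqrt (real s)))) b"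
    by (rule sum_superpose)
  also have "\<dots> = superpose G P1 (\<lambda>g. ?S (cls i g) / of_nat s) b"
  proof (rule fun_cong[OF superpose_cong])
    fix g assume g: "g \<in> G"
    have "(\<Sum>r\<in>cls i ` G. (?S r / complex_of_real (sqrt (real s))) * (of_bool (cls i g = r) / complex_of_real (sqrt (real s))))
      = (\<Sum>r\<in>cls i ` G. (?S r / of_nat s) * of_bool (cls i g = r))"
      by (intro sum.cong refl) (simp add: csqrt_sq)
    also have "\<dots> = ?S (cls i g) / of_nat s" using G(1) g by (simp add: of_bool_def if_distrib[of "\<lambda>x. _ * x"] cong: if_cong)
    finally show "(\<Sum>r\<in>cls i ` G. (?S r / complex_of_real (sqrt (real s))) * (of_bool (cls i g = r) / complex_of_real (sqrt (real s))))
      = ?S (cls i g) / of_nat s" .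
  qed
  also have "superpose G P1 \<phi> b + (\<alpha> - 1) * superpose G P1 (\<lambda>g. ?S (cls i g) / of_nat s) b = superpose G P1 (diffuse i \<phi>) b"
    unfolding superpose_def diffuse_def sum_distrib_left sum.distrib[symmetric] by (intro sum.cong refl) (simp add: algebra_simps)
  finally show "apply_matrix B (diffuse_U i) (superpose G P1 \<phi>) b = superpose G P1 (diffuse i \<phi>) b" .
qed (rule superpose_outside[OF P_in(1)])

lemma final_U_apply:
  assumes g: "g \<in> G"
  shows "apply_matrix B final_U (superpose G P1 \<phi>) (P2 g) = project \<phi> g"
proof -
  have gB: "P2 g \<in> B" "P2 g \<notin> P1 ` G" using g P_in(2) P_disj(1) by auto
  have "ip B (superpose G P2 (v e)) (superpose G P1 \<phi>) = 0" for e
    using P_disj(1) by (intro ip_superpose_disjoint[OF finB G(1) inj_P(2) P_in(2)]) auto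
  then have "apply_matrix B final_U (superpose G P1 \<phi>) (P2 g) = superpose G P1 \<phi> (P2 g)
    - (\<Sum>e\<in>E. (superpose G P1 (u e) (P2 g) - superpose G P2 (v e) (P2 g)) * ip B (superpose G P1 (u e)) (superpose G P1 \<phi>))"
    unfolding final_U_def using gB(1) by (intro apply_swap) auto
  also have "\<dots> = (\<Sum>e\<in>E. ip B (superpose G P1 (u e)) (superpose G P1 \<phi>) * v e g)"
    using superpose_at[OF G(1) inj_P(2) g] by (simp add: superpose_off[OF gB(2)] sum_negf mult.commute)
  also have "\<dots> = project \<phi> g"
    unfolding project_def ip_superpose_same[OF finB G(1) inj_P(1) P_in(1)] ..
  finally show ?thesis .
qed

text \<open>The second call erases the answer, since a string xored with itself is zero; in between,
  the answer register is available for the phase.\<close>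

lemma oracle_apply:
  assumes i: "i < N" and H: "H \<in> oracles nq na"
  shows "apply_matrix B (oracle_matrix H) (superpose G (Pq i) \<phi>) = superpose G (Po H i) \<phi>"
    and "apply_matrix B (oracle_matrix H) (superpose G (Po H i) \<phi>) = superpose G (Pq i) \<phi>"
proof -
  have len: "length (H (pt i g)) = na" if "g \<in> G" for g
    using H pt[OF i that] by (auto simp: oracles_def bitstrs_def dest!: PiE_mem)
  have "apply_matrix B (oracle_matrix H) (superpose G (Pq i) \<phi>) = superpose G (Po H i) (\<lambda>g. 1 * \<phi> g)"
  proof (rule apply_matrix_relabel[OF finB G(1) inj_P(3) P_in(3)[OF i] P_in(4)[OF i H]])
    show "oracle_matrix H b (Pq i g) = of_bool (b = Po H i g) * 1" if "g \<in> G" for b g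
      using len[OF that] by (cases b) (auto simp: oracle_matrix_def Pq_def Po_def za_def xor_bits_zero)
  qed
  then show "apply_matrix B (oracle_matrix H) (superpose G (Pq i) \<phi>) = superpose G (Po H i) \<phi>" by simp
  have "apply_matrix B (oracle_matrix H) (superpose G (Po H i) \<phi>) = superpose G (Pq i) (\<lambda>g. 1 * \<phi> g)"
  proof (rule apply_matrix_relabel[OF finB G(1) inj_P(4) P_in(4)[OF i H] P_in(3)[OF i]])
    show "oracle_matrix H b (Po H i g) = of_bool (b = Pq i g) * 1" if "g \<in> G" for b g
      using len[OF that] by (cases b) (auto simp: oracle_matrix_def Pq_def Po_def za_def xor_bits_zero)
  qed
  then show "apply_matrix B (oracle_matrix H) (superpose G (Po H i) \<phi>) = superpose G (Pq i) \<phi>" by simp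
qed

definition stage_U :: "nat \<Rightarrow> qmatrix" where
  "stage_U i = (if i < N then copy_U i else final_U)"

text \<open>Two queries per block: ask, apply the phase, and ask again to erase the answer. The
  even-numbered unitaries after the initial one clear the query, diffuse and load the next block, or
  apply \<open>final_U\<close> after the last block.\<close>

definition sampling_alg :: "('g \<Rightarrow> bitstr) \<Rightarrow> qalg" where
  "sampling_alg out = \<lparr>num_queries = 2 * N, work_dim = 3 * card G,
     unitaries = (\<lambda>j. if j = 0 then mat_mul B (stage_U 0) start_U
        else if odd j then mark_U
        else mat_mul B (stage_U (j div 2)) (mat_mul B (diffuse_U (j div 2 - 1)) (copy_U (j div 2 - 1)))),
     postprocess = (\<lambda>(x, y, w). out (inv_into G idx (w - 2 * card G)))\<rparr>"

lemma basis: "qalg_basis nq na (sampling_alg out) = B"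
  by (simp add: qalg_basis_def sampling_alg_def B_def)

lemma sampling_alg_valid: "valid_qalg nq na (sampling_alg out)"
  unfolding valid_qalg_def basis
proof (intro conjI allI impI)
  show "0 < work_dim (sampling_alg out)" using card_G_pos by (simp add: sampling_alg_def)
  have st: "unitary_on B (stage_U i)" for i by (simp add: stage_U_def unitaries)
  fix j assume j: "j \<le> num_queries (sampling_alg out)"
  then have "j div 2 - 1 < N \<or> j = 0" using N by (auto simp: sampling_alg_def)
  then show "unitary_on B (unitaries (sampling_alg out) j)"
    by (auto simp: sampling_alg_def intro!: unitary_mat_mul unitaries st)
qed

text \<open>Loading the next query is merged into the preceding unitary, so between rounds the wave
  appears with the operator of the next stage already applied.\<close>

lemma state_even:
  assumes H: "H \<in> oracles nq na"
  shows "i \<le> N \<Longrightarrow> state_after nq na H (sampling_alg out) (2 * i) = apply_matrix B (stage_U i) (superpose G P1 (wave H i))"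
proof (induction i)
  case 0
  have "unitaries (sampling_alg out) 0 = mat_mul B (stage_U 0) start_U" by (simp add: sampling_alg_def)
  then show ?case by (simp only: mult_0_right state_after.simps basis apply_mat_mul start_U_apply[of H])
next
  case (Suc i)
  then have i: "i < N" by simp
  have u1: "unitaries (sampling_alg out) (Suc (2 * i)) = mark_U" by (simp add: sampling_alg_def)
  have u2: "unitaries (sampling_alg out) (Suc (Suc (2 * i))) = mat_mul B (stage_U (Suc i)) (mat_mul B (diffuse_U i) (copy_U i))"
    by (simp add: sampling_alg_def)
  have "state_after nq na H (sampling_alg out) (2 * i) = superpose G (Pq i) (wave H i)"
    using Suc.IH i by (simp add: stage_U_def copy_U_apply)
  then have "state_after nq na H (sampling_alg out) (Suc (2 * i)) = superpose G (Po H i) (mark_step H i (wave H i))"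
    by (simp add: u1 basis oracle_apply[OF i H] mark_U_apply[OF i H])
  then have "state_after nq na H (sampling_alg out) (Suc (Suc (2 * i))) = apply_matrix B (stage_U (Suc i)) (superpose G P1 (wave H (Suc i)))"
    by (simp add: u2 basis oracle_apply[OF i H] apply_mat_mul copy_U_apply_inverse[OF i] diffuse_U_apply[OF i] del: state_after.simps(1))
  then show ?case by simp
qed

text \<open>Only an inequality, because outcomes outside the labels \<open>P2\<close> are decoded as
  well and may happen to succeed.\<close>

theorem sampling_alg_output:
  assumes H: "H \<in> oracles nq na"
  shows "(\<Sum>g\<in>{g \<in> G. Pr (out g)}. (cmod (project (wave H N) g))\<^sup>2) \<le> output_prob nq na H (sampling_alg out) Pr"
proof -
  let ?st = "state_after nq na H (sampling_alg out) (num_queries (sampling_alg out))"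
  have nq: "num_queries (sampling_alg out) = 2 * N" by (simp add: sampling_alg_def)
  have st: "?st = apply_matrix B final_U (superpose G P1 (wave H N))"
    unfolding nq state_even[OF H le_refl] by (simp add: stage_U_def)
  have post: "postprocess (sampling_alg out) (P2 g) = out g" if "g \<in> G" for g
    using that idx_inj by (simp add: sampling_alg_def P2_def slot_def)
  let ?X = "{g \<in> G. Pr (out g)}"
  have inj: "inj_on P2 ?X" using inj_P(2) by (rule inj_on_subset) auto
  have "(\<Sum>g\<in>?X. (cmod (project (wave H N) g))\<^sup>2) = (\<Sum>g\<in>?X. (cmod (?st (P2 g)))\<^sup>2)"
    unfolding st by (intro sum.cong refl) (simp add: final_U_apply)
  also have "\<dots> = (\<Sum>b\<in>P2 ` ?X. (cmod (?st b))\<^sup>2)" using inj by (simp add: sum.reindex)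
  also have "\<dots> \<le> output_prob nq na H (sampling_alg out) Pr"
    unfolding output_prob_def basis
  proof (rule sum_mono2)
    show "P2 ` ?X \<subseteq> {b \<in> B. Pr (postprocess (sampling_alg out) b)}" using P_in(2) post by auto
  qed auto
  finally show ?thesis .
qed

end

section \<open>Fourier analysis and failure of one-wayness\<close>

section \<open>Fourier analysis of the sampled state\<close>

lemma cmod_sq: "complex_of_real ((cmod z)\<^sup>2) = z * cnj z"
  by (metis complex_norm_square)

lemma cmod_add_sq: "(cmod (x + y))\<^sup>2 = (cmod x)\<^sup>2 + (cmod y)\<^sup>2 + 2 * Re (x * cnj y)"
  unfolding cmod_power2 unfolding power2_eq_square by (simp add: algebra_simps)

lemma half_cmod_sq_le: "(cmod x)\<^sup>2 / 2 - (cmod (x - y))\<^sup>2 \<le> (cmod y)\<^sup>2"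
proof -
  have "cmod x \<le> cmod y + cmod (x - y)" by (metis diff_add_cancel norm_triangle_ineq add.commute)
  then have "(cmod x)\<^sup>2 \<le> (cmod y + cmod (x - y))\<^sup>2" by (rule power_mono) simp
  also have "\<dots> \<le> 2 * (cmod y)\<^sup>2 + 2 * (cmod (x - y))\<^sup>2"
    using sum_squares_bound[of "cmod y" "cmod (x - y)"] by (simp add: power2_sum)
  finally show ?thesis by simp
qed

lemma parseval:
  fixes ch :: "'a \<Rightarrow> 'b \<Rightarrow> complex"
  assumes fin: "finite S" "finite R"
    and dual: "\<And>x y. x \<in> S \<Longrightarrow> y \<in> S \<Longrightarrow> (\<Sum>e\<in>R. cnj (ch e x) * ch e y) = (if x = y then of_real c else 0)"
  shows "(\<Sum>e\<in>R. (cmod (\<Sum>x\<in>S. cnj (ch e x) * f x))\<^sup>2) = c * (\<Sum>x\<in>S. (cmod (f x))\<^sup>2)"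
proof -
  have "complex_of_real (\<Sum>e\<in>R. (cmod (\<Sum>x\<in>S. cnj (ch e x) * f x))\<^sup>2)
      = (\<Sum>e\<in>R. \<Sum>x\<in>S. \<Sum>y\<in>S. (f x * cnj (f y)) * (cnj (ch e x) * ch e y))"
    unfolding of_real_sum cmod_sq cnj_sum sum_product by (intro sum.cong refl) (simp add: algebra_simps)
  also have "\<dots> = (\<Sum>x\<in>S. \<Sum>y\<in>S. (f x * cnj (f y)) * (\<Sum>e\<in>R. cnj (ch e x) * ch e y))"
    unfolding sum_distrib_left by (subst sum.swap, rule sum.cong[OF refl], subst sum.swap) rule
  also have "\<dots> = (\<Sum>x\<in>S. \<Sum>y\<in>S. if x = y then (f x * cnj (f y)) * of_real c else 0)"
    using dual by (intro sum.cong refl) auto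
  also have "\<dots> = (\<Sum>x\<in>S. (f x * cnj (f x)) * of_real c)"
    using fin by (intro sum.cong refl) (simp add: sum.delta')
  also have "\<dots> = complex_of_real (c * (\<Sum>x\<in>S. (cmod (f x))\<^sup>2))"
    unfolding of_real_mult of_real_sum cmod_sq sum_distrib_left by (simp add: mult.commute)
  finally show ?thesis by (simp only: of_real_eq_iff)
qed

text \<open>Modelled on a finite abelian group \<Sigma> whose characters are indexed by \<Sigma>
  itself; at this stage \<open>C\<close> is any nonempty set of words. The condition on \<alpha> is
  that of exact amplitude amplification: if precisely a fraction \<open>p\<close> of the symbols is
  marked, one phase and one partial reflection leave no amplitude on the unmarked symbols.\<close>

locale code_sampling =
  fixes N t :: nat and \<Sigma> :: "'s set" and z :: 's and ch :: "'s \<Rightarrow> 's \<Rightarrow> complex" and add :: "'s \<Rightarrow> 's \<Rightarrow> 's"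
    and C :: "(nat \<Rightarrow> 's) set" and \<alpha> :: complex and p :: real
  assumes \<Sigma>: "finite \<Sigma>" "z \<in> \<Sigma>"
    and orth: "\<And>x y. x \<in> \<Sigma> \<Longrightarrow> y \<in> \<Sigma> \<Longrightarrow> (\<Sum>\<sigma>\<in>\<Sigma>. cnj (ch x \<sigma>) * ch y \<sigma>) = (if x = y then of_nat (card \<Sigma>) else 0)"
    and dual: "\<And>x y. x \<in> \<Sigma> \<Longrightarrow> y \<in> \<Sigma> \<Longrightarrow> (\<Sum>\<epsilon>\<in>\<Sigma>. cnj (ch \<epsilon> x) * ch \<epsilon> y) = (if x = y then of_nat (card \<Sigma>) else 0)"
    and add: "\<And>\<epsilon> x y. \<epsilon> \<in> \<Sigma> \<Longrightarrow> x \<in> \<Sigma> \<Longrightarrow> y \<in> \<Sigma> \<Longrightarrow> ch \<epsilon> (add x y) = ch \<epsilon> x * ch \<epsilon> y"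
    and add_bij: "\<And>x. x \<in> \<Sigma> \<Longrightarrow> bij_betw (add x) \<Sigma> \<Sigma>" "\<And>x. x \<in> \<Sigma> \<Longrightarrow> bij_betw (\<lambda>y. add y x) \<Sigma> \<Sigma>"
    and ch_unit: "\<And>\<epsilon> x. \<epsilon> \<in> \<Sigma> \<Longrightarrow> x \<in> \<Sigma> \<Longrightarrow> cmod (ch \<epsilon> x) = 1" and ch_z: "\<And>x. x \<in> \<Sigma> \<Longrightarrow> ch z x = 1"
    and C: "C \<subseteq> {..<N} \<rightarrow>\<^sub>E \<Sigma>" "C \<noteq> {}"
    and p: "p > 0" and \<alpha>: "cmod \<alpha> = 1" "(cmod (\<alpha> - 1))\<^sup>2 = 1 / p"
begin

definition G :: "(nat \<Rightarrow> 's) set" where "G = {..<N} \<rightarrow>\<^sub>E \<Sigma>"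

definition mark_frac :: "(nat \<Rightarrow> 's \<Rightarrow> bool) \<Rightarrow> nat \<Rightarrow> real" where
  "mark_frac A i = avg \<Sigma> (\<lambda>\<sigma>. of_bool (A i \<sigma>))"

text \<open>The effect of phase and partial reflection on one block, starting from the constant 1
  and simplified by (\<alpha> - 1)^2 = - \<alpha> / p, as \<open>wave_eq\<close> confirms. The first
  summand is the amplitude of the unmarked symbols and vanishes if the marked fraction is
  \<open>p\<close>.\<close>

definition amp :: "(nat \<Rightarrow> 's \<Rightarrow> bool) \<Rightarrow> nat \<Rightarrow> 's \<Rightarrow> complex" where
  "amp A i \<sigma> = \<alpha> * of_real (1 - mark_frac A i / p) + (\<alpha> - 1) * of_bool (A i \<sigma>)"

definition nrm :: complex where "nrm = complex_of_real (sqrt (real (card G)))"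

definition state :: "(nat \<Rightarrow> 's \<Rightarrow> bool) \<Rightarrow> (nat \<Rightarrow> 's) \<Rightarrow> complex" where
  "state A g = (\<Prod>i<N. amp A i (g i)) / nrm"

definition char :: "(nat \<Rightarrow> 's) \<Rightarrow> (nat \<Rightarrow> 's) \<Rightarrow> complex" where
  "char e g = (\<Prod>i<N. ch (e i) (g i))"

definition fourier :: "((nat \<Rightarrow> 's) \<Rightarrow> complex) \<Rightarrow> (nat \<Rightarrow> 's) \<Rightarrow> complex" where
  "fourier f e = (\<Sum>g\<in>G. cnj (char e g) * (f g / nrm))"

definition weight :: "(nat \<Rightarrow> 's) \<Rightarrow> nat" where
  "weight e = card {i. i < N \<and> e i \<noteq> z}"

definition errors :: "(nat \<Rightarrow> 's) set" where
  "errors = {e \<in> G. weight e \<le> t}"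

definition trunc :: "(nat \<Rightarrow> 's \<Rightarrow> bool) \<Rightarrow> (nat \<Rightarrow> 's) \<Rightarrow> complex" where
  "trunc A g = (\<Sum>e\<in>errors. fourier (state A) e * (char e g / nrm))"

text \<open>What the final unitary produces on the code: the Fourier coefficients of light errors
  are kept, while their characters are restricted to the code and renormalised.\<close>

definition out_amp :: "(nat \<Rightarrow> 's \<Rightarrow> bool) \<Rightarrow> (nat \<Rightarrow> 's) \<Rightarrow> complex" where
  "out_amp A c = (\<Sum>e\<in>errors. fourier (state A) e * (char e c / complex_of_real (sqrt (real (card C)))))"

definition success :: "(nat \<Rightarrow> 's \<Rightarrow> bool) \<Rightarrow> real" where
  "success A = (\<Sum>c\<in>{c \<in> C. \<forall>i<N. A i (c i)}. (cmod (out_amp A c))\<^sup>2)"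

definition shift :: "(nat \<Rightarrow> 's) \<Rightarrow> (nat \<Rightarrow> 's) \<Rightarrow> nat \<Rightarrow> 's" where
  "shift a g = (\<lambda>i\<in>{..<N}. add (g i) (a i))"

definition shift_marks :: "(nat \<Rightarrow> 's \<Rightarrow> bool) \<Rightarrow> (nat \<Rightarrow> 's) \<Rightarrow> nat \<Rightarrow> 's \<Rightarrow> bool" where
  "shift_marks A a = (\<lambda>i \<sigma>. A i (add \<sigma> (a i)))"

lemma finG: "finite G" "G \<noteq> {}" and card_G: "card G = card \<Sigma> ^ N"
  using \<Sigma> by (auto simp: G_def finite_PiE card_PiE PiE_eq_empty_iff)

lemma finC: "finite C"
  using C(1) finG(1) finite_subset by (auto simp: G_def)

lemma card_pos: "card \<Sigma> > 0" "card G > 0" "card C > 0"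
  using \<Sigma> finG finC C(2) by (auto simp: card_gt_0_iff)

lemma nrm_sq: "nrm * nrm = of_nat (card G)" "nrm \<noteq> 0" "cnj nrm = nrm" "(cmod nrm)\<^sup>2 = real (card G)"
  using card_pos(2) by (auto simp: nrm_def simp flip: of_real_mult)

lemma G_mem: "g \<in> G \<Longrightarrow> i < N \<Longrightarrow> g i \<in> \<Sigma>"
  by (auto simp: G_def)

lemma sum_G_prod: "(\<Sum>g\<in>G. \<Prod>i<N. f i (g i)) = (\<Prod>i<N. \<Sum>\<sigma>\<in>\<Sigma>. f i \<sigma> :: 'c :: comm_semiring_1)"
  unfolding G_def using \<Sigma> by (intro prod_sum_PiE[symmetric]) auto

lemma prod_delta: "x \<in> G \<Longrightarrow> y \<in> G \<Longrightarrow> (\<Prod>i<N. if x i = y i then c else 0) = (if x = y then c ^ N else (0 :: complex))"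
proof (cases "x = y")
  case False
  assume "x \<in> G" "y \<in> G"
  then obtain i where "i < N" "x i \<noteq> y i" using False PiE_ext[of x "{..<N}" "\<lambda>_. \<Sigma>" y] by (auto simp: G_def)
  then show ?thesis using False by (auto intro!: prod_zero)
qed simp

lemma char_orth:
  assumes "x \<in> G" "y \<in> G"
  shows "(\<Sum>g\<in>G. cnj (char x g) * char y g) = (if x = y then of_real (real (card G)) else 0)"
proof -
  have "(\<Sum>g\<in>G. cnj (char x g) * char y g) = (\<Sum>g\<in>G. \<Prod>i<N. cnj (ch (x i) (g i)) * ch (y i) (g i))"
    by (simp add: char_def prod.distrib)
  also have "\<dots> = (\<Prod>i<N. if x i = y i then of_nat (card \<Sigma>) else 0)"
    unfolding sum_G_prod[of "\<lambda>i \<sigma>. cnj (ch (x i) \<sigma>) * ch (y i) \<sigma>"]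
    using assms by (intro prod.cong refl orth) (auto intro: G_mem)
  finally show ?thesis using assms by (simp add: prod_delta card_G)
qed

lemma char_dual:
  assumes "x \<in> G" "y \<in> G"
  shows "(\<Sum>e\<in>G. cnj (char e x) * char e y) = (if x = y then of_real (real (card G)) else 0)"
proof -
  have "(\<Sum>e\<in>G. cnj (char e x) * char e y) = (\<Sum>e\<in>G. \<Prod>i<N. cnj (ch (e i) (x i)) * ch (e i) (y i))"
    by (simp add: char_def prod.distrib)
  also have "\<dots> = (\<Prod>i<N. if x i = y i then of_nat (card \<Sigma>) else 0)"
    unfolding sum_G_prod[of "\<lambda>i \<epsilon>. cnj (ch \<epsilon> (x i)) * ch \<epsilon> (y i)"]
    using assms by (intro prod.cong refl dual) (auto intro: G_mem)
  finally show ?thesis using assms by (simp add: prod_delta card_G)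
qed

lemma fourier_parseval: "(\<Sum>e\<in>G. (cmod (fourier f e))\<^sup>2) = (\<Sum>g\<in>G. (cmod (f g))\<^sup>2)"
proof -
  have "(\<Sum>e\<in>G. (cmod (fourier f e))\<^sup>2) = real (card G) * (\<Sum>g\<in>G. (cmod (f g / nrm))\<^sup>2)"
    unfolding fourier_def by (rule parseval[OF finG(1) finG(1) char_dual])
  also have "\<dots> = (\<Sum>g\<in>G. (cmod (f g))\<^sup>2)"
    unfolding sum_distrib_left using card_pos(2) by (intro sum.cong refl) (simp add: norm_divide power_divide nrm_sq)
  finally show ?thesis .
qed

lemma errors_sub: "errors \<subseteq> G" "finite errors"
  using finG(1) by (auto simp: errors_def)

lemma fourier_trunc:
  assumes "e \<in> G"
  shows "fourier (trunc A) e = (if e \<in> errors then fourier (state A) e else 0)"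
proof -
  have "fourier (trunc A) e = (\<Sum>g\<in>G. \<Sum>e'\<in>errors. fourier (state A) e' * (cnj (char e g) * char e' g) / of_nat (card G))"
    unfolding fourier_def[of "trunc A"] trunc_def sum_divide_distrib sum_distrib_left
    by (intro sum.cong refl) (simp add: nrm_sq(1)[symmetric])
  also have "\<dots> = (\<Sum>e'\<in>errors. fourier (state A) e' * (\<Sum>g\<in>G. cnj (char e g) * char e' g) / of_nat (card G))"
    unfolding sum_distrib_left sum_divide_distrib by (rule sum.swap)
  also have "\<dots> = (\<Sum>e'\<in>errors. if e = e' then fourier (state A) e' else 0)"
    using card_pos(2) errors_sub(1) by (intro sum.cong refl) (subst char_orth[OF assms], auto)
  also have "\<dots> = (if e \<in> errors then fourier (state A) e else 0)"
    using errors_sub(2) by (simp add: sum.delta')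
  finally show ?thesis .
qed

lemma fourier_diff: "fourier (\<lambda>g. f g - h g) e = fourier f e - fourier h e"
  by (simp add: fourier_def sum_subtractf[symmetric] algebra_simps diff_divide_distrib)

lemma trunc_error:
  "(\<Sum>g\<in>G. (cmod (state A g - trunc A g))\<^sup>2) = (\<Sum>e\<in>G - errors. (cmod (fourier (state A) e))\<^sup>2)"
proof -
  have "(\<Sum>g\<in>G. (cmod (state A g - trunc A g))\<^sup>2) = (\<Sum>e\<in>G. (cmod (fourier (state A) e - fourier (trunc A) e))\<^sup>2)"
    using fourier_parseval[of "\<lambda>g. state A g - trunc A g"] by (simp only: fourier_diff)
  also have "\<dots> = (\<Sum>e\<in>G. if e \<in> errors then 0 else (cmod (fourier (state A) e))\<^sup>2)"
    by (intro sum.cong refl) (simp add: fourier_trunc)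
  also have "\<dots> = (\<Sum>e\<in>G - errors. (cmod (fourier (state A) e))\<^sup>2)"
    using finG(1) by (intro sum.mono_neutral_cong_right) auto
  finally show ?thesis .
qed

lemma Re_\<alpha>: "2 * Re (1 - \<alpha>) = 1 / p" "Re (\<alpha> * cnj (\<alpha> - 1)) = Re (1 - \<alpha>)"
proof -
  have a: "(Re \<alpha>)\<^sup>2 + (Im \<alpha>)\<^sup>2 = 1" using \<alpha>(1) by (simp add: cmod_power2[symmetric])
  then show "2 * Re (1 - \<alpha>) = 1 / p" using \<alpha>(2) unfolding cmod_power2
    by (simp add: power2_eq_square algebra_simps)
  show "Re (\<alpha> * cnj (\<alpha> - 1)) = Re (1 - \<alpha>)" using a by (simp add: power2_eq_square algebra_simps)
qed

lemma mark_frac_bounds: "0 \<le> mark_frac A i" "mark_frac A i \<le> 1"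
proof -
  show "0 \<le> mark_frac A i" unfolding mark_frac_def by (rule avg_nonneg) auto
  have "mark_frac A i \<le> avg \<Sigma> (\<lambda>_. 1)" unfolding mark_frac_def by (rule avg_mono) auto
  then show "mark_frac A i \<le> 1" using card_pos(1) by (simp add: avg_def)
qed

lemma amp_gen_sq:
  "(cmod (\<alpha> * of_real r + (\<alpha> - 1) * of_real b))\<^sup>2 = r\<^sup>2 + b\<^sup>2 / p + r * b / p"
proof -
  have "Re (\<alpha> * of_real r * cnj ((\<alpha> - 1) * of_real b)) = r * b * Re (\<alpha> * cnj (\<alpha> - 1))"
    by (simp add: algebra_simps)
  then have "2 * Re (\<alpha> * of_real r * cnj ((\<alpha> - 1) * of_real b)) = r * b * (2 * Re (1 - \<alpha>))"
    unfolding Re_\<alpha>(2) by (simp only: mult_ac)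
  also have "\<dots> = r * b * (1 / p)" unfolding Re_\<alpha>(1) ..
  finally have "2 * Re (\<alpha> * of_real r * cnj ((\<alpha> - 1) * of_real b)) = r * b * (1 / p)" .
  then show ?thesis unfolding cmod_add_sq using \<alpha> by (simp add: norm_mult power_mult_distrib)
qed

lemma amp_sq: "(cmod (amp A i \<sigma>))\<^sup>2 = (1 - mark_frac A i / p)\<^sup>2 + of_bool (A i \<sigma>) * (1 / p + (1 - mark_frac A i / p) / p)"
proof -
  have "amp A i \<sigma> = \<alpha> * of_real (1 - mark_frac A i / p) + (\<alpha> - 1) * of_real (of_bool (A i \<sigma>))" by (simp add: amp_def)
  then show ?thesis using amp_gen_sq[of "1 - mark_frac A i / p" "of_bool (A i \<sigma>)"] by (cases "A i \<sigma>") auto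
qed

lemma amp_avg: "avg \<Sigma> (\<lambda>\<sigma>. (cmod (amp A i \<sigma>))\<^sup>2) = 1"
proof -
  have "avg \<Sigma> (\<lambda>\<sigma>. (cmod (amp A i \<sigma>))\<^sup>2) = (1 - mark_frac A i / p)\<^sup>2 + mark_frac A i * (1 / p + (1 - mark_frac A i / p) / p)"
    unfolding amp_sq avg_add avg_mult_left mark_frac_def[symmetric] using \<Sigma> by (subst avg_const) auto
  also have "\<dots> = 1" using p by (simp add: power2_eq_square field_simps)
  finally show ?thesis .
qed

lemma amp_off_avg: "avg \<Sigma> (\<lambda>\<sigma>. of_bool (\<not> A i \<sigma>) * (cmod (amp A i \<sigma>))\<^sup>2) = (1 - mark_frac A i / p)\<^sup>2 * (1 - mark_frac A i)"
proof -
  have "avg \<Sigma> (\<lambda>\<sigma>. of_bool (\<not> A i \<sigma>) * (cmod (amp A i \<sigma>))\<^sup>2) = avg \<Sigma> (\<lambda>\<sigma>. (1 - mark_frac A i / p)\<^sup>2 * (1 - of_bool (A i \<sigma>)))"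
    unfolding amp_sq by (rule avg_cong) auto
  also have "\<dots> = (1 - mark_frac A i / p)\<^sup>2 * (1 - mark_frac A i)"
    unfolding avg_mult_right avg_diff mark_frac_def[symmetric] using \<Sigma> by (subst avg_const) auto
  finally show ?thesis .
qed

definition famp :: "(nat \<Rightarrow> 's \<Rightarrow> bool) \<Rightarrow> nat \<Rightarrow> 's \<Rightarrow> complex" where
  "famp A i \<epsilon> = (\<Sum>\<sigma>\<in>\<Sigma>. cnj (ch \<epsilon> \<sigma>) * (amp A i \<sigma> / of_nat (card \<Sigma>)))"

lemma famp_sum: "(\<Sum>\<epsilon>\<in>\<Sigma>. (cmod (famp A i \<epsilon>))\<^sup>2) = 1"
proof -
  have "(\<Sum>\<epsilon>\<in>\<Sigma>. (cmod (famp A i \<epsilon>))\<^sup>2) = real (card \<Sigma>) * (\<Sum>\<sigma>\<in>\<Sigma>. (cmod (amp A i \<sigma> / of_nat (card \<Sigma>)))\<^sup>2)"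
    unfolding famp_def using dual by (intro parseval \<Sigma>(1)) auto
  also have "\<dots> = avg \<Sigma> (\<lambda>\<sigma>. (cmod (amp A i \<sigma>))\<^sup>2)"
    using card_pos(1) by (simp add: avg_def norm_divide power_divide power2_eq_square sum_divide_distrib[symmetric] field_simps)
  finally show ?thesis by (simp add: amp_avg)
qed

text \<open>Read as probabilities, the squared Fourier coefficients say that a block with marked
  fraction f is in error with probability f * (1 - f) / p, which is about 1 - p when f is close to
  p.\<close>

lemma famp_zero: "(cmod (famp A i z))\<^sup>2 = 1 - mark_frac A i * (1 - mark_frac A i) / p"
proof -
  have "famp A i z = (\<Sum>\<sigma>\<in>\<Sigma>. \<alpha> * of_real (1 - mark_frac A i / p) / of_nat (card \<Sigma>) + (\<alpha> - 1) * (of_bool (A i \<sigma>) / of_nat (card \<Sigma>)))"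
    unfolding famp_def using ch_z by (intro sum.cong refl) (simp add: amp_def add_divide_distrib)
  also have "\<dots> = \<alpha> * of_real (1 - mark_frac A i / p) + (\<alpha> - 1) * of_real (mark_frac A i)"
    unfolding sum.distrib sum_distrib_left[symmetric] mark_frac_def avg_def using card_pos(1)
    by (simp add: sum_divide_distrib of_bool_def if_distrib[of complex_of_real] cong: if_cong)
  finally have "(cmod (famp A i z))\<^sup>2 = (1 - mark_frac A i / p)\<^sup>2 + (mark_frac A i)\<^sup>2 / p + (1 - mark_frac A i / p) * mark_frac A i / p"
    by (simp only: amp_gen_sq)
  also have "\<dots> = 1 - mark_frac A i * (1 - mark_frac A i) / p" using p by (simp add: power2_eq_square field_simps)
  finally show ?thesis .
qed

lemma fourier_state: "fourier (state A) e = (\<Prod>i<N. famp A i (e i))"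
proof -
  have "fourier (state A) e = (\<Sum>g\<in>G. \<Prod>i<N. cnj (ch (e i) (g i)) * (amp A i (g i) / of_nat (card \<Sigma>)))"
    unfolding fourier_def state_def divide_divide_eq_left nrm_sq card_G
    by (intro sum.cong refl) (simp add: char_def prod.distrib prod_dividef)
  also have "\<dots> = (\<Prod>i<N. famp A i (e i))"
    unfolding famp_def by (rule sum_G_prod[of "\<lambda>i \<sigma>. cnj (ch (e i) \<sigma>) * (amp A i \<sigma> / of_nat (card \<Sigma>))"])
  finally show ?thesis .
qed

lemma sum_G_marked:
  fixes h :: "nat \<Rightarrow> 's \<Rightarrow> real"
  assumes i: "i < N" and h: "\<And>j. j < N \<Longrightarrow> (\<Sum>\<sigma>\<in>\<Sigma>. h j \<sigma>) = 1"
  shows "(\<Sum>g\<in>G. of_bool (P (g i)) * (\<Prod>j<N. h j (g j))) = (\<Sum>\<sigma>\<in>\<Sigma>. of_bool (P \<sigma>) * h i \<sigma>)"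
proof -
  let ?f = "\<lambda>j \<sigma>. (if j = i then of_bool (P \<sigma>) else 1) * h j \<sigma>"
  have "(\<Sum>g\<in>G. of_bool (P (g i)) * (\<Prod>j<N. h j (g j))) = (\<Sum>g\<in>G. \<Prod>j<N. ?f j (g j))"
    using i by (intro sum.cong refl) (simp add: prod.distrib prod.delta)
  also have "\<dots> = (\<Prod>j<N. \<Sum>\<sigma>\<in>\<Sigma>. ?f j \<sigma>)" by (rule sum_G_prod)
  also have "\<dots> = (\<Prod>j<N. if j = i then (\<Sum>\<sigma>\<in>\<Sigma>. of_bool (P \<sigma>) * h i \<sigma>) else 1)"
    using h by (intro prod.cong refl) auto
  also have "\<dots> = (\<Sum>\<sigma>\<in>\<Sigma>. of_bool (P \<sigma>) * h i \<sigma>)" using i by (simp add: prod.delta)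
  finally show ?thesis .
qed

lemma state_sq: "(cmod (state A g))\<^sup>2 = (\<Prod>i<N. (cmod (amp A i (g i)))\<^sup>2 / real (card \<Sigma>))"
  by (simp add: state_def norm_divide power_divide nrm_sq(4) card_G prod_norm[symmetric] prod_power_distrib prod_dividef)

lemma amp_sum: "(\<Sum>\<sigma>\<in>\<Sigma>. (cmod (amp A i \<sigma>))\<^sup>2 / real (card \<Sigma>)) = 1"
  using amp_avg[of A i] by (simp add: avg_def sum_divide_distrib)

lemma state_norm: "(\<Sum>g\<in>G. (cmod (state A g))\<^sup>2) = 1"
  unfolding state_sq sum_G_prod[of "\<lambda>i \<sigma>. (cmod (amp A i \<sigma>))\<^sup>2 / real (card \<Sigma>)"] amp_sum by simp

text \<open>Union bound over the blocks. Each contributes the mass of its unmarked symbols, which is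
  of second order in the deviation of the marked fraction from \<open>p\<close>.\<close>

lemma state_off_marks:
  "(\<Sum>g\<in>{g \<in> G. \<not> (\<forall>i<N. A i (g i))}. (cmod (state A g))\<^sup>2) \<le> (\<Sum>i<N. (1 - mark_frac A i / p)\<^sup>2)"
proof -
  have "(\<Sum>g\<in>{g \<in> G. \<not> (\<forall>i<N. A i (g i))}. (cmod (state A g))\<^sup>2)
      \<le> (\<Sum>g\<in>{g \<in> G. \<not> (\<forall>i<N. A i (g i))}. \<Sum>i<N. of_bool (\<not> A i (g i)) * (cmod (state A g))\<^sup>2)"
  proof (rule sum_mono)
    fix g assume "g \<in> {g \<in> G. \<not> (\<forall>i<N. A i (g i))}"
    then obtain i where i: "i < N" "\<not> A i (g i)" by blast
    then have "(cmod (state A g))\<^sup>2 = of_bool (\<not> A i (g i)) * (cmod (state A g))\<^sup>2" by simp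
    also have "\<dots> \<le> (\<Sum>i<N. of_bool (\<not> A i (g i)) * (cmod (state A g))\<^sup>2)"
      using i by (intro member_le_sum[of i _ "\<lambda>i. of_bool (\<not> A i (g i)) * (cmod (state A g))\<^sup>2"]) auto
    finally show "(cmod (state A g))\<^sup>2 \<le> (\<Sum>i<N. of_bool (\<not> A i (g i)) * (cmod (state A g))\<^sup>2)" .
  qed
  also have "\<dots> \<le> (\<Sum>g\<in>G. \<Sum>i<N. of_bool (\<not> A i (g i)) * (cmod (state A g))\<^sup>2)"
    using finG(1) by (intro sum_mono2) (auto intro!: sum_nonneg)
  also have "\<dots> = (\<Sum>i<N. \<Sum>g\<in>G. of_bool (\<not> A i (g i)) * (cmod (state A g))\<^sup>2)" by (rule sum.swap)
  also have "\<dots> = (\<Sum>i<N. (1 - mark_frac A i / p)\<^sup>2 * (1 - mark_frac A i))"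
  proof (intro sum.cong refl)
    fix i assume "i \<in> {..<N}"
    then have "(\<Sum>g\<in>G. of_bool (\<not> A i (g i)) * (cmod (state A g))\<^sup>2)
       = (\<Sum>\<sigma>\<in>\<Sigma>. of_bool (\<not> A i \<sigma>) * ((cmod (amp A i \<sigma>))\<^sup>2 / real (card \<Sigma>)))"
      unfolding state_sq using amp_sum by (intro sum_G_marked[where h = "\<lambda>i \<sigma>. (cmod (amp A i \<sigma>))\<^sup>2 / real (card \<Sigma>)"]) auto
    also have "\<dots> = (1 - mark_frac A i / p)\<^sup>2 * (1 - mark_frac A i)"
      unfolding amp_off_avg[symmetric] by (simp add: avg_def sum_divide_distrib)
    finally show "(\<Sum>g\<in>G. of_bool (\<not> A i (g i)) * (cmod (state A g))\<^sup>2) = (1 - mark_frac A i / p)\<^sup>2 * (1 - mark_frac A i)" .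
  qed
  also have "\<dots> \<le> (\<Sum>i<N. (1 - mark_frac A i / p)\<^sup>2)"
    using mark_frac_bounds by (intro sum_mono mult_left_le) auto
  finally show ?thesis .
qed

text \<open>Markov's inequality for the number of nonzero blocks, whose expectation under the
  squared Fourier coefficients is the sum of the error probabilities of the blocks.\<close>

lemma heavy_errors:
  "(\<Sum>e\<in>G - errors. (cmod (fourier (state A) e))\<^sup>2) \<le> (\<Sum>i<N. mark_frac A i * (1 - mark_frac A i) / p) / real (t + 1)"
proof -
  let ?q = "\<lambda>e. (cmod (fourier (state A) e))\<^sup>2"
  have q: "?q e = (\<Prod>i<N. (cmod (famp A i (e i)))\<^sup>2)" for e
    by (simp add: fourier_state prod_norm[symmetric] prod_power_distrib)
  have "real (t + 1) * (\<Sum>e\<in>G - errors. ?q e) \<le> (\<Sum>e\<in>G - errors. real (weight e) * ?q e)"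
    unfolding sum_distrib_left by (intro sum_mono mult_right_mono) (auto simp: errors_def)
  also have "\<dots> \<le> (\<Sum>e\<in>G. real (weight e) * ?q e)"
    using finG(1) by (intro sum_mono2) auto
  also have "\<dots> = (\<Sum>e\<in>G. \<Sum>i<N. of_bool (e i \<noteq> z) * ?q e)"
  proof (intro sum.cong refl)
    fix e
    have "{i. i < N \<and> e i \<noteq> z} = {i \<in> {..<N}. e i \<noteq> z}" by auto
    then have "real (weight e) = (\<Sum>i<N. of_bool (e i \<noteq> z))"
      by (simp add: weight_def of_bool_def sum.inter_filter[symmetric])
    then show "real (weight e) * ?q e = (\<Sum>i<N. of_bool (e i \<noteq> z) * ?q e)" by (simp add: sum_distrib_right)
  qed
  also have "\<dots> = (\<Sum>i<N. \<Sum>e\<in>G. of_bool (e i \<noteq> z) * ?q e)" by (rule sum.swap)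
  also have "\<dots> = (\<Sum>i<N. mark_frac A i * (1 - mark_frac A i) / p)"
  proof (intro sum.cong refl)
    fix i assume "i \<in> {..<N}"
    then have "(\<Sum>e\<in>G. of_bool (e i \<noteq> z) * ?q e) = (\<Sum>\<epsilon>\<in>\<Sigma>. of_bool (\<epsilon> \<noteq> z) * (cmod (famp A i \<epsilon>))\<^sup>2)"
      unfolding q using famp_sum by (intro sum_G_marked[where h = "\<lambda>i \<epsilon>. (cmod (famp A i \<epsilon>))\<^sup>2"]) auto
    also have "\<dots> = (\<Sum>\<epsilon>\<in>\<Sigma> - {z}. (cmod (famp A i \<epsilon>))\<^sup>2)"
      using \<Sigma>(1) by (intro sum.mono_neutral_cong_right) auto
    also have "\<dots> = (\<Sum>\<epsilon>\<in>\<Sigma>. (cmod (famp A i \<epsilon>))\<^sup>2) - (cmod (famp A i z))\<^sup>2"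
      unfolding sum.remove[OF \<Sigma>, of "\<lambda>\<epsilon>. (cmod (famp A i \<epsilon>))\<^sup>2"] by simp
    finally show "(\<Sum>e\<in>G. of_bool (e i \<noteq> z) * ?q e) = mark_frac A i * (1 - mark_frac A i) / p"
      unfolding famp_sum famp_zero by simp
  qed
  finally show ?thesis by (simp add: field_simps)
qed

text \<open>By \<open>trunc_error\<close> truncation disturbs the state only by the mass of the
  heavy errors. \<open>half_cmod_sq_le\<close> trades the cross terms for a factor 1/2, which a
  constant success probability can afford.\<close>

lemma trunc_marked:
  "(1 - (\<Sum>i<N. (1 - mark_frac A i / p)\<^sup>2)) / 2 - (\<Sum>i<N. mark_frac A i * (1 - mark_frac A i) / p) / real (t + 1)
    \<le> (\<Sum>g\<in>{g \<in> G. \<forall>i<N. A i (g i)}. (cmod (trunc A g))\<^sup>2)"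
proof -
  let ?T = "{g \<in> G. \<forall>i<N. A i (g i)}" and ?U = "{g \<in> G. \<not> (\<forall>i<N. A i (g i))}"
  have "(\<Sum>g\<in>G. (cmod (state A g))\<^sup>2) = (\<Sum>g\<in>?T. (cmod (state A g))\<^sup>2) + (\<Sum>g\<in>?U. (cmod (state A g))\<^sup>2)"
    using finG(1) by (subst sum.union_disjoint[symmetric]) (auto intro!: sum.cong)
  then have 1: "1 - (\<Sum>i<N. (1 - mark_frac A i / p)\<^sup>2) \<le> (\<Sum>g\<in>?T. (cmod (state A g))\<^sup>2)"
    using state_off_marks[of A] state_norm[of A] by linarith
  have 2: "(\<Sum>g\<in>?T. (cmod (state A g - trunc A g))\<^sup>2) \<le> (\<Sum>i<N. mark_frac A i * (1 - mark_frac A i) / p) / real (t + 1)"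
  proof -
    have "(\<Sum>g\<in>?T. (cmod (state A g - trunc A g))\<^sup>2) \<le> (\<Sum>g\<in>G. (cmod (state A g - trunc A g))\<^sup>2)"
      using finG(1) by (intro sum_mono2) auto
    then show ?thesis unfolding trunc_error using heavy_errors[of A] by linarith
  qed
  have "(\<Sum>g\<in>?T. (cmod (state A g))\<^sup>2) / 2 - (\<Sum>g\<in>?T. (cmod (state A g - trunc A g))\<^sup>2) \<le> (\<Sum>g\<in>?T. (cmod (trunc A g))\<^sup>2)"
    unfolding sum_divide_distrib sum_subtractf[symmetric] by (intro sum_mono half_cmod_sq_le)
  moreover have "a / 2 - b \<le> c \<Longrightarrow> 1 - d \<le> a \<Longrightarrow> b \<le> e \<Longrightarrow> (1 - d) / 2 - e \<le> c" for a b c d e :: real by (simp add: field_simps)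
  ultimately show ?thesis using 1 2 by blast
qed

lemma shift_in: "a \<in> G \<Longrightarrow> g \<in> G \<Longrightarrow> shift a g \<in> G"
  using add_bij(1) by (auto simp: shift_def G_def dest!: bij_betwE)

lemma shift_bij: "c \<in> G \<Longrightarrow> bij_betw (\<lambda>a. shift a c) G G"
proof -
  assume c: "c \<in> G"
  have inj: "inj_on (\<lambda>a. shift a c) G"
  proof (rule inj_onI)
    fix a b assume ab: "a \<in> G" "b \<in> G" "shift a c = shift b c"
    have "a i = b i" if "i < N" for i
    proof -
      have "add (c i) (a i) = add (c i) (b i)" using fun_cong[OF ab(3), of i] that by (simp add: shift_def)
      then show ?thesis using add_bij(1)[OF G_mem[OF c that]] G_mem[OF ab(1) that] G_mem[OF ab(2) that]
        by (auto simp: bij_betw_def dest: inj_onD)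
    qed
    then show "a = b" using ab(1,2) unfolding G_def by (intro PiE_ext) auto
  qed
  moreover have "(\<lambda>a. shift a c) ` G \<subseteq> G" using shift_in c by auto
  ultimately show ?thesis using finG(1) by (simp add: bij_betw_def card_image card_subset_eq)
qed

lemma mark_frac_shift: "a \<in> G \<Longrightarrow> i < N \<Longrightarrow> mark_frac (shift_marks A a) i = mark_frac A i"
  unfolding mark_frac_def shift_marks_def avg_def
  using sum.reindex_bij_betw[OF add_bij(2)[OF G_mem], of a i "\<lambda>\<sigma>. of_bool (A i \<sigma>) :: real"] by simp

lemma famp_shift:
  assumes a: "a \<in> G" and i: "i < N" and \<epsilon>: "\<epsilon> \<in> \<Sigma>"
  shows "famp (shift_marks A a) i \<epsilon> = ch \<epsilon> (a i) * famp A i \<epsilon>"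
proof -
  have ai: "a i \<in> \<Sigma>" using G_mem[OF a i] .
  have "famp A i \<epsilon> = (\<Sum>\<sigma>\<in>\<Sigma>. cnj (ch \<epsilon> (add \<sigma> (a i))) * (amp A i (add \<sigma> (a i)) / of_nat (card \<Sigma>)))"
    unfolding famp_def
    by (rule sum.reindex_bij_betw[OF add_bij(2)[OF ai], symmetric, of "\<lambda>\<sigma>. cnj (ch \<epsilon> \<sigma>) * (amp A i \<sigma> / of_nat (card \<Sigma>))"])
  also have "\<dots> = (\<Sum>\<sigma>\<in>\<Sigma>. cnj (ch \<epsilon> (a i)) * (cnj (ch \<epsilon> \<sigma>) * (amp (shift_marks A a) i \<sigma> / of_nat (card \<Sigma>))))"
    using add[OF \<epsilon> _ ai] mark_frac_shift[OF a i] by (intro sum.cong refl) (simp add: amp_def shift_marks_def)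
  also have "\<dots> = cnj (ch \<epsilon> (a i)) * famp (shift_marks A a) i \<epsilon>" by (simp only: famp_def sum_distrib_left)
  finally have "ch \<epsilon> (a i) * famp A i \<epsilon> = (ch \<epsilon> (a i) * cnj (ch \<epsilon> (a i))) * famp (shift_marks A a) i \<epsilon>" by simp
  also have "ch \<epsilon> (a i) * cnj (ch \<epsilon> (a i)) = 1" using ch_unit[OF \<epsilon> ai] cmod_sq[of "ch \<epsilon> (a i)"] by simp
  finally show ?thesis by simp
qed

lemma char_shift:
  assumes "e \<in> G" "a \<in> G" "g \<in> G"
  shows "char e (shift a g) = char e g * char e a"
  unfolding char_def prod.distrib[symmetric] shift_def
  using assms by (intro prod.cong refl) (auto intro!: add G_mem)

text \<open>Translating the marks multiplies each Fourier coefficient by a character value, which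
  amounts to evaluating the truncated state at a translated word. So the amplitudes on the code are,
  up to normalisation, values of \<open>trunc\<close> on a translate of the code.\<close>

lemma out_amp_shift:
  assumes a: "a \<in> G" and c: "c \<in> C"
  shows "(cmod (out_amp (shift_marks A a) c))\<^sup>2 = real (card G) / real (card C) * (cmod (trunc A (shift a c)))\<^sup>2"
proof -
  have cG: "c \<in> G" using c C(1) by (auto simp: G_def)
  have f: "fourier (state (shift_marks A a)) e = char e a * fourier (state A) e" if "e \<in> G" for e
    unfolding fourier_state char_def prod.distrib[symmetric]
    using that by (intro prod.cong refl famp_shift[OF a]) (auto intro: G_mem)
  have "out_amp (shift_marks A a) c = (\<Sum>e\<in>errors. fourier (state A) e * (char e (shift a c) / complex_of_real (sqrt (real (card C)))))"
    unfolding out_amp_def using errors_sub(1) f char_shift[OF _ a cG] by (intro sum.cong refl) auto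
  also have "\<dots> = nrm / complex_of_real (sqrt (real (card C))) * trunc A (shift a c)"
    unfolding trunc_def sum_distrib_left using nrm_sq(2) by (intro sum.cong refl) simp
  finally show ?thesis by (simp add: norm_mult norm_divide power_mult_distrib power_divide nrm_sq(4))
qed

text \<open>For a fixed code word, the translated word runs through all words exactly once as the
  translation varies. Hence the average success is the mass of \<open>trunc\<close> on all words
  with every block marked, whatever the code is.\<close>

theorem success_avg_shift:
  "(1 - (\<Sum>i<N. (1 - mark_frac A i / p)\<^sup>2)) / 2 - (\<Sum>i<N. mark_frac A i * (1 - mark_frac A i) / p) / real (t + 1)
    \<le> avg G (\<lambda>a. success (shift_marks A a))"
proof -
  let ?T = "{g \<in> G. \<forall>i<N. A i (g i)}"
  let ?f = "\<lambda>g. of_bool (\<forall>i<N. A i (g i)) * (cmod (trunc A g))\<^sup>2"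
  have cG: "c \<in> G" if "c \<in> C" for c using that C(1) by (auto simp: G_def)
  have "success (shift_marks A a) = (\<Sum>c\<in>C. real (card G) / real (card C) * ?f (shift a c))" if a: "a \<in> G" for a
  proof -
    have "success (shift_marks A a) = (\<Sum>c\<in>C. of_bool (\<forall>i<N. shift_marks A a i (c i)) * (cmod (out_amp (shift_marks A a) c))\<^sup>2)"
      unfolding success_def using finC by (intro sum.mono_neutral_cong_left) auto
    also have "\<dots> = (\<Sum>c\<in>C. real (card G) / real (card C) * ?f (shift a c))"
    proof (intro sum.cong refl)
      fix c assume c: "c \<in> C"
      have "(\<forall>i<N. shift_marks A a i (c i)) \<longleftrightarrow> (\<forall>i<N. A i (shift a c i))" by (simp add: shift_marks_def shift_def)
      then show "of_bool (\<forall>i<N. shift_marks A a i (c i)) * (cmod (out_amp (shift_marks A a) c))\<^sup>2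
          = real (card G) / real (card C) * ?f (shift a c)"
        unfolding out_amp_shift[OF a c] by (simp only: mult_ac)
    qed
    finally show ?thesis .
  qed
  then have "avg G (\<lambda>a. success (shift_marks A a)) = avg G (\<lambda>a. \<Sum>c\<in>C. real (card G) / real (card C) * ?f (shift a c))"
    by (rule avg_cong)
  also have "\<dots> = (\<Sum>c\<in>C. (\<Sum>a\<in>G. ?f (shift a c)) / real (card C))"
    unfolding avg_sum avg_mult_right unfolding avg_def using card_pos(2) by (intro sum.cong refl) simp
  also have "\<dots> = (\<Sum>c\<in>C. (\<Sum>g\<in>G. ?f g) / real (card C))"
    by (rule sum.cong[OF refl], subst sum.reindex_bij_betw[OF shift_bij[OF cG]]) auto
  also have "\<dots> = (\<Sum>g\<in>?T. (cmod (trunc A g))\<^sup>2)"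
    using card_pos(3) finG(1) by (simp, intro sum.mono_neutral_cong_right) auto
  finally show ?thesis using trunc_marked[of A] by simp
qed

end

section \<open>Folded polynomial codes over a prime field\<close>

definition root_char :: "nat \<Rightarrow> nat \<Rightarrow> complex" where
  "root_char l k = exp (2 * of_real pi * \<i> * of_nat k / of_nat l)"

lemma root_char_add: "root_char l (a + b) = root_char l a * root_char l b"
  by (simp add: root_char_def exp_add[symmetric] add_divide_distrib algebra_simps)

lemma root_char_0 [simp]: "root_char l 0 = 1"
  by (simp add: root_char_def)

lemma root_char_eq: "l > 0 \<Longrightarrow> root_char l a = root_char l b \<longleftrightarrow> a mod l = b mod l"
  unfolding root_char_def using complex_root_unity_eq[of l a b] by simp

lemma root_char_unit: "cmod (root_char l a) = 1"
  unfolding root_char_def by (simp add: norm_exp_eq_Re)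

lemma unit_cnj: "cmod w = 1 \<Longrightarrow> cnj w * w = 1"
  using cmod_sq[of w] by (simp add: mult.commute)

lemma unit_cnj_eq_1: "cmod v = 1 \<Longrightarrow> cnj v * w = 1 \<longleftrightarrow> v = w"
proof
  assume v: "cmod v = 1" and "cnj v * w = 1"
  then have "v * (cnj v * w) = v" by simp
  then show "v = w" using unit_cnj[OF v] by (simp add: mult.assoc[symmetric] mult.commute[of v])
qed (use unit_cnj in auto)

text \<open>The usual argument for vanishing character sums: a translation permutes the summands and
  at the same time multiplies the sum by a factor other than one.\<close>

lemma sum_zero_by_translation:
  fixes \<psi> :: "'a \<Rightarrow> complex"
  assumes "bij_betw h S S" "\<And>x. x \<in> S \<Longrightarrow> \<psi> (h x) = c * \<psi> x" "c \<noteq> 1"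
  shows "(\<Sum>x\<in>S. \<psi> x) = 0"
proof -
  have "(\<Sum>x\<in>S. \<psi> x) = (\<Sum>x\<in>S. \<psi> (h x))" by (rule sum.reindex_bij_betw[OF assms(1), symmetric])
  also have "\<dots> = c * (\<Sum>x\<in>S. \<psi> x)" unfolding sum_distrib_left using assms(2) by (rule sum.cong[OF refl])
  finally show ?thesis using assms(3) by (metis mult_cancel_right1)
qed

lemma mod_add_bij: "bij_betw (\<lambda>x. (x + a) mod l) {..<l} {..<l :: nat}"
proof (cases "l = 0")
  case False
  have "inj_on (\<lambda>x. (x + a) mod l) {..<l}"
  proof (rule inj_onI)
    fix x y assume xy: "x \<in> {..<l}" "y \<in> {..<l}" "(x + a) mod l = (y + a) mod l"
    then have "(int x + int a) mod int l = (int y + int a) mod int l" by (simp flip: of_nat_add of_nat_mod)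
    then have "int l dvd int x - int y" by (simp add: mod_eq_dvd_iff)
    moreover have "\<bar>int x - int y\<bar> < int l" using xy by auto
    ultimately have "int x - int y = 0" by (metis dvd_imp_le_int abs_of_nat not_less)
    then show "x = y" by simp
  qed
  moreover have "(\<lambda>x. (x + a) mod l) ` {..<l} \<subseteq> {..<l}" using False by auto
  ultimately show ?thesis by (simp add: bij_betw_def card_image card_subset_eq)
qed (simp add: bij_betw_def)

lemma root_char_orth:
  assumes "l > 0" "x < l" "y < l"
  shows "(\<Sum>s<l. cnj (root_char l (x * s)) * root_char l (y * s)) = (if x = y then of_nat l else 0)"
proof (cases "x = y")
  case True
  then show ?thesis using unit_cnj[OF root_char_unit] by simp
next
  case False
  have "(\<Sum>s<l. cnj (root_char l (x * s)) * root_char l (y * s)) = 0"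
  proof (rule sum_zero_by_translation[OF mod_add_bij[of 1]])
    have m: "root_char l (w * ((s + 1) mod l)) = root_char l w * root_char l (w * s)" for w s
    proof -
      have "root_char l (w * ((s + 1) mod l)) = root_char l (w * (s + 1))"
        using assms(1) by (simp only: root_char_eq mod_mult_right_eq)
      then show ?thesis by (simp add: root_char_add[symmetric] algebra_simps)
    qed
    show "cnj (root_char l (x * ((s + 1) mod l))) * root_char l (y * ((s + 1) mod l))
        = (cnj (root_char l x) * root_char l y) * (cnj (root_char l (x * s)) * root_char l (y * s))" for s
      unfolding m by simp
    show "cnj (root_char l x) * root_char l y \<noteq> 1"
      using False assms by (simp add: unit_cnj_eq_1[OF root_char_unit] root_char_eq)
  qed
  then show ?thesis using False by simp
qed

definition symbols :: "nat \<Rightarrow> nat \<Rightarrow> (nat \<Rightarrow> nat) set" where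
  "symbols m l = {..<m} \<rightarrow>\<^sub>E {..<l}"

definition sym_char :: "nat \<Rightarrow> nat \<Rightarrow> (nat \<Rightarrow> nat) \<Rightarrow> (nat \<Rightarrow> nat) \<Rightarrow> complex" where
  "sym_char m l \<epsilon> \<sigma> = (\<Prod>j<m. root_char l (\<epsilon> j * \<sigma> j))"

definition sym_add :: "nat \<Rightarrow> nat \<Rightarrow> (nat \<Rightarrow> nat) \<Rightarrow> (nat \<Rightarrow> nat) \<Rightarrow> nat \<Rightarrow> nat" where
  "sym_add m l \<sigma> \<tau> = (\<lambda>j\<in>{..<m}. (\<sigma> j + \<tau> j) mod l)"

lemma symbols_finite: "finite (symbols m l)" and card_symbols: "card (symbols m l) = l ^ m"
  by (auto simp: symbols_def finite_PiE card_PiE)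

lemma sym_char_commute: "sym_char m l \<epsilon> \<sigma> = sym_char m l \<sigma> \<epsilon>"
  by (simp add: sym_char_def mult.commute)

lemma sym_char_unit: "cmod (sym_char m l \<epsilon> \<sigma>) = 1"
  by (simp add: sym_char_def prod_norm[symmetric] root_char_unit)

lemma symbols_mem: "\<sigma> \<in> symbols m l \<Longrightarrow> j < m \<Longrightarrow> \<sigma> j < l"
  by (auto simp: symbols_def)

lemma symbols_eqI: "\<sigma> \<in> symbols m l \<Longrightarrow> \<tau> \<in> symbols m l \<Longrightarrow> (\<And>j. j < m \<Longrightarrow> \<sigma> j = \<tau> j) \<Longrightarrow> \<sigma> = \<tau>"
  unfolding symbols_def by (rule PiE_ext) auto

lemma sym_char_orth:
  assumes "l > 0" "x \<in> symbols m l" "y \<in> symbols m l"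
  shows "(\<Sum>\<sigma>\<in>symbols m l. cnj (sym_char m l x \<sigma>) * sym_char m l y \<sigma>) = (if x = y then of_nat (card (symbols m l)) else 0)"
proof -
  have "(\<Sum>\<sigma>\<in>symbols m l. cnj (sym_char m l x \<sigma>) * sym_char m l y \<sigma>)
      = (\<Sum>\<sigma>\<in>symbols m l. \<Prod>j<m. cnj (root_char l (x j * \<sigma> j)) * root_char l (y j * \<sigma> j))"
    by (simp add: sym_char_def prod.distrib)
  also have "\<dots> = (\<Prod>j<m. \<Sum>s<l. cnj (root_char l (x j * s)) * root_char l (y j * s))"
    unfolding symbols_def by (rule prod_sum_PiE[symmetric]) auto
  also have "\<dots> = (\<Prod>j<m. if x j = y j then of_nat l else 0)"
    using assms by (intro prod.cong refl root_char_orth) (auto intro: symbols_mem)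
  also have "\<dots> = (if x = y then of_nat (card (symbols m l)) else 0)"
  proof (cases "x = y")
    case False
    then obtain j where "j < m" "x j \<noteq> y j" using symbols_eqI[OF assms(2,3)] by blast
    then show ?thesis using False by (auto intro!: prod_zero)
  qed (simp add: card_symbols)
  finally show ?thesis .
qed

lemma sym_char_add: "l > 0 \<Longrightarrow> sym_char m l \<epsilon> (sym_add m l x y) = sym_char m l \<epsilon> x * sym_char m l \<epsilon> y"
  unfolding sym_char_def prod.distrib[symmetric] sym_add_def root_char_add[symmetric]
  by (intro prod.cong refl) (simp add: root_char_eq mod_mult_right_eq distrib_left)

lemma sym_add_commute: "sym_add m l x y = sym_add m l y x"
  by (simp add: sym_add_def add.commute)

lemma sym_add_bij:
  assumes "l > 0" "x \<in> symbols m l"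
  shows "bij_betw (sym_add m l x) (symbols m l) (symbols m l)" "bij_betw (\<lambda>y. sym_add m l y x) (symbols m l) (symbols m l)"
proof -
  have inj: "inj_on (sym_add m l x) (symbols m l)"
  proof (rule inj_onI)
    fix a b assume ab: "a \<in> symbols m l" "b \<in> symbols m l" "sym_add m l x a = sym_add m l x b"
    show "a = b"
    proof (rule symbols_eqI[OF ab(1,2)])
      fix j assume j: "j < m"
      then have "(a j + x j) mod l = (b j + x j) mod l" using fun_cong[OF ab(3), of j] by (simp add: sym_add_def add.commute)
      then show "a j = b j" using mod_add_bij[of "x j" l] symbols_mem[OF ab(1) j] symbols_mem[OF ab(2) j]
        by (auto simp: bij_betw_def dest: inj_onD)
    qed
  qed
  have "sym_add m l x y \<in> symbols m l" for y using assms(1) by (simp add: sym_add_def symbols_def restrict_PiE_iff)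
  then have "sym_add m l x ` symbols m l \<subseteq> symbols m l" by blast
  then show "bij_betw (sym_add m l x) (symbols m l) (symbols m l)"
    using inj symbols_finite by (simp add: bij_betw_def card_image card_subset_eq)
  then show "bij_betw (\<lambda>y. sym_add m l y x) (symbols m l) (symbols m l)" by (simp add: sym_add_commute[of _ _ _ x])
qed

definition fold_word :: "nat \<Rightarrow> (nat \<Rightarrow> nat) \<Rightarrow> nat \<Rightarrow> nat \<Rightarrow> nat" where
  "fold_word l F = (\<lambda>i\<in>{..<block_count l}. \<lambda>j\<in>{..<fold_len l}. F (i * fold_len l + j))"

definition folded_code :: "nat \<Rightarrow> (nat \<Rightarrow> nat \<Rightarrow> nat) set" where
  "folded_code l = fold_word l ` code_words l"

text \<open>The point z of the unit circle with 2 * (1 - Re z) = 1 / p, that is, at squared distance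
  1 / p from 1; it exists because \<open>mark_prob l\<close> is at least 1/2.\<close>

definition mark_phase :: "nat \<Rightarrow> complex" where
  "mark_phase l = Complex (1 - 1 / (2 * mark_prob l)) (sqrt (1 - (1 - 1 / (2 * mark_prob l))\<^sup>2))"

text \<open>Half of \<open>code_dim l / fold_len l\<close>, rounded down: two errors of this weight
  together involve at most \<open>code_dim l\<close> field elements.\<close>

definition error_weight :: "nat \<Rightarrow> nat" where
  "error_weight l = fold_len l ^ 2 div 2"

lemma mark_phase: "cmod (mark_phase l) = 1" "(cmod (mark_phase l - 1))\<^sup>2 = 1 / mark_prob l"
proof -
  let ?r = "1 - 1 / (2 * mark_prob l)"
  have pp: "mark_prob l > 0" using mark_prob_bounds[of l] by linarith
  have "0 \<le> ?r" "?r \<le> 1" using mark_prob_bounds[of l] pp by (auto simp: field_simps)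
  then have "?r\<^sup>2 \<le> 1" by (simp add: power_le_one)
  then have im: "(sqrt (1 - ?r\<^sup>2))\<^sup>2 = 1 - ?r\<^sup>2" by simp
  have "(cmod (mark_phase l))\<^sup>2 = 1" unfolding cmod_power2 by (simp add: mark_phase_def im del: real_sqrt_pow2_iff)
  then show "cmod (mark_phase l) = 1" using power2_eq_1_iff[of "cmod (mark_phase l)"] norm_ge_zero[of "mark_phase l"] by linarith
  have "(cmod (mark_phase l - 1))\<^sup>2 = (?r - 1)\<^sup>2 + (1 - ?r\<^sup>2)"
    unfolding cmod_power2 by (simp add: mark_phase_def im del: real_sqrt_pow2_iff)
  also have "\<dots> = 1 / mark_prob l" using pp by (simp add: power2_eq_square field_simps)
  finally show "(cmod (mark_phase l - 1))\<^sup>2 = 1 / mark_prob l" .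
qed

lemma fold_word_in: "prime l \<Longrightarrow> F \<in> code_words l \<Longrightarrow> fold_word l F \<in> {..<block_count l} \<rightarrow>\<^sub>E symbols (fold_len l) l"
proof -
  assume l: "prime l" and F: "F \<in> code_words l"
  have "F x < l" if "x < l" for x using F that mod_fun_less[OF prime_gt_0_nat[OF l]] by (auto simp: code_words_def)
  then show ?thesis using code_index_less[OF l] by (simp add: fold_word_def symbols_def restrict_PiE_iff)
qed

lemma folded_code_sampling:
  assumes l: "prime l"
  shows "code_sampling (block_count l) (symbols (fold_len l) l) (\<lambda>j\<in>{..<fold_len l}. 0) (sym_char (fold_len l) l)
    (sym_add (fold_len l) l) (folded_code l) (mark_phase l) (mark_prob l)"
proof
  have l0: "l > 0" using l prime_gt_0_nat by blast
  show "finite (symbols (fold_len l) l)" by (rule symbols_finite)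
  show "(\<lambda>j\<in>{..<fold_len l}. 0) \<in> symbols (fold_len l) l" using l0 by (auto simp: symbols_def)
  fix x y \<epsilon> assume x: "x \<in> symbols (fold_len l) l"
  show "y \<in> symbols (fold_len l) l \<Longrightarrow> (\<Sum>\<sigma>\<in>symbols (fold_len l) l. cnj (sym_char (fold_len l) l x \<sigma>) * sym_char (fold_len l) l y \<sigma>)
      = (if x = y then of_nat (card (symbols (fold_len l) l)) else 0)"
    using sym_char_orth[OF l0 x] .
  show "y \<in> symbols (fold_len l) l \<Longrightarrow> (\<Sum>\<epsilon>\<in>symbols (fold_len l) l. cnj (sym_char (fold_len l) l \<epsilon> x) * sym_char (fold_len l) l \<epsilon> y)
      = (if x = y then of_nat (card (symbols (fold_len l) l)) else 0)"
    unfolding sym_char_commute[of _ _ _ x] sym_char_commute[of _ _ _ y] using sym_char_orth[OF l0 x] .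
  show "sym_char (fold_len l) l \<epsilon> (sym_add (fold_len l) l x y) = sym_char (fold_len l) l \<epsilon> x * sym_char (fold_len l) l \<epsilon> y"
    using l0 by (rule sym_char_add)
  show "bij_betw (sym_add (fold_len l) l x) (symbols (fold_len l) l) (symbols (fold_len l) l)"
    "bij_betw (\<lambda>y. sym_add (fold_len l) l y x) (symbols (fold_len l) l) (symbols (fold_len l) l)"
    using sym_add_bij[OF l0 x] .
  show "sym_char (fold_len l) l (\<lambda>j\<in>{..<fold_len l}. 0) x = 1" by (simp add: sym_char_def)
  show "cmod (sym_char (fold_len l) l \<epsilon> x) = 1" by (rule sym_char_unit)
next
  show "folded_code l \<subseteq> {..<block_count l} \<rightarrow>\<^sub>E symbols (fold_len l) l"
    using fold_word_in[OF l] by (auto simp: folded_code_def)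
  have "mod_fun l 0 \<in> code_words l" by (auto simp: code_words_def)
  then show "folded_code l \<noteq> {}" by (auto simp: folded_code_def)
  show "0 < mark_prob l" using mark_prob_bounds[of l] by linarith
qed (rule mark_phase)+

section \<open>Sampling puzzle solutions with quantum queries\<close>

text \<open>The class over which a partial reflection averages: words that agree with
  \<open>g\<close> off block \<open>i\<close> correspond to the symbols of that block.\<close>

lemma card_PiE_fiber:
  assumes "i \<in> I" "g \<in> I \<rightarrow>\<^sub>E S"
  shows "card {h \<in> I \<rightarrow>\<^sub>E S. restrict h (I - {i}) = restrict g (I - {i})} = card S"
    and "(\<Sum>h\<in>{h \<in> I \<rightarrow>\<^sub>E S. restrict h (I - {i}) = restrict g (I - {i})}. f h) = (\<Sum>x\<in>S. f (g(i := x)) :: 'b :: comm_monoid_add)"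
proof -
  have bij: "bij_betw (\<lambda>x. g(i := x)) S {h \<in> I \<rightarrow>\<^sub>E S. restrict h (I - {i}) = restrict g (I - {i})}"
  proof (rule bij_betwI[where g = "\<lambda>h. h i"])
    show "(\<lambda>x. g(i := x)) \<in> S \<rightarrow> {h \<in> I \<rightarrow>\<^sub>E S. restrict h (I - {i}) = restrict g (I - {i})}"
    proof
      fix x assume x: "x \<in> S"
      have "g(i := x) \<in> I \<rightarrow>\<^sub>E S" using assms x by (auto simp: PiE_iff extensional_def)
      moreover have "restrict (g(i := x)) (I - {i}) = restrict g (I - {i})" by (rule restrict_ext) auto
      ultimately show "g(i := x) \<in> {h \<in> I \<rightarrow>\<^sub>E S. restrict h (I - {i}) = restrict g (I - {i})}" by blast
    qed
    show "(\<lambda>h. h i) \<in> {h \<in> I \<rightarrow>\<^sub>E S. restrict h (I - {i}) = restrict g (I - {i})} \<rightarrow> S" using assms(1) by auto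
    show "g(i := h i) = h" if h: "h \<in> {h \<in> I \<rightarrow>\<^sub>E S. restrict h (I - {i}) = restrict g (I - {i})}" for h
    proof
      fix j
      show "(g(i := h i)) j = h j"
      proof (cases "j \<in> I - {i}")
        case True
        have "restrict h (I - {i}) j = restrict g (I - {i}) j" using h by simp
        then show ?thesis using True by simp
      next
        case False
        then have "j = i \<or> j \<notin> I" by blast
        then show ?thesis
        proof
          assume "j \<notin> I"
          then have "h j = undefined" "g j = undefined" "j \<noteq> i" using h assms by (auto intro: PiE_arb)
          then show ?thesis by simp
        qed simp
      qed
    qed
  qed simp
  show "card {h \<in> I \<rightarrow>\<^sub>E S. restrict h (I - {i}) = restrict g (I - {i})} = card S"
    using bij_betw_same_card[OF bij] by simp
  show "(\<Sum>h\<in>{h \<in> I \<rightarrow>\<^sub>E S. restrict h (I - {i}) = restrict g (I - {i})}. f h) = (\<Sum>x\<in>S. f (g(i := x)))"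
    by (rule sum.reindex_bij_betw[OF bij, symmetric])
qed

locale puzzle =
  fixes l \<kappa> :: nat and k :: bitstr
  assumes l: "prime l" and k: "length k = \<kappa>" and m2: "2 \<le> fold_len l"
begin

abbreviation "m \<equiv> fold_len l"
abbreviation "N \<equiv> block_count l"
abbreviation "\<Sigma> \<equiv> symbols (fold_len l) l"
abbreviation "C \<equiv> folded_code l"
abbreviation "nq \<equiv> \<kappa> + l * l + l + 2"
abbreviation "na \<equiv> 2 * l + 6"

lemma l0: "l > 0"
  using l prime_gt_0_nat by blast

sublocale code_sampling "block_count l" "error_weight l" "symbols (fold_len l) l" "\<lambda>j\<in>{..<fold_len l}. 0" "sym_char (fold_len l) l"
    "sym_add (fold_len l) l" "folded_code l" "mark_phase l" "mark_prob l"
  by (rule folded_code_sampling[OF l])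

lemma code_closed:
  assumes "a \<in> C" "c \<in> C"
  shows "shift a c \<in> C"
proof -
  obtain f g where f: "degree f < code_dim l" "a = fold_word l (mod_fun l f)"
    and g: "degree g < code_dim l" "c = fold_word l (mod_fun l g)"
    using assms by (auto simp: folded_code_def code_words_def)
  have "mod_fun l (g + f) \<in> code_words l" using f(1) g(1) by (auto simp: code_words_def intro: degree_add_less)
  moreover have "shift a c = fold_word l (mod_fun l (g + f))"
  proof -
    have e: "(mod_fun l g x + mod_fun l f x) mod l = mod_fun l (g + f) x" if "x < l" for x
    proof -
      have "int ((mod_fun l g x + mod_fun l f x) mod l) = int (mod_fun l (g + f) x)"
        using that l0 by (simp add: mod_fun_def zmod_int mod_add_eq)
      then show ?thesis by simp
    qed
    show ?thesis
      unfolding shift_def fold_word_def f(2) g(2) sym_add_def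
      by (intro restrict_ext) (simp add: e code_index_less[OF l])
  qed
  ultimately show ?thesis by (simp add: folded_code_def)
qed

lemma C_sub: "C \<subseteq> G"
  using fold_word_in[OF l] by (auto simp: folded_code_def G_def)

lemma code_shift_bij:
  assumes a: "a \<in> C"
  shows "bij_betw (shift a) C C"
proof -
  have aG: "a i \<in> \<Sigma>" if "i < N" for i using a C_sub G_mem that by blast
  have "inj_on (shift a) C"
  proof (rule inj_onI)
    fix c d assume cd: "c \<in> C" "d \<in> C" "shift a c = shift a d"
    then have cdG: "c \<in> G" "d \<in> G" using C_sub by auto
    have "c i = d i" if i: "i < N" for i
    proof -
      have "sym_add m l (c i) (a i) = sym_add m l (d i) (a i)" using fun_cong[OF cd(3), of i] i by (simp add: shift_def)
      then show ?thesis using sym_add_bij(2)[OF l0 aG[OF i]] G_mem[OF cdG(1) i] G_mem[OF cdG(2) i]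
        by (auto simp: bij_betw_def dest: inj_onD)
    qed
    then show "c = d" using cdG unfolding G_def by (intro PiE_ext) auto
  qed
  moreover have "shift a ` C \<subseteq> C" using code_closed a by blast
  ultimately show ?thesis using finC by (simp add: bij_betw_def card_image card_subset_eq)
qed

lemma char_unit: "cmod (char e g) = 1"
  by (simp add: char_def prod_norm[symmetric] sym_char_unit)

lemma error_weight_le: "2 * error_weight l * m \<le> code_dim l"
proof -
  have "2 * error_weight l * m \<le> m ^ 2 * m" unfolding error_weight_def by (intro mult_right_mono) auto
  then show ?thesis by (simp add: code_dim_def eval_nat_numeral)
qed

text \<open>Together the two errors touch at most \<open>code_dim l\<close> field elements. A
  polynomial can vanish on all of these except one at which the errors differ, so both characters
  depend on that element alone. This is the minimum distance of the dual code in disguise.\<close>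

lemma separating_code_word:
  assumes e: "e \<in> errors" "e' \<in> errors" "e \<noteq> e'"
  shows "\<exists>a\<in>C. char e a \<noteq> char e' a"
proof -
  have eG: "e \<in> G" "e' \<in> G" using e errors_sub by auto
  obtain i0 where i0: "i0 < N" "e i0 \<noteq> e' i0" using e(3) eG unfolding G_def by (metis PiE_ext lessThan_iff)
  then obtain j0 where j0: "j0 < m" "e i0 j0 \<noteq> e' i0 j0"
    using symbols_eqI[OF G_mem[OF eG(1) i0(1)] G_mem[OF eG(2) i0(1)]] by blast
  let ?z = "\<lambda>j\<in>{..<m}. 0 :: nat"
  define J where "J = {i. i < N \<and> e i \<noteq> ?z} \<union> {i. i < N \<and> e' i \<noteq> ?z}"
  define X where "X = (\<lambda>(i, j). i * m + j) ` (J \<times> {..<m})"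
  have finJ: "finite J" by (simp add: J_def)
  have "card J \<le> weight e + weight e'" unfolding J_def weight_def by (rule card_Un_le)
  also have "\<dots> \<le> 2 * error_weight l" using e by (auto simp: errors_def)
  finally have cJ: "card J \<le> 2 * error_weight l" .
  have "card X \<le> card (J \<times> {..<m})" unfolding X_def using finJ by (intro card_image_le) auto
  also have "\<dots> \<le> 2 * error_weight l * m" using cJ by (simp add: card_cartesian_product)
  also have "\<dots> \<le> code_dim l" by (rule error_weight_le)
  finally have cX: "card X \<le> code_dim l" .
  have Xl: "X \<subseteq> {..<l}" using code_index_less[OF l] by (auto simp: X_def J_def)
  have i0J: "i0 \<in> J" using i0 by (auto simp: J_def)
  let ?x0 = "i0 * m + j0"
  have x0: "?x0 \<in> X" using i0J j0 by (auto simp: X_def)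
  obtain f :: "int poly" where f: "degree f < code_dim l" "\<And>x. x \<in> X - {?x0} \<Longrightarrow> poly f (int x) = 0" "\<not> int l dvd poly f (int ?x0)"
    using lagrange_mod_prime[OF l Xl x0 cX] by blast
  define a where "a = fold_word l (mod_fun l f)"
  define r where "r = mod_fun l f ?x0"
  have aC: "a \<in> C" using f(1) by (auto simp: a_def folded_code_def code_words_def)
  have a0: "a i j = (if i = i0 \<and> j = j0 then r else 0)" if ij: "i \<in> J" "j < m" for i j
  proof -
    have iN: "i < N" using ij by (auto simp: J_def)
    have eq: "i * m + j = ?x0 \<longleftrightarrow> i = i0 \<and> j = j0"
    proof
      assume h: "i * m + j = ?x0"
      have "(i * m + j) div m = i" "(i0 * m + j0) div m = i0" using ij j0(1) by simp_all
      then have "i = i0" using h by metis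
      then show "i = i0 \<and> j = j0" using h by simp
    qed simp
    have xX: "i * m + j \<in> X" using ij by (auto simp: X_def)
    have "a i j = mod_fun l f (i * m + j)" using iN ij by (simp add: a_def fold_word_def)
    also have "\<dots> = (if i = i0 \<and> j = j0 then r else 0)"
    proof (cases "i = i0 \<and> j = j0")
      case False
      then have "poly f (int (i * m + j)) = 0" using f(2)[of "i * m + j"] xX eq by blast
      then have "mod_fun l f (i * m + j) = 0" using code_index_less[OF l iN ij(2)] by (simp add: mod_fun_def)
      then show ?thesis using False by auto
    qed (simp add: r_def)
    finally show ?thesis .
  qed
  have r: "\<not> l dvd r"
  proof
    assume "l dvd r"
    moreover have "?x0 < l" using Xl x0 by auto
    ultimately have "int l dvd poly f (int ?x0) mod int l"
      using l0 by (simp add: r_def mod_fun_def flip: int_dvd_int_iff)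
    then show False using f(3) by (simp add: dvd_mod_iff)
  qed
  have char_a: "char x a = root_char l (x i0 j0 * r)" if x: "x \<in> G" "\<And>i. i < N \<Longrightarrow> i \<notin> J \<Longrightarrow> x i = ?z" for x
  proof -
    have "char x a = (\<Prod>i<N. if i = i0 then root_char l (x i0 j0 * r) else 1)"
      unfolding char_def
    proof (intro prod.cong refl)
      fix i assume "i \<in> {..<N}"
      then have iN: "i < N" by simp
      show "sym_char m l (x i) (a i) = (if i = i0 then root_char l (x i0 j0 * r) else 1)"
      proof (cases "i \<in> J")
        case True
        have "sym_char m l (x i) (a i) = (\<Prod>j<m. if j = j0 then (if i = i0 then root_char l (x i0 j0 * r) else 1) else 1)"
          unfolding sym_char_def using a0[OF True] by (intro prod.cong refl) auto
        then show ?thesis using j0(1) by (simp add: prod.delta)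
      next
        case False
        then show ?thesis using x(2)[OF iN False] i0J by (auto simp: sym_char_def)
      qed
    qed
    then show ?thesis using i0(1) by (simp add: prod.delta)
  qed
  have "char e a = root_char l (e i0 j0 * r)" "char e' a = root_char l (e' i0 j0 * r)"
    using eG by (auto intro!: char_a simp: J_def)
  moreover have "root_char l (e i0 j0 * r) \<noteq> root_char l (e' i0 j0 * r)"
  proof
    assume "root_char l (e i0 j0 * r) = root_char l (e' i0 j0 * r)"
    then have "int (e i0 j0 * r) mod int l = int (e' i0 j0 * r) mod int l"
      by (simp only: root_char_eq[OF l0] zmod_int[symmetric])
    then have "int l dvd (int (e i0 j0) - int (e' i0 j0)) * int r" by (simp add: mod_eq_dvd_iff left_diff_distrib)
    then have "int l dvd int (e i0 j0) - int (e' i0 j0)"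
      using r l prime_dvd_mult_iff[of "int l"] by (auto simp: int_dvd_int_iff)
    moreover have "e i0 j0 < l" "e' i0 j0 < l"
      using symbols_mem[OF G_mem[OF eG(1) i0(1)] j0(1)] symbols_mem[OF G_mem[OF eG(2) i0(1)] j0(1)] by auto
    then have "\<bar>int (e i0 j0) - int (e' i0 j0)\<bar> < int l" by linarith
    ultimately have "int (e i0 j0) - int (e' i0 j0) = 0" by (metis dvd_imp_le_int abs_of_nat not_less)
    then show False using j0(2) by simp
  qed
  ultimately show ?thesis using aC by metis
qed

text \<open>Translation by a separating code word maps the code to itself and multiplies the sum by
  a factor other than one. So characters of light errors stay orthogonal on the code, which makes
  \<open>out_vec\<close> an orthonormal target.\<close>

lemma code_dual_orth:
  assumes e: "e \<in> errors" "e' \<in> errors"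
  shows "(\<Sum>c\<in>C. cnj (char e c) * char e' c) = (if e = e' then of_nat (card C) else 0)"
proof (cases "e = e'")
  case True
  then show ?thesis using unit_cnj[OF char_unit] by simp
next
  case False
  obtain a where a: "a \<in> C" "char e a \<noteq> char e' a" using separating_code_word[OF e False] by blast
  have eG: "e \<in> G" "e' \<in> G" using e errors_sub by auto
  have "(\<Sum>c\<in>C. cnj (char e c) * char e' c) = 0"
  proof (rule sum_zero_by_translation[OF code_shift_bij[OF a(1)]])
    show "cnj (char e (shift a c)) * char e' (shift a c) = (cnj (char e a) * char e' a) * (cnj (char e c) * char e' c)" if "c \<in> C" for c
    proof -
      have ac: "a \<in> G" "c \<in> G" using a(1) that C_sub by auto
      show ?thesis unfolding char_shift[OF eG(1) ac] char_shift[OF eG(2) ac] by simp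
    qed
    show "cnj (char e a) * char e' a \<noteq> 1" using a(2) by (simp add: unit_cnj_eq_1[OF char_unit])
  qed
  then show ?thesis using False by simp
qed

definition point :: "nat \<Rightarrow> (nat \<Rightarrow> nat) \<Rightarrow> bitstr" where
  "point i \<sigma> = block_point l k i (map \<sigma> [0..<m])"

definition marks :: "oracle_fn \<Rightarrow> nat \<Rightarrow> (nat \<Rightarrow> nat) \<Rightarrow> bool" where
  "marks H i \<sigma> = marked l (H (point i \<sigma>))"

lemma symbols_le: "\<sigma> \<in> \<Sigma> \<Longrightarrow> \<forall>v\<in>set (map \<sigma> [0..<m]). v \<le> l"
  using symbols_mem[of \<sigma> m l] by (auto simp: less_imp_le)

lemma point_in: "i < N \<Longrightarrow> \<sigma> \<in> \<Sigma> \<Longrightarrow> point i \<sigma> \<in> bitstrs nq"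
  unfolding point_def using k l0 block_count_le[OF l]
  by (intro block_point_in symbols_le) auto

lemma point_inj:
  assumes "i < N" "i' < N" "\<sigma> \<in> \<Sigma>" "\<sigma>' \<in> \<Sigma>" "point i \<sigma> = point i' \<sigma>'"
  shows "i = i' \<and> \<sigma> = \<sigma>'"
proof -
  have "k = k \<and> i = i' \<and> map \<sigma> [0..<m] = map \<sigma>' [0..<m]"
    using assms block_count_le[OF l] unfolding point_def
    by (intro block_point_inject[of k k i l] symbols_le) auto
  then show ?thesis using symbols_eqI[OF assms(3,4)] by auto
qed

definition out_vec :: "(nat \<Rightarrow> nat \<Rightarrow> nat) \<Rightarrow> (nat \<Rightarrow> nat \<Rightarrow> nat) \<Rightarrow> complex" where
  "out_vec e g = of_bool (g \<in> C) * char e g / complex_of_real (sqrt (real (card C)))"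

definition others :: "nat \<Rightarrow> (nat \<Rightarrow> nat \<Rightarrow> nat) \<Rightarrow> nat \<Rightarrow> nat \<Rightarrow> nat" where
  "others i g = restrict g ({..<N} - {i})"

sublocale smp: sampler nq na N "card \<Sigma>" G "\<lambda>i g. point i (g i)" "marked l" "mark_phase l" others errors "\<lambda>e g. char e g / nrm" out_vec
proof
  show "finite G" "G \<noteq> {}" by (rule finG)+
  show "0 < N" by (simp add: block_count_def)
  show "point i (g i) \<in> bitstrs nq \<and> point i (g i) \<noteq> replicate nq False" if "i < N" "g \<in> G" for i g
  proof -
    have "hd (point i (g i)) = True" by (simp add: point_def block_point_def)
    moreover have "hd (replicate nq False) = False" by simp
    ultimately show ?thesis using point_in[OF that(1) G_mem[OF that(2,1)]] by metis
  qed
  show "cnj (mark_phase l) * mark_phase l = 1" by (rule unit_cnj[OF mark_phase(1)])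
  show "card \<Sigma> > 0" by (rule card_pos)
  show "card {g' \<in> G. others i g' = others i g} = card \<Sigma>" if "i < N" "g \<in> G" for i g
    using that card_PiE_fiber(1)[of i "{..<N}" g \<Sigma>] unfolding G_def others_def by blast
  show "finite errors" by (rule errors_sub)
  show "(\<Sum>g\<in>G. cnj (char e g / nrm) * (char e' g / nrm)) = of_bool (e = e')" if "e \<in> errors" "e' \<in> errors" for e e'
  proof -
    have "(\<Sum>g\<in>G. cnj (char e g / nrm) * (char e' g / nrm)) = (\<Sum>g\<in>G. cnj (char e g) * char e' g) / of_nat (card G)"
      unfolding sum_divide_distrib by (intro sum.cong refl) (simp add: nrm_sq)
    also have "\<dots> = of_bool (e = e')" using that errors_sub card_pos(2) by (subst char_orth) auto
    finally show ?thesis .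
  qed
  show "(\<Sum>g\<in>G. cnj (out_vec e g) * out_vec e' g) = of_bool (e = e')" if "e \<in> errors" "e' \<in> errors" for e e'
  proof -
    have "(\<Sum>g\<in>G. cnj (out_vec e g) * out_vec e' g) = (\<Sum>g\<in>C. cnj (char e g) * char e' g / of_nat (card C))"
      using finG(1) C_sub by (intro sum.mono_neutral_cong_right) (auto simp: out_vec_def csqrt_sq)
    also have "\<dots> = of_bool (e = e')" unfolding sum_divide_distrib[symmetric] code_dual_orth[OF that] using card_pos(3) by simp
    finally show ?thesis .
  qed
qed

text \<open>After \<open>n\<close> rounds the first \<open>n\<close> blocks carry their amplitudes
  and the others are still uniform. In the next round the marked wave therefore varies over a class
  through the phase alone, and the class average reduces to the marked fraction of that
  block.\<close>

lemma wave_eq: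
  assumes "g \<in> G"
  shows "n \<le> N \<Longrightarrow> smp.wave H n g = (\<Prod>i<n. amp (marks H) i (g i)) / nrm"
  using assms
proof (induction n arbitrary: g)
  case 0
  then show ?case by (simp add: nrm_def)
next
  case (Suc n)
  then have n: "n < N" by simp
  define Pn where "Pn = (\<Prod>i<n. amp (marks H) i (g i)) / nrm"
  define c where "c \<sigma> = (if marks H n \<sigma> then mark_phase l else 1)" for \<sigma>
  have step: "smp.mark_step H n (smp.wave H n) (g(n := \<sigma>)) = c \<sigma> * Pn" if \<sigma>: "\<sigma> \<in> \<Sigma>" for \<sigma>
  proof -
    have "g(n := \<sigma>) \<in> G" unfolding G_def
    proof (rule PiE_I)
      show "(g(n := \<sigma>)) x \<in> \<Sigma>" if "x \<in> {..<N}" for x using that \<sigma> G_mem[OF Suc.prems(2)] by simp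
      show "(g(n := \<sigma>)) x = undefined" if "x \<notin> {..<N}" for x
      proof -
        have "x \<noteq> n" using that n by auto
        then show ?thesis using PiE_arb[OF Suc.prems(2)[unfolded G_def] that] by simp
      qed
    qed
    then have "smp.wave H n (g(n := \<sigma>)) = (\<Prod>i<n. amp (marks H) i ((g(n := \<sigma>)) i)) / nrm"
      by (rule Suc.IH[OF less_imp_le[OF n]])
    also have "\<dots> = Pn" unfolding Pn_def by (intro arg_cong2[where f = "(/)"] prod.cong refl) auto
    finally have w: "smp.wave H n (g(n := \<sigma>)) = Pn" .
    show ?thesis unfolding smp.mark_step_def w c_def marks_def by simp
  qed
  have gn: "g n \<in> \<Sigma>" using G_mem[OF Suc.prems(2) n] .
  have sum_c: "(\<Sum>\<sigma>\<in>\<Sigma>. c \<sigma>) = of_nat (card \<Sigma>) * (1 + (mark_phase l - 1) * of_real (mark_frac (marks H) n))"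
  proof -
    have "c \<sigma> = 1 + (mark_phase l - 1) * of_real (of_bool (marks H n \<sigma>))" for \<sigma> by (simp add: c_def)
    then have "(\<Sum>\<sigma>\<in>\<Sigma>. c \<sigma>) = of_nat (card \<Sigma>) + (mark_phase l - 1) * of_real (\<Sum>\<sigma>\<in>\<Sigma>. of_bool (marks H n \<sigma>))"
      by (simp only: sum.distrib sum_distrib_left of_real_sum sum_constant mult_1_right)
    also have "(\<Sum>\<sigma>\<in>\<Sigma>. of_bool (marks H n \<sigma>)) = real (card \<Sigma>) * mark_frac (marks H) n"
      using card_pos(1) by (simp add: mark_frac_def avg_def)
    finally show ?thesis by (simp add: algebra_simps)
  qed
  have "smp.wave H (Suc n) g = c (g n) * Pn + (mark_phase l - 1) * ((\<Sum>\<sigma>\<in>\<Sigma>. c \<sigma> * Pn) / of_nat (card \<Sigma>))"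
  proof -
    have "(\<Sum>g'\<in>{g' \<in> G. others n g' = others n g}. smp.mark_step H n (smp.wave H n) g')
       = (\<Sum>\<sigma>\<in>\<Sigma>. c \<sigma> * Pn)"
      using card_PiE_fiber(2)[of n "{..<N}" g \<Sigma> "smp.mark_step H n (smp.wave H n)"] n Suc.prems(2) step
      unfolding G_def others_def by simp
    moreover have "smp.mark_step H n (smp.wave H n) g = c (g n) * Pn" using step[OF gn] by simp
    ultimately show ?thesis by (simp only: smp.wave.simps smp.diffuse_def)
  qed
  also have "\<dots> = Pn * (c (g n) + (mark_phase l - 1) * (1 + (mark_phase l - 1) * of_real (mark_frac (marks H) n)))"
  proof -
    define X where "X = 1 + (mark_phase l - 1) * complex_of_real (mark_frac (marks H) n)"
    have "(\<Sum>\<sigma>\<in>\<Sigma>. c \<sigma> * Pn) / of_nat (card \<Sigma>) = X * Pn"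
      unfolding sum_distrib_right[symmetric] sum_c X_def[symmetric] using card_pos(1) by simp
    then show ?thesis unfolding X_def[symmetric] by (simp add: algebra_simps)
  qed
  also have "c (g n) + (mark_phase l - 1) * (1 + (mark_phase l - 1) * of_real (mark_frac (marks H) n)) = amp (marks H) n (g n)"
  proof -
    have pp: "mark_prob l \<noteq> 0" using mark_prob_bounds[of l] by linarith
    have u: "mark_phase l * cnj (mark_phase l) = 1" using unit_cnj[OF mark_phase(1), of l] by (simp add: mult.commute)
    \<comment> \<open>On the unit circle, \<alpha> * cnj (\<alpha> - 1) = - (\<alpha> - 1), so the
      known modulus of \<alpha> - 1 yields its square.\<close>
    have "(mark_phase l - 1) * cnj (mark_phase l - 1) = of_real (1 / mark_prob l)"
      using cmod_sq[of "mark_phase l - 1"] mark_phase(2) by simp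
    then have "mark_phase l * ((mark_phase l - 1) * cnj (mark_phase l - 1)) = mark_phase l * of_real (1 / mark_prob l)" by simp
    moreover have "mark_phase l * ((mark_phase l - 1) * cnj (mark_phase l - 1)) = (mark_phase l - 1) * (mark_phase l * cnj (mark_phase l) - mark_phase l)"
      by (simp add: algebra_simps)
    ultimately have sq: "(mark_phase l - 1) * (mark_phase l - 1) = - (mark_phase l * of_real (1 / mark_prob l))"
      unfolding u by (simp add: algebra_simps)
    have "c (g n) + (mark_phase l - 1) * (1 + (mark_phase l - 1) * of_real (mark_frac (marks H) n))
      = 1 + (mark_phase l - 1) * of_bool (marks H n (g n)) + (mark_phase l - 1) + ((mark_phase l - 1) * (mark_phase l - 1)) * of_real (mark_frac (marks H) n)"
      by (simp add: c_def algebra_simps)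
    also have "\<dots> = amp (marks H) n (g n)" unfolding sq amp_def by (simp add: algebra_simps)
    finally show ?thesis .
  qed
  finally show ?case by (simp add: Pn_def)
qed

lemma project_wave:
  assumes c: "c \<in> C"
  shows "smp.project (smp.wave H N) c = out_amp (marks H) c"
proof -
  have "(\<Sum>g'\<in>G. cnj (char e g' / nrm) * smp.wave H N g') = fourier (state (marks H)) e" for e
    unfolding fourier_def by (intro sum.cong refl) (simp add: wave_eq state_def nrm_sq)
  then show ?thesis unfolding smp.project_def out_amp_def using c by (simp add: out_vec_def)
qed

definition decode :: "(nat \<Rightarrow> nat \<Rightarrow> nat) \<Rightarrow> bitstr" where
  "decode c = (SOME z. z \<in> bitstrs (l * l + 1) \<and> (\<forall>i<N. code_block l (code_value l z) i = map (c i) [0..<m]))"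

lemma decode:
  assumes "c \<in> C"
  shows "decode c \<in> bitstrs (l * l + 1)" "\<And>i. i < N \<Longrightarrow> code_block l (code_value l (decode c)) i = map (c i) [0..<m]"
proof -
  obtain f where f: "degree f < code_dim l" "c = fold_word l (mod_fun l f)"
    using assms by (auto simp: folded_code_def code_words_def)
  obtain z where z: "z \<in> bitstrs (l * l + 1)" "\<And>x. x < l \<Longrightarrow> code_value l z x = mod_fun l f x"
    using code_value_surj[OF l f(1)] by blast
  have "code_block l (code_value l z) i = map (c i) [0..<m]" if "i < N" for i
    using z(2) code_index_less[OF l that] that by (auto simp: code_block_def f(2) fold_word_def)
  then have "\<exists>z. z \<in> bitstrs (l * l + 1) \<and> (\<forall>i<N. code_block l (code_value l z) i = map (c i) [0..<m])" using z(1) by blast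
  from someI_ex[OF this] show "decode c \<in> bitstrs (l * l + 1)"
    "\<And>i. i < N \<Longrightarrow> code_block l (code_value l (decode c)) i = map (c i) [0..<m]"
    unfolding decode_def by auto
qed

text \<open>A puzzle solution \<open>z\<close> inverts every \<open>y\<close> of length
  \<open>l\<close>, as \<open>y @ z\<close> hashes to \<open>y\<close>; so it suffices to measure a
  code word with all blocks marked.\<close>

lemma inverter_success:
  assumes H: "H \<in> oracles nq na" and y: "y \<in> bitstrs l"
  shows "success (marks H) \<le> output_prob nq na H (smp.sampling_alg (\<lambda>c. y @ decode c))
    (\<lambda>x. x \<in> bitstrs (l * l + l + 1) \<and> y = trapdoor_hash l H k x)"
proof -
  let ?Pr = "\<lambda>x. x \<in> bitstrs (l * l + l + 1) \<and> y = trapdoor_hash l H k x"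
  have good: "?Pr (y @ decode c)" if c: "c \<in> C" "\<forall>i<N. marks H i (c i)" for c
  proof -
    have "solves l H k (decode c)"
      using c(2) l decode(2)[OF c(1)] by (auto simp: solves_def marks_def point_def)
    then show ?thesis using y decode(1)[OF c(1)] by (simp add: trapdoor_hash_def bitstrs_def)
  qed
  have "success (marks H) = (\<Sum>c\<in>{c \<in> C. \<forall>i<N. marks H i (c i)}. (cmod (smp.project (smp.wave H N) c))\<^sup>2)"
    unfolding success_def by (intro sum.cong refl) (simp add: project_wave)
  also have "\<dots> \<le> (\<Sum>c\<in>{c \<in> G. ?Pr (y @ decode c)}. (cmod (smp.project (smp.wave H N) c))\<^sup>2)"
    using finG(1) C_sub good by (intro sum_mono2) auto
  also have "\<dots> \<le> output_prob nq na H (smp.sampling_alg (\<lambda>c. y @ decode c)) ?Pr"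
    by (rule smp.sampling_alg_output[OF H])
  finally show ?thesis .
qed

end

section \<open>Averaging over the random oracle\<close>

lemma (in code_sampling) success_cong:
  assumes A: "\<And>i \<sigma>. i < N \<Longrightarrow> \<sigma> \<in> \<Sigma> \<Longrightarrow> A i \<sigma> = A' i \<sigma>"
  shows "success A = success A'"
proof -
  have fr: "mark_frac A i = mark_frac A' i" if "i < N" for i
    unfolding mark_frac_def using A[OF that] by (intro avg_cong) simp
  have st: "state A g = state A' g" if "g \<in> G" for g
    unfolding state_def amp_def using fr A G_mem[OF that] by (intro arg_cong2[where f = "(/)"] prod.cong refl) auto
  have "fourier (state A) e = fourier (state A') e" for e
    unfolding fourier_def using st by (intro sum.cong refl) simp
  moreover have "c i \<in> \<Sigma>" if "c \<in> C" "i < N" for c i using C(1) that by auto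
  ultimately show ?thesis unfolding success_def out_amp_def using A by (intro sum.cong Collect_cong) auto
qed

lemma avg_reindex: "bij_betw h S S \<Longrightarrow> avg S (\<lambda>x. f (h x)) = avg S f"
  unfolding avg_def by (simp add: sum.reindex_bij_betw)

lemma avg_marked_point:
  assumes "table n (2 * l + 6) \<tau>" "x \<in> bitstrs n" "\<tau> x = None"
  shows "avg (ext_oracles n (2 * l + 6) \<tau>) (\<lambda>H. of_bool (marked l (H x))) = mark_prob l"
proof -
  have "avg (ext_oracles n (2 * l + 6) \<tau>) (\<lambda>H. of_bool (marked l (H x)))
      = avg (bitstrs (2 * l + 6)) (\<lambda>y. avg (ext_oracles n (2 * l + 6) (\<tau>(x \<mapsto> y))) (\<lambda>H. of_bool (marked l (H x))))"
    by (rule avg_ext_oracles_step[OF assms])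
  also have "\<dots> = avg (bitstrs (2 * l + 6)) (\<lambda>y. of_bool (marked l y))"
  proof (rule avg_cong)
    fix y assume "y \<in> bitstrs (2 * l + 6)"
    then have t: "table n (2 * l + 6) (\<tau>(x \<mapsto> y))" using assms by (intro table_update)
    have "avg (ext_oracles n (2 * l + 6) (\<tau>(x \<mapsto> y))) (\<lambda>H. of_bool (marked l (H x)))
        = avg (ext_oracles n (2 * l + 6) (\<tau>(x \<mapsto> y))) (\<lambda>H. of_bool (marked l y))"
      by (rule avg_cong) (simp add: ext_oracles_def)
    then show "avg (ext_oracles n (2 * l + 6) (\<tau>(x \<mapsto> y))) (\<lambda>H. of_bool (marked l (H x))) = of_bool (marked l y)"
      by (simp only: avg_const[OF finite_ext_oracles ext_oracles_nonempty[OF t]])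
  qed
  finally show ?thesis by (simp add: avg_marked)
qed

lemma avg_marked_pair:
  assumes "x \<in> bitstrs n" "x' \<in> bitstrs n" "x \<noteq> x'"
  shows "avg (oracles n (2 * l + 6)) (\<lambda>H. of_bool (marked l (H x)) * of_bool (marked l (H x'))) = mark_prob l * mark_prob l"
proof -
  let ?F = "\<lambda>H. of_bool (marked l (H x)) * of_bool (marked l (H x')) :: real"
  have "avg (ext_oracles n (2 * l + 6) Map.empty) ?F
      = avg (bitstrs (2 * l + 6)) (\<lambda>y. avg (ext_oracles n (2 * l + 6) (Map.empty(x \<mapsto> y))) ?F)"
    using assms by (intro avg_ext_oracles_step) auto
  also have "\<dots> = avg (bitstrs (2 * l + 6)) (\<lambda>y. of_bool (marked l y) * mark_prob l)"
  proof (rule avg_cong)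
    fix y assume y: "y \<in> bitstrs (2 * l + 6)"
    have t: "table n (2 * l + 6) (Map.empty(x \<mapsto> y))" using assms y by (intro table_update table_empty)
    have "avg (ext_oracles n (2 * l + 6) (Map.empty(x \<mapsto> y))) ?F
        = avg (ext_oracles n (2 * l + 6) (Map.empty(x \<mapsto> y))) (\<lambda>H. of_bool (marked l y) * of_bool (marked l (H x')))"
      by (rule avg_cong) (simp add: ext_oracles_def)
    then show "avg (ext_oracles n (2 * l + 6) (Map.empty(x \<mapsto> y))) ?F = of_bool (marked l y) * mark_prob l"
      using avg_marked_point[OF t assms(2)] assms(3) by (simp add: avg_mult_right del: fun_upd_apply) simp
  qed
  finally show ?thesis by (simp add: avg_mult_left avg_marked)
qed

context puzzle
begin

text \<open>Translating the symbols permutes the block points. Extended to all query points, this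
  permutation acts on the oracles by composition, so the marks of a random oracle are distributed
  like their translates.\<close>

lemma oracle_shift:
  assumes a: "a \<in> G"
  shows "\<exists>\<pi>. bij_betw \<pi> (oracles nq na) (oracles nq na) \<and>
    (\<forall>H\<in>oracles nq na. \<forall>i<N. \<forall>\<sigma>\<in>\<Sigma>. marks (\<pi> H) i \<sigma> = shift_marks (marks H) a i \<sigma>)"
proof -
  let ?I = "{..<N} \<times> \<Sigma>"
  let ?pt = "\<lambda>(i, \<sigma>). point i \<sigma>"
  let ?\<rho> = "\<lambda>(i, \<sigma>). (i, sym_add m l \<sigma> (a i))"
  have inj: "inj_on ?pt ?I" using point_inj by (fastforce simp: inj_on_def)
  have \<rho>: "bij_betw ?\<rho> ?I ?I"
  proof -
    have s: "bij_betw (\<lambda>\<sigma>. sym_add m l \<sigma> (a i)) \<Sigma> \<Sigma>" if "i < N" for i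
      using sym_add_bij(2)[OF l0 G_mem[OF a that]] .
    have "inj_on ?\<rho> ?I" using s by (auto simp: inj_on_def bij_betw_def)
    moreover have "?\<rho> ` ?I \<subseteq> ?I" using s by (auto dest: bij_betwE)
    moreover have "finite ?I" using symbols_finite by simp
    ultimately show ?thesis by (simp add: bij_betw_def card_image card_subset_eq)
  qed
  \<comment> \<open>Block points with genuine symbols are moved; all other queries, hash points
    included, stay fixed.\<close>
  define \<tau> where "\<tau> x = (if x \<in> ?pt ` ?I then ?pt (?\<rho> (the_inv_into ?I ?pt x)) else x)" for x
  have \<tau>_pt: "\<tau> (point i \<sigma>) = point i (sym_add m l \<sigma> (a i))" if "i < N" "\<sigma> \<in> \<Sigma>" for i \<sigma>
  proof -
    have "the_inv_into ?I ?pt (?pt (i, \<sigma>)) = (i, \<sigma>)" using that by (intro the_inv_into_f_f[OF inj]) auto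
    then show ?thesis using that by (auto simp: \<tau>_def)
  qed
  have sym_in: "sym_add m l \<sigma> (a i) \<in> \<Sigma>" if "i < N" "\<sigma> \<in> \<Sigma>" for i \<sigma>
    using sym_add_bij(2)[OF l0 G_mem[OF a that(1)]] that(2) by (rule bij_betw_apply)
  have \<tau>_in: "\<tau> x \<in> bitstrs nq" if "x \<in> bitstrs nq" for x
  proof (cases "x \<in> ?pt ` ?I")
    case True
    then obtain i \<sigma> where x: "i < N" "\<sigma> \<in> \<Sigma>" "x = point i \<sigma>" by auto
    then show ?thesis using \<tau>_pt point_in sym_in by simp
  qed (use that in \<open>simp add: \<tau>_def\<close>)
  have \<tau>_inj: "inj_on \<tau> (bitstrs nq)"
  proof (rule inj_onI)
    fix x y assume xy: "\<tau> x = \<tau> y"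
    have mem: "\<tau> x \<in> ?pt ` ?I \<longleftrightarrow> x \<in> ?pt ` ?I" for x
    proof (cases "x \<in> ?pt ` ?I")
      case True
      then obtain i \<sigma> where x: "i < N" "\<sigma> \<in> \<Sigma>" "x = point i \<sigma>" by auto
      then have "\<tau> x = ?pt (i, sym_add m l \<sigma> (a i))" "(i, sym_add m l \<sigma> (a i)) \<in> ?I" using \<tau>_pt sym_in by auto
      then show ?thesis using True by blast
    qed (auto simp: \<tau>_def)
    show "x = y"
    proof (cases "x \<in> ?pt ` ?I")
      case True
      then have "y \<in> ?pt ` ?I" using mem[of x] mem[of y] xy by simp
      then obtain i \<sigma> i' \<sigma>' where x: "i < N" "\<sigma> \<in> \<Sigma>" "x = point i \<sigma>" and y: "i' < N" "\<sigma>' \<in> \<Sigma>" "y = point i' \<sigma>'"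
        using True by auto
      have "point i (sym_add m l \<sigma> (a i)) = point i' (sym_add m l \<sigma>' (a i'))" using xy \<tau>_pt x y by simp
      then have "i = i' \<and> sym_add m l \<sigma> (a i) = sym_add m l \<sigma>' (a i')"
        by (rule point_inj[OF x(1) y(1) sym_in[OF x(1,2)] sym_in[OF y(1,2)]])
      then have "?\<rho> (i, \<sigma>) = ?\<rho> (i', \<sigma>')" unfolding case_prod_conv prod.inject .
      then have "(i, \<sigma>) = (i', \<sigma>')"
        by (rule inj_onD[OF bij_betw_imp_inj_on[OF \<rho>]]) (use x(1,2) y(1,2) in auto)
      then show ?thesis using x y by simp
    next
      case False
      then have "y \<notin> ?pt ` ?I" using mem[of x] mem[of y] xy by simp
      then show ?thesis using False xy by (simp add: \<tau>_def)
    qed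
  qed
  have surj: "\<tau> ` bitstrs nq = bitstrs nq"
    using \<tau>_in \<tau>_inj by (intro card_subset_eq) (auto simp: card_image)
  define \<pi> where "\<pi> H = (\<lambda>x\<in>bitstrs nq. H (\<tau> x))" for H :: oracle_fn
  have \<pi>_in: "\<pi> H \<in> oracles nq na" if "H \<in> oracles nq na" for H
    using that \<tau>_in by (auto simp: \<pi>_def oracles_def)
  have \<pi>_inj: "inj_on \<pi> (oracles nq na)"
  proof (rule inj_onI)
    fix H H' assume H: "H \<in> oracles nq na" "H' \<in> oracles nq na" "\<pi> H = \<pi> H'"
    have "H x = H' x" if x: "x \<in> bitstrs nq" for x
    proof -
      obtain w where w: "w \<in> bitstrs nq" "x = \<tau> w" using surj x by blast
      then show ?thesis using fun_cong[OF H(3), of w] by (simp add: \<pi>_def)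
    qed
    then show "H = H'" using H(1,2) unfolding oracles_def by (intro PiE_ext) auto
  qed
  have "\<pi> ` oracles nq na = oracles nq na"
    using \<pi>_in by (intro card_subset_eq card_image[OF \<pi>_inj] finite_oracles) blast
  then have "bij_betw \<pi> (oracles nq na) (oracles nq na)" using \<pi>_inj by (simp only: bij_betw_def)
  moreover have "marks (\<pi> H) i \<sigma> = shift_marks (marks H) a i \<sigma>" if "i < N" "\<sigma> \<in> \<Sigma>" for H i \<sigma>
    using that point_in \<tau>_pt by (simp add: marks_def shift_marks_def \<pi>_def)
  ultimately show ?thesis by blast
qed

text \<open>By translation invariance the average over oracles absorbs the average over translations
  in \<open>success_avg_shift\<close>.\<close>

lemma avg_success_ge:
  "avg (oracles nq na) (\<lambda>H. (1 - (\<Sum>i<N. (1 - mark_frac (marks H) i / mark_prob l)\<^sup>2)) / 2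
      - (\<Sum>i<N. mark_frac (marks H) i * (1 - mark_frac (marks H) i) / mark_prob l) / real (error_weight l + 1))
    \<le> avg (oracles nq na) (\<lambda>H. success (marks H))"
proof -
  have eq: "avg (oracles nq na) (\<lambda>H. success (shift_marks (marks H) a)) = avg (oracles nq na) (\<lambda>H. success (marks H))" if a: "a \<in> G" for a
  proof -
    obtain \<pi> where \<pi>: "bij_betw \<pi> (oracles nq na) (oracles nq na)"
      "\<And>H i \<sigma>. H \<in> oracles nq na \<Longrightarrow> i < N \<Longrightarrow> \<sigma> \<in> \<Sigma> \<Longrightarrow> marks (\<pi> H) i \<sigma> = shift_marks (marks H) a i \<sigma>"
      using oracle_shift[OF a] by blast
    have "avg (oracles nq na) (\<lambda>H. success (shift_marks (marks H) a)) = avg (oracles nq na) (\<lambda>H. success (marks (\<pi> H)))"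
      using \<pi>(2) by (intro avg_cong success_cong) simp
    also have "\<dots> = avg (oracles nq na) (\<lambda>H. success (marks H))"
      using \<pi>(1) by (rule avg_reindex[where f = "\<lambda>H. success (marks H)"])
    finally show ?thesis .
  qed
  have "avg (oracles nq na) (\<lambda>H. (1 - (\<Sum>i<N. (1 - mark_frac (marks H) i / mark_prob l)\<^sup>2)) / 2
      - (\<Sum>i<N. mark_frac (marks H) i * (1 - mark_frac (marks H) i) / mark_prob l) / real (error_weight l + 1))
    \<le> avg (oracles nq na) (\<lambda>H. avg G (\<lambda>a. success (shift_marks (marks H) a)))"
    by (intro avg_mono success_avg_shift)
  also have "\<dots> = avg G (\<lambda>a. avg (oracles nq na) (\<lambda>H. success (shift_marks (marks H) a)))" by (rule avg_swap)
  also have "\<dots> = avg G (\<lambda>a. avg (oracles nq na) (\<lambda>H. success (marks H)))" using eq by (rule avg_cong)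
  also have "\<dots> = avg (oracles nq na) (\<lambda>H. success (marks H))" using finG by (rule avg_const)
  finally show ?thesis .
qed

lemma avg_mark_frac:
  assumes i: "i < N"
  shows "avg (oracles nq na) (\<lambda>H. mark_frac (marks H) i) = mark_prob l"
proof -
  have "avg (oracles nq na) (\<lambda>H. mark_frac (marks H) i) = avg \<Sigma> (\<lambda>\<sigma>. avg (oracles nq na) (\<lambda>H. of_bool (marks H i \<sigma>)))"
    unfolding mark_frac_def by (rule avg_swap)
  also have "\<dots> = avg \<Sigma> (\<lambda>\<sigma>. mark_prob l)"
    using avg_marked_point[OF table_empty point_in[OF i]] by (intro avg_cong) (simp add: marks_def)
  also have "\<dots> = mark_prob l" using \<Sigma> by (intro avg_const) auto
  finally show ?thesis .
qed

text \<open>Second moment by pairwise independence: only the diagonal pairs contribute to the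
  variance.\<close>

lemma avg_mark_frac_sq:
  assumes i: "i < N"
  shows "avg (oracles nq na) (\<lambda>H. (mark_frac (marks H) i)\<^sup>2) \<le> (mark_prob l)\<^sup>2 + mark_prob l * (1 - mark_prob l) / real (card \<Sigma>)"
proof -
  let ?p = "mark_prob l" and ?s = "real (card \<Sigma>)"
  have "(mark_frac (marks H) i)\<^sup>2 = avg \<Sigma> (\<lambda>\<sigma>. avg \<Sigma> (\<lambda>\<tau>. of_bool (marks H i \<sigma>) * of_bool (marks H i \<tau>)))" for H
    unfolding avg_mult_right avg_mult_left power2_eq_square mark_frac_def ..
  then have "avg (oracles nq na) (\<lambda>H. (mark_frac (marks H) i)\<^sup>2)
      = avg \<Sigma> (\<lambda>\<sigma>. avg \<Sigma> (\<lambda>\<tau>. avg (oracles nq na) (\<lambda>H. of_bool (marks H i \<sigma>) * of_bool (marks H i \<tau>))))"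
    by (simp only: avg_swap[of "oracles nq na"])
  also have "\<dots> = avg \<Sigma> (\<lambda>\<sigma>. avg \<Sigma> (\<lambda>\<tau>. ?p * ?p + of_bool (\<tau> = \<sigma>) * (?p * (1 - ?p))))"
  proof (intro avg_cong)
    fix \<sigma> \<tau> assume st: "\<sigma> \<in> \<Sigma>" "\<tau> \<in> \<Sigma>"
    show "avg (oracles nq na) (\<lambda>H. of_bool (marks H i \<sigma>) * of_bool (marks H i \<tau>)) = ?p * ?p + of_bool (\<tau> = \<sigma>) * (?p * (1 - ?p))"
    proof (cases "\<tau> = \<sigma>")
      case True
      have "avg (oracles nq na) (\<lambda>H. of_bool (marks H i \<sigma>) * of_bool (marks H i \<tau>)) = avg (oracles nq na) (\<lambda>H. of_bool (marked l (H (point i \<sigma>))))"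
        unfolding True by (rule avg_cong) (simp add: marks_def)
      also have "\<dots> = ?p" using avg_marked_point[OF table_empty point_in[OF i st(1)]] by simp
      finally show ?thesis using True by (simp add: algebra_simps)
    next
      case False
      then have "point i \<sigma> \<noteq> point i \<tau>" using point_inj[OF i i st] by auto
      then show ?thesis using avg_marked_pair[OF point_in[OF i st(1)] point_in[OF i st(2)]] False by (simp add: marks_def)
    qed
  qed
  also have "\<dots> = avg \<Sigma> (\<lambda>\<sigma>. ?p * ?p + 1 / ?s * (?p * (1 - ?p)))"
  proof (rule avg_cong)
    fix \<sigma> assume "\<sigma> \<in> \<Sigma>"
    then have "{x \<in> \<Sigma>. x = \<sigma>} = {\<sigma>}" by auto
    then show "avg \<Sigma> (\<lambda>\<tau>. ?p * ?p + of_bool (\<tau> = \<sigma>) * (?p * (1 - ?p))) = ?p * ?p + 1 / ?s * (?p * (1 - ?p))"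
      unfolding avg_add avg_mult_left using \<Sigma> by (subst avg_const, simp, blast, subst avg_indicator_card) auto
  qed
  also have "\<dots> = ?p * ?p + 1 / ?s * (?p * (1 - ?p))" using \<Sigma> by (intro avg_const) auto
  finally show ?thesis by (simp add: power2_eq_square)
qed

text \<open>The two losses come to at most 1/8 each, which leaves (1 - 1/8) / 2 - 1/8 =
  5/16.\<close>

theorem avg_success_lower_bound: "1 / 4 \<le> avg (oracles nq na) (\<lambda>H. success (marks H))"
proof -
  let ?p = "mark_prob l" and ?s = "real (card \<Sigma>)" and ?O = "oracles nq na" and ?f = "\<lambda>H i. mark_frac (marks H) i"
  have p: "1 / 2 \<le> ?p" "?p < 1" using mark_prob_bounds by auto
  have s0: "?s > 0" using card_pos(1) by simp
  have 1: "avg ?O (\<lambda>H. (1 - ?f H i / ?p)\<^sup>2) \<le> 1 / ?s" if i: "i < N" for i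
  proof -
    have "(1 - ?f H i / ?p)\<^sup>2 = 1 - 2 / ?p * ?f H i + 1 / ?p\<^sup>2 * (?f H i)\<^sup>2" for H
      using p by (simp add: power2_diff power_divide)
    then have "avg ?O (\<lambda>H. (1 - ?f H i / ?p)\<^sup>2) = 1 - 2 / ?p * ?p + 1 / ?p\<^sup>2 * avg ?O (\<lambda>H. (?f H i)\<^sup>2)"
      by (simp only: avg_add avg_diff avg_mult_right avg_mark_frac[OF i] avg_const[OF finite_oracles oracles_nonempty])
    also have "\<dots> \<le> 1 - 2 / ?p * ?p + 1 / ?p\<^sup>2 * (?p\<^sup>2 + ?p * (1 - ?p) / ?s)"
      using avg_mark_frac_sq[OF i] by (intro add_left_mono mult_left_mono) auto
    also have "\<dots> = (1 - ?p) / ?p / ?s" using p s0 by (simp add: field_simps power2_eq_square)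
    also have "\<dots> \<le> 1 / ?s" using p s0 by (intro divide_right_mono) (auto simp: field_simps)
    finally show ?thesis .
  qed
  have 2: "avg ?O (\<lambda>H. ?f H i * (1 - ?f H i) / ?p) \<le> 2 * (1 - ?p)" if i: "i < N" for i
  proof -
    have "avg ?O (\<lambda>H. ?f H i * (1 - ?f H i) / ?p) \<le> avg ?O (\<lambda>H. 2 * (1 - ?f H i))"
    proof (rule avg_mono)
      fix H
      have "?f H i * (1 - ?f H i) / ?p \<le> (1 - ?f H i) / (1 / 2)"
        using p mark_frac_bounds[of "marks H" i] by (intro frac_le mult_left_le_one_le) auto
      then show "?f H i * (1 - ?f H i) / ?p \<le> 2 * (1 - ?f H i)" by simp
    qed
    also have "\<dots> = 2 * (1 - ?p)"
      by (simp only: avg_diff avg_mult_right avg_mark_frac[OF i] avg_const[OF finite_oracles oracles_nonempty])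
    finally show ?thesis .
  qed
  have "avg ?O (\<lambda>H. (1 - (\<Sum>i<N. (1 - ?f H i / ?p)\<^sup>2)) / 2 - (\<Sum>i<N. ?f H i * (1 - ?f H i) / ?p) / real (error_weight l + 1))
      = (1 - (\<Sum>i<N. avg ?O (\<lambda>H. (1 - ?f H i / ?p)\<^sup>2))) / 2 - (\<Sum>i<N. avg ?O (\<lambda>H. ?f H i * (1 - ?f H i) / ?p)) / real (error_weight l + 1)"
    unfolding avg_diff divide_inverse[of _ 2] divide_inverse[of _ "real (error_weight l + 1)"] avg_mult_left avg_sum
    by (simp only: avg_diff avg_sum avg_const[OF finite_oracles oracles_nonempty])
  \<comment> \<open>Fluctuation of the marked fractions: the relative variance per block is at most
    \<open>1 / card \<Sigma>\<close>, and
    \<open>8 * N \<le> m ^ 8 \<le> l \<le> card \<Sigma>\<close>.\<close>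
  moreover have "(\<Sum>i<N. avg ?O (\<lambda>H. (1 - ?f H i / ?p)\<^sup>2)) \<le> 1 / 8"
  proof -
    have "(\<Sum>i<N. avg ?O (\<lambda>H. (1 - ?f H i / ?p)\<^sup>2)) \<le> (\<Sum>i<N. 1 / ?s)" using 1 by (intro sum_mono) auto
    also have "\<dots> = real N / ?s" by simp
    also have "\<dots> \<le> 1 / 8"
    proof -
      have "8 * N \<le> m ^ 8"
      proof -
        have "16 * m ^ 4 \<le> m ^ 4 * m ^ 4" using power_mono[OF m2, of 4] by (intro mult_right_mono) auto
        then show ?thesis by (simp add: block_count_def power_add[symmetric])
      qed
      also have "m ^ 8 \<le> l" using l0 by (rule fold_len_power_le)
      also have "l ^ 1 \<le> l ^ m" using l0 m2 by (intro power_increasing) auto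
      finally have "8 * N \<le> card \<Sigma>" by (simp add: card_symbols)
      then have "real (8 * N) \<le> ?s" by (simp only: of_nat_le_iff)
      then show ?thesis using s0 by (simp add: field_simps)
    qed
    finally show ?thesis .
  qed
  \<comment> \<open>Here the constant 64 enters: the expected error weight is at most 2 * m^4 * 2 /
    (64 * m^2) = m^2 / 16, against a truncation at half of m^2.\<close>
  moreover have "(\<Sum>i<N. avg ?O (\<lambda>H. ?f H i * (1 - ?f H i) / ?p)) / real (error_weight l + 1) \<le> 1 / 8"
  proof -
    have "(\<Sum>i<N. avg ?O (\<lambda>H. ?f H i * (1 - ?f H i) / ?p)) \<le> (\<Sum>i<N. 2 * (1 - ?p))" using 2 by (intro sum_mono) auto
    also have "\<dots> = real N * (2 * (1 - ?p))" by simp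
    also have "\<dots> = real m ^ 2 / 16"
    proof -
      have "2 ^ mark_len l = 64 * real m ^ 2"
        by (simp add: mark_len_def fold_len_def power_add power_mult power2_eq_square power_mult_distrib[symmetric])
      then show ?thesis by (simp add: mark_prob_def block_count_def field_simps eval_nat_numeral)
    qed
    also have "\<dots> \<le> 1 / 8 * real (error_weight l + 1)"
    proof -
      have "a \<le> 2 * (a div 2 + 1)" for a :: nat by presburger
      then have "real (m ^ 2) \<le> real (2 * (m ^ 2 div 2 + 1))" by (simp only: of_nat_le_iff)
      then show ?thesis by (simp add: error_weight_def)
    qed
    finally show ?thesis by (simp add: divide_le_eq)
  qed
  moreover have "1 / 4 \<le> s" if "L = (1 - a) / 2 - b" "a \<le> 1 / 8" "b \<le> 1 / 8" "L \<le> s" for L a b s :: real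
    using that by (simp add: field_simps)
  ultimately show ?thesis using avg_success_ge by blast
qed

definition inverter :: "bitstr \<Rightarrow> qalg" where
  "inverter y = smp.sampling_alg (\<lambda>c. y @ decode c)"

lemma inverter:
  shows "valid_qalg nq na (inverter y)" and "num_queries (inverter y) = 2 * N"
    and "H \<in> oracles nq na \<Longrightarrow> y \<in> bitstrs l \<Longrightarrow> success (marks H) \<le> output_prob nq na H (inverter y)
      (\<lambda>x. x \<in> bitstrs (l * l + l + 1) \<and> y = trapdoor_hash l H k x)"
proof -
  show "valid_qalg nq na (inverter y)" unfolding inverter_def by (rule smp.sampling_alg_valid)
  show "num_queries (inverter y) = 2 * N" unfolding inverter_def smp.sampling_alg_def by simp
  show "H \<in> oracles nq na \<Longrightarrow> y \<in> bitstrs l \<Longrightarrow> success (marks H) \<le> output_prob nq na H (inverter y)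
      (\<lambda>x. x \<in> bitstrs (l * l + l + 1) \<and> y = trapdoor_hash l H k x)"
    unfolding inverter_def by (rule inverter_success)
qed

end

section \<open>Failure of one-wayness against quantum queries\<close>

text \<open>A placeholder for inputs without a puzzle, where one-wayness still asks for a valid
  algorithm with few queries.\<close>

definition idle_alg :: qalg where
  "idle_alg = \<lparr>num_queries = 0, work_dim = 1, unitaries = (\<lambda>_. rotation 1 {} (\<lambda>_ :: unit. \<lambda>_. 0)), postprocess = (\<lambda>_. [])\<rparr>"

lemma idle_alg_valid: "valid_qalg n m idle_alg"
  unfolding valid_qalg_def
  by (auto simp: idle_alg_def qalg_basis_def orthonormal_on_def intro!: rotation_unitary finite_qbasis)

definition hash_inverter :: "(nat \<Rightarrow> nat) \<Rightarrow> nat \<Rightarrow> bitstr \<Rightarrow> bitstr \<Rightarrow> qalg" where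
  "hash_inverter \<kappa> l k y = (if prime l \<and> 2 \<le> fold_len l \<and> length k = \<kappa> l then puzzle.inverter l (\<kappa> l) k y else idle_alg)"

lemma trapdoor_hash_length:
  assumes "H \<in> oracles (\<kappa> + l * l + l + 2) (2 * l + 6)" "length k = \<kappa>" "x \<in> bitstrs (l * l + l + 1)"
  shows "trapdoor_hash l H k x \<in> bitstrs l"
proof -
  have "hash_point k x \<in> bitstrs (\<kappa> + l * l + l + 2)" using assms(2,3) by (simp add: hash_point_def bitstrs_def)
  then have "H (hash_point k x) \<in> bitstrs (2 * l + 6)" using assms(1) by (auto simp: oracles_def)
  then show ?thesis using assms(3) by (simp add: trapdoor_hash_def bitstrs_def)
qed

lemma inversion_prob_avg:
  "inversion_prob (hash_family \<kappa>) l A = avg (oracles (\<kappa> l + l * l + l + 2) (2 * l + 6)) (\<lambda>H. avg (bitstrs (\<kappa> l)) (\<lambda>k. avg (bitstrs (l * l + l + 1)) (\<lambda>x.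
     output_prob (\<kappa> l + l * l + l + 2) (2 * l + 6) H (A k (trapdoor_hash l H k x))
       (\<lambda>x'. x' \<in> bitstrs (l * l + l + 1) \<and> trapdoor_hash l H k x = trapdoor_hash l H k x'))))"
proof -
  have b: "measure_pmf.expectation (pmf_of_set S \<bind> f) h = avg S (\<lambda>x. measure_pmf.expectation (f x) h)"
    if "finite S" "S \<noteq> {}" "\<And>x. x \<in> S \<Longrightarrow> finite (set_pmf (f x))" for S :: "'x set" and f :: "'x \<Rightarrow> 'y pmf" and h :: "'y \<Rightarrow> real"
    using that by (subst pmf_expectation_bind_pmf_of_set) (auto simp: avg_def divide_inverse sum_distrib_left mult.commute)
  have fin: "finite (set_pmf (pmf_of_set S \<bind> f))"
    if "finite S" "S \<noteq> {}" "\<And>x. x \<in> S \<Longrightarrow> finite (set_pmf (f x))" for S :: "'x set" and f :: "'x \<Rightarrow> 'y pmf"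
    using that by (simp add: set_bind_pmf)
  show ?thesis
    unfolding inversion_prob_def
    by (simp add: hash_family_def oracles_of_def b fin)
qed

text \<open>The success bound for a key is the same for every image to be inverted, so the
  distribution of the image never enters.\<close>

lemma inversion_prob_ge:
  assumes l: "prime l" "2 \<le> fold_len l"
  shows "1 / 4 \<le> inversion_prob (hash_family \<kappa>) l (hash_inverter \<kappa> l)"
proof -
  let ?O = "oracles (\<kappa> l + l * l + l + 2) (2 * l + 6)" and ?K = "bitstrs (\<kappa> l)" and ?X = "bitstrs (l * l + l + 1)"
  define S where "S k H = code_sampling.success (block_count l) (error_weight l) (symbols (fold_len l) l) (\<lambda>j\<in>{..<fold_len l}. 0)
    (sym_char (fold_len l) l) (folded_code l) (mark_phase l) (mark_prob l) (puzzle.marks l k H)" for k H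
  have pz: "puzzle l (\<kappa> l) k" if "k \<in> ?K" for k
    using l that by unfold_locales (auto simp: bitstrs_def)
  have "1 / 4 = avg ?K (\<lambda>_. 1 / 4)" by (simp add: avg_const)
  also have "\<dots> \<le> avg ?K (\<lambda>k. avg ?O (S k))"
    unfolding S_def by (intro avg_mono puzzle.avg_success_lower_bound pz)
  also have "\<dots> = avg ?O (\<lambda>H. avg ?K (\<lambda>k. S k H))" by (rule avg_swap)
  also have "\<dots> = avg ?O (\<lambda>H. avg ?K (\<lambda>k. avg ?X (\<lambda>x. S k H)))" by (simp add: avg_const)
  also have "\<dots> \<le> inversion_prob (hash_family \<kappa>) l (hash_inverter \<kappa> l)"
    unfolding inversion_prob_avg
  proof (intro avg_mono)
    fix H k x assume H: "H \<in> ?O" and k: "k \<in> ?K" and x: "x \<in> ?X"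
    have "length k = \<kappa> l" using k by (simp add: bitstrs_def)
    then have "hash_inverter \<kappa> l k y = puzzle.inverter l (\<kappa> l) k y" for y using l by (simp add: hash_inverter_def)
    then show "S k H \<le> output_prob (\<kappa> l + l * l + l + 2) (2 * l + 6) H (hash_inverter \<kappa> l k (trapdoor_hash l H k x))
       (\<lambda>x'. x' \<in> bitstrs (l * l + l + 1) \<and> trapdoor_hash l H k x = trapdoor_hash l H k x')"
      unfolding S_def using puzzle.inverter(3)[OF pz[OF k] H trapdoor_hash_length[OF H \<open>length k = \<kappa> l\<close> x]] by simp
  qed
  finally show ?thesis .
qed

text \<open>A negligible inversion probability would be below \<open>1 / l\<close> for all large
  \<open>l\<close>, contradicting the bound \<open>1 / 4\<close> at large primes, of which there are
  infinitely many.\<close>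

theorem hash_family_not_one_way: "\<not> one_way_QROM (hash_family \<kappa>)"
proof
  assume ow: "one_way_QROM (hash_family \<kappa>)"
  obtain q :: "nat poly" where q: "\<And>l. block_count l \<le> poly q l" using pbounded_block_count by (auto simp: pbounded_def)
  have v: "valid_qalg (\<kappa> l + l * l + l + 2) (2 * l + 6) (hash_inverter \<kappa> l k y) \<and> num_queries (hash_inverter \<kappa> l k y) \<le> poly ([:2:] * q) l" for l k y
  proof (cases "prime l \<and> 2 \<le> fold_len l \<and> length k = \<kappa> l")
    case True
    then interpret puzzle l "\<kappa> l" k by unfold_locales auto
    show ?thesis using True inverter q[of l] by (simp add: hash_inverter_def)
  next
    case False
    have "hash_inverter \<kappa> l k y = idle_alg" unfolding hash_inverter_def by (rule if_not_P[OF False])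
    moreover have "num_queries idle_alg = 0" by (simp add: idle_alg_def)
    ultimately show ?thesis using idle_alg_valid by simp
  qed
  have "negl (\<lambda>l. inversion_prob (hash_family \<kappa>) l (hash_inverter \<kappa> l))"
  proof (rule ow[unfolded one_way_QROM_def, THEN spec, THEN spec, THEN mp, of "hash_inverter \<kappa>" "[:2:] * q"])
    show "\<forall>l. \<forall>k\<in>bitstrs (key_len (hash_family \<kappa>) l). \<forall>y\<in>bitstrs (out_len (hash_family \<kappa>) l).
        valid_qalg (query_len (hash_family \<kappa>) l) (answer_len (hash_family \<kappa>) l) (hash_inverter \<kappa> l k y) \<and>
        num_queries (hash_inverter \<kappa> l k y) \<le> poly ([:2:] * q) l"
      unfolding hash_family_def function_family.simps using v by blast
  qed
  then have "\<forall>\<^sub>F l in sequentially. \<bar>inversion_prob (hash_family \<kappa>) l (hash_inverter \<kappa> l)\<bar> < 1 / real l ^ 1"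
    unfolding negl_def by blast
  moreover have "\<forall>\<^sub>F l in sequentially. 2 \<le> fold_len l" using filterlim_fold_len by (simp add: filterlim_at_top)
  moreover have "\<forall>\<^sub>F l :: nat in sequentially. 4 \<le> l" by (rule eventually_ge_at_top)
  ultimately have "\<forall>\<^sub>F l in sequentially. \<not> prime (l :: nat)"
  proof eventually_elim
    case (elim l)
    show ?case
    proof
      assume "prime l"
      then have "1 / 4 \<le> inversion_prob (hash_family \<kappa>) l (hash_inverter \<kappa> l)"
        using elim by (intro inversion_prob_ge)
      also have "\<dots> \<le> \<bar>inversion_prob (hash_family \<kappa>) l (hash_inverter \<kappa> l)\<bar>" by (rule abs_ge_self)
      also have "\<dots> < 1 / real l ^ 1" by (rule elim)
      also have "\<dots> \<le> 1 / 4" using elim by (intro frac_le) auto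
      finally show False by simp
    qed
  qed
  then obtain n where "\<And>l :: nat. l \<ge> n \<Longrightarrow> \<not> prime l" by (auto simp: eventually_sequentially)
  moreover obtain l :: nat where "prime l" "l > n" using bigger_prime by blast
  ultimately show False by (meson less_imp_le)
qed

section \<open>Polynomial running time on the oracle machine\<close>

section \<open>Programming the oracle machine\<close>

text \<open>Time enters as an upper bound, so that running times can be padded to polynomials in one
  common bound \<open>B\<close> and branches of different length agree.\<close>

definition runs :: "bitstr set \<Rightarrow> oracle_fn \<Rightarrow> prog \<Rightarrow> (nat \<Rightarrow> bitstr) \<Rightarrow> nat \<Rightarrow> (nat \<Rightarrow> bitstr) \<Rightarrow> bool" where
  "runs D H c s t s' \<longleftrightarrow> (\<exists>t'\<le>t. exec D H c s t' s')"

abbreviation unary :: "nat \<Rightarrow> bitstr" where "unary a \<equiv> replicate a True"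

lemma runs_mono: "runs D H c s t s' \<Longrightarrow> t \<le> u \<Longrightarrow> runs D H c s u s'"
  unfolding runs_def by (meson order_trans)

lemma runs_eq: "runs D H c s t s'' \<Longrightarrow> s'' = s' \<Longrightarrow> t \<le> u \<Longrightarrow> runs D H c s u s'"
  using runs_mono by blast

lemma runs_Skip: "runs D H Skip s 1 s"
  unfolding runs_def using exec_Skip by blast

lemma runs_Push: "s' = s(r := b # s r) \<Longrightarrow> runs D H (Push r b) s 1 s'"
  unfolding runs_def using exec_Push by blast

lemma runs_Pop: "s' = s(r := tl (s r)) \<Longrightarrow> runs D H (Pop r) s 1 s'"
  unfolding runs_def using exec_Pop by blast

lemma runs_Query: "s r \<in> D \<Longrightarrow> s' = s(r := H (s r)) \<Longrightarrow> runs D H (Query r) s 1 s'"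
  unfolding runs_def using exec_Query by blast

lemma runs_Seq: "runs D H c1 s t1 s1 \<Longrightarrow> runs D H c2 s1 t2 s2 \<Longrightarrow> runs D H (Seq c1 c2) s (t1 + t2) s2"
  unfolding runs_def by (metis exec_Seq add_mono)

lemma runs_Branch_empty: "s r = [] \<Longrightarrow> runs D H c0 s t s' \<Longrightarrow> runs D H (Branch r c0 c1 c2) s (t + 1) s'"
  unfolding runs_def by (metis exec_Branch_empty add_le_mono1)

lemma runs_Branch_True: "s r = True # w \<Longrightarrow> runs D H c1 s t s' \<Longrightarrow> runs D H (Branch r c0 c1 c2) s (t + 1) s'"
  unfolding runs_def by (metis exec_Branch_True add_le_mono1)

lemma runs_Branch_False: "s r = False # w \<Longrightarrow> runs D H c2 s t s' \<Longrightarrow> runs D H (Branch r c0 c1 c2) s (t + 1) s'"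
  unfolding runs_def by (metis exec_Branch_False add_le_mono1)

lemma runs_While_stop: "s r = [] \<Longrightarrow> runs D H (While r c) s 1 s"
  unfolding runs_def using exec_While_stop by blast

lemma runs_While_step: "s r \<noteq> [] \<Longrightarrow> runs D H c s t1 s1 \<Longrightarrow> runs D H (While r c) s1 t2 s2 \<Longrightarrow>
    runs D H (While r c) s (t1 + t2 + 1) s2"
proof -
  assume s: "s r \<noteq> []" and 1: "runs D H c s t1 s1" and 2: "runs D H (While r c) s1 t2 s2"
  obtain u1 where u1: "u1 \<le> t1" "exec D H c s u1 s1" using 1 by (auto simp: runs_def)
  obtain u2 where u2: "u2 \<le> t2" "exec D H (While r c) s1 u2 s2" using 2 by (auto simp: runs_def)
  show ?thesis unfolding runs_def using exec_While_step[OF s u1(2) u2(2)] u1(1) u2(1)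
    by (intro exI[of _ "u1 + u2 + 1"]) auto
qed

text \<open>The loop is described by the explicit sequence of its stores, which takes the place of
  an invariant.\<close>

lemma runs_While_list:
  assumes "\<And>i. i < n \<Longrightarrow> S i r \<noteq> [] \<and> runs D H c (S i) t (S (Suc i))" and "S n r = []"
  shows "runs D H (While r c) (S 0) (n * (t + 1) + 1) (S n)"
proof -
  have "runs D H (While r c) (S (n - k)) (k * (t + 1) + 1) (S n)" if "k \<le> n" for k
    using that
  proof (induction k)
    case 0
    then show ?case using runs_While_stop[of "S n" r] assms(2) by simp
  next
    case (Suc k)
    have e: "Suc (n - Suc k) = n - k" using Suc.prems by simp
    have "runs D H (While r c) (S (n - Suc k)) (t + (k * (t + 1) + 1) + 1) (S n)"
      using assms(1)[of "n - Suc k"] Suc e by (intro runs_While_step) auto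
    then show ?case by (rule runs_mono) simp
  qed
  from this[of n] show ?thesis by simp
qed

definition For :: "nat \<Rightarrow> prog \<Rightarrow> prog" where
  "For r c = While r (Seq (Pop r) c)"

text \<open>The counter is popped before the body runs, so in round \<open>i\<close> the body sees
  \<open>n - Suc i\<close> in register \<open>r\<close>. The stores \<open>S i\<close> are given
  apart from \<open>r\<close>, over which the remaining count is written.\<close>

lemma runs_For:
  assumes s: "s r = unary n" and S0: "(S 0)(r := unary n) = s" and Sn: "s' = (S n)(r := [])"
    and body: "\<And>i. i < n \<Longrightarrow> runs D H c ((S i)(r := unary (n - Suc i))) t ((S (Suc i))(r := unary (n - Suc i)))"
  shows "runs D H (For r c) s (n * (t + 2) + 1) s'"
proof -
  let ?S = "\<lambda>i. (S i)(r := unary (n - i))"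
  have "runs D H (While r (Seq (Pop r) c)) (?S 0) (n * ((1 + t) + 1) + 1) (?S n)"
  proof (rule runs_While_list)
    fix i assume i: "i < n"
    then have u: "unary (n - i) = True # unary (n - Suc i)" by (simp add: Suc_diff_Suc[symmetric])
    have "runs D H (Pop r) (?S i) 1 ((S i)(r := unary (n - Suc i)))" by (rule runs_Pop) (simp add: u)
    from runs_Seq[OF this body[OF i]]
    show "?S i r \<noteq> [] \<and> runs D H (Seq (Pop r) c) (?S i) (1 + t) (?S (Suc i))"
      using i by (intro conjI) simp_all
  qed simp
  then show ?thesis using S0 Sn by (simp add: For_def)
qed

definition Clear :: "nat \<Rightarrow> prog" where
  "Clear r = While r (Pop r)"

lemma runs_Clear:
  assumes "s' = s(r := [])" "length (s r) \<le> n"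
  shows "runs D H (Clear r) s (2 * n + 1) s'"
proof -
  let ?n = "length (s r)"
  have "runs D H (While r (Pop r)) (s(r := drop 0 (s r))) (?n * (1 + 1) + 1) (s(r := drop ?n (s r)))"
  proof (rule runs_While_list[where S = "\<lambda>i. s(r := drop i (s r))"])
    fix i assume "i < ?n"
    moreover have "runs D H (Pop r) (s(r := drop i (s r))) 1 (s(r := drop (Suc i) (s r)))"
      by (rule runs_Pop) (simp add: drop_Suc tl_drop)
    ultimately show "(s(r := drop i (s r))) r \<noteq> [] \<and> runs D H (Pop r) (s(r := drop i (s r))) 1 (s(r := drop (Suc i) (s r)))"
      by simp
  qed simp
  then show ?thesis unfolding Clear_def using assms by (auto elim!: runs_eq)
qed

text \<open>Reading a register empties it, so a second copy is collected in the scratch register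
  \<open>t\<close>, from which \<open>a\<close> is restored.\<close>

definition Copy :: "nat \<Rightarrow> nat \<Rightarrow> nat \<Rightarrow> prog" where
  "Copy a b t = Seq (For a (Seq (Push b True) (Push t True))) (For t (Push a True))"

lemma unary_Cons: "True # unary a = unary (Suc a)" "True # unary a @ w = unary (Suc a) @ w"
  by simp_all

lemma runs_Copy:
  assumes "s a = unary n" "s t = []" "distinct [a, b, t]" and s': "s' = s(b := unary n @ s b)" and N: "n \<le> N"
  shows "runs D H (Copy a b t) s (7 * N + 2) s'"
proof -
  let ?m = "s(b := unary n @ s b, t := unary n, a := [])"
  have 1: "runs D H (For a (Seq (Push b True) (Push t True))) s (n * ((1 + 1) + 2) + 1) ?m"
  proof (rule runs_For[where S = "\<lambda>i. s(b := unary i @ s b, t := unary i)"])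
    fix i
    show "runs D H (Seq (Push b True) (Push t True)) ((s(b := unary i @ s b, t := unary i))(a := unary (n - Suc i))) (1 + 1)
        ((s(b := unary (Suc i) @ s b, t := unary (Suc i)))(a := unary (n - Suc i)))"
      by (rule runs_Seq[OF runs_Push[OF refl] runs_Push]) (use assms(3) in \<open>auto simp: fun_eq_iff\<close>)
  qed (use assms in \<open>auto simp: fun_eq_iff\<close>)
  have 2: "runs D H (For t (Push a True)) ?m (n * (1 + 2) + 1) s'"
  proof (rule runs_For[where S = "\<lambda>i. s(b := unary n @ s b, a := unary i)"])
    fix i
    show "runs D H (Push a True) ((s(b := unary n @ s b, a := unary i))(t := unary (n - Suc i))) 1
        ((s(b := unary n @ s b, a := unary (Suc i)))(t := unary (n - Suc i)))"
      by (rule runs_Push) (use assms(3) in \<open>auto simp: fun_eq_iff\<close>)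
  qed (use assms in \<open>auto simp: fun_eq_iff\<close>)
  show ?thesis unfolding Copy_def by (rule runs_mono[OF runs_Seq[OF 1 2]]) (use N in simp)
qed

text \<open>The loop consumes a copy of the counter, so \<open>a\<close> stays intact and is
  available to the body.\<close>

definition Rep :: "nat \<Rightarrow> nat \<Rightarrow> nat \<Rightarrow> prog \<Rightarrow> prog" where
  "Rep a r t c = Seq (Copy a r t) (For r c)"

lemma runs_Rep:
  assumes s: "s a = unary n" "s r = []" "s t = []" "distinct [a, r, t]" and N: "n \<le> N"
    and S0: "S 0 = s" and Sn: "s' = S n" and Sr: "S n r = []"
    and body: "\<And>i w. i < n \<Longrightarrow> runs D H c ((S i)(r := unary w)) u ((S (Suc i))(r := unary w))"
  shows "runs D H (Rep a r t c) s (N * (u + 9) + 3) s'"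
proof -
  have 1: "runs D H (Copy a r t) s (7 * n + 2) (s(r := unary n))"
    using s by (intro runs_Copy) auto
  have 2: "runs D H (For r c) (s(r := unary n)) (n * (u + 2) + 1) s'"
    by (rule runs_For[where S = S]) (use S0 Sn Sr body in \<open>auto simp: fun_eq_iff\<close>)
  have "n * (u + 9) \<le> N * (u + 9)" using N by (rule mult_right_mono) simp
  then show ?thesis unfolding Rep_def by (intro runs_mono[OF runs_Seq[OF 1 2]]) (simp add: algebra_simps)
qed

definition Move_bits :: "nat \<Rightarrow> nat \<Rightarrow> prog" where
  "Move_bits a b = While a (Branch a Skip (Seq (Pop a) (Push b True)) (Seq (Pop a) (Push b False)))"

lemma runs_Move_bits:
  assumes "a \<noteq> b" "length (s a) \<le> N" and s': "s' = s(a := [], b := rev (s a) @ s b)"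
  shows "runs D H (Move_bits a b) s (4 * N + 1) s'"
proof -
  let ?S = "\<lambda>i. s(a := drop i (s a), b := rev (take i (s a)) @ s b)"
  have "runs D H (While a (Branch a Skip (Seq (Pop a) (Push b True)) (Seq (Pop a) (Push b False)))) (?S 0)
      (length (s a) * (((1 + 1) + 1) + 1) + 1) (?S (length (s a)))"
  proof (rule runs_While_list)
    fix i assume i: "i < length (s a)"
    have d: "drop i (s a) = (s a ! i) # drop (Suc i) (s a)" using i by (rule Cons_nth_drop_Suc[symmetric])
    have t: "take (Suc i) (s a) = take i (s a) @ [s a ! i]" using i by (rule take_Suc_conv_app_nth)
    have pp: "runs D H (Seq (Pop a) (Push b (s a ! i))) (?S i) (1 + 1) (?S (Suc i))"
      by (rule runs_Seq[OF runs_Pop[OF refl] runs_Push]) (use assms(1) d t in \<open>auto simp: fun_eq_iff\<close>)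
    have "runs D H (Branch a Skip (Seq (Pop a) (Push b True)) (Seq (Pop a) (Push b False))) (?S i) ((1 + 1) + 1) (?S (Suc i))"
    proof (cases "s a ! i")
      case True
      then show ?thesis using pp d assms(1) by (intro runs_Branch_True[where w = "drop (Suc i) (s a)"]) auto
    next
      case False
      then show ?thesis using pp d assms(1) by (intro runs_Branch_False[where w = "drop (Suc i) (s a)"]) auto
    qed
    then show "?S i a \<noteq> [] \<and> runs D H (Branch a Skip (Seq (Pop a) (Push b True)) (Seq (Pop a) (Push b False))) (?S i) ((1 + 1) + 1) (?S (Suc i))"
      using assms(1) i by auto
  qed (use assms(1) in auto)
  then show ?thesis unfolding Move_bits_def using assms by (auto elim!: runs_eq simp: fun_eq_iff)
qed

definition Copy_bits :: "nat \<Rightarrow> nat \<Rightarrow> nat \<Rightarrow> prog" where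
  "Copy_bits a b t = Seq (Move_bits a t) (While t (Branch t Skip (Seq (Pop t) (Seq (Push a True) (Push b True)))
      (Seq (Pop t) (Seq (Push a False) (Push b False)))))"

lemma runs_Copy_bits:
  assumes "distinct [a, b, t]" "s t = []" "length (s a) \<le> N" and s': "s' = s(b := s a @ s b)"
  shows "runs D H (Copy_bits a b t) s (9 * N + 2) s'"
proof -
  let ?w = "rev (s a)"
  let ?S = "\<lambda>i. s(a := rev (take i ?w), b := rev (take i ?w) @ s b, t := drop i ?w)"
  let ?c = "Branch t Skip (Seq (Pop t) (Seq (Push a True) (Push b True))) (Seq (Pop t) (Seq (Push a False) (Push b False)))"
  have 1: "runs D H (Move_bits a t) s (4 * N + 1) (?S 0)"
    using assms by (intro runs_Move_bits) (auto simp: fun_eq_iff)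
  have "runs D H (While t ?c) (?S 0) (length ?w * (((1 + (1 + 1)) + 1) + 1) + 1) (?S (length ?w))"
  proof (rule runs_While_list)
    fix i assume i: "i < length ?w"
    have d: "drop i ?w = (?w ! i) # drop (Suc i) ?w" using i by (rule Cons_nth_drop_Suc[symmetric])
    have tk: "take (Suc i) ?w = take i ?w @ [?w ! i]" using i by (rule take_Suc_conv_app_nth)
    have pp: "runs D H (Seq (Pop t) (Seq (Push a (?w ! i)) (Push b (?w ! i)))) (?S i) (1 + (1 + 1)) (?S (Suc i))"
      by (rule runs_Seq[OF runs_Pop[OF refl] runs_Seq[OF runs_Push[OF refl] runs_Push]]) (use assms(1) d tk in \<open>auto simp: fun_eq_iff\<close>)
    have "runs D H ?c (?S i) ((1 + (1 + 1)) + 1) (?S (Suc i))"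
    proof (cases "?w ! i")
      case True
      then show ?thesis using pp d assms(1) by (intro runs_Branch_True[where w = "drop (Suc i) ?w"]) auto
    next
      case False
      then show ?thesis using pp d assms(1) by (intro runs_Branch_False[where w = "drop (Suc i) ?w"]) auto
    qed
    then show "?S i t \<noteq> [] \<and> runs D H ?c (?S i) ((1 + (1 + 1)) + 1) (?S (Suc i))"
      using i by auto
  qed simp
  then have 2: "runs D H (While t ?c) (?S 0) (5 * N + 1) s'"
    using assms by (auto elim!: runs_eq simp: fun_eq_iff)
  show ?thesis unfolding Copy_bits_def by (rule runs_mono[OF runs_Seq[OF 1 2]]) simp
qed

lemma runs_For_le:
  assumes "s r = unary n" "(S 0)(r := unary n) = s" "s' = (S n)(r := [])" "n \<le> N"
    and "\<And>i w. i < n \<Longrightarrow> runs D H c ((S i)(r := unary w)) t ((S (Suc i))(r := unary w))"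
  shows "runs D H (For r c) s (N * (t + 2) + 1) s'"
  by (rule runs_mono[OF runs_For[where S = S and n = n]]) (use assms mult_right_mono[of n N "t + 2"] in auto)

text \<open>\<open>Inc c e\<close> increments a residue modulo \<open>d\<close> that is held together with its complement with respect to \<open>d - 1\<close>.\<close>

definition Inc :: "nat \<Rightarrow> nat \<Rightarrow> prog" where
  "Inc c e = Branch e (For c (Push e True)) (Seq (Pop e) (Push c True)) Skip"

lemma runs_Inc:
  assumes "s c = unary x" "s e = unary (d - 1 - x)" "x < d" "d \<le> B" "c \<noteq> e"
    and s': "s' = s(c := unary (Suc x mod d), e := unary (d - 1 - Suc x mod d))"
  shows "runs D H (Inc c e) s (3 * B + 3) s'"
proof (cases "Suc x = d")
  case True
  have "runs D H (For c (Push e True)) s (B * (1 + 2) + 1) s'"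
  proof (rule runs_For_le[where n = x and S = "\<lambda>i. s(e := unary i)"])
    fix i w
    show "runs D H (Push e True) ((s(e := unary i))(c := unary w)) 1 ((s(e := unary (Suc i)))(c := unary w))"
      by (rule runs_Push) (use assms(5) in \<open>auto simp: fun_eq_iff\<close>)
  qed (use assms True in \<open>auto simp: fun_eq_iff\<close>)
  from runs_Branch_empty[OF _ this, of e] show ?thesis unfolding Inc_def
    by (rule runs_mono) (use assms True in auto)
next
  case False
  have e: "s e = True # unary (d - 1 - Suc x)" using assms False by (cases "d - 1 - x") auto
  have "runs D H (Seq (Pop e) (Push c True)) s (1 + 1) s'"
    by (rule runs_Seq[OF runs_Pop[OF refl] runs_Push]) (use assms False e in \<open>auto simp: fun_eq_iff\<close>)
  from runs_Branch_True[OF e this] show ?thesis unfolding Inc_def by (rule runs_mono) simp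
qed

text \<open>Numbers are held in unary.  Registers of the hash program: 0 security parameter, finally output;
  1 key; 2 input; 4, 5 \<open>fold_len l\<close> and \<open>mark_len l\<close>; 6 flag, nonempty while the candidate solution
  passes all tests; 8 \<open>l - 1\<close>; 12, 13, 19 \<open>code_dim l\<close>, \<open>block_count l\<close> and the padding length of
  \<open>block_point\<close>; 14 candidate solution; 15, 16 current position in the code word and current block;
  18 query.  All others are scratch and empty between subprograms.\<close>

definition flag :: "bool \<Rightarrow> bitstr" where
  "flag b = (if b then [True] else [])"

lemma flag_simps [simp]: "flag True = [True]" "flag False = []" "tl (flag b) = []"
  by (simp_all add: flag_def)

text \<open>Counts to \<open>l\<close> modulo the divisor and clears the flag at residue zero.
  Register 8 holds the divisor minus one, the complement that \<open>Inc\<close> starts from; one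
  push at the end prepares it for the next divisor.\<close>

definition Divisor_test :: prog where
  "Divisor_test = Seq (Copy 8 11 7) (Seq (Rep 0 26 7 (Inc 10 11)) (Seq (Branch 10 (Pop 6) Skip Skip)
     (Seq (Clear 10) (Seq (Clear 11) (Push 8 True)))))"

lemma runs_Divisor_test:
  assumes s: "s 0 = unary l" "s 8 = unary (d - 1)" "s 7 = []" "s 10 = []" "s 11 = []" "s 26 = []"
    and d: "0 < d" "d \<le> B" "l \<le> B" and f: "s 6 = flag b"
    and s': "s' = s(6 := flag (b \<and> \<not> d dvd l), 8 := unary d)"
  shows "runs D H Divisor_test s (B * (3 * B + 12) + 11 * B + 15) s'"
proof -
  let ?s1 = "s(11 := unary (d - 1))"
  let ?s2 = "s(10 := unary (l mod d), 11 := unary (d - 1 - l mod d))"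
  have 1: "runs D H (Copy 8 11 7) s (7 * B + 2) ?s1"
    by (rule runs_Copy[where n = "d - 1"]) (use s d in auto)
  have 2: "runs D H (Rep 0 26 7 (Inc 10 11)) ?s1 (B * ((3 * B + 3) + 9) + 3) ?s2"
  proof (rule runs_Rep[where n = l and S = "\<lambda>i. s(10 := unary (i mod d), 11 := unary (d - 1 - i mod d))"])
    fix i w
    show "runs D H (Inc 10 11) ((s(10 := unary (i mod d), 11 := unary (d - 1 - i mod d)))(26 := unary w)) (3 * B + 3)
       ((s(10 := unary (Suc i mod d), 11 := unary (d - 1 - Suc i mod d)))(26 := unary w))"
      by (rule runs_Inc[where x = "i mod d" and d = d]) (use d in \<open>auto simp: fun_eq_iff mod_Suc_eq\<close>)
  qed (use s d in \<open>auto simp: fun_eq_iff\<close>)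
  let ?s3 = "?s2(6 := flag (b \<and> \<not> d dvd l))"
  have 3: "runs D H (Branch 10 (Pop 6) Skip Skip) ?s2 (1 + 1) ?s3"
  proof (cases "d dvd l")
    case True
    have "runs D H (Pop 6) ?s2 1 ?s3" by (rule runs_Pop) (use f True in \<open>auto simp: fun_eq_iff\<close>)
    then show ?thesis by (rule runs_Branch_empty[rotated]) (use True in auto)
  next
    case False
    then obtain w where w: "l mod d = Suc w" by (metis mod_eq_0_iff_dvd not0_implies_Suc)
    have "runs D H Skip ?s2 1 ?s3" by (rule runs_eq[OF runs_Skip]) (use f False in \<open>auto simp: fun_eq_iff\<close>)
    from runs_Branch_True[OF _ this, of 10 "unary w"] show ?thesis using w by simp
  qed
  have ld: "l mod d \<le> B" using d mod_less_divisor[of d l] by linarith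
  have 4: "runs D H (Clear 10) ?s3 (2 * B + 1) (?s3(10 := []))"
    by (rule runs_Clear) (use ld in auto)
  have 5: "runs D H (Clear 11) (?s3(10 := [])) (2 * B + 1) (?s3(10 := [], 11 := []))"
    by (rule runs_Clear) (use d in auto)
  have 6: "runs D H (Push 8 True) (?s3(10 := [], 11 := [])) 1 s'"
    by (rule runs_Push) (use s d s' in \<open>auto simp: fun_eq_iff unary_Cons\<close>)
  show ?thesis unfolding Divisor_test_def
    by (rule runs_mono[OF runs_Seq[OF 1 runs_Seq[OF 2 runs_Seq[OF 3 runs_Seq[OF 4 runs_Seq[OF 5 6]]]]]])
      (simp add: algebra_simps)
qed

text \<open>Trial division by 2 up to \<open>l - 1\<close>. Two pops set the number of rounds to
  \<open>l - 2\<close>, and in between \<open>2 \<le> l\<close> is decided. For prime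
  \<open>l\<close> the loop leaves \<open>l - 1\<close> in register 8, the value from which later
  increments modulo \<open>l\<close> start.\<close>

definition Prime_test :: prog where
  "Prime_test = Seq (Copy 0 9 7) (Seq (Pop 9) (Seq (Branch 9 Skip (Push 6 True) Skip)
     (Seq (Pop 9) (Seq (Push 8 True) (For 9 Divisor_test)))))"

definition divisor_time :: "nat \<Rightarrow> nat" where
  "divisor_time B = B * (3 * B + 12) + 11 * B + 15"

lemma runs_Prime_test:
  assumes s: "s 0 = unary l" and e: "s 6 = []" "s 7 = []" "s 8 = []" "s 9 = []" "s 10 = []" "s 11 = []" "s 26 = []"
    and l: "l \<le> B"
    and s': "s' = s(6 := flag (prime l), 8 := unary (max 1 (l - 1)))"
  shows "runs D H Prime_test s (B * (divisor_time B + 9) + 20) s'"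
proof -
  let ?s1 = "s(9 := unary l)"
  have 1: "runs D H (Copy 0 9 7) s (7 * B + 2) ?s1"
    by (rule runs_Copy[where n = l]) (use s e l in auto)
  let ?s2 = "s(9 := unary (l - 1))"
  have 2: "runs D H (Pop 9) ?s1 1 ?s2"
    by (rule runs_Pop) (auto simp: fun_eq_iff)
  let ?s3 = "s(9 := unary (l - 1), 6 := flag (2 \<le> l))"
  have 3: "runs D H (Branch 9 Skip (Push 6 True) Skip) ?s2 (1 + 1) ?s3"
  proof (cases "2 \<le> l")
    case True
    then have "unary (l - 1) = True # unary (l - 2)" by (cases "l - 1") auto
    moreover have "runs D H (Push 6 True) ?s2 1 ?s3" by (rule runs_Push) (use e True in \<open>auto simp: fun_eq_iff\<close>)
    ultimately show ?thesis using runs_Branch_True[of ?s2 9 "unary (l - 2)" D H "Push 6 True" 1 ?s3] by (simp add: numeral_2_eq_2)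
  next
    case False
    have "runs D H Skip ?s2 1 ?s3" by (rule runs_eq[OF runs_Skip]) (use e False in \<open>auto simp: fun_eq_iff\<close>)
    then show ?thesis using runs_Branch_empty[of ?s2 9 D H Skip 1 ?s3] False by (simp add: numeral_2_eq_2)
  qed
  let ?s4 = "s(9 := unary (l - 2), 6 := flag (2 \<le> l))"
  have 4: "runs D H (Pop 9) ?s3 1 ?s4"
    by (rule runs_Pop) (auto simp: fun_eq_iff)
  let ?s5 = "?s4(8 := unary 1)"
  have 5: "runs D H (Push 8 True) ?s4 1 ?s5"
    by (rule runs_Push) (use e in \<open>auto simp: fun_eq_iff\<close>)
  let ?P = "\<lambda>i. 2 \<le> l \<and> (\<forall>d\<in>{2..<i + 2}. \<not> d dvd l)"
  let ?S = "\<lambda>i. s(6 := flag (?P i), 8 := unary (i + 1))"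
  have 6: "runs D H (For 9 Divisor_test) ?s5 (B * ((B * (3 * B + 12) + 11 * B + 15) + 2) + 1) s'"
  proof (rule runs_For_le[where n = "l - 2" and S = ?S])
    fix i w assume i: "i < l - 2"
    have "?P (Suc i) \<longleftrightarrow> ?P i \<and> \<not> (i + 2) dvd l" by (auto simp: less_Suc_eq)
    then show "runs D H Divisor_test ((?S i)(9 := unary w)) (B * (3 * B + 12) + 11 * B + 15) ((?S (Suc i))(9 := unary w))"
      by (intro runs_Divisor_test[where d = "i + 2" and b = "?P i"]) (use s e l i in \<open>auto simp: fun_eq_iff\<close>)
  next
    have "prime l \<longleftrightarrow> ?P (l - 2)" unfolding prime_nat_iff' by auto
    moreover have "max 1 (l - 1) = l - 2 + 1" by auto
    ultimately show "s' = (?S (l - 2))(9 := [])"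
      unfolding s' using e by (auto simp: fun_eq_iff simp del: replicate_Suc)
  qed (use e l in \<open>auto simp: fun_eq_iff\<close>)
  show ?thesis unfolding Prime_test_def divisor_time_def
    by (rule runs_mono[OF runs_Seq[OF 1 runs_Seq[OF 2 runs_Seq[OF 3 runs_Seq[OF 4 runs_Seq[OF 5 6]]]]]])
      (simp add: algebra_simps)
qed

primrec Pops :: "nat \<Rightarrow> nat \<Rightarrow> prog" where
  "Pops r 0 = Skip"
| "Pops r (Suc n) = Seq (Pop r) (Pops r n)"

lemma runs_Pops: "s' = s(r := drop n (s r)) \<Longrightarrow> runs D H (Pops r n) s (n + 1) s'"
proof (induction n arbitrary: s)
  case 0
  then show ?case using runs_Skip by simp
next
  case (Suc n)
  have "runs D H (Pops r n) (s(r := tl (s r))) (n + 1) s'" by (rule Suc.IH) (simp add: Suc.prems drop_Suc fun_eq_iff)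
  from runs_Seq[OF runs_Pop[OF refl] this] show ?case by simp
qed

definition Div256 :: prog where
  "Div256 = While 3 (Seq (Pops 3 255) (Branch 3 Skip (Seq (Pop 3) (Push 20 True)) Skip))"

lemma runs_Div256:
  assumes "s 3 = unary a" "s 20 = unary b"
  shows "runs D H Div256 s (a * 261 + 1) (s(3 := [], 20 := unary (b + a div 256)))"
  using assms
proof (induction a arbitrary: s b rule: less_induct)
  case (less a)
  let ?c = "Seq (Pops 3 255) (Branch 3 Skip (Seq (Pop 3) (Push 20 True)) Skip)"
  show ?case
  proof (cases "a = 0")
    case True
    have "s(3 := [], 20 := unary (b + a div 256)) = s" using True less.prems by (auto simp: fun_eq_iff)
    then show ?thesis using runs_While_stop[of s 3] True less.prems unfolding Div256_def by (simp del: fun_upd_apply)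
  next
    case False
    let ?s1 = "s(3 := unary (a - 255))"
    let ?s2 = "s(3 := unary (a - 256), 20 := unary (b + (if a < 256 then 0 else 1)))"
    have 1: "runs D H (Pops 3 255) s (255 + 1) ?s1"
      by (rule runs_Pops) (use less.prems in \<open>auto simp: fun_eq_iff\<close>)
    have 2: "runs D H (Branch 3 Skip (Seq (Pop 3) (Push 20 True)) Skip) ?s1 3 ?s2"
    proof (cases "a < 256")
      case True
      have "runs D H Skip ?s1 2 ?s2" by (rule runs_eq[OF runs_Skip]) (use less.prems True in \<open>auto simp: fun_eq_iff\<close>)
      then show ?thesis using runs_Branch_empty[of ?s1 3 D H Skip 2 ?s2] True by simp
    next
      case False
      then have "unary (a - 255) = True # unary (a - 256)" by (cases "a - 255") auto
      moreover have "runs D H (Seq (Pop 3) (Push 20 True)) ?s1 (1 + 1) ?s2"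
        by (rule runs_Seq[OF runs_Pop[OF refl] runs_Push]) (use less.prems False in \<open>auto simp: fun_eq_iff\<close>)
      ultimately show ?thesis using runs_Branch_True[of ?s1 3 "unary (a - 256)" D H _ "1 + 1" ?s2] by (simp add: numeral_3_eq_3)
    qed
    have 3: "runs D H (While 3 ?c) ?s2 ((a - 256) * 261 + 1) (?s2(3 := [], 20 := unary (b + (if a < 256 then 0 else 1) + (a - 256) div 256)))"
      by (rule less.IH[unfolded Div256_def]) (use False in auto)
    have e: "(if a < 256 then 0 else 1) + (a - 256) div 256 = a div 256" by (simp add: le_div_geq)
    have "runs D H (While 3 ?c) s (((255 + 1) + 3) + ((a - 256) * 261 + 1) + 1)
        (?s2(3 := [], 20 := unary (b + (if a < 256 then 0 else 1) + (a - 256) div 256)))"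
      by (rule runs_While_step[OF _ runs_Seq[OF 1 2] 3]) (use less.prems False in auto)
    then show ?thesis unfolding Div256_def
      by (rule runs_eq) (use False e in \<open>auto simp: fun_eq_iff add.assoc\<close>)
  qed
qed

text \<open>One step of the recursion of \<open>log256\<close>: the quotient is nonzero exactly if
  the argument is at least 256, and then \<open>fold_len\<close> doubles and \<open>mark_len\<close>
  grows by two.\<close>

definition Fold_step :: prog where
  "Fold_step = Seq Div256 (Seq (For 20 (Push 3 True)) (Branch 3 Skip
     (Seq (For 4 (Seq (Push 20 True) (Push 20 True))) (Seq (For 20 (Push 4 True)) (Seq (Push 5 True) (Push 5 True)))) Skip))"

lemma runs_Fold_step:
  assumes s: "s 3 = unary a" "s 4 = unary m" "s 5 = unary \<beta>" "s 20 = []" and b: "a \<le> B" "m \<le> B"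
    and s': "s' = s(3 := unary (a div 256), 4 := unary (if a < 256 then m else 2 * m), 5 := unary (if a < 256 then \<beta> else \<beta> + 2))"
  shows "runs D H Fold_step s (274 * B + 10) s'"
proof -
  let ?s1 = "s(3 := [], 20 := unary (a div 256))"
  have 1: "runs D H Div256 s (261 * B + 1) ?s1"
    by (rule runs_eq[OF runs_Div256[of s a 0]]) (use s b in auto)
  let ?s2 = "s(3 := unary (a div 256))"
  have ab: "a div 256 \<le> B" using b div_le_dividend[of a 256] by linarith
  have 2: "runs D H (For 20 (Push 3 True)) ?s1 (B * (1 + 2) + 1) ?s2"
  proof (rule runs_For_le[where n = "a div 256" and S = "\<lambda>i. s(3 := unary i)"])
    fix i w
    show "runs D H (Push 3 True) ((s(3 := unary i))(20 := unary w)) 1 ((s(3 := unary (Suc i)))(20 := unary w))"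
      by (rule runs_Push) (auto simp: fun_eq_iff)
  qed (use s ab in \<open>auto simp: fun_eq_iff\<close>)
  have 3: "runs D H (Branch 3 Skip
     (Seq (For 4 (Seq (Push 20 True) (Push 20 True))) (Seq (For 20 (Push 4 True)) (Seq (Push 5 True) (Push 5 True)))) Skip)
     ?s2 ((B * ((1 + 1) + 2) + 1) + ((2 * B * (1 + 2) + 1) + (1 + 1)) + 1) s'"
  proof (cases "a < 256")
    case True
    have "runs D H Skip ?s2 ((B * ((1 + 1) + 2) + 1) + ((2 * B * (1 + 2) + 1) + (1 + 1))) s'"
      by (rule runs_eq[OF runs_Skip]) (use s s' True in \<open>auto simp: fun_eq_iff\<close>)
    then show ?thesis by (rule runs_Branch_empty[rotated]) (use True in simp)
  next
    case False
    then have c: "unary (a div 256) = True # unary (a div 256 - 1)" by (cases "a div 256") auto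
    let ?t1 = "s(3 := unary (a div 256), 4 := [], 20 := unary (2 * m))"
    have 1: "runs D H (For 4 (Seq (Push 20 True) (Push 20 True))) ?s2 (B * ((1 + 1) + 2) + 1) ?t1"
    proof (rule runs_For_le[where n = m and S = "\<lambda>i. ?s2(20 := unary (2 * i))"])
      fix i w
      show "runs D H (Seq (Push 20 True) (Push 20 True)) ((?s2(20 := unary (2 * i)))(4 := unary w)) (1 + 1) ((?s2(20 := unary (2 * Suc i)))(4 := unary w))"
        by (rule runs_Seq[OF runs_Push[OF refl] runs_Push]) (auto simp: fun_eq_iff)
    qed (use s b in \<open>auto simp: fun_eq_iff\<close>)
    let ?t2 = "s(3 := unary (a div 256), 4 := unary (2 * m))"
    have 2: "runs D H (For 20 (Push 4 True)) ?t1 (2 * B * (1 + 2) + 1) ?t2"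
    proof (rule runs_For_le[where n = "2 * m" and S = "\<lambda>i. s(3 := unary (a div 256), 4 := unary i)"])
      fix i w
      show "runs D H (Push 4 True) ((s(3 := unary (a div 256), 4 := unary i))(20 := unary w)) 1
          ((s(3 := unary (a div 256), 4 := unary (Suc i)))(20 := unary w))"
        by (rule runs_Push) (auto simp: fun_eq_iff)
    qed (use s b in \<open>auto simp: fun_eq_iff\<close>)
    have 3: "runs D H (Seq (Push 5 True) (Push 5 True)) ?t2 (1 + 1) s'"
      by (rule runs_Seq[OF runs_Push[OF refl] runs_Push]) (use s s' False in \<open>auto simp: fun_eq_iff\<close>)
    show ?thesis
      by (rule runs_Branch_True[OF _ runs_Seq[OF 1 runs_Seq[OF 2 3]]]) (simp add: c)
  qed
  show ?thesis unfolding Fold_step_def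
    by (rule runs_mono[OF runs_Seq[OF 1 runs_Seq[OF 2 3]]]) simp
qed

lemma fold_len_rec: "fold_len a = (if a < 256 then 1 else 2 * fold_len (a div 256))"
  and mark_len_rec: "mark_len a = (if a < 256 then 6 else 2 + mark_len (a div 256))"
  by (auto simp: fold_len_def mark_len_def log256.simps[of a])

lemma runs_Fold_loop:
  assumes "s 3 = unary a" "s 4 = unary m" "s 5 = unary \<beta>" "s 20 = []" "a \<le> B" "m * fold_len a \<le> B"
  shows "runs D H (While 3 Fold_step) s (a * (274 * B + 11) + 1)
      (s(3 := [], 4 := unary (m * fold_len a), 5 := unary (\<beta> + (mark_len a - 6))))"
  using assms
proof (induction a arbitrary: s m \<beta> rule: less_induct)
  case (less a)
  show ?case
  proof (cases "a = 0")
    case True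
    then have "s(3 := [], 4 := unary (m * fold_len a), 5 := unary (\<beta> + (mark_len a - 6))) = s"
      using less.prems by (auto simp: fun_eq_iff fold_len_rec[of 0] mark_len_rec[of 0])
    then show ?thesis using runs_While_stop[of s 3] True less.prems(1) by (simp del: fun_upd_apply)
  next
    case False
    let ?m = "if a < 256 then m else 2 * m" and ?b = "if a < 256 then \<beta> else \<beta> + 2"
    let ?s1 = "s(3 := unary (a div 256), 4 := unary ?m, 5 := unary ?b)"
    have f: "?m * fold_len (a div 256) = m * fold_len a"
      using fold_len_rec[of a] fold_len_rec[of "a div 256"] by auto
    have ml: "mark_len (a div 256) \<ge> 6" by (simp add: mark_len_def)
    have g: "?b + (mark_len (a div 256) - 6) = \<beta> + (mark_len a - 6)"
      using mark_len_rec[of a] mark_len_rec[of "a div 256"] ml by auto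
    have lt: "a div 256 < a" using False by simp
    have m: "m \<le> B" using less.prems(6) fold_len_pos(1)[of a] by (metis dual_order.trans mult_le_mono2 nat_mult_1_right Suc_leI One_nat_def)
    have 1: "runs D H Fold_step s (274 * B + 10) ?s1"
      by (rule runs_Fold_step[where a = a and m = m and \<beta> = \<beta>]) (use less.prems m in auto)
    have 2: "runs D H (While 3 Fold_step) ?s1 ((a div 256) * (274 * B + 11) + 1)
       (?s1(3 := [], 4 := unary (?m * fold_len (a div 256)), 5 := unary (?b + (mark_len (a div 256) - 6))))"
      by (rule less.IH[OF lt]) (use less.prems lt f in auto)
    have t: "(a div 256) * (274 * B + 11) + (274 * B + 11) \<le> a * (274 * B + 11)"
      using mult_right_mono[of "Suc (a div 256)" a "274 * B + 11"] lt by simp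
    show ?thesis
      by (rule runs_eq[OF runs_While_step[OF _ 1 2]]) (use less.prems False t in \<open>auto simp: fun_eq_iff f g\<close>)
  qed
qed

definition Fold_params :: prog where
  "Fold_params = Seq (Copy 0 3 7) (Seq (Push 4 True) (Seq (Push 5 True) (Seq (Push 5 True) (Seq (Push 5 True)
     (Seq (Push 5 True) (Seq (Push 5 True) (Seq (Push 5 True) (While 3 Fold_step))))))))"

lemma runs_Fold_params:
  assumes s: "s 0 = unary l" and e: "s 3 = []" "s 4 = []" "s 5 = []" "s 7 = []" "s 20 = []"
    and l: "l \<le> B" "fold_len l \<le> B" and s': "s' = s(4 := unary (fold_len l), 5 := unary (mark_len l))"
  shows "runs D H Fold_params s (B * (274 * B + 11) + 7 * B + 10) s'"
proof -
  have 1: "runs D H (Copy 0 3 7) s (7 * B + 2) (s(3 := unary l))"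
    by (rule runs_Copy[where n = l]) (use s e l in auto)
  let ?t = "s(3 := unary l, 4 := unary 1)"
  have 2: "runs D H (Push 4 True) (s(3 := unary l)) 1 ?t"
    by (rule runs_Push) (use e in auto)
  have p: "runs D H (Push 5 True) (?t(5 := unary i)) 1 (?t(5 := unary j))" if "j = Suc i" for i j
    by (rule runs_Push) (use that in \<open>auto simp: fun_eq_iff\<close>)
  have n: "(2::nat) = Suc 1" "(3::nat) = Suc 2" "(4::nat) = Suc 3" "(5::nat) = Suc 4" "(6::nat) = Suc 5"
    by simp_all
  have p0: "runs D H (Push 5 True) ?t 1 (?t(5 := unary 1))"
    by (rule runs_Push) (use e in \<open>auto simp: fun_eq_iff\<close>)
  have "runs D H (While 3 Fold_step) (?t(5 := unary 6)) (l * (274 * B + 11) + 1)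
     (?t(5 := unary 6, 3 := [], 4 := unary (1 * fold_len l), 5 := unary (6 + (mark_len l - 6))))"
    by (rule runs_Fold_loop) (use e l in auto)
  then have 3: "runs D H (While 3 Fold_step) (?t(5 := unary 6)) (B * (274 * B + 11) + 1) s'"
    by (rule runs_eq) (use e s' l mult_right_mono[of l B "274 * B + 11"] in \<open>auto simp: fun_eq_iff mark_len_def\<close>)
  show ?thesis unfolding Fold_params_def
    by (rule runs_mono[OF runs_Seq[OF 1 runs_Seq[OF 2 runs_Seq[OF p0 runs_Seq[OF p[OF n(1)] runs_Seq[OF p[OF n(2)]
       runs_Seq[OF p[OF n(3)] runs_Seq[OF p[OF n(4)] runs_Seq[OF p[OF n(5)] 3]]]]]]]]]) simp
qed

text \<open>All products arise by repeated copying. The padding is obtained as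
  \<open>(l - m) * l + 1\<close>, where \<open>m\<close> is \<open>fold_len l\<close>, since
  truncated subtraction is available only as popping.\<close>

definition Sizes :: prog where
  "Sizes = Seq (Rep 4 26 7 (Copy 4 20 7)) (Seq (Rep 20 26 7 (Copy 4 12 7)) (Seq (Rep 12 26 7 (Seq (Copy 4 13 7) (Copy 4 13 7)))
     (Seq (Clear 20) (Seq (Copy 0 21 7) (Seq (Rep 4 26 7 (Pop 21)) (Seq (Rep 21 26 7 (Copy 0 19 7))
     (Seq (Push 19 True) (Clear 21))))))))"

lemma runs_Rep_Copy:
  assumes s: "s a = unary n" "s c = unary m" "s r = []" "s t = []" "distinct [a, r, t]" "distinct [c, b, t, r]" "a \<noteq> b"
    and N: "n \<le> B" "m \<le> B" and s': "s' = s(b := unary (n * m) @ s b)"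
  shows "runs D H (Rep a r t (Copy c b t)) s (B * (7 * B + 11) + 3) s'"
proof -
  have "runs D H (Rep a r t (Copy c b t)) s (B * ((7 * B + 2) + 9) + 3) s'"
  proof (rule runs_Rep[where n = n and S = "\<lambda>i. s(b := unary (i * m) @ s b)"])
    fix i w
    show "runs D H (Copy c b t) ((s(b := unary (i * m) @ s b))(r := unary w)) (7 * B + 2) ((s(b := unary (Suc i * m) @ s b))(r := unary w))"
      by (rule runs_Copy[where n = m]) (use s N in \<open>auto simp: fun_eq_iff replicate_add\<close>)
  qed (use s N s' in \<open>auto simp: fun_eq_iff\<close>)
  then show ?thesis by (rule runs_mono) simp
qed

lemma runs_Sizes:
  assumes s: "s 0 = unary l" "s 4 = unary m" and e: "s 7 = []" "s 12 = []" "s 13 = []" "s 19 = []" "s 20 = []" "s 21 = []" "s 26 = []"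
    and b: "l \<le> B" "m ^ 3 \<le> B" and m: "0 < m" "m \<le> l"
    and s': "s' = s(12 := unary (m ^ 3), 13 := unary (2 * m ^ 4), 19 := unary (l * l + 1 - m * l))"
  shows "runs D H Sizes s (5 * (B * (14 * B + 22) + 3) + 30 * B + 20) s'"
proof -
  have mB: "m \<le> B" "m * m \<le> B" using b m by auto
    (metis b(2) dual_order.trans m(1) numeral_eq_Suc power2_eq_square power_increasing Suc_leI One_nat_def numeral_2_eq_2 pred_numeral_simps(3) le_SucI order_refl)
  let ?s1 = "s(20 := unary (m * m))"
  have 1: "runs D H (Rep 4 26 7 (Copy 4 20 7)) s (B * (7 * B + 11) + 3) ?s1"
    by (rule runs_Rep_Copy[where n = m and m = m]) (use s e mB in auto)
  let ?s2 = "?s1(12 := unary (m ^ 3))"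
  have 2: "runs D H (Rep 20 26 7 (Copy 4 12 7)) ?s1 (B * (7 * B + 11) + 3) ?s2"
    by (rule runs_Rep_Copy[where n = "m * m" and m = m]) (use s e mB in \<open>auto simp: fun_eq_iff power3_eq_cube\<close>)
  let ?s3 = "?s2(13 := unary (2 * m ^ 4))"
  have m4: "2 * m ^ 4 = m ^ 3 * (m + m)" by (simp add: eval_nat_numeral algebra_simps)
  have 3: "runs D H (Rep 12 26 7 (Seq (Copy 4 13 7) (Copy 4 13 7))) ?s2 (B * (((7 * B + 2) + (7 * B + 2)) + 9) + 3) ?s3"
  proof (rule runs_Rep[where n = "m ^ 3" and S = "\<lambda>i. ?s2(13 := unary (i * (m + m)))"])
    fix i w
    show "runs D H (Seq (Copy 4 13 7) (Copy 4 13 7)) ((?s2(13 := unary (i * (m + m))))(26 := unary w)) ((7 * B + 2) + (7 * B + 2))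
       ((?s2(13 := unary (Suc i * (m + m))))(26 := unary w))"
      by (rule runs_Seq[OF runs_Copy[where n = m, OF _ _ _ refl] runs_Copy[where n = m]])
        (use s e mB in \<open>auto simp: fun_eq_iff replicate_add[symmetric] algebra_simps\<close>)
  next
    show "?s3 = ?s2(13 := unary (m ^ 3 * (m + m)))" by (simp only: m4)
  qed (use s e b in \<open>auto simp: fun_eq_iff\<close>)
  let ?s4 = "s(12 := unary (m ^ 3), 13 := unary (2 * m ^ 4))"
  have 4: "runs D H (Clear 20) ?s3 (2 * B + 1) ?s4"
    by (rule runs_Clear) (use e mB in \<open>auto simp: fun_eq_iff\<close>)
  have 5: "runs D H (Copy 0 21 7) ?s4 (7 * B + 2) (?s4(21 := unary l))"
    by (rule runs_Copy[where n = l]) (use s e b in auto)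
  have 6: "runs D H (Rep 4 26 7 (Pop 21)) (?s4(21 := unary l)) (B * (1 + 9) + 3) (?s4(21 := unary (l - m)))"
  proof (rule runs_Rep[where n = m and S = "\<lambda>i. ?s4(21 := unary (l - i))"])
    fix i w
    show "runs D H (Pop 21) ((?s4(21 := unary (l - i)))(26 := unary w)) 1 ((?s4(21 := unary (l - Suc i)))(26 := unary w))"
      by (rule runs_Pop) (auto simp: fun_eq_iff)
  qed (use s e mB in \<open>auto simp: fun_eq_iff\<close>)
  have 7: "runs D H (Rep 21 26 7 (Copy 0 19 7)) (?s4(21 := unary (l - m))) (B * (7 * B + 11) + 3) (?s4(21 := unary (l - m), 19 := unary ((l - m) * l)))"
    by (rule runs_Rep_Copy[where n = "l - m" and m = l]) (use s e b in auto)
  have 8: "runs D H (Push 19 True) (?s4(21 := unary (l - m), 19 := unary ((l - m) * l))) 1 (?s4(21 := unary (l - m), 19 := unary (l * l + 1 - m * l)))"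
    by (rule runs_Push) (use m in \<open>auto simp: fun_eq_iff algebra_simps diff_mult_distrib Suc_diff_le unary_Cons simp del: replicate_Suc\<close>)
  have 9: "runs D H (Clear 21) (?s4(21 := unary (l - m), 19 := unary (l * l + 1 - m * l))) (2 * B + 1) s'"
    by (rule runs_Clear) (use e b s' in \<open>auto simp: fun_eq_iff\<close>)
  show ?thesis unfolding Sizes_def
    by (rule runs_mono[OF runs_Seq[OF 1 runs_Seq[OF 2 runs_Seq[OF 3 runs_Seq[OF 4 runs_Seq[OF 5 runs_Seq[OF 6
       runs_Seq[OF 7 runs_Seq[OF 8 9]]]]]]]]]) (simp add: algebra_simps)
qed

definition Enc :: prog where
  "Enc = Seq (Copy 0 26 7) (Seq (For 22 (Seq (Pop 26) (Push 18 True))) (For 26 (Push 18 False)))"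

lemma runs_Enc:
  assumes s: "s 0 = unary l" "s 22 = unary a" "s 7 = []" "s 26 = []" and a: "a \<le> l" "l \<le> B"
    and s': "s' = s(18 := enc l a @ s 18, 22 := [])"
  shows "runs D H Enc s (14 * B + 4) s'"
proof -
  have 1: "runs D H (Copy 0 26 7) s (7 * B + 2) (s(26 := unary l))"
    by (rule runs_Copy[where n = l]) (use s a in auto)
  let ?s2 = "s(26 := unary (l - a), 18 := unary a @ s 18, 22 := [])"
  have 2: "runs D H (For 22 (Seq (Pop 26) (Push 18 True))) (s(26 := unary l)) (B * ((1 + 1) + 2) + 1) ?s2"
  proof (rule runs_For_le[where n = a and S = "\<lambda>i. s(26 := unary (l - i), 18 := unary i @ s 18)"])
    fix i w
    show "runs D H (Seq (Pop 26) (Push 18 True)) ((s(26 := unary (l - i), 18 := unary i @ s 18))(22 := unary w)) (1 + 1)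
       ((s(26 := unary (l - Suc i), 18 := unary (Suc i) @ s 18))(22 := unary w))"
      by (rule runs_Seq[OF runs_Pop[OF refl] runs_Push]) (auto simp: fun_eq_iff)
  qed (use s a in \<open>auto simp: fun_eq_iff\<close>)
  have 3: "runs D H (For 26 (Push 18 False)) ?s2 (B * (1 + 2) + 1) s'"
  proof (rule runs_For_le[where n = "l - a" and S = "\<lambda>i. s(18 := replicate i False @ unary a @ s 18, 22 := [])"])
    fix i w
    show "runs D H (Push 18 False) ((s(18 := replicate i False @ unary a @ s 18, 22 := []))(26 := unary w)) 1
       ((s(18 := replicate (Suc i) False @ unary a @ s 18, 22 := []))(26 := unary w))"
      by (rule runs_Push) (auto simp: fun_eq_iff)
  qed (use s a s' in \<open>auto simp: fun_eq_iff enc_def\<close>)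
  show ?thesis unfolding Enc_def by (rule runs_mono[OF runs_Seq[OF 1 runs_Seq[OF 2 3]]]) simp
qed

text \<open>The product is accumulated by nested increments modulo \<open>l\<close>; the next
  coefficient is added by one increment for each one among the next \<open>l\<close> candidate bits,
  where bits past the end of the candidate count as zero.\<close>

definition Horner_step :: prog where
  "Horner_step = Seq (Copy 8 27 7) (Seq (For 22 (Rep 15 26 7 (Inc 25 27)))
     (Seq (Rep 0 26 7 (Branch 23 Skip (Seq (Pop 23) (Inc 25 27)) (Pop 23))) (Seq (Clear 27) (For 25 (Push 22 True)))))"

definition horner_time :: "nat \<Rightarrow> nat" where
  "horner_time B = B * (B * (3 * B + 12) + 5) + B * (3 * B + 14) + 12 * B + 8"

lemma runs_Horner_step:
  assumes s: "s 0 = unary l" "s 8 = unary (l - 1)" "s 15 = unary x" "s 22 = unary a" "s 23 = w"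
    and e: "s 7 = []" "s 25 = []" "s 26 = []" "s 27 = []"
    and l: "0 < l" "l \<le> B" "x \<le> B" "a < l"
    and s': "s' = s(22 := unary ((a * x + length (filter id (take l w))) mod l), 23 := drop l w)"
  shows "runs D H Horner_step s (horner_time B) s'"
proof -
  let ?S = "\<lambda>r v. s(22 := v, 25 := unary (r mod l), 27 := unary (l - 1 - r mod l))"
  have 1: "runs D H (Copy 8 27 7) s (7 * B + 2) (?S 0 (unary a))"
    by (rule runs_Copy[where n = "l - 1"]) (use s e l in \<open>auto simp: fun_eq_iff\<close>)
  have 2: "runs D H (For 22 (Rep 15 26 7 (Inc 25 27))) (?S 0 (unary a)) (B * ((B * ((3 * B + 3) + 9) + 3) + 2) + 1) (?S (a * x) [])"
  proof (rule runs_For_le[where n = a and S = "\<lambda>i. ?S (i * x) []"])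
    fix i w
    show "runs D H (Rep 15 26 7 (Inc 25 27)) ((?S (i * x) [])(22 := unary w)) (B * ((3 * B + 3) + 9) + 3) ((?S (Suc i * x) [])(22 := unary w))"
    proof (rule runs_Rep[where n = x and S = "\<lambda>j. (?S (i * x + j) (unary w))"])
      fix j v
      show "runs D H (Inc 25 27) ((?S (i * x + j) (unary w))(26 := unary v)) (3 * B + 3) ((?S (i * x + Suc j) (unary w))(26 := unary v))"
        by (rule runs_Inc[where x = "(i * x + j) mod l" and d = l]) (use l in \<open>auto simp: fun_eq_iff mod_Suc_eq\<close>)
    qed (use s e l in \<open>auto simp: fun_eq_iff add.commute\<close>)
  qed (use s e l in \<open>auto simp: fun_eq_iff\<close>)
  let ?c = "\<lambda>i. a * x + length (filter id (take i w))"
  let ?T = "\<lambda>i. (?S (?c i) [])(23 := drop i w)"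
  have 3: "runs D H (Rep 0 26 7 (Branch 23 Skip (Seq (Pop 23) (Inc 25 27)) (Pop 23))) (?S (a * x) [])
     (B * (((1 + (3 * B + 3)) + 1) + 9) + 3) (?T l)"
  proof (rule runs_Rep[where n = l and S = ?T])
    fix i v
    show "runs D H (Branch 23 Skip (Seq (Pop 23) (Inc 25 27)) (Pop 23)) ((?T i)(26 := unary v)) ((1 + (3 * B + 3)) + 1) ((?T (Suc i))(26 := unary v))"
    proof (cases "i < length w")
      case False
      then have "runs D H Skip ((?T i)(26 := unary v)) (1 + (3 * B + 3)) ((?T (Suc i))(26 := unary v))"
        by (intro runs_eq[OF runs_Skip]) (auto simp: fun_eq_iff)
      then show ?thesis by (rule runs_Branch_empty[rotated]) (use False in auto)
    next
      case True
      then have d: "drop i w = w ! i # drop (Suc i) w" and t: "take (Suc i) w = take i w @ [w ! i]"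
        by (simp_all add: Cons_nth_drop_Suc take_Suc_conv_app_nth)
      show ?thesis
      proof (cases "w ! i")
        case True
        have "runs D H (Inc 25 27) ((?T i)(26 := unary v, 23 := drop (Suc i) w)) (3 * B + 3) ((?T (Suc i))(26 := unary v))"
          by (rule runs_Inc[where x = "?c i mod l" and d = l]) (use l True t in \<open>auto simp: fun_eq_iff mod_Suc_eq\<close>)
        then have "runs D H (Seq (Pop 23) (Inc 25 27)) ((?T i)(26 := unary v)) (1 + (3 * B + 3)) ((?T (Suc i))(26 := unary v))"
          by (rule runs_Seq[OF runs_Pop, rotated]) (auto simp: fun_eq_iff d)
        then show ?thesis by (rule runs_Branch_True[rotated]) (use True d in simp)
      next
        case False
        have "runs D H (Pop 23) ((?T i)(26 := unary v)) 1 ((?T (Suc i))(26 := unary v))"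
          by (rule runs_Pop) (use False in \<open>auto simp: fun_eq_iff d t\<close>)
        then have "runs D H (Pop 23) ((?T i)(26 := unary v)) (1 + (3 * B + 3)) ((?T (Suc i))(26 := unary v))"
          by (rule runs_mono) simp
        then show ?thesis by (rule runs_Branch_False[rotated]) (use False d in simp)
      qed
    qed
  qed (use s e l in \<open>auto simp: fun_eq_iff\<close>)
  let ?r = "?c l mod l"
  let ?s4 = "s(22 := [], 25 := unary ?r, 23 := drop l w)"
  have r: "?r \<le> B" using mod_less_divisor[OF l(1), of "?c l"] l(2) by linarith
  have 4: "runs D H (Clear 27) (?T l) (2 * B + 1) ?s4"
    by (rule runs_Clear) (use e l in \<open>auto simp: fun_eq_iff\<close>)
  have 5: "runs D H (For 25 (Push 22 True)) ?s4 (B * (1 + 2) + 1) s'"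
  proof (rule runs_For_le[where n = ?r and S = "\<lambda>i. s(22 := unary i, 23 := drop l w)"])
    fix i v
    show "runs D H (Push 22 True) ((s(22 := unary i, 23 := drop l w))(25 := unary v)) 1 ((s(22 := unary (Suc i), 23 := drop l w))(25 := unary v))"
      by (rule runs_Push) (auto simp: fun_eq_iff)
  qed (use e l r s' in \<open>auto simp: fun_eq_iff\<close>)
  show ?thesis unfolding Horner_step_def horner_time_def
    by (rule runs_mono[OF runs_Seq[OF 1 runs_Seq[OF 2 runs_Seq[OF 3 runs_Seq[OF 4 5]]]]]) (simp add: algebra_simps)
qed

definition Eval :: prog where
  "Eval = Seq (Copy_bits 14 23 7) (Seq (Rep 12 24 7 Horner_step) (Clear 23))"

lemma horner_mod_less: "0 < p \<Longrightarrow> horner_mod p cs x < p"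
  by (cases cs rule: rev_cases) (simp_all add: horner_mod_def)

lemma runs_Eval:
  assumes s: "s 0 = unary l" "s 8 = unary (l - 1)" "s 12 = unary (code_dim l)" "s 14 = z" "s 15 = unary x"
    and e: "s 7 = []" "s 22 = []" "s 23 = []" "s 24 = []" "s 25 = []" "s 26 = []" "s 27 = []"
    and l: "0 < l" "l \<le> B" "x \<le> B" "code_dim l \<le> B" "length z \<le> B"
    and s': "s' = s(22 := unary (code_value l z x))"
  shows "runs D H Eval s (B * (horner_time B + 9) + 11 * B + 6) s'"
proof -
  define h where "h i = horner_mod l (map (digit l z) [0..<i]) x" for i
  have h0: "h 0 = 0" by (simp add: h_def horner_mod_def)
  have hS: "h (Suc i) = (h i * x + length (filter id (take l (drop (i * l) z)))) mod l" for i
    by (simp add: h_def horner_mod_def digit_def)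
  have hl: "h i < l" for i
    unfolding h_def by (rule horner_mod_less[OF l(1)])
  have hc: "h (code_dim l) = code_value l z x" by (simp add: h_def code_value_def)
  let ?S = "\<lambda>i. s(22 := unary (h i), 23 := drop (i * l) z)"
  have 1: "runs D H (Copy_bits 14 23 7) s (9 * B + 2) (?S 0)"
    by (rule runs_Copy_bits) (use s e l in \<open>auto simp: fun_eq_iff h0\<close>)
  have 2: "runs D H (Rep 12 24 7 Horner_step) (?S 0) (B * (horner_time B + 9) + 3) (?S (code_dim l))"
  proof (rule runs_Rep[where n = "code_dim l" and S = ?S])
    fix i v
    show "runs D H Horner_step ((?S i)(24 := unary v)) (horner_time B) ((?S (Suc i))(24 := unary v))"
    proof (rule runs_Horner_step[where a = "h i" and x = x and l = l and w = "drop (i * l) z"])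
      show "(?S (Suc i))(24 := unary v) = (?S i)(24 := unary v,
          22 := unary ((h i * x + length (filter id (take l (drop (i * l) z)))) mod l), 23 := drop l (drop (i * l) z))"
        unfolding hS[symmetric] by (rule ext) simp
    qed (use s e l hl[of i] in \<open>simp_all\<close>)
  qed (use s e l h0 in \<open>auto simp: fun_eq_iff\<close>)
  have 3: "runs D H (Clear 23) (?S (code_dim l)) (2 * B + 1) s'"
    by (rule runs_Clear) (use e l s' hc in \<open>auto simp: fun_eq_iff\<close>)
  show ?thesis unfolding Eval_def by (rule runs_mono[OF runs_Seq[OF 1 runs_Seq[OF 2 3]]]) simp
qed

definition Check :: prog where
  "Check = Seq (Rep 5 26 7 (Branch 18 Skip (Seq (Pop 18) (Push 28 True)) (Pop 18)))
     (Seq (Branch 28 (Pop 6) Skip Skip) (Seq (Clear 28) (Clear 18)))"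

lemma marked_filter: "mark_len l \<le> length y \<Longrightarrow> marked l y \<longleftrightarrow> filter id (take (mark_len l) y) \<noteq> []"
proof -
  assume "mark_len l \<le> length y"
  then have len: "length (take (mark_len l) y) = mark_len l" by simp
  have "marked l y \<longleftrightarrow> (\<exists>b\<in>set (take (mark_len l) y). b)"
    unfolding marked_def using len replicate_eqI[of "take (mark_len l) y" "mark_len l" False] by auto
  then show ?thesis by (auto simp: filter_empty_conv)
qed

lemma runs_Check:
  assumes s: "s 5 = unary (mark_len l)" "s 18 = y" "s 6 = flag b" "s 7 = []" "s 26 = []" "s 28 = []"
    and B: "mark_len l \<le> length y" "length y \<le> B"
    and s': "s' = s(6 := flag (b \<and> marked l y), 18 := [])"
  shows "runs D H Check s (16 * B + 9) s'"
proof -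
  let ?S = "\<lambda>i. s(18 := drop i y, 28 := unary (length (filter id (take i y))))"
  let ?m = "mark_len l"
  have 1: "runs D H (Rep 5 26 7 (Branch 18 Skip (Seq (Pop 18) (Push 28 True)) (Pop 18))) s (B * (((1 + 1) + 1) + 9) + 3) (?S ?m)"
  proof (rule runs_Rep[where n = ?m and S = ?S])
    fix i v assume "i < ?m"
    then have "i < length y" using B by simp
    then have d: "drop i y = y ! i # drop (Suc i) y" and t: "take (Suc i) y = take i y @ [y ! i]"
      by (simp_all add: Cons_nth_drop_Suc take_Suc_conv_app_nth)
    show "runs D H (Branch 18 Skip (Seq (Pop 18) (Push 28 True)) (Pop 18)) ((?S i)(26 := unary v)) ((1 + 1) + 1) ((?S (Suc i))(26 := unary v))"
    proof (cases "y ! i")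
      case True
      have "runs D H (Seq (Pop 18) (Push 28 True)) ((?S i)(26 := unary v)) (1 + 1) ((?S (Suc i))(26 := unary v))"
        by (rule runs_Seq[OF runs_Pop[OF refl] runs_Push]) (use True in \<open>auto simp: fun_eq_iff d t\<close>)
      then show ?thesis by (rule runs_Branch_True[rotated]) (use True d in simp)
    next
      case False
      have "runs D H (Pop 18) ((?S i)(26 := unary v)) 1 ((?S (Suc i))(26 := unary v))"
        by (rule runs_Pop) (use False in \<open>auto simp: fun_eq_iff d t\<close>)
      then have "runs D H (Pop 18) ((?S i)(26 := unary v)) (1 + 1) ((?S (Suc i))(26 := unary v))"
        by (rule runs_mono) simp
      then show ?thesis by (rule runs_Branch_False[rotated]) (use False d in simp)
    qed
  qed (use s B in \<open>auto simp: fun_eq_iff\<close>)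
  let ?s2 = "(?S ?m)(6 := flag (b \<and> marked l y))"
  have 2: "runs D H (Branch 28 (Pop 6) Skip Skip) (?S ?m) (1 + 1) ?s2"
  proof (cases "marked l y")
    case True
    then obtain c where c: "length (filter id (take ?m y)) = Suc c"
      using marked_filter[OF B(1)] by (cases "filter id (take ?m y)") auto
    have "runs D H Skip (?S ?m) 1 ?s2" by (rule runs_eq[OF runs_Skip]) (use s True in \<open>auto simp: fun_eq_iff\<close>)
    then show ?thesis by (rule runs_Branch_True[where w = "unary c", rotated]) (simp add: c)
  next
    case False
    have "runs D H (Pop 6) (?S ?m) 1 ?s2" by (rule runs_Pop) (use s False in \<open>auto simp: fun_eq_iff\<close>)
    then show ?thesis by (rule runs_Branch_empty[rotated]) (use False marked_filter[OF B(1)] in simp)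
  qed
  have lf: "length (filter id (take ?m y)) \<le> B"
    using length_filter_le[of id "take ?m y"] B by simp
  have 3: "runs D H (Clear 28) ?s2 (2 * B + 1) (?s2(28 := []))"
    by (rule runs_Clear) (use lf in auto)
  have 4: "runs D H (Clear 18) (?s2(28 := [])) (2 * B + 1) s'"
    by (rule runs_Clear) (use s s' B in \<open>auto simp: fun_eq_iff\<close>)
  show ?thesis unfolding Check_def
    by (rule runs_mono[OF runs_Seq[OF 1 runs_Seq[OF 2 runs_Seq[OF 3 4]]]]) simp
qed

text \<open>What every round of the block loop finds and preserves, apart from the running position,
  the block number and the flag.\<close>

definition block_ready :: "nat \<Rightarrow> bitstr \<Rightarrow> bitstr \<Rightarrow> (nat \<Rightarrow> bitstr) \<Rightarrow> bool" where
  "block_ready l k z s \<longleftrightarrow> s 0 = unary l \<and> s 1 = k \<and> s 4 = unary (fold_len l) \<and> s 5 = unary (mark_len l) \<and>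
     s 8 = unary (l - 1) \<and> s 12 = unary (code_dim l) \<and> s 14 = z \<and> s 19 = unary (l * l + 1 - fold_len l * l) \<and>
     s 7 = [] \<and> s 18 = [] \<and> s 21 = [] \<and> s 22 = [] \<and> s 23 = [] \<and> s 24 = [] \<and> s 25 = [] \<and> s 26 = [] \<and> s 27 = [] \<and> s 28 = []"

definition Block :: prog where
  "Block = Seq (Rep 4 21 7 (Seq Eval (Seq Enc (Push 15 True)))) (Seq (Rep 19 26 7 (Push 18 False))
     (Seq (Copy 16 22 7) (Seq Enc (Seq (Copy_bits 1 18 7) (Seq (Push 18 True) (Seq (Query 18) (Seq Check (Push 16 True))))))))"

definition block_time :: "nat \<Rightarrow> nat" where
  "block_time B = B * (B * (horner_time B + 9) + 25 * B + 20) + 56 * B + 30"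

lemma runs_Block:
  fixes l k z
  defines "v \<equiv> \<lambda>i. block_point l k i (code_block l (code_value l z) i)"
  assumes s: "block_ready l k z s" "s 15 = unary (i * fold_len l)" "s 16 = unary i" "s 6 = flag b"
    and l: "prime l" "i < block_count l"
    and D: "D = bitstrs (length k + l * l + l + 2)" "\<And>w. w \<in> D \<Longrightarrow> length (H w) = 2 * l + 6"
    and B: "l * l + 1 \<le> B" "length z \<le> B" "length k \<le> B" "2 * l + 6 \<le> B"
    and s': "s' = s(15 := unary (Suc i * fold_len l), 16 := unary (Suc i), 6 := flag (b \<and> marked l (H (v i))))"
  shows "runs D H Block s (block_time B) s'"
proof -
  note r = s(1)[unfolded block_ready_def]
  let ?m = "fold_len l"
  define F where "F = code_value l z"
  define P where "P j = foldl (\<lambda>s a. enc l a @ s) [] (map (\<lambda>j. F (i * ?m + j)) [0..<j])" for j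
  have l0: "0 < l" using l(1) prime_gt_0_nat by blast
  have il: "i \<le> l" using block_count_le[OF l(1)] l(2) by linarith
  have m: "?m \<le> B" "code_dim l \<le> B" using fold_len_le[OF l0, of 1] fold_len_le[OF l0, of 3] B(4) by (auto simp: code_dim_def)
  have P0: "P 0 = []" and PS: "P (Suc j) = enc l (F (i * ?m + j)) @ P j" for j
    by (simp_all add: P_def)
  have Fl: "F x \<le> l" for x
    unfolding F_def code_value_def using horner_mod_less[OF l0] less_imp_le by blast
  have vi: "v i = True # k @ enc l i @ replicate (l * l + 1 - ?m * l) False @ P ?m"
    by (simp add: v_def block_point_def code_block_def P_def F_def)
  have vD: "v i \<in> D"
    unfolding v_def D(1) using block_point_in[OF refl il l0, of "code_block l (code_value l z) i" k] Fl
    by (auto simp: code_block_def F_def)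
  let ?pad = "l * l + 1 - ?m * l"
  let ?s1 = "s(15 := unary (i * ?m + ?m), 18 := P ?m)"
  have 1: "runs D H (Rep 4 21 7 (Seq Eval (Seq Enc (Push 15 True)))) s
      (B * (((B * (horner_time B + 9) + 11 * B + 6) + ((14 * B + 4) + 1)) + 9) + 3) ?s1"
  proof (rule runs_Rep[where n = ?m and S = "\<lambda>j. s(15 := unary (i * ?m + j), 18 := P j)"])
    fix j w assume j: "j < ?m"
    have x: "i * ?m + j \<le> B" using code_index_less[OF l j] B(4) by linarith
    let ?t = "s(15 := unary (i * ?m + j), 18 := P j, 21 := unary w)"
    have e1: "runs D H Eval ?t (B * (horner_time B + 9) + 11 * B + 6) (?t(22 := unary (F (i * ?m + j))))"
      unfolding F_def by (rule runs_Eval[where l = l and z = z]) (use r s x B m l0 in simp_all)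
    have e2: "runs D H Enc (?t(22 := unary (F (i * ?m + j)))) (14 * B + 4) (?t(18 := P (Suc j)))"
      by (rule runs_Enc[where a = "F (i * ?m + j)" and l = l]) (use r B Fl in \<open>simp_all add: fun_eq_iff PS\<close>)
    have e3: "runs D H (Push 15 True) (?t(18 := P (Suc j))) 1 (s(15 := unary (i * ?m + Suc j), 18 := P (Suc j), 21 := unary w))"
      by (rule runs_Push) (simp add: fun_eq_iff)
    show "runs D H (Seq Eval (Seq Enc (Push 15 True))) ?t ((B * (horner_time B + 9) + 11 * B + 6) + ((14 * B + 4) + 1))
        (s(15 := unary (i * ?m + Suc j), 18 := P (Suc j), 21 := unary w))"
      by (rule runs_Seq[OF e1 runs_Seq[OF e2 e3]])
  next
    show "s(15 := unary (i * ?m + 0), 18 := P 0) = s" using s r by (auto simp: fun_eq_iff P0)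
  qed (use r m in simp_all)
  let ?s2 = "\<lambda>y. s(15 := unary (Suc i * ?m), 18 := y)"
  have 2: "runs D H (Rep 19 26 7 (Push 18 False)) ?s1 (B * (1 + 9) + 3) (?s2 (replicate ?pad False @ P ?m))"
  proof (rule runs_Rep[where n = ?pad and S = "\<lambda>j. ?s2 (replicate j False @ P ?m)"])
    fix j w
    show "runs D H (Push 18 False) ((?s2 (replicate j False @ P ?m))(26 := unary w)) 1 ((?s2 (replicate (Suc j) False @ P ?m))(26 := unary w))"
      by (rule runs_Push) (simp add: fun_eq_iff)
  qed (use r B in \<open>simp_all add: fun_eq_iff add.commute\<close>)
  have 3: "runs D H (Copy 16 22 7) (?s2 (replicate ?pad False @ P ?m)) (7 * B + 2) ((?s2 (replicate ?pad False @ P ?m))(22 := unary i))"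
    by (rule runs_Copy[where n = i]) (use r s il B in simp_all)
  have 4: "runs D H Enc ((?s2 (replicate ?pad False @ P ?m))(22 := unary i)) (14 * B + 4) (?s2 (enc l i @ replicate ?pad False @ P ?m))"
    by (rule runs_Enc[where a = i and l = l]) (use r B il in \<open>simp_all add: fun_eq_iff\<close>)
  have 5: "runs D H (Copy_bits 1 18 7) (?s2 (enc l i @ replicate ?pad False @ P ?m)) (9 * B + 2) (?s2 (k @ enc l i @ replicate ?pad False @ P ?m))"
    by (rule runs_Copy_bits) (use r B in \<open>simp_all add: fun_eq_iff\<close>)
  have 6: "runs D H (Push 18 True) (?s2 (k @ enc l i @ replicate ?pad False @ P ?m)) 1 (?s2 (v i))"
    by (rule runs_Push) (simp add: fun_eq_iff vi)
  have 7: "runs D H (Query 18) (?s2 (v i)) 1 (?s2 (H (v i)))"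
    by (rule runs_Query) (use vD in \<open>simp_all add: fun_eq_iff\<close>)
  let ?s8 = "s(15 := unary (Suc i * ?m), 6 := flag (b \<and> marked l (H (v i))))"
  have ml: "mark_len l \<le> 2 * l + 6" using log256_le[of l] by (simp add: mark_len_def)
  have 8: "runs D H Check (?s2 (H (v i))) (16 * B + 9) ?s8"
    by (rule runs_Check[where l = l and b = b]) (use r s B D(2)[OF vD] ml in \<open>simp_all add: fun_eq_iff\<close>)
  have 9: "runs D H (Push 16 True) ?s8 1 s'"
    by (rule runs_Push) (use s s' in \<open>simp add: fun_eq_iff\<close>)
  show ?thesis unfolding Block_def block_time_def
    by (rule runs_mono[OF runs_Seq[OF 1 runs_Seq[OF 2 runs_Seq[OF 3 runs_Seq[OF 4 runs_Seq[OF 5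
       runs_Seq[OF 6 runs_Seq[OF 7 runs_Seq[OF 8 9]]]]]]]]]) (simp add: algebra_simps)
qed

definition Solve :: prog where
  "Solve = Seq Sizes (Seq (Copy_bits 2 14 7) (Seq (Rep 0 26 7 (Pop 14)) (Rep 13 17 7 Block)))"

definition solve_time :: "nat \<Rightarrow> nat" where
  "solve_time B = 5 * (B * (14 * B + 22) + 3) + B * (block_time B + 9) + 50 * B + 40"

lemma runs_Solve:
  assumes s: "s 0 = unary l" "s 1 = k" "s 2 = x" "s 4 = unary (fold_len l)" "s 5 = unary (mark_len l)"
      "s 6 = [True]" "s 8 = unary (l - 1)"
    and e: "\<And>r. r \<ge> 12 \<or> r = 7 \<Longrightarrow> s r = []"
    and l: "prime l"
    and D: "D = bitstrs (length k + l * l + l + 2)" "\<And>w. w \<in> D \<Longrightarrow> length (H w) = 2 * l + 6"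
    and B: "l * l + 1 \<le> B" "length x \<le> B" "length k \<le> B" "2 * l + 6 \<le> B"
  shows "\<exists>s'. runs D H Solve s (solve_time B) s' \<and> (\<forall>r\<in>{0, 1, 2, 7, 18, 26, 29}. s' r = s r) \<and> s' 6 = flag (solves l H k (drop l x))"
proof -
  let ?m = "fold_len l"
  have l0: "0 < l" using l prime_gt_0_nat by blast
  have m: "?m \<le> l" "?m ^ 3 \<le> l" "block_count l \<le> B"
    using fold_len_le[OF l0, of 1] fold_len_le[OF l0, of 3] block_count_le[OF l] B(4) by auto
  let ?s1 = "s(12 := unary (?m ^ 3), 13 := unary (2 * ?m ^ 4), 19 := unary (l * l + 1 - ?m * l))"
  have 1: "runs D H Sizes s (5 * (B * (14 * B + 22) + 3) + 30 * B + 20) ?s1"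
    by (rule runs_Sizes[where l = l and m = ?m]) (use s e B m in simp_all)
  have 2: "runs D H (Copy_bits 2 14 7) ?s1 (9 * B + 2) (?s1(14 := x))"
    by (rule runs_Copy_bits) (use s e B in \<open>simp_all add: fun_eq_iff\<close>)
  have 3: "runs D H (Rep 0 26 7 (Pop 14)) (?s1(14 := x)) (B * (1 + 9) + 3) (?s1(14 := drop l x))"
  proof (rule runs_Rep[where n = l and S = "\<lambda>i. ?s1(14 := drop i x)"])
    fix i w
    show "runs D H (Pop 14) (?s1(14 := drop i x, 26 := unary w)) 1 (?s1(14 := drop (Suc i) x, 26 := unary w))"
      by (rule runs_Pop) (simp add: fun_eq_iff drop_Suc tl_drop)
  qed (use s e B in simp_all)
  define z where "z = drop l x"
  let ?b = "\<lambda>i. \<forall>j<i. marked l (H (block_point l k j (code_block l (code_value l z) j)))"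
  let ?s3 = "?s1(14 := z)"
  let ?S = "\<lambda>i. ?s3(15 := unary (i * ?m), 16 := unary i, 6 := flag (?b i))"
  have 4: "runs D H (Rep 13 17 7 Block) ?s3 (B * (block_time B + 9) + 3) (?S (block_count l))"
  proof (rule runs_Rep[where n = "block_count l" and S = ?S])
    fix i w assume i: "i < block_count l"
    have b: "?b (Suc i) \<longleftrightarrow> ?b i \<and> marked l (H (block_point l k i (code_block l (code_value l z) i)))"
      by (auto simp: less_Suc_eq)
    have rd: "block_ready l k z ((?S i)(17 := unary w))"
      unfolding block_ready_def using s e by (simp add: code_dim_def)
    show "runs D H Block ((?S i)(17 := unary w)) (block_time B) ((?S (Suc i))(17 := unary w))"
      by (rule runs_Block[where l = l and k = k and z = z and i = i and b = "?b i", OF rd _ _ _ l i D(1) D(2)])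
        (use s e B b in \<open>simp_all add: fun_eq_iff z_def\<close>)
  qed (use s e m in \<open>simp_all add: block_count_def fun_eq_iff\<close>)
  have "runs D H Solve s (solve_time B) (?S (block_count l))"
    unfolding Solve_def solve_time_def
    by (rule runs_mono[OF runs_Seq[OF 1 runs_Seq[OF 2 runs_Seq[OF 3[folded z_def] 4]]]]) (simp add: algebra_simps)
  moreover have "?S (block_count l) 6 = flag (solves l H k (drop l x))"
    using l by (simp add: solves_def z_def)
  ultimately show ?thesis by (intro exI[of _ "?S (block_count l)"] conjI) simp_all
qed

definition Output :: prog where
  "Output = Seq (Rep 0 26 7 (Branch 18 Skip (Seq (Pop 18) (Push 29 True)) (Seq (Pop 18) (Push 29 False))))
     (Seq (Clear 0) (Move_bits 29 0))"

lemma runs_Output: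
  assumes s: "s 0 = unary l" "s 18 = y" "s 7 = []" "s 26 = []" "s 29 = []" and B: "l \<le> length y" "l \<le> B"
  shows "\<exists>s'. runs D H Output s (18 * B + 5) s' \<and> s' 0 = take l y"
proof -
  let ?S = "\<lambda>i. s(18 := drop i y, 29 := rev (take i y))"
  let ?c = "Branch 18 Skip (Seq (Pop 18) (Push 29 True)) (Seq (Pop 18) (Push 29 False))"
  have 1: "runs D H (Rep 0 26 7 ?c) s (B * (((1 + 1) + 1) + 9) + 3) (?S l)"
  proof (rule runs_Rep[where n = l and S = ?S])
    fix i w assume "i < l"
    then have "i < length y" using B by simp
    then have d: "drop i y = y ! i # drop (Suc i) y" and t: "take (Suc i) y = take i y @ [y ! i]"
      by (simp_all add: Cons_nth_drop_Suc take_Suc_conv_app_nth)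
    have pp: "runs D H (Seq (Pop 18) (Push 29 (y ! i))) ((?S i)(26 := unary w)) (1 + 1) ((?S (Suc i))(26 := unary w))"
      by (rule runs_Seq[OF runs_Pop[OF refl] runs_Push]) (simp add: fun_eq_iff d t)
    show "runs D H ?c ((?S i)(26 := unary w)) ((1 + 1) + 1) ((?S (Suc i))(26 := unary w))"
    proof (cases "y ! i")
      case True
      with pp show ?thesis by (intro runs_Branch_True[where w = "drop (Suc i) y"]) (simp_all add: d)
    next
      case False
      with pp show ?thesis by (intro runs_Branch_False[where w = "drop (Suc i) y"]) (simp_all add: d)
    qed
  qed (use s B in \<open>simp_all add: fun_eq_iff\<close>)
  have 2: "runs D H (Clear 0) (?S l) (2 * B + 1) ((?S l)(0 := []))"
    by (rule runs_Clear) (use s B in simp_all)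
  have 3: "runs D H (Move_bits 29 0) ((?S l)(0 := [])) (4 * B + 1) (s(18 := drop l y, 29 := [], 0 := take l y))"
    by (rule runs_Move_bits) (use B in \<open>simp_all add: fun_eq_iff\<close>)
  have "runs D H Output s (18 * B + 5) (s(18 := drop l y, 29 := [], 0 := take l y))"
    unfolding Output_def by (rule runs_mono[OF runs_Seq[OF 1 runs_Seq[OF 2 3]]]) simp
  then show ?thesis by auto
qed

text \<open>Both alternatives place a string in register 18, the input itself or the oracle's
  answer, and \<open>Output\<close> cuts off its first \<open>l\<close> bits. \<open>Solve\<close>
  runs only for prime \<open>l\<close>, which the bounds in its block loop presuppose.\<close>

definition Hash :: prog where
  "Hash = Seq Fold_params (Seq Prime_test (Seq (Branch 6 Skip Solve Skip)
     (Seq (Branch 6 (Seq (Copy_bits 2 18 7) (Seq (Copy_bits 1 18 7) (Seq (Push 18 False) (Query 18)))) (Copy_bits 2 18 7) Skip)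
     Output)))"

definition hash_time :: "nat \<Rightarrow> nat" where
  "hash_time B = B * (274 * B + 11) + B * (divisor_time B + 9) + solve_time B + 70 * B + 60"

lemma runs_Hash:
  assumes k: "length k = \<kappa>" and x: "x \<in> bitstrs (l * l + l + 1)"
    and H: "H \<in> oracles (\<kappa> + l * l + l + 2) (2 * l + 6)"
    and B: "B = l * l + 3 * l + \<kappa> + 8"
  shows "\<exists>s'. runs (bitstrs (\<kappa> + l * l + l + 2)) H Hash (init_store l k x) (hash_time B) s' \<and> s' 0 = trapdoor_hash l H k x"
proof -
  let ?D = "bitstrs (\<kappa> + l * l + l + 2)"
  let ?s = "init_store l k x"
  have Hl: "length (H w) = 2 * l + 6" if "w \<in> ?D" for w using H that by (auto simp: oracles_def bitstrs_def)
  have lx: "length x = l * l + l + 1" using x by (simp add: bitstrs_def)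
  have fB: "fold_len l \<le> B"
    using fold_len_le[of l 1] B by (cases "l = 0") (auto simp: fold_len_rec[of 0])
  let ?s1 = "?s(4 := unary (fold_len l), 5 := unary (mark_len l))"
  have 1: "runs ?D H Fold_params ?s (B * (274 * B + 11) + 7 * B + 10) ?s1"
    by (rule runs_Fold_params[where l = l]) (use B fB in \<open>simp_all add: init_store_def\<close>)
  let ?s2 = "?s1(6 := flag (prime l), 8 := unary (max 1 (l - 1)))"
  have 2: "runs ?D H Prime_test ?s1 (B * (divisor_time B + 9) + 20) ?s2"
    by (rule runs_Prime_test[where l = l]) (use B in \<open>simp_all add: init_store_def\<close>)
  obtain s3 where 3: "runs ?D H (Branch 6 Skip Solve Skip) ?s2 (solve_time B + 1) s3"
    and s3: "\<forall>r\<in>{0, 1, 2, 7, 18, 26, 29}. s3 r = ?s2 r" "s3 6 = flag (solves l H k (drop l x))"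
  proof (cases "prime l")
    case True
    have "\<exists>s'. runs ?D H Solve ?s2 (solve_time B) s' \<and> (\<forall>r\<in>{0, 1, 2, 7, 18, 26, 29}. s' r = ?s2 r) \<and> s' 6 = flag (solves l H k (drop l x))"
      by (rule runs_Solve[OF _ _ _ _ _ _ _ _ True]) (use True B k lx Hl prime_ge_2_nat[OF True] in \<open>auto simp: init_store_def\<close>)
    then obtain s' where s': "runs ?D H Solve ?s2 (solve_time B) s'" "\<forall>r\<in>{0, 1, 2, 7, 18, 26, 29}. s' r = ?s2 r" "s' 6 = flag (solves l H k (drop l x))"
      by blast
    have "runs ?D H (Branch 6 Skip Solve Skip) ?s2 (solve_time B + 1) s'"
      by (rule runs_Branch_True[OF _ s'(1)]) (use True in simp)
    then show ?thesis using that s' by blast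
  next
    case False
    have "runs ?D H Skip ?s2 (solve_time B) ?s2" by (rule runs_mono[OF runs_Skip]) (simp add: solve_time_def)
    then have "runs ?D H (Branch 6 Skip Solve Skip) ?s2 (solve_time B + 1) ?s2"
      by (rule runs_Branch_empty[rotated]) (use False in simp)
    then show ?thesis using that False by (simp add: solves_def)
  qed
  have s3': "s3 0 = unary l" "s3 1 = k" "s3 2 = x" "s3 7 = []" "s3 18 = []" "s3 26 = []" "s3 29 = []"
    using s3(1) by (simp_all add: init_store_def)
  let ?y = "if solves l H k (drop l x) then x else H (hash_point k x)"
  let ?s4 = "s3(18 := ?y)"
  let ?copy = "Copy_bits 2 18 7" and ?hash = "Seq (Copy_bits 2 18 7) (Seq (Copy_bits 1 18 7) (Seq (Push 18 False) (Query 18)))"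
  have cp: "runs ?D H ?copy s3 (9 * B + 2) (s3(18 := x))"
    by (rule runs_Copy_bits) (use s3' lx B in \<open>simp_all add: fun_eq_iff\<close>)
  have hD: "hash_point k x \<in> ?D" using k lx by (simp add: hash_point_def bitstrs_def)
  have 4: "runs ?D H (Branch 6 ?hash ?copy Skip) s3 (((9 * B + 2) + ((9 * B + 2) + (1 + 1))) + 1) ?s4"
  proof (cases "solves l H k (drop l x)")
    case True
    have "runs ?D H ?copy s3 ((9 * B + 2) + ((9 * B + 2) + (1 + 1))) ?s4" by (rule runs_eq[OF cp]) (use True in simp_all)
    then show ?thesis by (rule runs_Branch_True[rotated]) (use True s3(2) in simp)
  next
    case False
    have c2: "runs ?D H (Copy_bits 1 18 7) (s3(18 := x)) (9 * B + 2) (s3(18 := k @ x))"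
      by (rule runs_Copy_bits) (use s3' k B in \<open>simp_all add: fun_eq_iff\<close>)
    have c3: "runs ?D H (Push 18 False) (s3(18 := k @ x)) 1 (s3(18 := hash_point k x))"
      by (rule runs_Push) (simp add: fun_eq_iff hash_point_def)
    have c4: "runs ?D H (Query 18) (s3(18 := hash_point k x)) 1 ?s4"
      by (rule runs_Query) (use hD False in \<open>simp_all add: fun_eq_iff\<close>)
    show ?thesis
      by (rule runs_Branch_empty[OF _ runs_Seq[OF cp runs_Seq[OF c2 runs_Seq[OF c3 c4]]]]) (use False s3(2) in simp)
  qed
  have ly: "l \<le> length ?y" using lx Hl[OF hD] by simp
  obtain s5 where 5: "runs ?D H Output ?s4 (18 * B + 5) s5" "s5 0 = take l ?y"
    using runs_Output[of ?s4 l ?y B ?D H] s3' ly B by auto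
  have "runs ?D H Hash ?s (hash_time B) s5"
    unfolding Hash_def hash_time_def
    by (rule runs_mono[OF runs_Seq[OF 1 runs_Seq[OF 2 runs_Seq[OF 3 runs_Seq[OF 4 5(1)]]]]]) (simp add: algebra_simps)
  moreover have "s5 0 = trapdoor_hash l H k x" using 5(2) by (simp add: trapdoor_hash_def)
  ultimately show ?thesis by blast
qed

lemma pbounded_hash_time: "pbounded f \<Longrightarrow> pbounded (\<lambda>l. hash_time (f l))"
  unfolding hash_time_def solve_time_def block_time_def divisor_time_def horner_time_def
  by (intro pbounded_intros)

lemma polytime_lengthI:
  assumes "\<And>l. \<exists>s. runs {} (\<lambda>_. []) c (init_store l [] []) (T l) s \<and> s 0 = unary (len l)" "pbounded T"
  shows "polytime_length len"
proof -
  obtain p :: "nat poly" where p: "\<And>l. T l \<le> poly p l" using assms(2) by (auto simp: pbounded_def)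
  show ?thesis unfolding polytime_length_def
    by (intro exI[of _ c] exI[of _ p] allI) (use assms(1) p in \<open>unfold runs_def, meson order_trans\<close>)
qed

lemma polytime_length_zero: "polytime_length (\<lambda>_. 0)"
proof (rule polytime_lengthI)
  fix l
  have "runs {} (\<lambda>_. []) (Clear 0) (init_store l [] []) (2 * l + 1) ((init_store l [] [])(0 := []))"
    by (rule runs_Clear) (simp_all add: init_store_def)
  then show "\<exists>s. runs {} (\<lambda>_. []) (Clear 0) (init_store l [] []) (2 * l + 1) s \<and> s 0 = unary 0" by auto
qed (intro pbounded_intros)

lemma polytime_length_id: "polytime_length (\<lambda>l. l)"
proof (rule polytime_lengthI)
  show "\<exists>s. runs {} (\<lambda>_. []) Skip (init_store l [] []) 1 s \<and> s 0 = unary l" for l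
    by (rule exI[of _ "init_store l [] []"], rule conjI[OF runs_Skip]) (simp add: init_store_def)
qed (rule pbounded_const)

lemma polytime_length_in: "polytime_length (\<lambda>l. l * l + l + 1)"
proof (rule polytime_lengthI)
  fix l
  let ?s = "init_store l [] []"
  have 1: "runs {} (\<lambda>_. []) (Copy 0 3 7) ?s (7 * l + 2) (?s(3 := unary l))"
    by (rule runs_Copy[where n = l]) (simp_all add: init_store_def fun_eq_iff)
  have 2: "runs {} (\<lambda>_. []) (Rep 3 26 7 (Copy 3 0 7)) (?s(3 := unary l)) (l * (7 * l + 11) + 3) (?s(3 := unary l, 0 := unary (l * l + l)))"
    by (rule runs_Rep_Copy[where n = l and m = l]) (simp_all add: init_store_def fun_eq_iff replicate_add)
  have 3: "runs {} (\<lambda>_. []) (Push 0 True) (?s(3 := unary l, 0 := unary (l * l + l))) 1 (?s(3 := unary l, 0 := unary (l * l + l + 1)))"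
    by (rule runs_Push) (simp add: fun_eq_iff)
  show "\<exists>s. runs {} (\<lambda>_. []) (Seq (Copy 0 3 7) (Seq (Rep 3 26 7 (Copy 3 0 7)) (Push 0 True))) ?s
      (7 * l + 2 + (l * (7 * l + 11) + 3 + 1)) s \<and> s 0 = unary (l * l + l + 1)"
    by (rule exI, rule conjI[OF runs_Seq[OF 1 runs_Seq[OF 2 3]]]) simp
qed (intro pbounded_intros)

lemma efficient_hash_family:
  assumes "polytime_length \<kappa>" "\<kappa> = poly p"
  shows "efficient_family (hash_family \<kappa>)"
  unfolding efficient_family_def
proof (intro conjI)
  let ?F = "hash_family \<kappa>"
  have "query_len ?F = poly (p + [:2, 1, 1:])" "answer_len ?F = poly [:6, 2:]"
    using assms(2) by (auto simp: hash_family_def fun_eq_iff algebra_simps)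
  then show "\<exists>(pn :: nat poly) (pm :: nat poly). query_len ?F = poly pn \<and> answer_len ?F = poly pm" by blast
  show "polytime_length (key_len ?F)" "polytime_length (in_len ?F)" "polytime_length (out_len ?F)"
    using assms(1) polytime_length_in polytime_length_id by (simp_all add: hash_family_def)
  show "\<forall>l. \<forall>H\<in>oracles_of ?F l. \<forall>k\<in>bitstrs (key_len ?F l). \<forall>x\<in>bitstrs (in_len ?F l).
      apply_fn ?F l H k x \<in> bitstrs (out_len ?F l)"
    using trapdoor_hash_length by (simp add: hash_family_def oracles_of_def bitstrs_def)
  let ?B = "\<lambda>l. l * l + 3 * l + \<kappa> l + 8"
  have "pbounded \<kappa>" unfolding assms(2) by (rule pbounded_poly)
  then have "pbounded (\<lambda>l. hash_time (?B l))" by (intro pbounded_hash_time pbounded_intros)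
  then obtain q :: "nat poly" where q: "\<And>l. hash_time (?B l) \<le> poly q l" by (auto simp: pbounded_def)
  show "\<exists>c (q :: nat poly). \<forall>l. \<forall>H\<in>oracles_of ?F l. \<forall>k\<in>bitstrs (key_len ?F l). \<forall>x\<in>bitstrs (in_len ?F l). \<exists>t s.
      exec (bitstrs (query_len ?F l)) H c (init_store l k x) t s \<and> t \<le> poly q l \<and> s 0 = apply_fn ?F l H k x"
  proof (intro exI[of _ Hash] exI[of _ q] allI ballI)
    fix l H k x assume H: "H \<in> oracles_of ?F l" and k: "k \<in> bitstrs (key_len ?F l)" and x: "x \<in> bitstrs (in_len ?F l)"
    obtain s' where "runs (bitstrs (\<kappa> l + l * l + l + 2)) H Hash (init_store l k x) (hash_time (?B l)) s'" "s' 0 = trapdoor_hash l H k x"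
      using runs_Hash[of k "\<kappa> l" x l H "?B l"] H k x by (auto simp: hash_family_def oracles_of_def bitstrs_def)
    then show "\<exists>t s. exec (bitstrs (query_len ?F l)) H Hash (init_store l k x) t s \<and> t \<le> poly q l \<and> s 0 = apply_fn ?F l H k x"
      using order_trans[OF _ q[of l]] by (auto simp: runs_def hash_family_def)
  qed
qed

text \<open>The two families differ only in their key length. Length 0 gives the keyless family;
  with length \<open>l\<close> a run meets an already queried key with probability at most
  \<open>B / 2 ^ l\<close>, which makes independent runs against the same advice effective.\<close>

theorem theorem7p6:
  shows "(\<exists>F. efficient_family F \<and> compressing F \<and> keyless F \<and>
              collision_resistant_CROM F \<and> \<not> one_way_QROM F) \<and>
         (\<exists>F. efficient_family F \<and> compressing F \<and>
              collision_resistant_AI_CROM F \<and> \<not> one_way_QROM F)"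
proof -
  have "compressing (hash_family \<kappa>)" for \<kappa>
    by (simp add: compressing_def hash_family_def)
  moreover have "keyless (hash_family (\<lambda>_. 0))"
    by (simp add: keyless_def hash_family_def)
  moreover have "efficient_family (hash_family (\<lambda>_. 0))"
    using efficient_hash_family[OF polytime_length_zero, of 0] by (simp add: fun_eq_iff)
  moreover have "efficient_family (hash_family (\<lambda>l. l))"
    using efficient_hash_family[OF polytime_length_id, of "[:0, 1:]"] by (simp add: fun_eq_iff)
  ultimately show ?thesis
    using hash_family_CROM hash_family_AI_CROM hash_family_not_one_way by blast
qed

end
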